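(* Let $\mathcal Q_{II}$ be the decorated quiver with frozen vertices $0$ (type $-$), $3$ (type $+$), unfrozen vertices $1$ (no loop) and $2$ (one loop of label $q_1$), and arrows $0\to3$ (label $q_3$), $1\to0$ (label $q_1$), $3\to1$ (label $1$), $1\to2$ (label $1$), $2\to1$ (label $q_3$). Let $\mathcal P_+:X_0\to X_3$ and $\mathcal P_-:X_3\to X_1\to X_2\to X_1\to X_0$ be two paths in this quiver. The assignment $$(q-q^{-1})E(z)=\Sigma[\mathcal P_+](z),\quad \psi^-(z)=\Psi[\mathcal P_+](q^{2-\mathsf k/2}z),\quad (q-q^{-1})F(z)=-\Sigma[\mathcal P_-](q^{2+\mathsf k}z),\quad \psi^+(z)=\Psi[\mathcal P_-](q^{\mathsf k/2}z)$$ defines a free field realization of the quantum affine algebra $U_q(\widehat{\mathfrak{sl}(2)})$ at level $q^{\mathsf k}=q_3^{1/2}q_2^{-1/2}$. The currents $\Sigma[\mathcal P_\pm](z)$, $\Psi[\mathcal P_\pm](z)$, whose modes generate the corresponding subalgebra of the chiral cluster seed algebra, commute or anticommute with the screening charges associated with the unfrozen vertices. Moreover, this second realization is obtained from the following first one by a mutation of the chiral cluster seed at the vertex $1$, followed by gauging $X_1$ by $qq_3$: the first realization is given by the same assignment for the quiver $\mathcal Q_I$ with frozen vertices $0$ (type $-$), $3$ (type $+$), unfrozen vertices $1,2$ (no loops), arrows $0\to1$ (label $1$), $1\to3$ (label $q_3$), $3\to2$ (label $1$), $2\to0$ (label $q_2^{-1}$), $1\to2$ (label $1$), $2\to1$ (label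 $q_1$), and paths $\mathcal P_+:X_0\to X_1\to X_3$, $\mathcal P_-:X_3\to X_2\to X_0$.
   Context: **Parameters.** $q_1,q_2,q_3\in\mathbb C^\times$ with $q_1q_2q_3=1$, otherwise generic; $q=q_2^{1/2}$; $(q_1,q_2,q_3)=(q^{-2\mathsf k-4},q^2,q^{2\mathsf k+2})$. $f^{[n]}$: replace $q$, $q_c$, labels by their $n$-th powers. $\delta(x)=\sum_{n\in\mathbb Z}x^n$. **Seeds.** For a decorated quiver (vertices unfrozen or frozen of type $\pm$, arrows $a$ with labels $\kappa_a$) put $\epsilon_{ii}=0$, $\epsilon_{ij}=\#(i\to j)-\#(j\to i)$, $C_{ij}=(q-q^{-1})c_{ij}$ with $c_{ii}=(q-q^{-1})-\sum_{\ell:i\to i}(q\kappa_\ell-q^{-1}\kappa_\ell^{-1})$ ($i$ unfrozen), $c_{ii}=\mp q^{\mp1}$ ($i$ frozen of type $\pm$), $c_{ij}=\sum_{a:i\to j}q^{-1}\kappa_a^{-1}-\sum_{a:j\to i}q\kappa_a$ ($i\neq j$). The chiral cluster seed algebra $\mathcal A_{\mathcal Q}$ is the (completed) algebra generated by $X_i^{\pm1},x_{i,n}$ ($n\neq0$), with $X_iX_j=q^{2\epsilon_{ij}}X_jX_i$, $[X_i,x_{j,n}]=0$, $[x_{i,n},x_{j,m}]=\frac{\delta_{n+m,0}}nC^{[n]}_{ij}$ for $n>0$ (modes of the same sign commute). $X_i(z)=X_ie^{\sum_{n>0}z^nx_{i,-n}}e^{\sum_{n>0}z^{-n}x_{i,n}}$;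 $:\ :$ puts $x_{i,n}$, $n>0$, to the right, and $X_i:\prod_jX_j^{n_j}:=q^{\sum_j\epsilon_{ij}n_j}:X_i\prod_jX_j^{n_j}:$ on zero modes. **Paths.** For a path $Z_0\to\cdots\to Z_n$ along arrows with labels $\kappa_1,\dots,\kappa_n$: $\Sigma[\mathcal P](z)=\sum_{j=0}^{n-1}:Z_0(z)Z_1(\kappa_1z)\cdots Z_j(\kappa_1\cdots\kappa_jz):$, $\Psi[\mathcal P](z)=:Z_0(z)Z_1(\kappa_1z)\cdots Z_n(\kappa_1\cdots\kappa_nz):$. E.g. for $\mathcal Q_{II}$: $\Sigma[\mathcal P_+](z)=X_0(z)$, $\Psi[\mathcal P_+](z)=:X_0(z)X_3(q_3z):$, $\Sigma[\mathcal P_-](z)=X_3(z)+:X_3(z)X_1(z):+:X_3(z)X_1(z)X_2(z):+:X_3(z)X_1(z)X_2(z)X_1(q_3z):$, $\Psi[\mathcal P_-](z)=:X_3(z)X_1(z)X_2(z)X_1(q_3z)X_0(q_1q_3z):$. **$U_q(\widehat{\mathfrak{sl}(2)})$.** Generated by the modes of $E(z)=\sum_{n\in\mathbb Z}z^{-n}E_n$, $F(z)=\sum_{n\in\mathbb Z}z^{-n}F_n$, $\psi^\pm(z)=\psi_0^\pm\exp\bigl(\frac1{q-q^{-1}}\sum_{n>0}H_{\pm n}z^{\mp n}\bigr)$, and central $q^{\mathsf k}$, with, for $G(z)=\frac{q^2z-1}{z-q^2}$: $[\psi^\pm(z),\psi^\pm(w)]=0$, $\psi^+(z)\psi^-(w)=\frac{G(q^{\mathsf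 k}z/w)}{G(q^{-\mathsf k}z/w)}\psi^-(w)\psi^+(z)$, $\psi_0^+\psi_0^-=\psi_0^-\psi_0^+=1$, $\psi^\pm(z)E(w)=G(q^{\pm\mathsf k/2}z/w)E(w)\psi^\pm(z)$, $\psi^\pm(z)F(w)=G(q^{\mp\mathsf k/2}z/w)^{-1}F(w)\psi^\pm(z)$, $(z-q^2w)E(z)E(w)=(q^2z-w)E(w)E(z)$, $(z-q^{-2}w)F(z)F(w)=(q^{-2}z-w)F(w)F(z)$, $(q-q^{-1})[E(z),F(w)]=\delta(q^{-\mathsf k}z/w)\psi^+(q^{\mathsf k/2}w)-\delta(q^{\mathsf k}z/w)\psi^-(q^{-\mathsf k/2}w)$. A free field realization is a realization of the generating currents by currents in $\mathcal A_{\mathcal Q}$. **Screening charges.** *Unfrozen $k$ without loop:* write $X_k=-q^{-2J}$, with $\hat q$ such that $[J,\hat q]=1$, set $\Psi^*_k(z)=:e^{-\hat q}z^{-J}:e^{\sum_{n>0}z^n\frac{x_{k,-n}}{q^n-q^{-n}}}e^{-\sum_{n>0}z^{-n}\frac{x_{k,n}}{q^n-q^{-n}}}$, $\Psi_k(z)$ the same with exponents negated; then $\{\Psi_k(z),\Psi_k^*(w)\}=\delta(z/w)$, $\{\Psi_k,\Psi_k\}=\{\Psi^*_k,\Psi^*_k\}=0$, $X_k(z)=-:\Psi_k(q^{-1}z)\Psi_k^*(qz):$, and for $j\ne k$ the vertex operators are parametrized as $X_j(z)=:\prod_{a:j\to k}\Psi_k(q\kappa_az)\prod_{b:k\to j}\Psi_k^*(q^{-1}\kappa_b^{-1}z):V_j(z)$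 with $V_j$ commuting with $\Psi_k,\Psi_k^*$; $Q_k=\oint\Psi_k^*(z)\frac{dz}z$ ($J$ acting with integer eigenvalues). *Unfrozen $k$ with one loop of label $\kappa$:* two charges $Q^\pm_k=\oint S^\pm_k(z)\frac{dz}z$: for $\sigma=\sigma_\pm$, $\sigma_+=q$, $\sigma_-=\kappa^{1/2}$, $\bar\sigma=q\kappa^{1/2}\sigma^{-1}$, $s_n=x_{k,n}/(\sigma^n-\sigma^{-n})$, $X_k=\sigma^{-2s_0}$, $S$ with $[s_0,S]=2\frac{\log\bar\sigma}{\log\sigma}S$, $SX_j=\bar\sigma^{-2}X_jS$ for $j\ne k$ adjacent to $k$, $S$ commuting with the other zero modes, $S_k^\pm(z)=Sz^{-s_0}e^{-\sum_{n>0}z^ns_{-n}}e^{-\sum_{n>0}z^{-n}s_n}$. **Mutation** at an unfrozen loopless vertex $k$: (i) reverse arrows at $k$, $\kappa\mapsto q^{-1}\kappa^{-1}$; (ii) then for each pair of arrows $i\to k$, $k\to j$ with labels $\kappa_1,\kappa_2$ add $j\to i$ with label $q^{-2}\kappa_1^{-1}\kappa_2^{-1}$; (iii) delete opposite pairs of arrows and pairs of loops with $\kappa_1\kappa_2=q^{-2}$. On operators: with $\Psi=\Psi_k$, $\Psi^*=\Psi_k^*$, introduce fermions $\tilde\Psi,\tilde\Psi^*$ by $\tilde\Psi^*(z)=\Psi(qz)-\Psi(q^{-1}z)$, $\Psi^*(z)=\tilde\Psi(q^{-1}z)-\tilde\Psi(qz)$; the new operators are $\tilde X_k(z)=-:\tilde\Psi(q^{-1}z)\tilde\Psi^*(qz):$,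 $\tilde X_j(z)=:\prod_{a:j\to k}\tilde\Psi^*(\kappa_az)\prod_{b:k\to j}(-\tilde\Psi(\kappa_b^{-1}z)):V_j(z)$ (arrows and labels of the old quiver). Gauging $k$ by $\alpha$: incoming labels times $\alpha$, outgoing times $\alpha^{-1}$, $X_k(z)\mapsto X_k(z/\alpha)$. "Obtained by mutation" means that the quivers correspond and the currents of the first realization, re-expressed through the new vertex operators, are those of the second.
   Formalization: Corrected: ψ^-(z)=Ψ[P+](q^{-k/2}z), ψ^+(z)=Ψ[P-](q^{2+k/2}z); the realization holds modulo the radical of C and with the central monomial set to 1; screening zero modes are Weyl ordered (J in Z+1/2, s_0 shifted); V_j carries z^{-ε_jk p}, p a copy of J. *)

theory Defs
  imports
    Complex_Main
    "HOL-Library.Multiset"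
    "HOL-Computational_Algebra.Formal_Power_Series"
begin

text \<open>
  Conventions. A complex number \<open>h\<close> with \<open>q = exp h\<close> is fixed, and \<open>q\<^sup>c\<close> means \<open>qp h c = exp (c h)\<close>.
  Every nonzero number is such a power, so an arrow label \<open>\<kappa>\<close> is stored as an exponent \<open>e\<close> with
  \<open>\<kappa> = q\<^sup>e\<close>. This fixes all logarithms and roots that occur (\<open>q\<^sup>k\<close>, \<open>\<kappa>\<^sup>1\<^sup>/\<^sup>2\<close>, \<open>log \<sigma>\<close>, powers \<open>\<kappa>\<^sup>J\<close> for
  an operator \<open>J\<close>), and the operation \<open>f\<^sup>[\<^sup>n\<^sup>]\<close> (all parameters to the \<open>n\<close>-th power) is \<open>h \<mapsto> n h\<close>.
\<close>

definition qp :: "complex \<Rightarrow> complex \<Rightarrow> complex" where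
  "qp h c = exp (c * h)"

definition generic :: "complex \<Rightarrow> complex \<Rightarrow> bool" where
  "generic q1 q2 \<longleftrightarrow> (\<forall>a b :: int. q1 powi a * q2 powi b = 1 \<longrightarrow> a = 0 \<and> b = 0)"


section \<open>Decorated quivers\<close>

datatype vtype = Unfrozen | FrozenPlus | FrozenMinus

text \<open>An arrow \<open>(i, j, e)\<close> goes from \<open>i\<close> to \<open>j\<close> and has label \<open>q\<^sup>e\<close>.\<close>

record 'i dquiver =
  verts :: "'i set"
  vkind :: "'i \<Rightarrow> vtype"
  arrows :: "('i \<times> 'i \<times> complex) multiset"

definition labels :: "'i dquiver \<Rightarrow> 'i \<Rightarrow> 'i \<Rightarrow> complex multiset" where
  "labels Q i j = image_mset (\<lambda>(s, t, e). e) (filter_mset (\<lambda>(s, t, e). s = i \<and> t = j) (arrows Q))"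

definition eps :: "'i dquiver \<Rightarrow> 'i \<Rightarrow> 'i \<Rightarrow> int" where
  "eps Q i j = (if i = j then 0 else int (size (labels Q i j)) - int (size (labels Q j i)))"

definition cmat :: "complex \<Rightarrow> 'i dquiver \<Rightarrow> 'i \<Rightarrow> 'i \<Rightarrow> complex" where
  "cmat h Q i j =
    (if i = j then
       (case vkind Q i of
          Unfrozen \<Rightarrow> (qp h 1 - qp h (-1)) - (\<Sum>e\<in>#labels Q i i. qp h (1 + e) - qp h (-1 - e))
        | FrozenPlus \<Rightarrow> - qp h (-1)
        | FrozenMinus \<Rightarrow> qp h 1)
     else (\<Sum>e\<in>#labels Q i j. qp h (-1 - e)) - (\<Sum>e\<in>#labels Q j i. qp h (1 + e)))"

definition Cmat :: "complex \<Rightarrow> 'i dquiver \<Rightarrow> 'i \<Rightarrow> 'i \<Rightarrow> complex" where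
  "Cmat h Q i j = (qp h 1 - qp h (-1)) * cmat h Q i j"

text \<open>
  Mutation of quivers. Pairs of loops and pairs of opposite arrows are both of the form
  \<open>(i, j, e1), (j, i, e2)\<close>; \<open>mutated\<close> is a relation because the deleted pairs may be chosen.
\<close>

definition reverse_at :: "'i \<Rightarrow> ('i \<times> 'i \<times> complex) multiset \<Rightarrow> ('i \<times> 'i \<times> complex) multiset" where
  "reverse_at k A = image_mset (\<lambda>(s, t, e). if s = k \<or> t = k then (t, s, -1 - e) else (s, t, e)) A"

definition composed_at :: "'i \<Rightarrow> ('i \<times> 'i \<times> complex) multiset \<Rightarrow> ('i \<times> 'i \<times> complex) multiset" where
  "composed_at k A =
    (\<Sum>(i, _, e1)\<in>#filter_mset (\<lambda>(s, t, e). t = k) A.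
       image_mset (\<lambda>(_, j, e2). (j, i, -2 - e1 - e2)) (filter_mset (\<lambda>(s, t, e). s = k) A))"

definition deletes_pair ::
  "complex \<Rightarrow> ('i \<times> 'i \<times> complex) multiset \<Rightarrow> ('i \<times> 'i \<times> complex) multiset \<Rightarrow> bool" where
  "deletes_pair h A B \<longleftrightarrow>
    (\<exists>i j e1 e2. A = B + {#(i, j, e1), (j, i, e2)#} \<and> qp h e1 * qp h e2 = qp h (-2))"

definition mutated :: "complex \<Rightarrow> 'i \<Rightarrow> 'i dquiver \<Rightarrow> 'i dquiver \<Rightarrow> bool" where
  "mutated h k Q Q' \<longleftrightarrow>
     k \<in> verts Q \<and> vkind Q k = Unfrozen \<and> labels Q k k = {#} \<and>
     verts Q' = verts Q \<and> vkind Q' = vkind Q \<and>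
     (let A = reverse_at k (arrows Q)
      in (deletes_pair h)\<^sup>*\<^sup>* (A + composed_at k A) (arrows Q')) \<and>
     (\<nexists>B. deletes_pair h (arrows Q') B)"

text \<open>Gauging the vertex \<open>k\<close> by \<open>q\<^sup>c\<close>.\<close>

definition gauge_quiver :: "'i \<Rightarrow> complex \<Rightarrow> 'i dquiver \<Rightarrow> 'i dquiver" where
  "gauge_quiver k c Q = Q\<lparr>arrows :=
     image_mset (\<lambda>(s, t, e). (s, t, e + (if t = k then c else 0) - (if s = k then c else 0))) (arrows Q)\<rparr>"


section \<open>The chiral cluster seed algebra and its modules\<close>

text \<open>
  The completion of the seed algebra makes sums of normally ordered monomials convergent when only
  finitely many terms of them lie outside each left ideal generated by the products of total degree
  at least \<open>N\<close> in the \<open>x\<^sub>i\<^sub>,\<^sub>n\<close>, \<open>n > 0\<close>. An identity holds in the completed algebra iff it holds in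
  all smooth modules, i.e. those in which each vector is killed by all such products of large degree
  (the quotients by these left ideals are smooth modules). We therefore work with operators on an
  arbitrary smooth module, a complex vector space with scalar multiplication \<open>sc\<close>.
\<close>

abbreviation linop :: "(complex \<Rightarrow> 'v \<Rightarrow> 'v) \<Rightarrow> ('v \<Rightarrow> 'v::ab_group_add) \<Rightarrow> bool" where
  "linop sc f \<equiv> Vector_Spaces.linear sc sc f"

text \<open>\<open>zer M i\<close> is \<open>X\<^sub>i\<close> and \<open>osc M i n\<close> is \<open>x\<^sub>i\<^sub>,\<^sub>n\<close> (irrelevant at \<open>n = 0\<close>).\<close>

record ('i, 'v) seed_ops =
  zer :: "'i \<Rightarrow> 'v \<Rightarrow> 'v"
  osc :: "'i \<Rightarrow> int \<Rightarrow> 'v \<Rightarrow> 'v"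

definition smooth :: "'i set \<Rightarrow> ('i \<Rightarrow> int \<Rightarrow> 'v \<Rightarrow> 'v::ab_group_add) \<Rightarrow> bool" where
  "smooth I x \<longleftrightarrow> (\<forall>v. \<exists>N. \<forall>ps :: ('i \<times> nat) list.
     set ps \<subseteq> I \<times> {1..} \<and> N \<le> sum_list (map snd ps) \<longrightarrow>
     foldr (\<lambda>(i, n). x i (int n)) ps v = 0)"

definition seed_module ::
  "complex \<Rightarrow> (complex \<Rightarrow> 'v \<Rightarrow> 'v) \<Rightarrow> 'i dquiver \<Rightarrow> ('i, 'v::ab_group_add) seed_ops \<Rightarrow> bool" where
  "seed_module h sc Q M \<longleftrightarrow>
     (\<forall>i\<in>verts Q. linop sc (zer M i) \<and> bij (zer M i) \<and> (\<forall>n. n \<noteq> 0 \<longrightarrow> linop sc (osc M i n))) \<and>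
     smooth (verts Q) (osc M) \<and>
     (\<forall>i\<in>verts Q. \<forall>j\<in>verts Q. \<forall>v.
        zer M i (zer M j v) = sc (qp h (2 * of_int (eps Q i j))) (zer M j (zer M i v)) \<and>
        (\<forall>n. n \<noteq> 0 \<longrightarrow> zer M i (osc M j n v) = osc M j n (zer M i v)) \<and>
        (\<forall>n m. n > 0 \<and> m \<noteq> 0 \<longrightarrow>
           osc M i n (osc M j m v) - osc M j m (osc M i n v) =
             (if n + m = 0 then sc (Cmat (of_int n * h) Q i j / of_int n) v else 0)) \<and>
        (\<forall>n m. n < 0 \<and> m < 0 \<longrightarrow> osc M i n (osc M j m v) = osc M j m (osc M i n v)))"

text \<open>
  The linear combinations of the \<open>x\<^sub>i\<^sub>,\<^sub>n\<close> which the commutation relations make central form the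
  radical of the pairing \<open>C\<close>; \<open>reduced\<close> says that they act by zero.
\<close>

definition reduced ::
  "complex \<Rightarrow> (complex \<Rightarrow> 'v \<Rightarrow> 'v) \<Rightarrow> 'i dquiver \<Rightarrow> ('i, 'v::ab_group_add) seed_ops \<Rightarrow> bool" where
  "reduced h sc Q M \<longleftrightarrow> (\<forall>n>0. \<forall>b :: 'i \<Rightarrow> complex.
     ((\<forall>j\<in>verts Q. (\<Sum>i\<in>verts Q. b i * Cmat (of_int n * h) Q i j) = 0) \<longrightarrow>
        (\<forall>v. (\<Sum>i\<in>verts Q. sc (b i) (osc M i n v)) = 0)) \<and>
     ((\<forall>i\<in>verts Q. (\<Sum>j\<in>verts Q. Cmat (of_int n * h) Q i j * b j) = 0) \<longrightarrow>
        (\<forall>v. (\<Sum>j\<in>verts Q. sc (b j) (osc M j (- n) v)) = 0)))"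


section \<open>Vertex operators\<close>

text \<open>
  \<open>expc sc a m\<close> is the coefficient of \<open>z\<^sup>m\<close> in \<open>exp (\<Sum>n>0. z\<^sup>n a\<^sub>n)\<close>, and \<open>powc a j m\<close> the one in
  \<open>(\<Sum>n>0. z\<^sup>n a\<^sub>n)\<^sup>j\<close>. For a family \<open>a\<close> indexed by integers, \<open>bexp sc a c\<close> is the coefficient of
  \<open>z\<^sup>c\<close> in \<open>exp (\<Sum>n>0. z\<^sup>n a\<^sub>-\<^sub>n) exp (\<Sum>n>0. z\<^sup>-\<^sup>n a\<^sub>n)\<close>; on a vector of a smooth module the sum is finite.
\<close>

primrec powc :: "(nat \<Rightarrow> 'v \<Rightarrow> 'v) \<Rightarrow> nat \<Rightarrow> nat \<Rightarrow> 'v \<Rightarrow> 'v::ab_group_add" where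
  "powc a 0 m v = (if m = 0 then v else 0)"
| "powc a (Suc j) m v = (\<Sum>n=1..m. a n (powc a j (m - n) v))"

definition expc :: "(complex \<Rightarrow> 'v \<Rightarrow> 'v) \<Rightarrow> (nat \<Rightarrow> 'v \<Rightarrow> 'v) \<Rightarrow> nat \<Rightarrow> 'v \<Rightarrow> 'v::ab_group_add" where
  "expc sc a m v = (\<Sum>j\<le>m. sc (1 / fact j) (powc a j m v))"

definition bexp :: "(complex \<Rightarrow> 'v \<Rightarrow> 'v) \<Rightarrow> (int \<Rightarrow> 'v \<Rightarrow> 'v) \<Rightarrow> int \<Rightarrow> 'v \<Rightarrow> 'v::ab_group_add" where
  "bexp sc a c v =
    (\<Sum>r | expc sc (\<lambda>n. a (int n)) r v \<noteq> 0 \<and> 0 \<le> c + int r.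
       expc sc (\<lambda>n. a (- int n)) (nat (c + int r)) (expc sc (\<lambda>n. a (int n)) r v))"

text \<open>
  The zero mode part of a normally ordered product, from
  \<open>X\<^sub>i :X\<^sub>j\<^sub>1 \<dots> X\<^sub>j\<^sub>r: = q\<^bsup>\<Sum> eps i j\<^esub> :X\<^sub>i X\<^sub>j\<^sub>1 \<dots> X\<^sub>j\<^sub>r:\<close>.
\<close>

primrec zprod ::
  "complex \<Rightarrow> (complex \<Rightarrow> 'v \<Rightarrow> 'v) \<Rightarrow> 'i dquiver \<Rightarrow> ('i \<Rightarrow> 'v \<Rightarrow> 'v) \<Rightarrow> 'i list \<Rightarrow> 'v \<Rightarrow> 'v" where
  "zprod h sc Q X [] v = v"
| "zprod h sc Q X (i # is) v = sc (qp h (- of_int (\<Sum>j\<leftarrow>is. eps Q i j))) (X i (zprod h sc Q X is v))"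

definition osc_sum ::
  "complex \<Rightarrow> (complex \<Rightarrow> 'v \<Rightarrow> 'v) \<Rightarrow> ('i \<Rightarrow> int \<Rightarrow> 'v \<Rightarrow> 'v) \<Rightarrow> ('i \<times> complex) list \<Rightarrow>
   int \<Rightarrow> 'v \<Rightarrow> 'v::ab_group_add" where
  "osc_sum h sc x ps n v = (\<Sum>(i, e)\<leftarrow>ps. sc (qp h (- of_int n * e)) (x i n v))"

text \<open>
  A current \<open>A(z) = \<Sum> z\<^sup>-\<^sup>n A\<^sub>n\<close> is represented by its modes \<open>A\<^sub>n\<close>. For a list \<open>ps\<close> of pairs
  \<open>(Z\<^sub>l, e\<^sub>l)\<close>, \<open>nprod h sc Q M ps\<close> is the current \<open>:\<Prod> Z\<^sub>l(q\<^bsup>e\<^sub>l\<^esup> z):\<close>.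
\<close>

definition nprod ::
  "complex \<Rightarrow> (complex \<Rightarrow> 'v \<Rightarrow> 'v) \<Rightarrow> 'i dquiver \<Rightarrow> ('i, 'v::ab_group_add) seed_ops \<Rightarrow>
   ('i \<times> complex) list \<Rightarrow> int \<Rightarrow> 'v \<Rightarrow> 'v" where
  "nprod h sc Q M ps n v =
     zprod h sc Q (zer M) (map fst ps) (bexp sc (osc_sum h sc (osc M) ps) (- n) v)"

text \<open>
  A path is its first vertex together with the list of pairs (label of the arrow, next vertex).
  \<open>path_points\<close> attaches to each vertex the product of the labels passed so far.
\<close>

type_synonym 'i qpath = "'i \<times> (complex \<times> 'i) list"

fun walk :: "'i dquiver \<Rightarrow> 'i \<Rightarrow> (complex \<times> 'i) list \<Rightarrow> bool" where
  "walk Q i [] \<longleftrightarrow> i \<in> verts Q"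
| "walk Q i ((e, j) # r) \<longleftrightarrow> i \<in> verts Q \<and> (i, j, e) \<in># arrows Q \<and> walk Q j r"

fun points :: "'i \<Rightarrow> complex \<Rightarrow> (complex \<times> 'i) list \<Rightarrow> ('i \<times> complex) list" where
  "points i c [] = [(i, c)]"
| "points i c ((e, j) # r) = (i, c) # points j (c + e) r"

definition path_points :: "'i qpath \<Rightarrow> ('i \<times> complex) list" where
  "path_points P = points (fst P) 0 (snd P)"

definition Sigma_cur ::
  "complex \<Rightarrow> (complex \<Rightarrow> 'v \<Rightarrow> 'v) \<Rightarrow> 'i dquiver \<Rightarrow> ('i, 'v::ab_group_add) seed_ops \<Rightarrow>
   'i qpath \<Rightarrow> int \<Rightarrow> 'v \<Rightarrow> 'v" where
  "Sigma_cur h sc Q M P n v =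
     (\<Sum>j<length (snd P). nprod h sc Q M (take (Suc j) (path_points P)) n v)"

definition Psi_cur ::
  "complex \<Rightarrow> (complex \<Rightarrow> 'v \<Rightarrow> 'v) \<Rightarrow> 'i dquiver \<Rightarrow> ('i, 'v::ab_group_add) seed_ops \<Rightarrow>
   'i qpath \<Rightarrow> int \<Rightarrow> 'v \<Rightarrow> 'v" where
  "Psi_cur h sc Q M P n v = nprod h sc Q M (path_points P) n v"

text \<open>The current \<open>A(q\<^sup>c z)\<close>.\<close>

definition rescale ::
  "complex \<Rightarrow> (complex \<Rightarrow> 'v \<Rightarrow> 'v) \<Rightarrow> complex \<Rightarrow> (int \<Rightarrow> 'v \<Rightarrow> 'v) \<Rightarrow> int \<Rightarrow> 'v \<Rightarrow> 'v" where
  "rescale h sc c A n v = sc (qp h (- of_int n * c)) (A n v)"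


section \<open>Free field realizations of the quantum affine algebra\<close>

text \<open>
  Expansions of \<open>G(a x) = (q\<^sup>2 a x - 1) / (a x - q\<^sup>2)\<close>: \<open>G_inf\<close> in powers of \<open>1/x\<close>, used with
  \<open>\<psi>\<^sup>+\<close>, and \<open>G_zero\<close> in powers of \<open>x\<close>, used with \<open>\<psi>\<^sup>-\<close>.
\<close>

definition G_inf :: "complex \<Rightarrow> complex \<Rightarrow> complex fps" where
  "G_inf h a = (fps_const (qp h 2 * a) - fps_X) / (fps_const a - fps_const (qp h 2) * fps_X)"

definition G_zero :: "complex \<Rightarrow> complex \<Rightarrow> complex fps" where
  "G_zero h a = (fps_const (qp h 2 * a) * fps_X - 1) / (fps_const a * fps_X - fps_const (qp h 2))"

text \<open>
  The defining relations at level \<open>q\<^sup>k\<close> for currents with modes \<open>E\<^sub>n\<close>, \<open>F\<^sub>n\<close>, \<open>\<psi>\<^sup>+\<^sub>n\<close> = \<open>P n\<close>,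
  \<open>\<psi>\<^sup>-\<^sub>n\<close> = \<open>R n\<close>, each relation being read off at \<open>z\<^sup>-\<^sup>m w\<^sup>-\<^sup>n\<close>.
\<close>

definition Uq_sl2_relations ::
  "complex \<Rightarrow> complex \<Rightarrow> (complex \<Rightarrow> 'v \<Rightarrow> 'v) \<Rightarrow> (int \<Rightarrow> 'v \<Rightarrow> 'v) \<Rightarrow> (int \<Rightarrow> 'v \<Rightarrow> 'v) \<Rightarrow>
   (int \<Rightarrow> 'v \<Rightarrow> 'v) \<Rightarrow> (int \<Rightarrow> 'v \<Rightarrow> 'v::ab_group_add) \<Rightarrow> bool" where
  "Uq_sl2_relations h k sc E F P R \<longleftrightarrow>
     (\<forall>n. linop sc (E n) \<and> linop sc (F n) \<and> linop sc (P n) \<and> linop sc (R n)) \<and>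
     (\<exists>H :: int \<Rightarrow> 'v \<Rightarrow> 'v. (\<forall>n. linop sc (H n)) \<and>
        (\<forall>m<0. \<forall>v. P m v = 0 \<and> R (- m) v = 0) \<and>
        (\<forall>m v. P (int m) v =
           P 0 (expc sc (\<lambda>n u. sc (1 / (qp h 1 - qp h (-1))) (H (int n) u)) m v)) \<and>
        (\<forall>m v. R (- int m) v =
           R 0 (expc sc (\<lambda>n u. sc (1 / (qp h 1 - qp h (-1))) (H (- int n) u)) m v))) \<and>
     (\<forall>v. P 0 (R 0 v) = v \<and> R 0 (P 0 v) = v) \<and>
     (\<forall>m n v. P m (P n v) = P n (P m v) \<and> R m (R n v) = R n (R m v)) \<and>
     (\<forall>m n v. P (int m) (R (- int n) v) =
        (\<Sum>l\<le>min m n. sc (fps_nth (G_inf h (qp h k) / G_inf h (qp h (- k))) l)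
           (R (- int (n - l)) (P (int (m - l)) v)))) \<and>
     (\<forall>m n v. P (int m) (E n v) =
        (\<Sum>l\<le>m. sc (fps_nth (G_inf h (qp h (k / 2))) l) (E (n + int l) (P (int (m - l)) v)))) \<and>
     (\<forall>m n v. R (- int m) (E n v) =
        (\<Sum>l\<le>m. sc (fps_nth (G_zero h (qp h (- k / 2))) l) (E (n - int l) (R (- int (m - l)) v)))) \<and>
     (\<forall>m n v. P (int m) (F n v) =
        (\<Sum>l\<le>m. sc (fps_nth (inverse (G_inf h (qp h (- k / 2)))) l)
           (F (n + int l) (P (int (m - l)) v)))) \<and>
     (\<forall>m n v. R (- int m) (F n v) =
        (\<Sum>l\<le>m. sc (fps_nth (inverse (G_zero h (qp h (k / 2)))) l)
           (F (n - int l) (R (- int (m - l)) v)))) \<and>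
     (\<forall>m n v. E (m + 1) (E n v) - sc (qp h 2) (E m (E (n + 1) v)) =
        sc (qp h 2) (E n (E (m + 1) v)) - E (n + 1) (E m v)) \<and>
     (\<forall>m n v. F (m + 1) (F n v) - sc (qp h (-2)) (F m (F (n + 1) v)) =
        sc (qp h (-2)) (F n (F (m + 1) v)) - F (n + 1) (F m v)) \<and>
     (\<forall>m n v. sc (qp h 1 - qp h (-1)) (E m (F n v) - F n (E m v)) =
        sc (qp h (k * of_int m)) (rescale h sc (k / 2) P (m + n) v)
        - sc (qp h (- k * of_int m)) (rescale h sc (- k / 2) R (m + n) v))"

text \<open>
  The relations \<open>\<psi>\<^sup>+\<^sub>0 \<psi>\<^sup>-\<^sub>0 = 1\<close> and \<open>\<psi>\<^sup>\<plusminus>(z) \<in> \<psi>\<^sup>\<plusminus>\<^sub>0 exp(\<dots> z\<^sup>\<mp>\<^sup>n \<dots>)\<close> cannot hold before the centre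
  of the seed algebra is specialized: in \<open>\<psi>\<^sup>\<plusminus>\<close> the oscillators of the wrong sign are nonzero central
  elements, and \<open>\<psi>\<^sup>+\<^sub>0 \<psi>\<^sup>-\<^sub>0\<close> is a central monomial in the \<open>X\<^sub>i\<close>. So the target is the quotient by
  \<open>reduced\<close> and by \<open>:\<Prod> X\<^sub>i: = 1\<close> over the vertices of both paths; the condition on \<open>eps\<close>
  states that this monomial is central.

  In \<open>\<psi>\<^sup>-(z) = \<Psi>[P\<^sub>+](q\<^sup>-\<^sup>k\<^sup>/\<^sup>2 z)\<close> and \<open>\<psi>\<^sup>+(z) = \<Psi>[P\<^sub>-](q\<^sup>2\<^sup>+\<^sup>k\<^sup>/\<^sup>2 z)\<close> the arguments are the ones forced
  by the formulas for \<open>E\<close>, \<open>F\<close> and the relation for \<open>[E(z), F(w)]\<close>.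
\<close>

definition free_field_realization ::
  "complex \<Rightarrow> complex \<Rightarrow> (complex \<Rightarrow> 'v \<Rightarrow> 'v::ab_group_add) \<Rightarrow> 'i dquiver \<Rightarrow> 'i qpath \<Rightarrow> 'i qpath \<Rightarrow> bool"
  where
  "free_field_realization h k sc Q Pp Pm \<longleftrightarrow>
     (let vs = map fst (path_points Pp) @ map fst (path_points Pm) in
      walk Q (fst Pp) (snd Pp) \<and> walk Q (fst Pm) (snd Pm) \<and>
      (\<forall>i\<in>verts Q. (\<Sum>j\<leftarrow>vs. eps Q i j) = 0) \<and>
      (\<forall>M :: ('i, 'v) seed_ops.
         seed_module h sc Q M \<and> reduced h sc Q M \<and> (\<forall>v. zprod h sc Q (zer M) vs v = v) \<longrightarrow>
         Uq_sl2_relations h k sc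
           (\<lambda>n v. sc (1 / (qp h 1 - qp h (-1))) (Sigma_cur h sc Q M Pp n v))
           (\<lambda>n v. sc (- 1 / (qp h 1 - qp h (-1))) (rescale h sc (2 + k) (Sigma_cur h sc Q M Pm) n v))
           (rescale h sc (2 + k / 2) (Psi_cur h sc Q M Pm))
           (rescale h sc (- k / 2) (Psi_cur h sc Q M Pp))))"


section \<open>Zero modes depending on the spectral parameter\<close>

text \<open>
  \<open>eigcomp sc T v \<mu>\<close> is the component of \<open>v\<close> in the \<open>\<mu>\<close>-eigenspace of a diagonalizable \<open>T\<close>, and
  \<open>opfun sc g T\<close> is \<open>g(T)\<close>.
\<close>

definition eigdec ::
  "(complex \<Rightarrow> 'v \<Rightarrow> 'v) \<Rightarrow> ('v \<Rightarrow> 'v) \<Rightarrow> 'v \<Rightarrow> (complex \<Rightarrow> 'v::ab_group_add) \<Rightarrow> bool" where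
  "eigdec sc T v f \<longleftrightarrow>
     finite {\<mu>. f \<mu> \<noteq> 0} \<and> (\<forall>\<mu>. T (f \<mu>) = sc \<mu> (f \<mu>)) \<and> v = (\<Sum>\<mu> | f \<mu> \<noteq> 0. f \<mu>)"

definition eigcomp ::
  "(complex \<Rightarrow> 'v \<Rightarrow> 'v) \<Rightarrow> ('v \<Rightarrow> 'v) \<Rightarrow> 'v \<Rightarrow> complex \<Rightarrow> 'v::ab_group_add" where
  "eigcomp sc T v = (THE f. eigdec sc T v f)"

definition diagonalizable ::
  "(complex \<Rightarrow> 'v \<Rightarrow> 'v) \<Rightarrow> complex set \<Rightarrow> ('v \<Rightarrow> 'v::ab_group_add) \<Rightarrow> bool" where
  "diagonalizable sc S T \<longleftrightarrow> linop sc T \<and> (\<forall>v. \<exists>f. eigdec sc T v f \<and> {\<mu>. f \<mu> \<noteq> 0} \<subseteq> S)"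

definition opfun ::
  "(complex \<Rightarrow> 'v \<Rightarrow> 'v) \<Rightarrow> (complex \<Rightarrow> complex) \<Rightarrow> ('v \<Rightarrow> 'v) \<Rightarrow> 'v \<Rightarrow> 'v::ab_group_add" where
  "opfun sc g T v = (\<Sum>\<mu> | eigcomp sc T v \<mu> \<noteq> 0. sc (g \<mu>) (eigcomp sc T v \<mu>))"

text \<open>
  \<open>vop sc U T a c\<close> is the coefficient of \<open>z\<^sup>c\<close> in
  \<open>U z\<^sup>T exp (\<Sum>n>0. z\<^sup>n a\<^sub>-\<^sub>n) exp (\<Sum>n>0. z\<^sup>-\<^sup>n a\<^sub>n)\<close>, where \<open>T\<close> is diagonalizable and commutes with the
  \<open>a\<^sub>n\<close>. The exponent \<open>c\<close> may be any complex number.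
\<close>

definition vop ::
  "(complex \<Rightarrow> 'v \<Rightarrow> 'v) \<Rightarrow> ('v \<Rightarrow> 'v) \<Rightarrow> ('v \<Rightarrow> 'v) \<Rightarrow> (int \<Rightarrow> 'v \<Rightarrow> 'v) \<Rightarrow> complex \<Rightarrow> 'v \<Rightarrow> 'v::ab_group_add"
  where
  "vop sc U T a c v =
    (\<Sum>\<mu> | eigcomp sc T v \<mu> \<noteq> 0 \<and> c - \<mu> \<in> \<int>. U (bexp sc a \<lfloor>Re (c - \<mu>)\<rfloor> (eigcomp sc T v \<mu>)))"


section \<open>Fermions at a loopless unfrozen vertex\<close>

text \<open>
  Zero modes are Weyl ordered, in agreement with \<open>zprod\<close>: with \<open>Y = exp q^\<close> and \<open>J Y = Y (J + 1)\<close>,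
  \<open>:exp (\<epsilon> q^) q\<^bsup>c J\<^esup>: = Y\<^sup>\<epsilon> q\<^bsup>c (J + \<epsilon>/2)\<^esup>\<close>. In particular
  \<open>:exp (- q^) z\<^sup>-\<^sup>J: = Y\<^sup>-\<^sup>1 z\<^bsup>-J + 1/2\<^esup>\<close> and \<open>:exp q^ z\<^sup>J: = Y z\<^bsup>J + 1/2\<^esup>\<close>, which gives
  \<open>{\<Psi>(z), \<Psi>*(w)} = \<delta>(z/w)\<close>.
\<close>

record ('i, 'v) fermi_ops =
  fJ :: "'v \<Rightarrow> 'v"
  fY :: "'v \<Rightarrow> 'v"
  fYinv :: "'v \<Rightarrow> 'v"
  fp :: "'v \<Rightarrow> 'v"
  fV :: "'i \<Rightarrow> 'v \<Rightarrow> 'v"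

definition fermi :: "complex \<Rightarrow> (complex \<Rightarrow> 'v \<Rightarrow> 'v) \<Rightarrow> ('v \<Rightarrow> 'v) \<Rightarrow> ('v \<Rightarrow> 'v) \<Rightarrow>
   (int \<Rightarrow> 'v \<Rightarrow> 'v) \<Rightarrow> complex \<Rightarrow> 'v \<Rightarrow> 'v::ab_group_add" where
  "fermi h sc J Y x =
     vop sc Y (\<lambda>v. J v + sc (1/2) v)
       (\<lambda>n v. sc (1 / (qp h (of_int n) - qp h (- of_int n))) (x n v))"

definition fermi_star :: "complex \<Rightarrow> (complex \<Rightarrow> 'v \<Rightarrow> 'v) \<Rightarrow> ('v \<Rightarrow> 'v) \<Rightarrow> ('v \<Rightarrow> 'v) \<Rightarrow>
   (int \<Rightarrow> 'v \<Rightarrow> 'v) \<Rightarrow> complex \<Rightarrow> 'v \<Rightarrow> 'v::ab_group_add" where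
  "fermi_star h sc J Yinv x =
     vop sc Yinv (\<lambda>v. sc (1/2) v - J v)
       (\<lambda>n v. sc (- 1 / (qp h (of_int n) - qp h (- of_int n))) (x n v))"

text \<open>\<open>weyl\<close> is \<open>:exp (s q^) q\<^bsup>c J\<^esup>:\<close>.\<close>

definition weyl :: "complex \<Rightarrow> (complex \<Rightarrow> 'v \<Rightarrow> 'v) \<Rightarrow> ('v \<Rightarrow> 'v) \<Rightarrow> ('v \<Rightarrow> 'v) \<Rightarrow> ('v \<Rightarrow> 'v) \<Rightarrow>
   int \<Rightarrow> complex \<Rightarrow> 'v \<Rightarrow> 'v::ab_group_add" where
  "weyl h sc J Y Yinv s c v =
     ((if 0 \<le> s then Y else Yinv) ^^ nat \<bar>s\<bar>) (opfun sc (\<lambda>\<mu>. qp h (c * (\<mu> + of_int s / 2))) J v)"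

text \<open>
  The parametrization \<open>X\<^sub>j(z) = :\<Prod>\<^sub>a \<Psi>\<^sub>k(q \<kappa>\<^sub>a z) \<Prod>\<^sub>b \<Psi>\<^sub>k*(q\<^sup>-\<^sup>1 \<kappa>\<^sub>b\<^sup>-\<^sup>1 z): V\<^sub>j(z)\<close>, \<open>j \<noteq> k\<close>, over the arrows
  \<open>a : j \<rightarrow> k\<close> and \<open>b : k \<rightarrow> j\<close>. The fermions contribute \<open>fermi_coeff\<close> times \<open>x\<^sub>k\<^sub>,\<^sub>n / (q\<^sup>n - q\<^sup>-\<^sup>n)\<close> to
  \<open>x\<^sub>j\<^sub>,\<^sub>n\<close>, and the rest \<open>v_osc\<close> belongs to \<open>V\<^sub>j\<close>.
\<close>

definition fermi_coeff :: "complex \<Rightarrow> 'i dquiver \<Rightarrow> 'i \<Rightarrow> 'i \<Rightarrow> int \<Rightarrow> complex" where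
  "fermi_coeff h Q k j n =
     (\<Sum>e\<in>#labels Q j k. qp h (- of_int n * (1 + e))) - (\<Sum>e\<in>#labels Q k j. qp h (of_int n * (1 + e)))"

definition v_osc :: "complex \<Rightarrow> (complex \<Rightarrow> 'v \<Rightarrow> 'v) \<Rightarrow> 'i dquiver \<Rightarrow> 'i \<Rightarrow>
   ('i, 'v::ab_group_add) seed_ops \<Rightarrow> 'i \<Rightarrow> int \<Rightarrow> 'v \<Rightarrow> 'v" where
  "v_osc h sc Q k M j n v =
     osc M j n v - sc (fermi_coeff h Q k j n / (qp h (of_int n) - qp h (- of_int n))) (osc M k n v)"

text \<open>
  The fermions contain \<open>z\<^sup>\<plusminus>\<^sup>J\<close> whereas \<open>X\<^sub>j(z) = X\<^sub>j exp(\<dots>) exp(\<dots>)\<close> has no power of \<open>z\<close> at the zero modes.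
  As \<open>V\<^sub>j(z)\<close> has to commute with \<open>exp q^\<close>, its zero mode is \<open>:V\<^sub>j z\<^bsup>-\<epsilon>\<^sub>j\<^sub>k p\<^esup>:\<close>, where \<open>p\<close> agrees with \<open>J\<close> as far
  as its commutation with the seed algebra goes but commutes with \<open>exp q^\<close>. Thus
  \<open>X\<^sub>j(z) = X\<^sub>j z\<^bsup>\<epsilon>\<^sub>j\<^sub>k (J - p)\<^esup> exp(\<dots>) exp(\<dots>)\<close>, which is the vertex operator of the seed algebra on the
  subspace \<open>J = p\<close>; the operator \<open>J - p\<close> is central for the seed algebra and shifted by \<open>exp q^\<close>.
\<close>

definition fermionization ::
  "complex \<Rightarrow> (complex \<Rightarrow> 'v \<Rightarrow> 'v) \<Rightarrow> 'i dquiver \<Rightarrow> 'i \<Rightarrow>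
   ('i, 'v::ab_group_add) seed_ops \<Rightarrow> ('i, 'v) fermi_ops \<Rightarrow> bool" where
  "fermionization h sc Q k M \<Phi> \<longleftrightarrow>
     k \<in> verts Q \<and> vkind Q k = Unfrozen \<and> labels Q k k = {#} \<and>
     seed_module h sc Q M \<and>
     diagonalizable sc UNIV (fJ \<Phi>) \<and> diagonalizable sc UNIV (fp \<Phi>) \<and>
     diagonalizable sc \<int> (\<lambda>v. fJ \<Phi> v - fp \<Phi> v) \<and>
     linop sc (fY \<Phi>) \<and> (\<forall>j\<in>verts Q - {k}. linop sc (fV \<Phi> j)) \<and>
     (\<forall>v. fY \<Phi> (fYinv \<Phi> v) = v \<and> fYinv \<Phi> (fY \<Phi> v) = v \<and>
        fJ \<Phi> (fY \<Phi> v) = fY \<Phi> (fJ \<Phi> v + v) \<and>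
        fJ \<Phi> (fp \<Phi> v) = fp \<Phi> (fJ \<Phi> v) \<and> fY \<Phi> (fp \<Phi> v) = fp \<Phi> (fY \<Phi> v) \<and>
        zer M k v = - opfun sc (\<lambda>\<mu>. qp h (-2 * \<mu>)) (fJ \<Phi>) v) \<and>
     (\<forall>i\<in>verts Q. \<forall>n v. n \<noteq> 0 \<longrightarrow>
        fJ \<Phi> (osc M i n v) = osc M i n (fJ \<Phi> v) \<and>
        fY \<Phi> (osc M i n v) = osc M i n (fY \<Phi> v) \<and>
        fp \<Phi> (osc M i n v) = osc M i n (fp \<Phi> v)) \<and>
     (\<forall>j\<in>verts Q - {k}. \<forall>v.
        zer M j v = weyl h sc (fJ \<Phi>) (fY \<Phi>) (fYinv \<Phi>) (eps Q j k)
          ((\<Sum>e\<in>#labels Q j k. 1 + e) + (\<Sum>e\<in>#labels Q k j. 1 + e)) (fV \<Phi> j v) \<and>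
        fV \<Phi> j (fJ \<Phi> v) = fJ \<Phi> (fV \<Phi> j v) \<and> fV \<Phi> j (fY \<Phi> v) = fY \<Phi> (fV \<Phi> j v) \<and>
        (\<forall>i\<in>verts Q. \<forall>n. n \<noteq> 0 \<longrightarrow> fV \<Phi> j (osc M i n v) = osc M i n (fV \<Phi> j v)) \<and>
        fp \<Phi> (fV \<Phi> j v) = fV \<Phi> j (fp \<Phi> v + sc (of_int (eps Q j k)) v))"

text \<open>
  The currents of paths built from the vertex operators \<open>X\<^sub>j z\<^bsup>\<epsilon>\<^sub>j\<^sub>k D\<^esup> exp(\<dots>) exp(\<dots>)\<close>, where \<open>D\<close> is
  \<open>J - p\<close>; for \<open>D = 0\<close> they are \<open>nprod\<close>, \<open>Sigma_cur\<close> and \<open>Psi_cur\<close>.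
\<close>

definition nprodD ::
  "complex \<Rightarrow> (complex \<Rightarrow> 'v \<Rightarrow> 'v) \<Rightarrow> 'i dquiver \<Rightarrow> 'i \<Rightarrow> ('v \<Rightarrow> 'v) \<Rightarrow>
   ('i, 'v::ab_group_add) seed_ops \<Rightarrow> ('i \<times> complex) list \<Rightarrow> int \<Rightarrow> 'v \<Rightarrow> 'v" where
  "nprodD h sc Q k D M ps n =
     vop sc (zprod h sc Q (zer M) (map fst ps) \<circ>
             opfun sc (\<lambda>\<mu>. qp h (\<mu> * (\<Sum>(i, e)\<leftarrow>ps. e * of_int (eps Q i k)))) D)
       (\<lambda>v. sc (of_int (\<Sum>(i, e)\<leftarrow>ps. eps Q i k)) (D v))
       (osc_sum h sc (osc M) ps) (- of_int n)"

definition SigmaD_cur ::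
  "complex \<Rightarrow> (complex \<Rightarrow> 'v \<Rightarrow> 'v) \<Rightarrow> 'i dquiver \<Rightarrow> 'i \<Rightarrow> ('v \<Rightarrow> 'v) \<Rightarrow>
   ('i, 'v::ab_group_add) seed_ops \<Rightarrow> 'i qpath \<Rightarrow> int \<Rightarrow> 'v \<Rightarrow> 'v" where
  "SigmaD_cur h sc Q k D M P n v =
     (\<Sum>j<length (snd P). nprodD h sc Q k D M (take (Suc j) (path_points P)) n v)"

definition PsiD_cur ::
  "complex \<Rightarrow> (complex \<Rightarrow> 'v \<Rightarrow> 'v) \<Rightarrow> 'i dquiver \<Rightarrow> 'i \<Rightarrow> ('v \<Rightarrow> 'v) \<Rightarrow>
   ('i, 'v::ab_group_add) seed_ops \<Rightarrow> 'i qpath \<Rightarrow> int \<Rightarrow> 'v \<Rightarrow> 'v" where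
  "PsiD_cur h sc Q k D M P n v = nprodD h sc Q k D M (path_points P) n v"


section \<open>Screening charges\<close>

definition supercommutes :: "('v \<Rightarrow> 'v) \<Rightarrow> (int \<Rightarrow> 'v \<Rightarrow> 'v::ab_group_add) \<Rightarrow> bool" where
  "supercommutes S A \<longleftrightarrow> (\<forall>n v. S (A n v) = A n (S v)) \<or> (\<forall>n v. S (A n v) = - A n (S v))"

text \<open>
  The contour integral of \<open>\<Psi>\<^sub>k*(z) dz/z\<close> is the coefficient of \<open>z\<^sup>0\<close>. It requires integer powers of \<open>z\<close>, so
  the integer operator is the exponent \<open>J - 1/2\<close> of \<open>:exp (- q^) z\<^sup>-\<^sup>J:\<close>. (For \<open>J\<close> itself integer the
  coefficient is zero.)
\<close>

definition commutes_with_fermionic_screening ::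
  "complex \<Rightarrow> (complex \<Rightarrow> 'v \<Rightarrow> 'v::ab_group_add) \<Rightarrow> 'i dquiver \<Rightarrow> 'i \<Rightarrow> 'i qpath \<Rightarrow> bool" where
  "commutes_with_fermionic_screening h sc Q k P \<longleftrightarrow>
     (\<forall>(M :: ('i, 'v) seed_ops) \<Phi>.
        fermionization h sc Q k M \<Phi> \<and> diagonalizable sc {\<mu>. \<mu> - 1/2 \<in> \<int>} (fJ \<Phi>) \<longrightarrow>
        (let D = (\<lambda>v. fJ \<Phi> v - fp \<Phi> v);
             charge = fermi_star h sc (fJ \<Phi>) (fYinv \<Phi>) (osc M k) 0
         in supercommutes charge (SigmaD_cur h sc Q k D M P) \<and>
            supercommutes charge (PsiD_cur h sc Q k D M P)))"

text \<open>
  At a vertex with one loop of label \<open>\<kappa> = q\<^sup>e\<close>, let \<open>\<sigma> = q\<^sup>s\<close> with \<open>s = 1\<close> or \<open>s = e/2\<close>, and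
  \<open>\<sigma>' = q \<kappa>\<^sup>1\<^sup>/\<^sup>2 \<sigma>\<^sup>-\<^sup>1 = q\<^sup>t\<close>, so that \<open>log \<sigma>' / log \<sigma> = t / s\<close>. The commutator of \<open>s\<^sub>0\<close> with \<open>X\<^sub>j\<close> is the
  logarithm of \<open>X\<^sub>k X\<^sub>j = q\<^bsup>2 eps k j\<^esup> X\<^sub>j X\<^sub>k\<close>.
\<close>

definition loop_extension ::
  "complex \<Rightarrow> (complex \<Rightarrow> 'v \<Rightarrow> 'v) \<Rightarrow> 'i dquiver \<Rightarrow> 'i \<Rightarrow> complex \<Rightarrow> complex \<Rightarrow>
   ('i, 'v::ab_group_add) seed_ops \<Rightarrow> ('v \<Rightarrow> 'v) \<Rightarrow> ('v \<Rightarrow> 'v) \<Rightarrow> bool" where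
  "loop_extension h sc Q k s t M S s0 \<longleftrightarrow>
     seed_module h sc Q M \<and> linop sc S \<and> diagonalizable sc UNIV s0 \<and>
     (\<forall>v. zer M k v = opfun sc (\<lambda>\<mu>. qp h (-2 * s * \<mu>)) s0 v \<and>
          s0 (S v) - S (s0 v) = sc (2 * t / s) (S v)) \<and>
     (\<forall>i\<in>verts Q. \<forall>n v. n \<noteq> 0 \<longrightarrow>
        s0 (osc M i n v) = osc M i n (s0 v) \<and> S (osc M i n v) = osc M i n (S v)) \<and>
     (\<forall>j\<in>verts Q. \<forall>v.
        s0 (zer M j v) - zer M j (s0 v) = sc (- of_int (eps Q k j) / s) (zer M j v) \<and>
        (j \<noteq> k \<longrightarrow> S (zer M j v) =
           (if labels Q j k \<noteq> {#} \<or> labels Q k j \<noteq> {#} then sc (qp h (-2 * t)) (zer M j (S v))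
            else zer M j (S v))))"

text \<open>
  The zero mode of the screening current is Weyl ordered as well:
  \<open>:S z\<^bsup>-s\<^sub>0\<^esup>: = S z\<^bsup>-s\<^sub>0 - log \<sigma>' / log \<sigma>\<^esup>\<close>. The charge is the coefficient of \<open>z\<^sup>0\<close>; it is zero on the
  eigenspaces of \<open>s\<^sub>0\<close> on which the powers of \<open>z\<close> are not integers.
\<close>

definition loop_charge ::
  "complex \<Rightarrow> (complex \<Rightarrow> 'v \<Rightarrow> 'v) \<Rightarrow> complex \<Rightarrow> complex \<Rightarrow> ('v \<Rightarrow> 'v) \<Rightarrow> ('v \<Rightarrow> 'v) \<Rightarrow>
   (int \<Rightarrow> 'v \<Rightarrow> 'v) \<Rightarrow> 'v \<Rightarrow> 'v::ab_group_add" where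
  "loop_charge h sc s t S s0 x =
     vop sc S (\<lambda>v. - s0 v - sc (t / s) v)
       (\<lambda>n v. sc (- 1 / (qp h (of_int n * s) - qp h (- of_int n * s))) (x n v)) 0"

definition commutes_with_loop_screening ::
  "complex \<Rightarrow> (complex \<Rightarrow> 'v \<Rightarrow> 'v::ab_group_add) \<Rightarrow> 'i dquiver \<Rightarrow> 'i \<Rightarrow> complex \<Rightarrow> 'i qpath \<Rightarrow> bool" where
  "commutes_with_loop_screening h sc Q k e P \<longleftrightarrow>
     (\<forall>s\<in>{1, e / 2}. \<forall>(M :: ('i, 'v) seed_ops) S s0.
        loop_extension h sc Q k s (1 + e / 2 - s) M S s0 \<longrightarrow>
        (let charge = loop_charge h sc s (1 + e / 2 - s) S s0 (osc M k)
         in supercommutes charge (Sigma_cur h sc Q M P) \<and>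
            supercommutes charge (Psi_cur h sc Q M P)))"

definition commutes_with_screenings ::
  "complex \<Rightarrow> (complex \<Rightarrow> 'v \<Rightarrow> 'v::ab_group_add) \<Rightarrow> 'i dquiver \<Rightarrow> 'i qpath \<Rightarrow> bool" where
  "commutes_with_screenings h sc Q P \<longleftrightarrow>
     (\<forall>k\<in>verts Q. vkind Q k = Unfrozen \<longrightarrow>
        (labels Q k k = {#} \<longrightarrow> commutes_with_fermionic_screening h sc Q k P) \<and>
        (\<forall>e. labels Q k k = {#e#} \<longrightarrow> commutes_with_loop_screening h sc Q k e P))"


section \<open>Mutation of the vertex operators\<close>

text \<open>
  The new fermions are given by their bosonization: \<open>J'\<close>, \<open>Y'\<close> and \<open>y\<^sub>n\<close>, the latter being the
  oscillators of the new \<open>X\<^sub>k(z)\<close>. All of them commute with the \<open>V\<^sub>j(z)\<close>. At \<open>z\<^sup>c\<close> the two relations between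
  the fermions are those of the last two lines.
\<close>

definition fermion_mutation ::
  "complex \<Rightarrow> (complex \<Rightarrow> 'v \<Rightarrow> 'v) \<Rightarrow> 'i dquiver \<Rightarrow> 'i \<Rightarrow>
   ('i, 'v::ab_group_add) seed_ops \<Rightarrow> ('i, 'v) fermi_ops \<Rightarrow>
   ('v \<Rightarrow> 'v) \<Rightarrow> ('v \<Rightarrow> 'v) \<Rightarrow> ('v \<Rightarrow> 'v) \<Rightarrow> (int \<Rightarrow> 'v \<Rightarrow> 'v) \<Rightarrow> bool" where
  "fermion_mutation h sc Q k M \<Phi> J' Y' Yinv' y \<longleftrightarrow>
     fermionization h sc Q k M \<Phi> \<and>
     diagonalizable sc UNIV J' \<and> diagonalizable sc \<int> (\<lambda>v. J' v + fp \<Phi> v) \<and>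
     linop sc Y' \<and> (\<forall>n. n \<noteq> 0 \<longrightarrow> linop sc (y n)) \<and> smooth {k} (\<lambda>_. y) \<and>
     (\<forall>v. Y' (Yinv' v) = v \<and> Yinv' (Y' v) = v \<and> J' (Y' v) = Y' (J' v + v)) \<and>
     (\<forall>n m v. n \<noteq> 0 \<and> m \<noteq> 0 \<longrightarrow>
        J' (y n v) = y n (J' v) \<and> Y' (y n v) = y n (Y' v) \<and>
        y n (y m v) - y m (y n v) =
          (if n + m = 0 then sc ((qp h (of_int n) - qp h (- of_int n))\<^sup>2 / of_int n) v else 0)) \<and>
     (\<forall>f \<in> {J', Y'} \<union> {y n | n. n \<noteq> 0}. \<forall>v.
        f (fp \<Phi> v) = fp \<Phi> (f v) \<and>
        (\<forall>j\<in>verts Q - {k}. f (fV \<Phi> j v) = fV \<Phi> j (f v) \<and>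
           (\<forall>n. n \<noteq> 0 \<longrightarrow> f (v_osc h sc Q k M j n v) = v_osc h sc Q k M j n (f v)))) \<and>
     (\<forall>c v. fermi_star h sc J' Yinv' y c v =
        sc (qp h c - qp h (- c)) (fermi h sc (fJ \<Phi>) (fY \<Phi>) (osc M k) c v)) \<and>
     (\<forall>c v. fermi_star h sc (fJ \<Phi>) (fYinv \<Phi>) (osc M k) c v =
        sc (qp h (- c) - qp h c) (fermi h sc J' Y' y c v))"

text \<open>
  The new vertex operators; \<open>Q\<close> is the old quiver, and \<open>j \<noteq> k\<close> corresponds to
  \<open>:\<Prod>\<^sub>a \<Psi>'*(\<kappa>\<^sub>a z) \<Prod>\<^sub>b (- \<Psi>'(\<kappa>\<^sub>b\<^sup>-\<^sup>1 z)): V\<^sub>j(z)\<close>. The power of \<open>z\<close> at its zero mode is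
  \<open>z\<^bsup>-\<epsilon>\<^sub>j\<^sub>k (J' + p)\<^esup>\<close>, i.e. the operator \<open>D\<close> for the mutated quiver is \<open>J' + p\<close>.
\<close>

definition mutated_ops ::
  "complex \<Rightarrow> (complex \<Rightarrow> 'v \<Rightarrow> 'v) \<Rightarrow> 'i dquiver \<Rightarrow> 'i \<Rightarrow>
   ('i, 'v::ab_group_add) seed_ops \<Rightarrow> ('i, 'v) fermi_ops \<Rightarrow>
   ('v \<Rightarrow> 'v) \<Rightarrow> ('v \<Rightarrow> 'v) \<Rightarrow> ('v \<Rightarrow> 'v) \<Rightarrow> (int \<Rightarrow> 'v \<Rightarrow> 'v) \<Rightarrow> ('i, 'v) seed_ops" where
  "mutated_ops h sc Q k M \<Phi> J' Y' Yinv' y = \<lparr>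
     zer = (\<lambda>j v. if j = k then - opfun sc (\<lambda>\<mu>. qp h (-2 * \<mu>)) J' v
        else sc ((-1) ^ size (labels Q k j))
          (weyl h sc J' Y' Yinv' (- eps Q j k)
             (- (\<Sum>e\<in>#labels Q j k. e) - (\<Sum>e\<in>#labels Q k j. e)) (fV \<Phi> j v))),
     osc = (\<lambda>j n v. if j = k then y n v
        else v_osc h sc Q k M j n v +
          sc (((\<Sum>e\<in>#labels Q k j. qp h (of_int n * e)) - (\<Sum>e\<in>#labels Q j k. qp h (- of_int n * e)))
              / (qp h (of_int n) - qp h (- of_int n))) (y n v))\<rparr>"

text \<open>\<open>X\<^sub>k(z) \<mapsto> X\<^sub>k(q\<^sup>-\<^sup>c z)\<close>.\<close>

definition gauge_ops ::
  "complex \<Rightarrow> (complex \<Rightarrow> 'v \<Rightarrow> 'v) \<Rightarrow> 'i \<Rightarrow> complex \<Rightarrow> ('i, 'v) seed_ops \<Rightarrow> ('i, 'v) seed_ops" where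
  "gauge_ops h sc k c M = M\<lparr>osc := (\<lambda>j n v.
     if j = k then sc (qp h (of_int n * c)) (osc M k n v) else osc M j n v)\<rparr>"

text \<open>
  The realization for \<open>Q'\<close> (paths \<open>Pp'\<close>, \<open>Pm'\<close>) is obtained from the one for \<open>Q\<close> (paths \<open>Pp\<close>, \<open>Pm\<close>) by
  mutation at \<open>k\<close> followed by gauging \<open>k\<close> by \<open>q\<^sup>c\<close>.
\<close>

definition obtained_by_mutation ::
  "complex \<Rightarrow> (complex \<Rightarrow> 'v \<Rightarrow> 'v::ab_group_add) \<Rightarrow> 'i \<Rightarrow> complex \<Rightarrow>
   'i dquiver \<Rightarrow> 'i qpath \<Rightarrow> 'i qpath \<Rightarrow> 'i dquiver \<Rightarrow> 'i qpath \<Rightarrow> 'i qpath \<Rightarrow> bool" where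
  "obtained_by_mutation h sc k c Q Pp Pm Q' Pp' Pm' \<longleftrightarrow>
     (\<exists>Q0. mutated h k Q Q0 \<and> Q' = gauge_quiver k c Q0) \<and>
     (\<forall>(M :: ('i, 'v) seed_ops) \<Phi> J' Y' Yinv' y.
        fermion_mutation h sc Q k M \<Phi> J' Y' Yinv' y \<longrightarrow>
        (let M' = gauge_ops h sc k c (mutated_ops h sc Q k M \<Phi> J' Y' Yinv' y);
             D = (\<lambda>v. fJ \<Phi> v - fp \<Phi> v);
             D' = (\<lambda>v. J' v + fp \<Phi> v)
         in seed_module h sc Q' M' \<and>
            SigmaD_cur h sc Q k D M Pp = SigmaD_cur h sc Q' k D' M' Pp' \<and>
            SigmaD_cur h sc Q k D M Pm = SigmaD_cur h sc Q' k D' M' Pm' \<and>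
            PsiD_cur h sc Q k D M Pp = PsiD_cur h sc Q' k D' M' Pp' \<and>
            PsiD_cur h sc Q k D M Pm = PsiD_cur h sc Q' k D' M' Pm'))"


section \<open>The two quivers\<close>

text \<open>Here \<open>q\<^sub>1 = q\<^bsup>-2k - 4\<^esup>\<close>, \<open>q\<^sub>2 = q\<^sup>2\<close>, \<open>q\<^sub>3 = q\<^bsup>2k + 2\<^esup>\<close>, so the exponents below are those of the labels.\<close>

definition kind03 :: "nat \<Rightarrow> vtype" where
  "kind03 i = (if i = 0 then FrozenMinus else if i = 3 then FrozenPlus else Unfrozen)"

definition Q_I :: "complex \<Rightarrow> nat dquiver" where
  "Q_I k = \<lparr>verts = {0, 1, 2, 3}, vkind = kind03,
     arrows = {#(0, 1, 0), (1, 3, 2 * k + 2), (3, 2, 0), (2, 0, -2), (1, 2, 0), (2, 1, -2 * k - 4)#}\<rparr>"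

definition Pp_I :: "complex \<Rightarrow> nat qpath" where
  "Pp_I k = (0, [(0, 1), (2 * k + 2, 3)])"

definition Pm_I :: "nat qpath" where
  "Pm_I = (3, [(0, 2), (-2, 0)])"

definition Q_II :: "complex \<Rightarrow> nat dquiver" where
  "Q_II k = \<lparr>verts = {0, 1, 2, 3}, vkind = kind03,
     arrows = {#(0, 3, 2 * k + 2), (1, 0, -2 * k - 4), (3, 1, 0), (1, 2, 0), (2, 1, 2 * k + 2),
                (2, 2, -2 * k - 4)#}\<rparr>"

definition Pp_II :: "complex \<Rightarrow> nat qpath" where
  "Pp_II k = (0, [(2 * k + 2, 3)])"

definition Pm_II :: "complex \<Rightarrow> nat qpath" where
  "Pm_II k = (3, [(0, 1), (0, 2), (2 * k + 2, 1), (-2 * k - 4, 0)])"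

end

theory Submission
  imports Defs "HOL-Library.Groups_Big_Fun"
begin

text \<open>
  All currents are sums of normally ordered exponentials, so every relation is a statement about
  contractions. If the pairing of the oscillators of \<open>A\<close> and \<open>B\<close> is \<open>(\<Sum>b\<^sup>n - \<Sum>a\<^sup>n) / n\<close>, then
  \<open>A(z) B(w) = \<Prod>(1 - a w/z) \<Prod>(1 - b w/z)\<^sup>-\<^sup>1 :A(z) B(w):\<close>, and the other order of the factors gives the
  expansion of the same rational function at the other end. Hence a commutator is supported at the
  poles. The delta terms of consecutive terms of a path cancel, and those at the two ends of the paths
  are the currents \<open>\<psi>\<^sup>+\<close> and \<open>\<psi>\<^sup>-\<close>.

  For the fermionic screening charge and for the mutation one decomposes into joint eigenvectors of \<open>J\<close>
  and \<open>p\<close>. There each term of a path is a single fermion (or none) times an operator that commutes with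
  the fermions and that is the same for the terms which differ by a factor \<open>X\<^sub>k\<close>. Up to powers of \<open>q\<close>
  such a pair of terms is the combination \<open>(q\<^sup>c - q\<^sup>-\<^sup>c) \<Psi>\<^sub>c\<close>, that is, one mode of a mutated fermion.
\<close>

text \<open>The modules carry no topology: a product of currents makes sense only because on each
  vector all but finitely many terms vanish. Hence sums over modes are \<open>Sum_any\<close>, whose
  value 0 on an infinite support turns every interchange into a finiteness question, and
  exponentials are handled through the recursion coming from z d/dz. A contraction is required as an
  identity of finite exponential sums at every H; putting H = n h yields all coefficients of its
  logarithm, so the contraction functions of a quiver follow from the sixteen entries of C.

  Two statements fail term by term in the second quiver: in the quadratic relation of F four pairs
  of terms keep a pole and cancel two by two, and a loop charge is compensated only between the
  second and third term of the long path. The mutated operators have to be shown to form a seed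
  module; for this both realizations are instances of one structure with the same V_j and the same
  residual oscillators, in which only the fermions are exchanged.\<close>

locale cvs = vector_space sc for sc :: "complex \<Rightarrow> 'v::ab_group_add \<Rightarrow> 'v"
begin

section \<open>Linear maps and finitely supported sums\<close>

abbreviation lin :: "('v \<Rightarrow> 'v) \<Rightarrow> bool" where "lin f \<equiv> Vector_Spaces.linear sc sc f"

lemma lin_iff: "lin f \<longleftrightarrow> (\<forall>u v. f (u + v) = f u + f v) \<and> (\<forall>c v. f (sc c v) = sc c (f v))"
  using vector_space_axioms by (auto simp: Vector_Spaces.linear_iff)

lemma lin_add: "lin f \<Longrightarrow> f (u + v) = f u + f v" by (simp add: lin_iff)
lemma lin_sc: "lin f \<Longrightarrow> f (sc c v) = sc c (f v)" by (simp add: lin_iff)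
lemma lin_zero: "lin f \<Longrightarrow> f 0 = 0" using lin_sc[of f 0 0] by simp
lemma lin_neg: "lin f \<Longrightarrow> f (- v) = - f v" using lin_sc[of f "-1" v] by simp
lemma lin_diff: "lin f \<Longrightarrow> f (u - v) = f u - f v" using lin_add[of f u "- v"] by (simp add: lin_neg)
lemma lin_sum: "lin f \<Longrightarrow> f (sum g A) = (\<Sum>x\<in>A. f (g x))"
  by (induction A rule: infinite_finite_induct) (auto simp: lin_zero lin_add)
lemma lin_sum_list: "lin f \<Longrightarrow> f (\<Sum>x\<leftarrow>xs. g x) = (\<Sum>x\<leftarrow>xs. f (g x))"
  by (induction xs) (auto simp: lin_zero lin_add)

lemma lin_id: "lin (\<lambda>v. v)" by (simp add: lin_iff)
lemma lin_const0: "lin (\<lambda>v. 0)" by (simp add: lin_iff)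
lemma lin_comp: "lin f \<Longrightarrow> lin g \<Longrightarrow> lin (\<lambda>v. f (g v))" by (simp add: lin_iff)
lemma lin_plus: "lin f \<Longrightarrow> lin g \<Longrightarrow> lin (\<lambda>v. f v + g v)" by (simp add: lin_iff scale_right_distrib)
lemma lin_minus: "lin f \<Longrightarrow> lin g \<Longrightarrow> lin (\<lambda>v. f v - g v)" by (simp add: lin_iff scale_right_diff_distrib)
lemma lin_uminus: "lin f \<Longrightarrow> lin (\<lambda>v. - f v)" by (simp add: lin_iff)
lemma lin_scale: "lin f \<Longrightarrow> lin (\<lambda>v. sc c (f v))" by (simp add: lin_iff scale_right_distrib mult.commute)
lemma lin_Sum: "(\<And>x. x \<in> A \<Longrightarrow> lin (f x)) \<Longrightarrow> lin (\<lambda>v. \<Sum>x\<in>A. f x v)"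
  by (induction A rule: infinite_finite_induct) (auto intro: lin_plus lin_const0)
lemma lin_Sum_list: "(\<And>x. x \<in> set xs \<Longrightarrow> lin (f x)) \<Longrightarrow> lin (\<lambda>v. \<Sum>x\<leftarrow>xs. f x v)"
  by (induction xs) (auto intro: lin_plus lin_const0)

lemmas lin_intros = lin_id lin_const0 lin_plus lin_minus lin_uminus lin_scale lin_Sum lin_Sum_list

text \<open>Finiteness is asked of \<open>g\<close> itself: \<open>f\<close> could kill all but
  finitely many terms of an infinite family, and then the left side would be \<open>f 0\<close>
  while the right side is a genuine sum.\<close>

lemma lin_Sum_any:
  assumes "lin f" "finite {x. g x \<noteq> 0}"
  shows "f (Sum_any g) = Sum_any (\<lambda>x. f (g x))"
proof -
  have "Sum_any (\<lambda>x. f (g x)) = (\<Sum>x | g x \<noteq> 0. f (g x))"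
    by (rule Sum_any.expand_superset) (use assms in \<open>auto simp: lin_zero\<close>)
  then show ?thesis by (simp add: Sum_any.expand_set lin_sum[OF assms(1)])
qed

lemma sc_Sum_any: "finite {x. g x \<noteq> 0} \<Longrightarrow> sc c (Sum_any g) = Sum_any (\<lambda>x. sc c (g x))"
  by (rule lin_Sum_any) (simp_all add: lin_iff scale_right_distrib mult.commute)

text \<open>The single supports must be finite; otherwise cancellation between members of
  \<open>A\<close> could make the left side a genuine sum while the sums on the right default to
  0.\<close>

lemma Sum_any_sum:
  fixes g :: "'a \<Rightarrow> 'b \<Rightarrow> 'w::comm_monoid_add"
  assumes "finite A" "\<And>a. a \<in> A \<Longrightarrow> finite {x. g a x \<noteq> 0}"
  shows "Sum_any (\<lambda>x. \<Sum>a\<in>A. g a x) = (\<Sum>a\<in>A. Sum_any (g a))"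
proof -
  define B where "B = (\<Union>a\<in>A. {x. g a x \<noteq> 0})"
  have B: "finite B" using assms by (auto simp: B_def)
  have "Sum_any (\<lambda>x. \<Sum>a\<in>A. g a x) = (\<Sum>x\<in>B. \<Sum>a\<in>A. g a x)"
    by (rule Sum_any.expand_superset[OF B])
      (auto simp: B_def elim: sum.not_neutral_contains_not_neutral)
  also have "\<dots> = (\<Sum>a\<in>A. \<Sum>x\<in>B. g a x)" by (rule sum.swap)
  also have "\<dots> = (\<Sum>a\<in>A. Sum_any (g a))"
    by (rule sum.cong[OF refl], rule Sum_any.expand_superset[symmetric, OF B]) (auto simp: B_def)
  finally show ?thesis .
qed

lemma Sum_any_shift: "Sum_any (\<lambda>x::int. g (x + c)) = Sum_any g"
  by (rule Sum_any.reindex_cong[symmetric, where l = "\<lambda>x. x + c"])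
    (auto simp: fun_eq_iff intro!: bijI injI surjI[of _ "\<lambda>x. x - c"])

lemma Sum_any_reflect: "Sum_any (\<lambda>x::int. g (c - x)) = Sum_any g"
  by (rule Sum_any.reindex_cong[symmetric, where l = "\<lambda>x. c - x"])
    (auto simp: fun_eq_iff intro!: bijI injI surjI[of _ "\<lambda>x. c - x"])

subsection \<open>Exponentials of commuting families\<close>

text \<open>Index 0 is excluded: the oscillators carry no meaning there and the exponentials never
  touch it.\<close>

definition cfam :: "(nat \<Rightarrow> 'v \<Rightarrow> 'v) \<Rightarrow> bool" where
  "cfam a \<longleftrightarrow> (\<forall>n>0. lin (a n)) \<and> (\<forall>m>0. \<forall>n>0. \<forall>v. a m (a n v) = a n (a m v))"

lemma cfam_lin: "cfam a \<Longrightarrow> n > 0 \<Longrightarrow> lin (a n)" by (simp add: cfam_def)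

lemma powc_lin: "cfam a \<Longrightarrow> lin (powc a j m)"
proof (induction j arbitrary: m)
  case 0 show ?case by (cases "m = 0") (auto intro: lin_intros)
next
  case (Suc j)
  show ?case unfolding powc.simps
    by (rule lin_Sum, rule lin_comp[where f = "a _"]) (use Suc cfam_lin in auto)
qed

lemma powc_comm:
  assumes "cfam a" "lin T" "\<And>n v. n > 0 \<Longrightarrow> T (a n v) = a n (T v)"
  shows "T (powc a j m v) = powc a j m (T v)"
  by (induction j arbitrary: m v) (auto simp: assms lin_zero lin_sum intro!: sum.cong)

lemma powc_zero: "m < j \<Longrightarrow> cfam a \<Longrightarrow> powc a j m v = 0"
proof (induction j arbitrary: m)
  case (Suc j)
  have "powc a j (m - n) v = 0" if "n \<in> {1..m}" for n using Suc that by (intro Suc.IH) auto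
  then show ?case using Suc.prems by (auto intro!: sum.neutral simp: lin_zero cfam_lin)
qed simp

text \<open>Coefficient of z^m in z d/dz A^(j+1) = (j+1) (z A') A^j for A(z) = \<Sum> z^n
  \<open>a n\<close>; commutativity lets the differentiated factor be pulled to the front.\<close>

lemma powc_rec:
  assumes a: "cfam a"
  shows "sc (of_nat m) (powc a (Suc j) m v) =
    sc (of_nat (Suc j)) (\<Sum>n=1..m. sc (of_nat n) (a n (powc a j (m - n) v)))"
proof (induction j arbitrary: m)
  case 0
  have "(\<Sum>n=1..m. sc (of_nat m) (a n (if m - n = 0 then v else 0))) =
    (\<Sum>n=1..m. sc (of_nat n) (a n (if m - n = 0 then v else 0)))"
    by (intro sum.cong refl) (auto simp: lin_zero cfam_lin[OF a])
  then show ?case by (simp add: scale_sum_right)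
next
  case (Suc j)
  \<comment> \<open>Split m = n + (m - n): the first part differentiates the newly added factor, the
    second is the derivative of the remaining power, where the induction hypothesis applies.\<close>
  have "sc (of_nat m) (powc a (Suc (Suc j)) m v) =
      (\<Sum>n=1..m. sc (of_nat n) (a n (powc a (Suc j) (m - n) v))) +
      (\<Sum>n=1..m. a n (sc (of_nat (m - n)) (powc a (Suc j) (m - n) v)))"
    unfolding powc.simps(2)[of a "Suc j"] scale_sum_right sum.distrib[symmetric]
    by (intro sum.cong refl)
      (simp add: lin_sc cfam_lin[OF a] scale_left_distrib[symmetric] of_nat_diff)
  also have "(\<Sum>n=1..m. a n (sc (of_nat (m - n)) (powc a (Suc j) (m - n) v))) =
      sc (of_nat (Suc j)) (\<Sum>n=1..m. \<Sum>i=1..m-n. sc (of_nat i) (a n (a i (powc a j (m - n - i) v))))"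
    unfolding Suc.IH scale_sum_right
    by (intro sum.cong refl) (simp add: lin_sc lin_sum cfam_lin[OF a] scale_sum_right)
  also have "(\<Sum>n=1..m. \<Sum>i=1..m-n. sc (of_nat i) (a n (a i (powc a j (m - n - i) v)))) =
     (\<Sum>i=1..m. \<Sum>n=1..m-i. sc (of_nat i) (a n (a i (powc a j (m - n - i) v))))"
    unfolding sum.Sigma[OF finite_atLeastAtMost ballI[OF finite_atLeastAtMost]]
    by (rule sum.reindex_bij_witness[where i = "\<lambda>(x,y). (y,x)" and j = "\<lambda>(x,y). (y,x)"]) auto
  also have "\<dots> = (\<Sum>i=1..m. sc (of_nat i) (a i (powc a (Suc j) (m - i) v)))"
  proof (intro sum.cong refl)
    fix i assume i: "i \<in> {1..m}"
    have "(\<Sum>n=1..m-i. sc (of_nat i) (a n (a i (powc a j (m - n - i) v)))) =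
      sc (of_nat i) (\<Sum>n=1..m-i. a i (a n (powc a j (m - i - n) v)))"
      unfolding scale_sum_right
    proof (intro sum.cong refl)
      fix n assume n: "n \<in> {1..m-i}"
      have e: "m - n - i = m - i - n" by simp
      have "a n (a i u) = a i (a n u)" for u using a i n by (simp add: cfam_def)
      then show "sc (of_nat i) (a n (a i (powc a j (m - n - i) v))) = sc (of_nat i) (a i (a n (powc a j (m - i - n) v)))"
        unfolding e by simp
    qed
    then show "(\<Sum>n=1..m-i. sc (of_nat i) (a n (a i (powc a j (m - n - i) v)))) =
      sc (of_nat i) (a i (powc a (Suc j) (m - i) v))"
      using i by (simp add: lin_sum cfam_lin[OF a])
  qed
  also have "(\<Sum>n=1..m. sc (of_nat n) (a n (powc a (Suc j) (m - n) v))) +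
      sc (of_nat (Suc j)) (\<Sum>i=1..m. sc (of_nat i) (a i (powc a (Suc j) (m - i) v))) =
      sc (of_nat (Suc (Suc j))) (\<Sum>n=1..m. sc (of_nat n) (a n (powc a (Suc j) (m - n) v)))"
    unfolding of_nat_Suc[of "Suc j"] scale_left_distrib scale_one ..
  finally show ?case .
qed

text \<open>Extended by 0 to negative exponents, so that the convolutions below can shift indices
  without case distinctions.\<close>

definition Ez :: "(nat \<Rightarrow> 'v \<Rightarrow> 'v) \<Rightarrow> int \<Rightarrow> 'v \<Rightarrow> 'v" where
  "Ez a r v = (if r < 0 then 0 else expc sc a (nat r) v)"

lemma Ez_neg [simp]: "r < 0 \<Longrightarrow> Ez a r v = 0" by (simp add: Ez_def)
lemma Ez_0 [simp]: "Ez a 0 v = v" by (simp add: Ez_def expc_def)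

lemma Ez_lin: "cfam a \<Longrightarrow> lin (Ez a r)"
  unfolding Ez_def expc_def by (cases "r < 0") (auto intro!: lin_intros intro: powc_lin)

lemma Ez_comm:
  assumes "cfam a" "lin T" "\<And>n v. n > 0 \<Longrightarrow> T (a n v) = a n (T v)"
  shows "T (Ez a r v) = Ez a r (T v)"
  using assms by (simp add: Ez_def expc_def lin_zero lin_sum lin_sc powc_comm[OF assms])

lemma powc_cong: "(\<And>n v. n > 0 \<Longrightarrow> a n v = b n v) \<Longrightarrow> powc a j m v = powc b j m v"
  by (induction j arbitrary: m) auto

lemma Ez_cong: "(\<And>n v. n > 0 \<Longrightarrow> a n v = b n v) \<Longrightarrow> Ez a r v = Ez b r v"
  using powc_cong[of a b] by (simp add: Ez_def expc_def)

lemma Ez_scale: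
  assumes "cfam a"
  shows "Ez (\<lambda>n v. sc (c ^ n) (a n v)) r v = sc (c ^ nat r) (Ez a r v)"
proof -
  have "powc (\<lambda>n v. sc (c ^ n) (a n v)) j m v = sc (c ^ m) (powc a j m v)" for j m
  proof (induction j arbitrary: m)
    case (Suc j)
    have "powc (\<lambda>n v. sc (c ^ n) (a n v)) (Suc j) m v = (\<Sum>n=1..m. sc (c ^ n * c ^ (m - n)) (a n (powc a j (m - n) v)))"
      by (auto simp: Suc lin_sc cfam_lin[OF assms] intro!: sum.cong)
    then show ?case by (simp add: power_add[symmetric] scale_sum_right)
  qed auto
  then show ?thesis by (simp add: Ez_def expc_def scale_sum_right mult.commute)
qed

lemma Ez_trivial:
  assumes "\<And>n v. n > 0 \<Longrightarrow> a n v = 0" shows "Ez a r v = (if r = 0 then v else 0)"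
proof -
  have "powc a (Suc j) m v = 0" for j m using assms by (auto intro!: sum.neutral)
  then have "powc a j m v = (if j = 0 \<and> m = 0 then v else 0)" for j m
    by (cases j) auto
  then have "expc sc a m v = (if m = 0 then v else 0)" for m
    by (auto simp: expc_def sum.delta if_distrib[where f = "sc _"] cong: if_cong)
  then show ?thesis by (auto simp: Ez_def)
qed

text \<open>z d/dz exp A = (z A') exp A. Any bound \<open>N\<close> beyond the degree is allowed,
  since later summands vanish; this freedom lets recursions of different degree share one range of
  summation.\<close>

lemma Ez_rec:
  assumes a: "cfam a" and N: "r \<le> int N"
  shows "sc (of_int r) (Ez a r v) = (\<Sum>n=1..N. sc (of_nat n) (a n (Ez a (r - int n) v)))"
proof (cases "r \<ge> 0")
  case False
  then show ?thesis by (simp add: lin_zero cfam_lin[OF a])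
next
  case True
  define m where "m = nat r"
  have r: "r = int m" using True by (simp add: m_def)
  have e: "expc sc a k v = (\<Sum>j\<le>M. sc (1 / fact j) (powc a j k v))" if "k \<le> M" for k M
    unfolding expc_def by (rule sum.mono_neutral_left) (use that in \<open>auto simp: powc_zero[OF _ a]\<close>)
  have "sc (of_nat m) (expc sc a m v) = (\<Sum>j\<le>Suc m. sc (1 / fact j) (sc (of_nat m) (powc a j m v)))"
    by (simp add: e[of m "Suc m"] scale_sum_right mult.commute del: sum.atMost_Suc)
  also have "\<dots> = (\<Sum>j\<le>m. sc (1 / fact (Suc j)) (sc (of_nat m) (powc a (Suc j) m v)))"
    by (subst sum.atMost_Suc_shift) simp
  also have "\<dots> = (\<Sum>j\<le>m. \<Sum>n=1..m. sc (of_nat n) (a n (sc (1 / fact j) (powc a j (m - n) v))))"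
  proof (intro sum.cong refl)
    fix j
    have f: "(1 / fact (Suc j)) * of_nat (Suc j) = (1 / fact j :: complex)"
      by (simp add: divide_simps del: of_nat_Suc)
    show "sc (1 / fact (Suc j)) (sc (of_nat m) (powc a (Suc j) m v)) =
      (\<Sum>n=1..m. sc (of_nat n) (a n (sc (1 / fact j) (powc a j (m - n) v))))"
      unfolding powc_rec[OF a] scale_scale f scale_sum_right
      by (intro sum.cong refl) (simp add: lin_sc cfam_lin[OF a] mult.commute del: of_nat_Suc)
  qed
  also have "\<dots> = (\<Sum>n=1..m. sc (of_nat n) (a n (expc sc a (m - n) v)))"
    by (subst sum.swap, intro sum.cong refl)
      (simp add: e[of _ m] lin_sum cfam_lin[OF a] scale_sum_right)
  also have "\<dots> = (\<Sum>n=1..m. sc (of_nat n) (a n (Ez a (r - int n) v)))"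
    by (intro sum.cong refl) (auto simp: Ez_def r nat_diff_distrib)
  also have "\<dots> = (\<Sum>n=1..N. sc (of_nat n) (a n (Ez a (r - int n) v)))"
    by (rule sum.mono_neutral_left) (use N r in \<open>auto simp: lin_zero cfam_lin[OF a]\<close>)
  finally show ?thesis by (simp add: Ez_def r)
qed

text \<open>Division by r > 0 makes the recursion determine everything from degree 0, so an identity
  between exponentials reduces to checking that both sides obey the same recursion.\<close>

lemma Ez_unique:
  assumes a: "cfam a" and G: "\<And>r. r < 0 \<Longrightarrow> G r = 0" "G 0 = g"
    and rec: "\<And>r. r > 0 \<Longrightarrow> sc (of_int r) (G r) = (\<Sum>n=1..nat r. sc (of_nat n) (a n (G (r - int n))))"
  shows "G r = Ez a r g"
proof -
  have "G (int m) = Ez a (int m) g" for m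
  proof (induction m rule: less_induct)
    case (less m)
    show ?case
    proof (cases "m = 0")
      case False
      have "sc (of_int (int m)) (G (int m)) = (\<Sum>n=1..m. sc (of_nat n) (a n (G (int m - int n))))"
        using rec[of "int m"] False by simp
      also have "\<dots> = (\<Sum>n=1..m. sc (of_nat n) (a n (Ez a (int m - int n) g)))"
        using less.IH by (intro sum.cong refl) (auto simp: of_nat_diff[symmetric] simp del: of_nat_diff)
      also have "\<dots> = sc (of_int (int m)) (Ez a (int m) g)"
        by (rule Ez_rec[symmetric]) (use a in auto)
      finally show ?thesis using False by simp
    qed (simp add: G)
  qed
  from this[of "nat r"] show ?thesis using G(1)[of r] by (cases "r < 0") auto
qed

lemma cfam_add:
  assumes "cfam a" "cfam b" "\<And>m n v. m > 0 \<Longrightarrow> n > 0 \<Longrightarrow> a m (b n v) = b n (a m v)"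
  shows "cfam (\<lambda>n v. a n v + b n v)"
  using assms unfolding cfam_def by (auto intro!: lin_plus simp: lin_add)

lemma cfam_scale: "cfam a \<Longrightarrow> cfam (\<lambda>n v. sc (c n) (a n v))"
  unfolding cfam_def by (auto intro!: lin_scale simp: lin_sc mult.commute)

text \<open>exp (A + B) = exp A exp B: by the Leibniz rule the convolution on the right obeys the
  recursion of A + B. The degree r of a summand is split as i + (r - i) between the two
  factors.\<close>

lemma Ez_add:
  assumes a: "cfam a" and b: "cfam b" and ab: "\<And>m n v. m > 0 \<Longrightarrow> n > 0 \<Longrightarrow> a m (b n v) = b n (a m v)"
  shows "Ez (\<lambda>n v. a n v + b n v) r v = (\<Sum>i\<in>{0..r}. Ez a i (Ez b (r - i) v))"
proof (rule Ez_unique[symmetric])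
  show "cfam (\<lambda>n v. a n v + b n v)" using assms by (rule cfam_add)
next
  fix r :: int assume r: "r > 0"
  let ?G = "\<lambda>r. \<Sum>i\<in>{0..r}. Ez a i (Ez b (r - i) v)"
  have ab': "Ez a i (b n u) = b n (Ez a i u)" if "n > 0" for i n u
    by (rule Ez_comm[symmetric, OF a]) (use that ab cfam_lin[OF b] in auto)
  have "sc (of_int r) (?G r) =
     (\<Sum>i\<in>{0..r}. sc (of_int i) (Ez a i (Ez b (r - i) v)) + Ez a i (sc (of_int (r - i)) (Ez b (r - i) v)))"
    unfolding scale_sum_right
    by (intro sum.cong refl) (simp add: lin_sc Ez_lin[OF a] scale_left_distrib[symmetric])
  also have "\<dots> = (\<Sum>i\<in>{0..r}. \<Sum>n=1..nat r. sc (of_nat n) (a n (Ez a (i - int n) (Ez b (r - i) v))) +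
      sc (of_nat n) (b n (Ez a i (Ez b (r - i - int n) v))))"
  proof (intro sum.cong refl)
    fix i assume i: "i \<in> {0..r}"
    have "Ez a i (sc (of_int (r - i)) (Ez b (r - i) v)) = (\<Sum>n=1..nat r. sc (of_nat n) (b n (Ez a i (Ez b (r - i - int n) v))))"
      using i by (subst Ez_rec[OF b, where N = "nat r"]) (auto simp: lin_sum Ez_lin[OF a] lin_sc ab')
    moreover have "sc (of_int i) (Ez a i (Ez b (r - i) v)) = (\<Sum>n=1..nat r. sc (of_nat n) (a n (Ez a (i - int n) (Ez b (r - i) v))))"
      using i by (subst Ez_rec[OF a, where N = "nat r"]) auto
    ultimately show "sc (of_int i) (Ez a i (Ez b (r - i) v)) + Ez a i (sc (of_int (r - i)) (Ez b (r - i) v)) =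
      (\<Sum>n=1..nat r. sc (of_nat n) (a n (Ez a (i - int n) (Ez b (r - i) v))) + sc (of_nat n) (b n (Ez a i (Ez b (r - i - int n) v))))"
      by (simp add: sum.distrib)
  qed
  also have "\<dots> = (\<Sum>n=1..nat r. sc (of_nat n) (a n (\<Sum>i\<in>{0..r}. Ez a (i - int n) (Ez b (r - i) v)) +
      b n (\<Sum>i\<in>{0..r}. Ez a i (Ez b (r - i - int n) v))))"
    by (subst sum.swap, intro sum.cong refl)
      (simp add: lin_sum cfam_lin[OF a] cfam_lin[OF b] scale_sum_right sum.distrib scale_right_distrib)
  also have "\<dots> = (\<Sum>n=1..nat r. sc (of_nat n) (a n (?G (r - int n)) + b n (?G (r - int n))))"
  proof (intro sum.cong refl)
    fix n assume n: "n \<in> {1..nat r}"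
    have "(\<Sum>i\<in>{0..r}. Ez a (i - int n) (Ez b (r - i) v)) = (\<Sum>i\<in>{int n..r}. Ez a (i - int n) (Ez b (r - i) v))"
      by (rule sum.mono_neutral_right) auto
    also have "\<dots> = ?G (r - int n)"
      by (rule sum.reindex_bij_witness[where i = "\<lambda>i. i + int n" and j = "\<lambda>i. i - int n"]) (auto simp: algebra_simps)
    finally have 1: "(\<Sum>i\<in>{0..r}. Ez a (i - int n) (Ez b (r - i) v)) = ?G (r - int n)" .
    have 2: "(\<Sum>i\<in>{0..r}. Ez a i (Ez b (r - i - int n) v)) = ?G (r - int n)"
      by (rule sum.mono_neutral_cong_right) (auto simp: lin_zero Ez_lin[OF a] algebra_simps)
    show "sc (of_nat n) (a n (\<Sum>i\<in>{0..r}. Ez a (i - int n) (Ez b (r - i) v)) + b n (\<Sum>i\<in>{0..r}. Ez a i (Ez b (r - i - int n) v)))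
      = sc (of_nat n) (a n (?G (r - int n)) + b n (?G (r - int n)))" unfolding 1 2 ..
  qed
  finally show "sc (of_int r) (?G r) = (\<Sum>n=1..nat r. sc (of_nat n) (a n (?G (r - int n)) + b n (?G (r - int n))))" .
qed auto

text \<open>A scalar commutator makes T act as a derivation, [T, exp B] = [T, B] exp B. By induction
  on the degree m: the commutator with the letter split off contributes n \<beta>, the one with the
  remaining exponential (m - n) \<beta>, together m \<beta>.\<close>

lemma Ez_bracket:
  assumes b: "cfam b" and T: "lin T"
    and br: "\<And>m v. m > 0 \<Longrightarrow> T (b m v) = b m (T v) + (if m = n then sc \<beta> v else 0)" and n: "n > 0"
  shows "T (Ez b s v) = Ez b s (T v) + sc \<beta> (Ez b (s - int n) v)"
proof -
  have "T (Ez b (int m) v) = Ez b (int m) (T v) + sc \<beta> (Ez b (int m - int n) v)" for m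
  proof (induction m rule: less_induct)
    case (less m)
    show ?case
    proof (cases "m = 0")
      case False
      \<comment> \<open>Large enough for the recursions in degree m and in degree m - n, and it
        keeps i = n in range even when n > m.\<close>
      define N where "N = m + n"
      have ih: "T (Ez b (int m - int i) v) = Ez b (int m - int i) (T v) + sc \<beta> (Ez b (int m - int i - int n) v)" if "i > 0" for i
      proof (cases "i \<le> m")
        case True
        then have "int m - int i = int (m - i)" by simp
        then show ?thesis using less.IH[of "m - i"] that True False by simp
      qed (simp add: lin_zero[OF T])
      have "sc (of_int (int m)) (T (Ez b (int m) v)) = (\<Sum>i=1..N. sc (of_nat i) (T (b i (Ez b (int m - int i) v))))"
      proof -
        have "sc (of_int (int m)) (Ez b (int m) v) = (\<Sum>i=1..N. sc (of_nat i) (b i (Ez b (int m - int i) v)))"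
          by (rule Ez_rec[OF b]) (simp add: N_def)
        then have "T (sc (of_int (int m)) (Ez b (int m) v)) = T (\<Sum>i=1..N. sc (of_nat i) (b i (Ez b (int m - int i) v)))"
          by (rule arg_cong)
        then show ?thesis by (simp only: lin_sum[OF T] lin_sc[OF T])
      qed
      also have "\<dots> = (\<Sum>i=1..N. sc (of_nat i) (b i (Ez b (int m - int i) (T v)))) +
          sc \<beta> (\<Sum>i=1..N. sc (of_nat i) (b i (Ez b (int m - int n - int i) v))) +
          (\<Sum>i=1..N. if i = n then sc (of_nat i * \<beta>) (Ez b (int m - int i) v) else 0)"
        unfolding scale_sum_right sum.distrib[symmetric]
      proof (intro sum.cong refl)
        fix i assume "i \<in> {1..N}"
        then have i: "i > 0" by simp
        have comm: "int m - int i - int n = int m - int n - int i" by simp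
        have "T (b i (Ez b (int m - int i) v)) = b i (Ez b (int m - int i) (T v)) +
            sc \<beta> (b i (Ez b (int m - int n - int i) v)) + (if i = n then sc \<beta> (Ez b (int m - int i) v) else 0)"
          unfolding br[OF i] ih[OF i] lin_add[OF cfam_lin[OF b i]] lin_sc[OF cfam_lin[OF b i]] comm ..
        then show "sc (of_nat i) (T (b i (Ez b (int m - int i) v))) =
          sc (of_nat i) (b i (Ez b (int m - int i) (T v))) + sc \<beta> (sc (of_nat i) (b i (Ez b (int m - int n - int i) v))) +
          (if i = n then sc (of_nat i * \<beta>) (Ez b (int m - int i) v) else 0)"
          by (simp add: scale_right_distrib mult.commute)
      qed
      also have "\<dots> = sc (of_int (int m)) (Ez b (int m) (T v)) + sc \<beta> (sc (of_int (int m - int n)) (Ez b (int m - int n) v)) +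
          sc (of_nat n * \<beta>) (Ez b (int m - int n) v)"
      proof -
        have "(\<Sum>i=1..N. sc (of_nat i) (b i (Ez b (int m - int i) (T v)))) = sc (of_int (int m)) (Ez b (int m) (T v))"
          by (rule Ez_rec[OF b, symmetric]) (simp add: N_def)
        moreover have "(\<Sum>i=1..N. sc (of_nat i) (b i (Ez b (int m - int n - int i) v))) = sc (of_int (int m - int n)) (Ez b (int m - int n) v)"
          by (rule Ez_rec[OF b, symmetric]) (simp add: N_def)
        moreover have "n \<in> {1..N}" using n by (simp add: N_def)
        ultimately show ?thesis by (simp only: sum.delta[OF finite_atLeastAtMost] if_True)
      qed
      also have "\<dots> = sc (of_int (int m)) (Ez b (int m) (T v) + sc \<beta> (Ez b (int m - int n) v))"
      proof -
        have "of_int (int m) * \<beta> = \<beta> * of_int (int m - int n) + of_nat n * \<beta>" by (simp add: algebra_simps)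
        then show ?thesis by (simp only: scale_right_distrib scale_scale add.assoc scale_left_distrib)
      qed
      finally show ?thesis using False by simp
    qed (use n in simp)
  qed
  from this[of "nat s"] show ?thesis using n by (cases "s < 0") (auto simp: lin_zero[OF T])
qed

end

section \<open>Powers of q and contraction functions as formal exponentials\<close>

lemma qp_add: "qp h (a + b) = qp h a * qp h b" by (simp add: qp_def distrib_right exp_add)
lemma qp_0 [simp]: "qp h 0 = 1" by (simp add: qp_def)
lemma qp_nz [simp]: "qp h a \<noteq> 0" by (simp add: qp_def)
lemma qp_pow: "qp h a ^ n = qp h (of_nat n * a)" by (simp add: qp_def exp_of_nat_mult[symmetric] mult.assoc)

text \<open>Says F = exp (\<Sum> \<beta>_n x^n), in the form x F' = (\<Sum> n \<beta>_n x^n) F. Such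
  an F is the scalar that appears when an annihilation exponential passes a creation
  exponential.\<close>

definition contr :: "(nat \<Rightarrow> complex) \<Rightarrow> complex fps \<Rightarrow> bool" where
  "contr \<beta> F \<longleftrightarrow> fps_nth F 0 = 1 \<and>
     (\<forall>n. of_nat n * fps_nth F n = (\<Sum>j=1..n. of_nat j * \<beta> j * fps_nth F (n - j)))"

text \<open>Coefficients indexed by all integers, so that expansions in x and in 1/x can be compared
  index by index.\<close>

definition co :: "complex fps \<Rightarrow> int \<Rightarrow> complex" where
  "co F l = (if l < 0 then 0 else fps_nth F (nat l))"

lemma finite_shift: "finite {x::int. P x} \<Longrightarrow> finite {x. P (x - c)}"
  using finite_vimageI[of "Collect P" "\<lambda>x. x - c"] by (simp add: vimage_def inj_def)

context cvs
begin

text \<open>exp A exp B = F exp B exp A. Induction on the degree in A: one letter is peeled off by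
  the recursion of exp A and moved through exp B as a derivation; the extra terms reproduce the
  recursion of F.\<close>

lemma Ez_exchange:
  assumes a: "cfam a" and b: "cfam b"
    and br: "\<And>m n v. m > 0 \<Longrightarrow> n > 0 \<Longrightarrow> a n (b m v) = b m (a n v) + (if m = n then sc (\<beta> n) v else 0)"
    and F: "contr \<beta> F" and L: "r \<le> int L"
  shows "Ez a r (Ez b s v) = (\<Sum>l=0..L. sc (fps_nth F l) (Ez b (s - int l) (Ez a (r - int l) v)))"
proof -
  have "Ez a (int m) (Ez b s v) = (\<Sum>l=0..L. sc (fps_nth F l) (Ez b (s - int l) (Ez a (int m - int l) v)))"
    if "m \<le> L" for m using that
  proof (induction m rule: less_induct)
    case (less m)
    have b0: "Ez b k 0 = 0" for k by (rule lin_zero[OF Ez_lin[OF b]])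
    show ?case
    proof (cases "m = 0")
      case True
      have "(\<Sum>l=0..L. sc (fps_nth F l) (Ez b (s - int l) (Ez a (int m - int l) v))) =
        (\<Sum>l\<in>{0}. sc (fps_nth F l) (Ez b (s - int l) (Ez a (int m - int l) v)))"
        by (rule sum.mono_neutral_right) (auto simp: True b0)
      then show ?thesis using F by (simp add: True contr_def)
    next
      case False
      define T where "T j = Ez b (s - int j) (Ez a (int m - int j) v)" for j
      have T0: "T j = 0" if "j > m" for j using that by (simp add: T_def b0)
      have ab: "a n (Ez b k u) = Ez b k (a n u) + sc (\<beta> n) (Ez b (k - int n) u)" if "n > 0" for n k u
        by (rule Ez_bracket[OF b cfam_lin[OF a that] _ that]) (use br that in auto)
      have ih: "Ez a (int m - int n) (Ez b s v) =
         (\<Sum>l=0..L. sc (fps_nth F l) (Ez b (s - int l) (Ez a (int m - int n - int l) v)))" if "n > 0" for n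
      proof (cases "n \<le> m")
        case True
        then show ?thesis using less.IH[of "m - n"] less.prems that False by (simp add: of_nat_diff)
      next
        case False
        then show ?thesis by (simp add: b0)
      qed
      have "sc (of_int (int m)) (Ez a (int m) (Ez b s v)) = (\<Sum>n=1..L. sc (of_nat n) (a n (Ez a (int m - int n) (Ez b s v))))"
        by (rule Ez_rec[OF a]) (use less.prems in simp)
      also have "\<dots> = (\<Sum>n=1..L. (\<Sum>l=0..L. sc (fps_nth F l) (Ez b (s - int l) (sc (of_nat n) (a n (Ez a (int m - int l - int n) v)))))
         + (\<Sum>l=0..L. sc (of_nat n * \<beta> n * fps_nth F l) (T (n + l))))"
      proof (intro sum.cong refl)
        fix n assume "n \<in> {1..L}"
        then have n: "n > 0" by simp
        have i1: "int m - int n - int l = int m - int l - int n" and i2: "s - int l - int n = s - int (n + l)"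
          and i3: "int m - int l - int n = int m - int (n + l)" for l by simp_all
        show "sc (of_nat n) (a n (Ez a (int m - int n) (Ez b s v))) =
          (\<Sum>l=0..L. sc (fps_nth F l) (Ez b (s - int l) (sc (of_nat n) (a n (Ez a (int m - int l - int n) v)))))
         + (\<Sum>l=0..L. sc (of_nat n * \<beta> n * fps_nth F l) (T (n + l)))"
          unfolding ih[OF n] sum.distrib[symmetric] lin_sum[OF cfam_lin[OF a n]] scale_sum_right T_def
        proof (intro sum.cong refl)
          fix l
          show "sc (of_nat n) (a n (sc (fps_nth F l) (Ez b (s - int l) (Ez a (int m - int n - int l) v)))) =
            sc (fps_nth F l) (Ez b (s - int l) (sc (of_nat n) (a n (Ez a (int m - int l - int n) v)))) +
            sc (of_nat n * \<beta> n * fps_nth F l) (Ez b (s - int (n + l)) (Ez a (int m - int (n + l)) v))"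
            unfolding lin_sc[OF cfam_lin[OF a n]] ab[OF n] i1 i2 lin_sc[OF Ez_lin[OF b]]
            by (simp only: scale_right_distrib scale_scale i3 mult_ac)
        qed
      qed
      also have "\<dots> = (\<Sum>l=0..L. sc (fps_nth F l) (Ez b (s - int l) (\<Sum>n=1..L. sc (of_nat n) (a n (Ez a (int m - int l - int n) v)))))
         + (\<Sum>n=1..L. \<Sum>l=0..L. sc (of_nat n * \<beta> n * fps_nth F l) (T (n + l)))"
        unfolding sum.distrib by (subst sum.swap) (simp add: lin_sum[OF Ez_lin[OF b]] scale_sum_right)
      also have "(\<Sum>l=0..L. sc (fps_nth F l) (Ez b (s - int l) (\<Sum>n=1..L. sc (of_nat n) (a n (Ez a (int m - int l - int n) v)))))
         = (\<Sum>l=0..L. sc (of_int (int m - int l) * fps_nth F l) (T l))"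
      proof (intro sum.cong refl)
        fix l
        have "(\<Sum>n=1..L. sc (of_nat n) (a n (Ez a (int m - int l - int n) v))) = sc (of_int (int m - int l)) (Ez a (int m - int l) v)"
          by (rule Ez_rec[OF a, symmetric]) (use less.prems in simp)
        then show "sc (fps_nth F l) (Ez b (s - int l) (\<Sum>n=1..L. sc (of_nat n) (a n (Ez a (int m - int l - int n) v))))
          = sc (of_int (int m - int l) * fps_nth F l) (T l)"
          by (simp only: T_def lin_sc[OF Ez_lin[OF b]] scale_scale mult.commute)
      qed
      also have "(\<Sum>n=1..L. \<Sum>l=0..L. sc (of_nat n * \<beta> n * fps_nth F l) (T (n + l))) =
         (\<Sum>j=0..L. sc (\<Sum>n=1..j. of_nat n * \<beta> n * fps_nth F (j - n)) (T j))"
      proof -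
        have "(\<Sum>n=1..L. \<Sum>l=0..L. sc (of_nat n * \<beta> n * fps_nth F l) (T (n + l))) =
           (\<Sum>n=1..L. \<Sum>l=0..L-n. sc (of_nat n * \<beta> n * fps_nth F l) (T (n + l)))"
          by (intro sum.cong refl sum.mono_neutral_right) (use T0 less.prems in auto)
        also have "\<dots> = (\<Sum>j=0..L. \<Sum>n=1..j. sc (of_nat n * \<beta> n * fps_nth F (j - n)) (T j))"
          unfolding sum.Sigma[OF finite_atLeastAtMost ballI[OF finite_atLeastAtMost]]
          by (rule sum.reindex_bij_witness[where i = "\<lambda>(j,n). (n, j - n)" and j = "\<lambda>(n,l). (n + l, n)"]) auto
        finally show ?thesis by (simp add: scale_sum_left)
      qed
      also have "\<dots> = (\<Sum>j=0..L. sc (of_nat j * fps_nth F j) (T j))"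
        using F by (intro sum.cong refl) (simp add: contr_def)
      \<comment> \<open>The degree m - l of the remaining factor and the weight l from the recursion
        of F add up to m.\<close>
      also have "(\<Sum>l=0..L. sc (of_int (int m - int l) * fps_nth F l) (T l)) + (\<Sum>j=0..L. sc (of_nat j * fps_nth F j) (T j))
         = sc (of_int (int m)) (\<Sum>l=0..L. sc (fps_nth F l) (T l))"
        unfolding sum.distrib[symmetric] scale_sum_right
      proof (intro sum.cong refl)
        fix l
        have "of_int (int m - int l) * fps_nth F l + of_nat l * fps_nth F l = of_int (int m) * fps_nth F l"
          by (simp add: algebra_simps)
        then show "sc (of_int (int m - int l) * fps_nth F l) (T l) + sc (of_nat l * fps_nth F l) (T l) =
          sc (of_int (int m)) (sc (fps_nth F l) (T l))"
          by (simp only: scale_left_distrib[symmetric] scale_scale)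
      qed
      finally show ?thesis using False by (simp add: T_def)
    qed
  qed
  from this[of "nat r"] show ?thesis using L
    by (cases "r < 0") (auto simp: lin_zero[OF Ez_lin[OF b]])
qed

subsection \<open>Vertex operators\<close>

text \<open>Coefficients of the annihilation factor; \<open>EM\<close> gives those of the creation
  factor. Annihilators act first, so local finiteness is asked of this factor alone.\<close>

definition EP :: "(int \<Rightarrow> 'v \<Rightarrow> 'v) \<Rightarrow> int \<Rightarrow> 'v \<Rightarrow> 'v" where "EP a = Ez (\<lambda>n. a (int n))"
definition EM :: "(int \<Rightarrow> 'v \<Rightarrow> 'v) \<Rightarrow> int \<Rightarrow> 'v \<Rightarrow> 'v" where "EM a = Ez (\<lambda>n. a (- int n))"

definition fam :: "(int \<Rightarrow> 'v \<Rightarrow> 'v) \<Rightarrow> bool" where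
  "fam a \<longleftrightarrow> cfam (\<lambda>n. a (int n)) \<and> cfam (\<lambda>n. a (- int n)) \<and> (\<forall>v. finite {r. EP a r v \<noteq> 0})"

definition comm2 :: "(int \<Rightarrow> 'v \<Rightarrow> 'v) \<Rightarrow> (int \<Rightarrow> 'v \<Rightarrow> 'v) \<Rightarrow> bool" where
  "comm2 a b \<longleftrightarrow> (\<forall>m n v. m > 0 \<and> n > 0 \<longrightarrow> a m (b n v) = b n (a m v) \<and> a (- m) (b (- n) v) = b (- n) (a (- m) v))"

definition brk :: "(int \<Rightarrow> 'v \<Rightarrow> 'v) \<Rightarrow> (int \<Rightarrow> 'v \<Rightarrow> 'v) \<Rightarrow> (nat \<Rightarrow> complex) \<Rightarrow> bool" where
  "brk a b \<beta> \<longleftrightarrow> (\<forall>m n v. m > 0 \<and> n > 0 \<longrightarrow>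
     a (int m) (b (- int n) v) = b (- int n) (a (int m) v) + (if m = n then sc (\<beta> m) v else 0))"

text \<open>The coefficient of z^c w^d in :A(z) B(w):, all annihilators applied first.\<close>

definition BB :: "(int \<Rightarrow> 'v \<Rightarrow> 'v) \<Rightarrow> (int \<Rightarrow> 'v \<Rightarrow> 'v) \<Rightarrow> int \<Rightarrow> int \<Rightarrow> 'v \<Rightarrow> 'v" where
  "BB a b c d v = Sum_any (\<lambda>s. Sum_any (\<lambda>r. EM a (c + r) (EM b (d + s) (EP a r (EP b s v)))))"

lemma fam_lin: "fam a \<Longrightarrow> n \<noteq> 0 \<Longrightarrow> lin (a n)"
  unfolding fam_def cfam_def
  by (cases "n > 0") (metis zero_less_imp_eq_int, metis minus_minus neg_0_less_iff_less zero_less_imp_eq_int linorder_neqE)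

lemma EP_lin: "fam a \<Longrightarrow> lin (EP a r)" and EM_lin: "fam a \<Longrightarrow> lin (EM a r)"
  by (auto simp: fam_def EP_def EM_def intro: Ez_lin)

lemma EP_neg [simp]: "r < 0 \<Longrightarrow> EP a r v = 0" and EM_neg [simp]: "r < 0 \<Longrightarrow> EM a r v = 0"
  and EP_0 [simp]: "EP a 0 v = v" and EM_0 [simp]: "EM a 0 v = v"
  by (simp_all add: EP_def EM_def)

lemma EP_nz: "EP a r v \<noteq> 0 \<Longrightarrow> 0 \<le> r" and EM_nz: "EM a r v \<noteq> 0 \<Longrightarrow> 0 \<le> r"
  using EP_neg EM_neg not_le by metis+

lemma EP_fin: "fam a \<Longrightarrow> finite {r. EP a r v \<noteq> 0}" by (simp add: fam_def)

lemma EP_comm: "fam a \<Longrightarrow> lin T \<Longrightarrow> (\<And>n v. n > 0 \<Longrightarrow> T (a n v) = a n (T v)) \<Longrightarrow> T (EP a r v) = EP a r (T v)"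
  unfolding EP_def by (rule Ez_comm) (auto simp: fam_def)
lemma EM_comm: "fam a \<Longrightarrow> lin T \<Longrightarrow> (\<And>n v. n > 0 \<Longrightarrow> T (a (- n) v) = a (- n) (T v)) \<Longrightarrow> T (EM a r v) = EM a r (T v)"
  unfolding EM_def by (rule Ez_comm) (auto simp: fam_def)

lemma comm2_sym: "comm2 a b \<Longrightarrow> comm2 b a" by (auto simp: comm2_def)

lemma EP_EP:
  assumes "fam a" "fam b" "comm2 a b" shows "EP a r (EP b s v) = EP b s (EP a r v)"
  using assms by (intro EP_comm EP_lin EP_comm[symmetric] fam_lin) (auto simp: comm2_def)
lemma EM_EM:
  assumes "fam a" "fam b" "comm2 a b" shows "EM a r (EM b s v) = EM b s (EM a r v)"
  using assms by (intro EM_comm EM_lin EM_comm[symmetric] fam_lin) (auto simp: comm2_def)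

lemma bexp_eq:
  assumes a: "fam a" shows "bexp sc a c v = Sum_any (\<lambda>r. EM a (c + r) (EP a r v))"
proof -
  let ?S = "{r. expc sc (\<lambda>n. a (int n)) r v \<noteq> 0 \<and> 0 \<le> c + int r}"
  have e: "EP a (int r) v = expc sc (\<lambda>n. a (int n)) r v" for r by (simp add: EP_def Ez_def)
  have "int ` ?S \<subseteq> {r. EP a r v \<noteq> 0}" by (auto simp: e)
  then have fin: "finite (int ` ?S)" using EP_fin[OF a] finite_subset by blast
  have "Sum_any (\<lambda>r. EM a (c + r) (EP a r v)) = (\<Sum>r\<in>int ` ?S. EM a (c + r) (EP a r v))"
  proof (rule Sum_any.expand_superset[OF fin], rule subsetI)
    fix r assume "r \<in> {r. EM a (c + r) (EP a r v) \<noteq> 0}"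
    then have "EM a (c + r) (EP a r v) \<noteq> 0" by simp
    then have "r \<ge> 0" "EP a r v \<noteq> 0" "c + r \<ge> 0"
      using lin_zero[OF EM_lin[OF a]] by (metis EP_neg linorder_not_less, metis, metis EM_neg linorder_not_less)
    then show "r \<in> int ` ?S" by (intro image_eqI[of _ _ "nat r"]) (auto simp: e[symmetric])
  qed
  also have "\<dots> = (\<Sum>r\<in>?S. EM a (c + int r) (EP a (int r) v))"
    by (simp add: sum.reindex)
  finally show ?thesis by (simp add: bexp_def e) (auto simp: EM_def Ez_def intro!: sum.cong)
qed

lemma EMEP_fin: "fam a \<Longrightarrow> finite {r. EM a (c + r) (EP a r v) \<noteq> 0}"
  by (rule finite_subset[OF _ EP_fin[of a v]]) (auto simp: lin_zero[OF EM_lin])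

lemma bexp_lin: assumes a: "fam a" shows "lin (bexp sc a c)"
  unfolding lin_iff bexp_eq[OF a]
proof (intro conjI allI)
  show "Sum_any (\<lambda>r. EM a (c + r) (EP a r (u + v))) =
    Sum_any (\<lambda>r. EM a (c + r) (EP a r u)) + Sum_any (\<lambda>r. EM a (c + r) (EP a r v))" for u v
    by (simp add: lin_add[OF EP_lin[OF a]] lin_add[OF EM_lin[OF a]] Sum_any.distrib EMEP_fin[OF a])
  show "Sum_any (\<lambda>r. EM a (c + r) (EP a r (sc k v))) = sc k (Sum_any (\<lambda>r. EM a (c + r) (EP a r v)))" for k v
    by (simp add: lin_sc[OF EP_lin[OF a]] lin_sc[OF EM_lin[OF a]] sc_Sum_any EMEP_fin[OF a])
qed

lemma bexp_comm:
  assumes a: "fam a" and T: "lin T" and c: "\<And>n v. n \<noteq> 0 \<Longrightarrow> T (a n v) = a n (T v)"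
  shows "T (bexp sc a c v) = bexp sc a c (T v)"
proof -
  have "T (EM a i u) = EM a i (T u)" "T (EP a i u) = EP a i (T u)" for i u
    using c by (auto intro!: EM_comm EP_comm a T)
  then show ?thesis by (simp add: bexp_eq[OF a] lin_Sum_any[OF T] EMEP_fin[OF a])
qed

lemma bexp_cong: "(\<And>n v. n \<noteq> 0 \<Longrightarrow> a n v = b n v) \<Longrightarrow> bexp sc a c v = bexp sc b c v"
proof -
  assume *: "\<And>n v. n \<noteq> 0 \<Longrightarrow> a n v = b n v"
  have "expc sc (\<lambda>n. a (int n)) = expc sc (\<lambda>n. b (int n))" "expc sc (\<lambda>n. a (- int n)) = expc sc (\<lambda>n. b (- int n))"
    using powc_cong[of "\<lambda>n. a (int n)" "\<lambda>n. b (int n)"] powc_cong[of "\<lambda>n. a (- int n)" "\<lambda>n. b (- int n)"] *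
    by (auto simp: fun_eq_iff expc_def)
  then show ?thesis by (simp add: bexp_def)
qed

lemma fam_cong:
  assumes "\<And>n v. n \<noteq> 0 \<Longrightarrow> a n v = b n v" "fam a" shows "fam b"
proof -
  have "EP a r v = EP b r v" for r v unfolding EP_def by (rule Ez_cong) (use assms in auto)
  then show ?thesis using assms unfolding fam_def cfam_def by (auto simp: lin_iff)
qed

text \<open>Any finite box containing the supports of both annihilation factors may replace the two
  sums. That the support in r can be taken at \<open>v\<close>, before B acts, uses that the
  annihilation factors commute.\<close>

lemma BB_box:
  assumes a: "fam a" and b: "fam b" and ab: "comm2 a b"
    and R: "finite R" "{r. EP a r v \<noteq> 0} \<subseteq> R" and S: "finite S" "{s. EP b s v \<noteq> 0} \<subseteq> S"
  shows "BB a b c d v = (\<Sum>s\<in>S. \<Sum>r\<in>R. EM a (c + r) (EM b (d + s) (EP a r (EP b s v))))"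
proof -
  note z = lin_zero[OF EM_lin[OF a]] lin_zero[OF EM_lin[OF b]] lin_zero[OF EP_lin[OF a]] lin_zero[OF EP_lin[OF b]]
  have r: "r \<in> R" if "EM a (c + r) (EM b (d + s) (EP a r (EP b s v))) \<noteq> 0" for r s
    using that R(2) unfolding EP_EP[OF a b ab] by (auto simp: z)
  have "Sum_any (\<lambda>r. EM a (c + r) (EM b (d + s) (EP a r (EP b s v)))) =
    (\<Sum>r\<in>R. EM a (c + r) (EM b (d + s) (EP a r (EP b s v))))" for s
    by (rule Sum_any.expand_superset[OF R(1)]) (auto intro: r)
  then have "BB a b c d v = Sum_any (\<lambda>s. \<Sum>r\<in>R. EM a (c + r) (EM b (d + s) (EP a r (EP b s v))))"
    by (simp add: BB_def)
  also have "\<dots> = (\<Sum>s\<in>S. \<Sum>r\<in>R. EM a (c + r) (EM b (d + s) (EP a r (EP b s v))))"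
    by (rule Sum_any.expand_superset[OF S(1)]) (use S(2) in \<open>auto simp: z elim!: sum.not_neutral_contains_not_neutral\<close>)
  finally show ?thesis .
qed

lemma BB_sym:
  assumes a: "fam a" and b: "fam b" and ab: "comm2 a b"
  shows "BB a b c d v = BB b a d c v"
proof -
  have "EM a i (EM b j (EP a r (EP b s v))) = EM b j (EM a i (EP b s (EP a r v)))" for i j r s
    by (simp add: EP_EP[OF a b ab] EM_EM[OF a b ab])
  then show ?thesis
    unfolding BB_box[OF a b ab EP_fin[OF a] order_refl EP_fin[OF b] order_refl]
      BB_box[OF b a comm2_sym[OF ab] EP_fin[OF b] order_refl EP_fin[OF a] order_refl]
    by (subst sum.swap) simp
qed

text \<open>Along z^(c+j) w^(d-j) the creation degrees c + j + r and d - j + s must both be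
  nonnegative, which bounds j on both sides for each of the finitely many r and s.\<close>

lemma BB_fin:
  assumes a: "fam a" and b: "fam b" and ab: "comm2 a b"
  shows "finite {j. BB a b (c + j) (d - j) v \<noteq> 0}"
proof -
  let ?R = "{r. EP a r v \<noteq> 0}" and ?S = "{s. EP b s v \<noteq> 0}"
  have "{j. BB a b (c + j) (d - j) v \<noteq> 0} \<subseteq> (\<Union>r\<in>?R. \<Union>s\<in>?S. {- c - r..d + s})"
  proof
    fix j assume "j \<in> {j. BB a b (c + j) (d - j) v \<noteq> 0}"
    then have "(\<Sum>s\<in>?S. \<Sum>r\<in>?R. EM a (c + j + r) (EM b (d - j + s) (EP a r (EP b s v)))) \<noteq> 0"
      unfolding BB_box[OF a b ab EP_fin[OF a] order_refl EP_fin[OF b] order_refl] by simp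
    then obtain s r where sr: "s \<in> ?S" "r \<in> ?R" and n: "EM a (c + j + r) (EM b (d - j + s) (EP a r (EP b s v))) \<noteq> 0"
      by (elim sum.not_neutral_contains_not_neutral) blast
    have "c + j + r \<ge> 0" "d - j + s \<ge> 0"
      using n lin_zero[OF EM_lin[OF a]] by (metis EM_neg linorder_not_less)+
    then show "j \<in> (\<Union>r\<in>?R. \<Union>s\<in>?S. {- c - r..d + s})" using sr by auto
  qed
  then show ?thesis by (rule finite_subset) (simp add: EP_fin a b)
qed

text \<open>Wick's theorem for two factors: A(z) B(w) = F(w/z) :A(z) B(w):, read off at z^c w^d.
  Only the annihilation factor of A has to pass the creation factor of B.\<close>

lemma bexp_prod:
  assumes a: "fam a" and b: "fam b" and ab: "comm2 a b" and br: "brk a b \<beta>" and F: "contr \<beta> F"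
  shows "bexp sc a c (bexp sc b d v) = Sum_any (\<lambda>l. sc (co F l) (BB a b (c + l) (d - l) v))"
proof -
  let ?R = "{r. EP a r v \<noteq> 0}" and ?S = "{s. EP b s v \<noteq> 0}"
  note z = lin_zero[OF EM_lin[OF a]] lin_zero[OF EM_lin[OF b]] lin_zero[OF EP_lin[OF a]] lin_zero[OF EP_lin[OF b]]
  \<comment> \<open>One length \<open>L\<close> for all exchanges: it bounds the creation degrees of
    B over the finite support \<open>?S\<close>.\<close>
  obtain L where L: "\<And>s. s \<in> ?S \<Longrightarrow> d + s \<le> int L"
  proof
    fix s assume "s \<in> ?S"
    then have "s \<le> Max (insert 0 ?S)" using EP_fin[OF b, of v] by simp
    then show "d + s \<le> int (nat (d + Max (insert 0 ?S)))" by simp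
  qed
  have x: "EP a r (EM b j w) = (\<Sum>l=0..nat j. sc (fps_nth F l) (EM b (j - int l) (EP a (r - int l) w)))" for r j w
  proof -
    define K where "K = max (nat r) (nat j)"
    have "EP a r (EM b j w) = (\<Sum>l=0..K. sc (fps_nth F l) (EM b (j - int l) (EP a (r - int l) w)))"
      unfolding EP_def EM_def
      by (rule Ez_exchange[OF _ _ _ F]) (use a b br in \<open>auto simp: fam_def brk_def K_def\<close>)
    also have "\<dots> = (\<Sum>l=0..nat j. sc (fps_nth F l) (EM b (j - int l) (EP a (r - int l) w)))"
      by (rule sum.mono_neutral_right) (auto simp: K_def)
    finally show ?thesis .
  qed
  have x': "EP a r (EM b j w) = (\<Sum>l=0..L. sc (fps_nth F l) (EM b (j - int l) (EP a (r - int l) w)))"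
    if "j \<le> int L" for r j w
    unfolding x by (rule sum.mono_neutral_left) (use that in auto)
  have "bexp sc a c (bexp sc b d v) = bexp sc a c (\<Sum>s\<in>?S. EM b (d + s) (EP b s v))"
    by (subst bexp_eq[OF b], subst Sum_any.expand_superset[OF EP_fin[OF b, of v]]) (auto simp: z)
  also have "\<dots> = (\<Sum>s\<in>?S. Sum_any (\<lambda>r. EM a (c + r) (EP a r (EM b (d + s) (EP b s v)))))"
    unfolding lin_sum[OF bexp_lin[OF a]] unfolding bexp_eq[OF a] ..
  also have "\<dots> = (\<Sum>s\<in>?S. \<Sum>l=0..L. sc (fps_nth F l)
      (Sum_any (\<lambda>r. EM a (c + int l + r) (EM b (d - int l + s) (EP a r (EP b s v))))))"
  proof (intro sum.cong refl)
    fix s assume s: "s \<in> ?S"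
    let ?g = "\<lambda>l r. EM a (c + int l + r) (EM b (d - int l + s) (EP a r (EP b s v)))"
    have fg: "finite {r. ?g l r \<noteq> 0}" for l
      by (rule finite_subset[OF _ EP_fin[OF a, of "EP b s v"]]) (auto simp: z)
    have fg': "finite {r. ?g l (r - int l) \<noteq> 0}" for l
      by (rule finite_shift[OF fg])
    have e: "EM a (c + r) (EP a r (EM b (d + s) (EP b s v))) = (\<Sum>l=0..L. sc (fps_nth F l) (?g l (r - int l)))" for r
    proof -
      have i: "c + int l + (r - int l) = c + r" "d - int l + s = d + s - int l" for l by simp_all
      show ?thesis unfolding x'[OF L[OF s]] lin_sum[OF EM_lin[OF a]] lin_sc[OF EM_lin[OF a]] i ..
    qed
    have "Sum_any (\<lambda>r. EM a (c + r) (EP a r (EM b (d + s) (EP b s v)))) =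
       (\<Sum>l=0..L. Sum_any (\<lambda>r. sc (fps_nth F l) (?g l (r - int l))))"
      unfolding e
      by (rule Sum_any_sum) (use fg' in \<open>auto intro: finite_subset[rotated]\<close>)
    also have "\<dots> = (\<Sum>l=0..L. sc (fps_nth F l) (Sum_any (?g l)))"
    proof (intro sum.cong refl)
      fix l
      have "Sum_any (\<lambda>r. ?g l (r - int l)) = Sum_any (?g l)" using Sum_any_shift[of "?g l" "- int l"] by simp
      then show "Sum_any (\<lambda>r. sc (fps_nth F l) (?g l (r - int l))) = sc (fps_nth F l) (Sum_any (?g l))"
        by (simp only: sc_Sum_any[OF fg', symmetric])
    qed
    finally show "Sum_any (\<lambda>r. EM a (c + r) (EP a r (EM b (d + s) (EP b s v)))) =
      (\<Sum>l=0..L. sc (fps_nth F l) (Sum_any (?g l)))" .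
  qed
  also have "\<dots> = (\<Sum>l=0..L. sc (fps_nth F l) (BB a b (c + int l) (d - int l) v))"
  proof (subst sum.swap, intro sum.cong refl)
    fix l
    have "BB a b (c + int l) (d - int l) v = (\<Sum>s\<in>?S. Sum_any (\<lambda>r. EM a (c + int l + r) (EM b (d - int l + s) (EP a r (EP b s v)))))"
      unfolding BB_def by (rule Sum_any.expand_superset[OF EP_fin[OF b]]) (auto simp: z)
    then show "(\<Sum>s\<in>?S. sc (fps_nth F l) (Sum_any (\<lambda>r. EM a (c + int l + r) (EM b (d - int l + s) (EP a r (EP b s v)))))) =
      sc (fps_nth F l) (BB a b (c + int l) (d - int l) v)"
      by (simp add: scale_sum_right)
  qed
  also have "\<dots> = Sum_any (\<lambda>l. sc (co F l) (BB a b (c + l) (d - l) v))"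
  proof -
    have sup: "{l. sc (co F l) (BB a b (c + l) (d - l) v) \<noteq> 0} \<subseteq> int ` {0..L}"
    proof
      fix l assume l: "l \<in> {l. sc (co F l) (BB a b (c + l) (d - l) v) \<noteq> 0}"
      then have l0: "l \<ge> 0" by (auto simp: co_def split: if_splits)
      have "l \<le> int L"
      proof (rule ccontr)
        assume "\<not> l \<le> int L"
        then have "EM b (d - l + s) w = 0" if "s \<in> ?S" for s w using L[OF that] by (intro EM_neg) simp
        then have "BB a b (c + l) (d - l) v = 0"
          unfolding BB_box[OF a b ab EP_fin[OF a] order_refl EP_fin[OF b] order_refl]
          by (auto intro!: sum.neutral simp: z)
        then show False using l by simp
      qed
      then show "l \<in> int ` {0..L}" using l0 by (intro image_eqI[of _ _ "nat l"]) auto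
    qed
    show ?thesis by (subst Sum_any.expand_superset[OF _ sup]) (auto simp: sum.reindex co_def)
  qed
  finally show ?thesis .
qed

lemma contr_0: "contr (\<lambda>_. 0) 1" by (auto simp: contr_def)

lemma co_1: "co 1 l = (if l = 0 then 1 else 0)" by (auto simp: co_def)

lemma bexp_prod0:
  assumes a: "fam a" and b: "fam b" and ab: "comm2 a b" and br: "brk a b (\<lambda>_. 0)"
  shows "bexp sc a c (bexp sc b d v) = BB a b c d v"
proof -
  have "sc (co 1 l) (BB a b (c + l) (d - l) v) = (if l = 0 then BB a b (c + l) (d - l) v else 0)" for l
    by (simp add: co_1)
  then show ?thesis by (simp add: bexp_prod[OF a b ab br contr_0])
qed

lemma EP_add:
  assumes a: "fam a" and b: "fam b" and ab: "comm2 a b"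
  shows "EP (\<lambda>n v. a n v + b n v) r v = (\<Sum>i\<in>{0..r}. EP a i (EP b (r - i) v))"
    and "EM (\<lambda>n v. a n v + b n v) r v = (\<Sum>i\<in>{0..r}. EM a i (EM b (r - i) v))"
  using assms unfolding EP_def EM_def
  by (auto intro!: Ez_add simp: fam_def comm2_def)

lemma fam_add:
  assumes a: "fam a" and b: "fam b" and ab: "comm2 a b"
  shows "fam (\<lambda>n v. a n v + b n v)"
proof -
  have "finite {r. EP (\<lambda>n v. a n v + b n v) r v \<noteq> 0}" for v
  proof (rule finite_subset)
    let ?R = "{r. EP a r v \<noteq> 0}" and ?S = "{s. EP b s v \<noteq> 0}"
    show "{r. EP (\<lambda>n v. a n v + b n v) r v \<noteq> 0} \<subseteq> (\<lambda>(r,s). r + s) ` (?R \<times> ?S)"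
    proof
      fix r assume "r \<in> {r. EP (\<lambda>n v. a n v + b n v) r v \<noteq> 0}"
      then obtain i where "EP a i (EP b (r - i) v) \<noteq> 0"
        unfolding EP_add(1)[OF assms] by (auto elim: sum.not_neutral_contains_not_neutral)
      moreover from this have "EP b (r - i) (EP a i v) \<noteq> 0" by (simp add: EP_EP[OF assms])
      ultimately have "i \<in> ?R" "r - i \<in> ?S" using lin_zero[OF EP_lin[OF a]] lin_zero[OF EP_lin[OF b]] by auto
      then show "r \<in> (\<lambda>(r,s). r + s) ` (?R \<times> ?S)" by (intro image_eqI[of _ _ "(i, r - i)"]) auto
    qed
  qed (simp add: EP_fin a b)
  then show ?thesis using assms by (auto simp: fam_def comm2_def intro!: cfam_add)
qed

text \<open>Summing the coefficients of z^j w^(t-j) puts w = z, and a normally ordered product at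
  equal arguments is the vertex operator of the summed family: annihilators and creators merge
  separately.\<close>

lemma BB_merge:
  assumes a: "fam a" and b: "fam b" and ab: "comm2 a b"
  shows "bexp sc (\<lambda>n v. a n v + b n v) t v = Sum_any (\<lambda>j. BB a b j (t - j) v)"
proof -
  let ?R = "{r. EP a r v \<noteq> 0}" and ?S = "{s. EP b s v \<noteq> 0}" and ?c = "\<lambda>n v. a n v + b n v"
  note z = lin_zero[OF EM_lin[OF a]] lin_zero[OF EM_lin[OF b]] lin_zero[OF EP_lin[OF a]] lin_zero[OF EP_lin[OF b]]
  note famc = fam_add[OF assms]
  have zc: "EM ?c i 0 = 0" for i by (rule lin_zero[OF EM_lin[OF famc]])
  let ?g = "\<lambda>r s. EM ?c (t + r + s) (EP a r (EP b s v))"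
  have ep: "EP ?c u v = Sum_any (\<lambda>r. EP a r (EP b (u - r) v))" for u
    unfolding EP_add(1)[OF assms]
  proof (rule Sum_any.expand_superset[symmetric], simp, rule subsetI)
    fix i assume "i \<in> {i. EP a i (EP b (u - i) v) \<noteq> 0}"
    then have "EP a i (EP b (u - i) v) \<noteq> 0" by simp
    moreover from this have "EP b (u - i) v \<noteq> 0" using z(3)[of i] by auto
    ultimately show "i \<in> {0..u}" using EP_nz by fastforce
  qed
  have g0: "EP a r (EP b s v) = 0" if "r \<notin> ?R \<or> s \<notin> ?S" for r s
    using that EP_EP[OF assms, of r s v] by (auto simp: z)
  have "bexp sc ?c t v = Sum_any (\<lambda>u. EM ?c (t + u) (\<Sum>r\<in>?R. EP a r (EP b (u - r) v)))"
  proof -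
    have "EP ?c u v = (\<Sum>r\<in>?R. EP a r (EP b (u - r) v))" for u
      unfolding ep by (rule Sum_any.expand_superset[OF EP_fin[OF a]]) (use g0 in blast)
    then show ?thesis by (simp only: bexp_eq[OF famc])
  qed
  also have "\<dots> = Sum_any (\<lambda>u. \<Sum>r\<in>?R. ?g r (u - r))"
    by (simp add: lin_sum[OF EM_lin[OF famc]])
  also have "\<dots> = (\<Sum>r\<in>?R. Sum_any (\<lambda>u. ?g r (u - r)))"
  proof (rule Sum_any_sum[OF EP_fin[OF a]])
    fix r
    have "finite {u. ?g r u \<noteq> 0}"
      by (rule finite_subset[OF _ EP_fin[OF b, of v]]) (auto simp: z zc)
    then show "finite {u. ?g r (u - r) \<noteq> 0}" by (rule finite_shift)
  qed
  also have "\<dots> = (\<Sum>r\<in>?R. Sum_any (?g r))"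
  proof (intro sum.cong refl)
    fix r show "Sum_any (\<lambda>u. ?g r (u - r)) = Sum_any (?g r)"
      using Sum_any_shift[of "?g r" "- r"] unfolding add_uminus_conv_diff .
  qed
  also have "\<dots> = (\<Sum>r\<in>?R. \<Sum>s\<in>?S. ?g r s)"
  proof (intro sum.cong refl)
    fix r show "Sum_any (?g r) = (\<Sum>s\<in>?S. ?g r s)"
      by (rule Sum_any.expand_superset[OF EP_fin[OF b]]) (auto simp: z zc)
  qed
  also have "\<dots> = (\<Sum>r\<in>?R. \<Sum>s\<in>?S. Sum_any (\<lambda>j. EM a (j + r) (EM b (t - j + s) (EP a r (EP b s v)))))"
  proof (intro sum.cong refl)
    fix r s
    let ?w = "EP a r (EP b s v)"
    have "?g r s = Sum_any (\<lambda>i. EM a i (EM b (t + r + s - i) ?w))"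
      unfolding EP_add(2)[OF assms]
    proof (rule Sum_any.expand_superset[symmetric], simp, rule subsetI)
      fix i assume "i \<in> {i. EM a i (EM b (t + r + s - i) ?w) \<noteq> 0}"
      then have "EM a i (EM b (t + r + s - i) ?w) \<noteq> 0" by simp
      moreover from this have "EM b (t + r + s - i) ?w \<noteq> 0" using z(1)[of i] by auto
      ultimately show "i \<in> {0..t + r + s}" using EM_nz by fastforce
    qed
    also have "\<dots> = Sum_any (\<lambda>j. EM a (j + r) (EM b (t - j + s) ?w))"
      by (subst Sum_any_shift[of _ r, symmetric]) (simp add: algebra_simps)
    finally show "?g r s = Sum_any (\<lambda>j. EM a (j + r) (EM b (t - j + s) ?w))" .
  qed
  also have "\<dots> = Sum_any (\<lambda>j. \<Sum>r\<in>?R. \<Sum>s\<in>?S. EM a (j + r) (EM b (t - j + s) (EP a r (EP b s v))))"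
  proof -
    have f: "finite {j. EM a (j + r) (EM b (t - j + s) (EP a r (EP b s v))) \<noteq> 0}" for r s
    proof (rule finite_subset)
      show "{j. EM a (j + r) (EM b (t - j + s) (EP a r (EP b s v))) \<noteq> 0} \<subseteq> {- r..t + s}"
      proof
        fix j assume "j \<in> {j. EM a (j + r) (EM b (t - j + s) (EP a r (EP b s v))) \<noteq> 0}"
        then have "EM a (j + r) (EM b (t - j + s) (EP a r (EP b s v))) \<noteq> 0" by simp
        moreover from this have "EM b (t - j + s) (EP a r (EP b s v)) \<noteq> 0" using z(1)[of "j + r"] by auto
        ultimately show "j \<in> {- r..t + s}" using EM_nz by fastforce
      qed
    qed simp
    have "Sum_any (\<lambda>j. \<Sum>r\<in>?R. \<Sum>s\<in>?S. EM a (j + r) (EM b (t - j + s) (EP a r (EP b s v)))) =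
      (\<Sum>r\<in>?R. Sum_any (\<lambda>j. \<Sum>s\<in>?S. EM a (j + r) (EM b (t - j + s) (EP a r (EP b s v)))))"
    proof (rule Sum_any_sum[OF EP_fin[OF a]])
      fix r
      show "finite {j. (\<Sum>s\<in>?S. EM a (j + r) (EM b (t - j + s) (EP a r (EP b s v)))) \<noteq> 0}"
        by (rule finite_subset[of _ "\<Union>s\<in>?S. {j. EM a (j + r) (EM b (t - j + s) (EP a r (EP b s v))) \<noteq> 0}"])
          (use f EP_fin[OF b] in \<open>auto elim: sum.not_neutral_contains_not_neutral\<close>)
    qed
    also have "\<dots> = (\<Sum>r\<in>?R. \<Sum>s\<in>?S. Sum_any (\<lambda>j. EM a (j + r) (EM b (t - j + s) (EP a r (EP b s v)))))"
      by (intro sum.cong refl Sum_any_sum EP_fin[OF b] f)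
    finally show ?thesis ..
  qed
  also have "\<dots> = Sum_any (\<lambda>j. BB a b j (t - j) v)"
    unfolding BB_box[OF assms EP_fin[OF a] order_refl EP_fin[OF b] order_refl]
    by (subst sum.swap) simp
  finally show ?thesis .
qed

text \<open>The oscillators of A(q^e z).\<close>

definition sh :: "complex \<Rightarrow> complex \<Rightarrow> (int \<Rightarrow> 'v \<Rightarrow> 'v) \<Rightarrow> int \<Rightarrow> 'v \<Rightarrow> 'v" where
  "sh h e a n v = sc (qp h (- of_int n * e)) (a n v)"

lemma EP_sh: assumes a: "fam a" shows "EP (sh h e a) r v = sc (qp h (- of_int r * e)) (EP a r v)"
proof (cases "r < 0")
  case False
  have "EP (sh h e a) r v = Ez (\<lambda>n v. sc (qp h (- e) ^ n) (a (int n) v)) r v"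
    unfolding EP_def by (rule Ez_cong) (simp add: sh_def qp_pow)
  also have "\<dots> = sc (qp h (- e) ^ nat r) (EP a r v)"
    unfolding EP_def by (rule Ez_scale) (use a in \<open>simp add: fam_def\<close>)
  finally show ?thesis using False by (simp add: qp_pow)
qed simp

lemma EM_sh: assumes a: "fam a" shows "EM (sh h e a) r v = sc (qp h (of_int r * e)) (EM a r v)"
proof (cases "r < 0")
  case False
  have "EM (sh h e a) r v = Ez (\<lambda>n v. sc (qp h e ^ n) (a (- int n) v)) r v"
    unfolding EM_def by (rule Ez_cong) (simp add: sh_def qp_pow)
  also have "\<dots> = sc (qp h e ^ nat r) (EM a r v)"
    unfolding EM_def by (rule Ez_scale) (use a in \<open>simp add: fam_def\<close>)
  finally show ?thesis using False by (simp add: qp_pow)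
qed simp

lemma fam_sh: assumes a: "fam a" shows "fam (sh h e a)"
proof -
  have "cfam (\<lambda>n. sh h e a (int n))" "cfam (\<lambda>n. sh h e a (- int n))"
    using a cfam_scale[of "\<lambda>n. a (int n)" "\<lambda>n. qp h (- of_int (int n) * e)"]
      cfam_scale[of "\<lambda>n. a (- int n)" "\<lambda>n. qp h (- of_int (- int n) * e)"]
    by (simp_all add: fam_def sh_def[abs_def])
  then show ?thesis using a unfolding fam_def EP_sh[OF a] by auto
qed

lemma comm2_sh:
  assumes "fam b" "fam a" "comm2 a b" shows "comm2 (sh h e a) b"
  using assms(3) fam_lin[OF assms(1)] unfolding comm2_def sh_def by (simp add: lin_sc)

lemma BB_sh:
  assumes a: "fam a" and b: "fam b" and ab: "comm2 a b"
  shows "BB (sh h e a) b c d v = sc (qp h (of_int c * e)) (BB a b c d v)"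
proof -
  have "EM (sh h e a) (c + r) (EM b (d + s) (EP (sh h e a) r (EP b s v))) =
    sc (qp h (of_int c * e)) (EM a (c + r) (EM b (d + s) (EP a r (EP b s v))))" for r s
  proof -
    have "qp h (- of_int r * e) * qp h (of_int (c + r) * e) = qp h (of_int c * e)"
      by (simp add: qp_add[symmetric] algebra_simps)
    then show ?thesis
      by (simp add: EP_sh[OF a] EM_sh[OF a] lin_sc[OF EM_lin[OF a]] lin_sc[OF EM_lin[OF b]] mult.commute)
  qed
  moreover have "{r. EP (sh h e a) r v \<noteq> 0} \<subseteq> {r. EP a r v \<noteq> 0}" by (auto simp: EP_sh[OF a])
  ultimately show ?thesis
    unfolding BB_box[OF assms EP_fin[OF a] order_refl EP_fin[OF b] order_refl]
    by (subst BB_box[OF fam_sh[OF a] b comm2_sh[OF b a ab] EP_fin[OF a, of v] _ EP_fin[OF b] order_refl])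
      (simp_all add: scale_sum_right)
qed

text \<open>The delta function \<open>\<delta>(q\<^sup>e w / z)\<close> specializes \<open>:A(z) B(w):\<close> to \<open>z = q\<^sup>e w\<close>.\<close>

lemma BB_delta:
  assumes a: "fam a" and b: "fam b" and ab: "comm2 a b"
  shows "Sum_any (\<lambda>l. sc (qp h (of_int (c + l) * e)) (BB a b (c + l) (d - l) v)) =
    bexp sc (\<lambda>n v. sh h e a n v + b n v) (c + d) v"
proof -
  have "bexp sc (\<lambda>n v. sh h e a n v + b n v) (c + d) v = Sum_any (\<lambda>j. BB (sh h e a) b j (c + d - j) v)"
    by (rule BB_merge[OF fam_sh[OF a] b comm2_sh[OF b a ab]])
  also have "\<dots> = Sum_any (\<lambda>l. BB (sh h e a) b (l + c) (c + d - (l + c)) v)"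
    by (rule Sum_any_shift[symmetric])
  finally show ?thesis by (simp add: BB_sh[OF assms] add.commute)
qed

lemma bexp_add0:
  assumes a: "fam a" and b: "fam b" and ab: "comm2 a b" and br: "brk a b (\<lambda>_. 0)"
  shows "bexp sc (\<lambda>n v. a n v + b n v) t v = Sum_any (\<lambda>j. bexp sc a (t - j) (bexp sc b j v))"
proof -
  have "Sum_any (\<lambda>j. BB a b j (t - j) v) = Sum_any (\<lambda>j. BB a b (t - j) (t - (t - j)) v)"
    by (rule Sum_any_reflect[symmetric])
  then show ?thesis by (simp add: BB_merge[OF a b ab] bexp_prod0[OF assms])
qed

lemma bexp_add0_fin:
  assumes a: "fam a" and b: "fam b" and ab: "comm2 a b" and br: "brk a b (\<lambda>_. 0)"
  shows "finite {j. bexp sc a (t - j) (bexp sc b j v) \<noteq> 0}"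
  using BB_fin[OF b a comm2_sym[OF ab], of 0 t v]
  by (simp add: bexp_prod0[OF assms] BB_sym[OF a b ab])

lemma bexp_sh: assumes a: "fam a" shows "bexp sc (sh h e a) c v = sc (qp h (of_int c * e)) (bexp sc a c v)"
proof -
  have "qp h (- of_int r * e) * qp h (of_int (c + r) * e) = qp h (of_int c * e)" for r
    by (simp add: qp_add[symmetric] algebra_simps)
  then show ?thesis
    by (simp add: bexp_eq[OF a] bexp_eq[OF fam_sh[OF a]] EP_sh[OF a] EM_sh[OF a] lin_sc[OF EM_lin[OF a]]
        sc_Sum_any[OF EMEP_fin[OF a]] mult.commute)
qed

end

subsection \<open>Contraction functions\<close>

definition geo :: "complex \<Rightarrow> complex fps" where "geo c = Abs_fps (\<lambda>n. c ^ n)"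

definition lin1 :: "complex \<Rightarrow> complex fps" where "lin1 c = 1 - fps_const c * fps_X"

lemma lin1_nth: "fps_nth (lin1 c) n = (if n = 0 then 1 else if n = 1 then - c else 0)"
  by (cases n) (auto simp: lin1_def)

lemma lin1_geo: "lin1 c * geo c = 1"
proof (rule fps_ext)
  fix n
  show "fps_nth (lin1 c * geo c) n = fps_nth 1 n"
    by (cases n) (auto simp: lin1_def geo_def algebra_simps)
qed

text \<open>The expansion at x = 0 of the rational function with numerator factors 1 - q^a x and
  denominator factors 1 - q^b x. Storing exponents makes a rescaling of x an addition.\<close>

definition rat :: "complex \<Rightarrow> complex list \<Rightarrow> complex list \<Rightarrow> complex fps" where
  "rat h as bs = (\<Prod>a\<leftarrow>as. lin1 (qp h a)) * (\<Prod>b\<leftarrow>bs. geo (qp h b))"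

lemma contr_iff:
  "contr \<beta> F \<longleftrightarrow> fps_nth F 0 = 1 \<and> fps_X * fps_deriv F = Abs_fps (\<lambda>n. of_nat n * \<beta> n) * F"
proof -
  have l: "fps_nth (fps_X * fps_deriv F) n = of_nat n * fps_nth F n" for n
    by (cases n) auto
  have r: "fps_nth (Abs_fps (\<lambda>n. of_nat n * \<beta> n) * F) n = (\<Sum>j=1..n. of_nat j * \<beta> j * fps_nth F (n - j))" for n
  proof -
    have "(\<Sum>j=0..n. of_nat j * \<beta> j * fps_nth F (n - j)) = (\<Sum>j=1..n. of_nat j * \<beta> j * fps_nth F (n - j))"
      by (rule sum.mono_neutral_right) (auto simp: Suc_le_eq)
    then show ?thesis by (simp add: fps_mult_nth)
  qed
  show ?thesis unfolding contr_def fps_eq_iff l r ..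
qed

lemma contr_mult:
  assumes "contr \<beta> F" "contr \<gamma> G" shows "contr (\<lambda>n. \<beta> n + \<gamma> n) (F * G)"
proof -
  have "Abs_fps (\<lambda>n. of_nat n * (\<beta> n + \<gamma> n)) = Abs_fps (\<lambda>n. of_nat n * \<beta> n) + Abs_fps (\<lambda>n. of_nat n * \<gamma> n)"
    by (simp add: fps_eq_iff algebra_simps)
  moreover have "fps_X * fps_deriv (F * G) = (fps_X * fps_deriv F) * G + F * (fps_X * fps_deriv G)"
    by (simp add: algebra_simps)
  ultimately show ?thesis using assms by (simp add: contr_iff algebra_simps)
qed

lemma contr_cong: "contr \<beta> F \<Longrightarrow> (\<And>n. n > 0 \<Longrightarrow> \<beta> n = \<gamma> n) \<Longrightarrow> contr \<gamma> F"
  by (auto simp: contr_def)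

lemma contr_geo: "contr (\<lambda>n. c ^ n / of_nat n) (geo c)"
  by (auto simp: contr_def geo_def power_add[symmetric] sum.cong[where h = "\<lambda>_. c ^ _"])

lemma contr_lin1: "contr (\<lambda>n. - (c ^ n) / of_nat n) (lin1 c)"
proof -
  have "of_nat n * fps_nth (lin1 c) n = (\<Sum>j=1..n. of_nat j * (- (c ^ j) / of_nat j) * fps_nth (lin1 c) (n - j))" for n
  proof (cases "n \<ge> 2")
    case True
    then obtain m where n: "n = Suc (Suc m)" by (metis add_2_eq_Suc le_Suc_ex)
    have "(\<Sum>j=1..n. of_nat j * (- (c ^ j) / of_nat j) * fps_nth (lin1 c) (n - j)) =
      (\<Sum>j\<in>{Suc m, Suc (Suc m)}. of_nat j * (- (c ^ j) / of_nat j) * fps_nth (lin1 c) (n - j))"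
      by (rule sum.mono_neutral_right) (auto simp: lin1_nth n)
    then show ?thesis by (simp add: lin1_nth n del: of_nat_Suc)
  next
    case False
    then have "n = 0 \<or> n = 1" by auto
    then show ?thesis by (auto simp: lin1_nth)
  qed
  then show ?thesis by (simp add: contr_def lin1_nth)
qed

lemma contr_1: "contr (\<lambda>_. 0) 1" by (auto simp: contr_def)

text \<open>From - log (1 - q^b x) = \<Sum> q^(n b) x^n / n. Writing q^(n b) as a power for the
  parameter n h matches the operation on C that replaces all parameters by their n-th
  powers.\<close>

lemma contr_rat:
  "contr (\<lambda>n. ((\<Sum>b\<leftarrow>bs. qp (of_nat n * h) b) - (\<Sum>a\<leftarrow>as. qp (of_nat n * h) a)) / of_nat n) (rat h as bs)"
proof -
  have p: "qp h c ^ n = qp (of_nat n * h) c" for c n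
    by (simp add: qp_def exp_of_nat_mult[symmetric] mult_ac)
  have 1: "contr (\<lambda>n. (\<Sum>b\<leftarrow>bs. qp (of_nat n * h) b) / of_nat n) (\<Prod>b\<leftarrow>bs. geo (qp h b))"
  proof (induction bs)
    case (Cons b bs)
    show ?case using contr_mult[OF contr_geo[of "qp h b"] Cons] by (simp add: p add_divide_distrib)
  qed (simp add: contr_1)
  have 2: "contr (\<lambda>n. - (\<Sum>a\<leftarrow>as. qp (of_nat n * h) a) / of_nat n) (\<Prod>a\<leftarrow>as. lin1 (qp h a))"
  proof (induction as)
    case (Cons a as)
    show ?case using contr_mult[OF contr_lin1[of "qp h a"] Cons] by (simp add: p add_divide_distrib diff_divide_distrib)
  qed (simp add: contr_1)
  show ?thesis unfolding rat_def
    by (rule contr_cong[OF contr_mult[OF 2 1]]) (simp add: diff_divide_distrib add_divide_distrib)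
qed

lemma co_lin1_mult: "co (lin1 c * F) l = co F l - c * co F (l - 1)"
proof (cases "l \<le> 0")
  case False
  then have l: "nat l = Suc (nat (l - 1))" by simp
  have "lin1 c * F = F - fps_const c * (fps_X * F)" by (simp add: lin1_def left_diff_distrib mult.assoc)
  then show ?thesis using False unfolding co_def l by simp
qed (auto simp: co_def lin1_def)
lemma co_lin1: "co (lin1 c) l = (if l = 0 then 1 else if l = 1 then - c else 0)"
  using co_lin1_mult[of c 1 l] by (auto simp: co_def)
lemma co_geo: "co (geo c) l = (if l < 0 then 0 else c ^ nat l)" by (simp add: co_def geo_def)

lemma qp_diff: "qp h (a - b) = qp h a / qp h b" by (simp add: qp_def left_diff_distrib exp_diff)
lemma qp_minus: "qp h (- a) = inverse (qp h a)" by (simp add: qp_def exp_minus)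

text \<open>The two expansions of \<open>(1 - q\<^sup>a x) / (1 - q\<^sup>b x)\<close> differ by a multiple of a delta function.\<close>

lemma co_pole:
  "co (rat h [a] [b]) l - qp h (a - b) * co (rat h [- a] [- b]) (- l) = (1 - qp h (a - b)) * qp h (b * of_int l)"
proof -
  have e: "co (rat h [a] [b]) l = co (geo (qp h b)) l - qp h a * co (geo (qp h b)) (l - 1)" for a b l
    by (simp add: rat_def co_lin1_mult)
  have g: "co (geo (qp h b)) l = (if l < 0 then 0 else qp h (b * of_int l))" for b l
    by (auto simp: co_geo qp_pow mult.commute of_nat_nat)
  show ?thesis
  proof (cases l "0 :: int" rule: linorder_cases)
    case less
    then show ?thesis unfolding e g
      by (simp add: qp_def algebra_simps exp_diff exp_add exp_minus)
  next
    case equal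
    then show ?thesis unfolding e g by simp
  next
    case greater
    then show ?thesis unfolding e g
      by (simp add: qp_def algebra_simps exp_diff exp_add exp_minus)
  qed
qed

context cvs
begin

subsection \<open>Smooth families\<close>

lemma smoothD:
  assumes "smooth I x"
  obtains N where "\<And>ps. set ps \<subseteq> I \<times> {1..} \<Longrightarrow> N \<le> sum_list (map snd ps) \<Longrightarrow> foldr (\<lambda>(i, n). x i (int n)) ps v = 0"
proof -
  have "\<exists>N. \<forall>ps. set ps \<subseteq> I \<times> {1..} \<and> N \<le> sum_list (map snd ps) \<longrightarrow> foldr (\<lambda>(i, n). x i (int n)) ps v = 0"
    using assms unfolding smooth_def by (rule spec)
  then obtain N where N: "\<forall>ps. set ps \<subseteq> I \<times> {1..} \<and> N \<le> sum_list (map snd ps) \<longrightarrow> foldr (\<lambda>(i, n). x i (int n)) ps v = 0" ..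
  show thesis by (rule that[OF mp[OF spec[OF N] conjI]])
qed

lemma smoothI:
  assumes "\<And>v. \<exists>N. \<forall>ps. set ps \<subseteq> I \<times> {1..} \<longrightarrow> N \<le> sum_list (map snd ps) \<longrightarrow> foldr (\<lambda>(i, n). x i (int n)) ps v = 0"
  shows "smooth I x"
  unfolding smooth_def using assms by (simp only: imp_conjL simp_thms)

lemma smooth_mono:
  assumes "smooth I x" "J \<subseteq> I" shows "smooth J x"
proof (rule smoothI)
  fix v
  obtain N where N: "\<And>ps. set ps \<subseteq> I \<times> {1..} \<Longrightarrow> N \<le> sum_list (map snd ps) \<Longrightarrow> foldr (\<lambda>(i, n). x i (int n)) ps v = 0"
    by (rule smoothD[OF assms(1), of v], rule that, blast)
  have "set ps \<subseteq> I \<times> {1..}" if "set ps \<subseteq> J \<times> {1..}" for ps :: "('a \<times> nat) list"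
    using that assms(2) by (blast dest: subsetD)
  then show "\<exists>N. \<forall>ps. set ps \<subseteq> J \<times> {1..} \<longrightarrow> N \<le> sum_list (map snd ps) \<longrightarrow> foldr (\<lambda>(i, n). x i (int n)) ps v = 0"
    by (intro exI[of _ N] allI impI N)
qed

lemma foldr_word_lin:
  "set ps \<subseteq> I \<times> {1..} \<Longrightarrow> (\<And>i n. i \<in> I \<Longrightarrow> n > 0 \<Longrightarrow> lin (x i (int n))) \<Longrightarrow> lin (foldr (\<lambda>(i, n). x i (int n)) ps)"
proof (induction ps)
  case (Cons p ps)
  obtain i n where p: "p = (i, n)" by force
  have "lin (\<lambda>w. x i (int n) (foldr (\<lambda>(i, n). x i (int n)) ps w))"
    by (rule lin_comp) (use Cons in \<open>auto simp: p\<close>)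
  then show ?case by (simp add: p comp_def)
qed (simp add: id_def lin_id)

text \<open>Linear combinations inherit the bound: expanding every letter of a word gives words of
  the same total degree in the old letters.\<close>

lemma smooth_comb:
  assumes x: "smooth I x" and lin: "\<And>i n. i \<in> I \<Longrightarrow> n > 0 \<Longrightarrow> lin (x i (int n))"
    and z: "\<And>j n v. j \<in> J \<Longrightarrow> n > 0 \<Longrightarrow> z j (int n) v = (\<Sum>i\<in>I. sc (k j i n) (x i (int n) v))"
  shows "smooth J z"
proof (rule smoothI)
  fix v
  obtain N where N: "\<And>ps. set ps \<subseteq> I \<times> {1..} \<Longrightarrow> N \<le> sum_list (map snd ps) \<Longrightarrow> foldr (\<lambda>(i, n). x i (int n)) ps v = 0"
    by (rule smoothD[OF x, of v], rule that, blast)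
  \<comment> \<open>The prefix \<open>qs\<close> collects the letters already expanded; each step
    expands the first letter of \<open>ps\<close> and appends it to \<open>qs\<close>.\<close>
  have "foldr (\<lambda>(i, n). x i (int n)) qs (foldr (\<lambda>(i, n). z i (int n)) ps v) = 0"
    if "set ps \<subseteq> J \<times> {1..}" "set qs \<subseteq> I \<times> {1..}" "N \<le> sum_list (map snd qs) + sum_list (map snd ps)" for ps qs
    using that
  proof (induction ps arbitrary: qs)
    case (Cons p ps)
    obtain j n where p: "p = (j, n)" by force
    have jn: "j \<in> J" "n > 0" using Cons.prems by (auto simp: p)
    let ?w = "foldr (\<lambda>(i, n). z i (int n)) ps v"
    have l: "lin (foldr (\<lambda>(i, n). x i (int n)) qs)"
      by (rule foldr_word_lin[OF Cons.prems(2)]) (rule lin)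
    have "foldr (\<lambda>(i, n). x i (int n)) qs (x i (int n) ?w) = 0" if "i \<in> I" for i
      using Cons.IH[of "qs @ [(i, n)]"] Cons.prems that by (auto simp: p)
    then show ?case
      by (simp add: p z[OF jn] lin_sum[OF l] lin_sc[OF l])
  qed (use N in auto)
  from this[of _ "[]"] show "\<exists>N. \<forall>ps. set ps \<subseteq> J \<times> {1..} \<longrightarrow> N \<le> sum_list (map snd ps) \<longrightarrow> foldr (\<lambda>(i, n). z i (int n)) ps v = 0"
    by (intro exI[of _ N] allI impI) simp
qed

text \<open>Every term of \<open>powc\<close> at degree l is a word of total degree l, so smoothness
  kills all high coefficients of the annihilation factor on a given vector.\<close>

lemma fam_smooth:
  assumes s: "smooth {i} x" and p: "cfam (\<lambda>n. x i (int n))" and m: "cfam (\<lambda>n. x i (- int n))"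
  shows "fam (x i)"
  unfolding fam_def
proof (intro conjI p m allI)
  fix v
  obtain N where N: "\<And>ps. set ps \<subseteq> {i} \<times> {1..} \<Longrightarrow> N \<le> sum_list (map snd ps) \<Longrightarrow> foldr (\<lambda>(i, n). x i (int n)) ps v = 0"
    by (rule smoothD[OF s, of v], rule that, blast)
  have "foldr (\<lambda>(i, n). x i (int n)) qs (powc (\<lambda>n. x i (int n)) j l v) = 0"
    if "set qs \<subseteq> {i} \<times> {1..}" "N \<le> sum_list (map snd qs) + l" for qs j l
    using that
  proof (induction j arbitrary: qs l)
    case 0
    have l: "lin (foldr (\<lambda>(i, n). x i (int n)) qs)"
      by (rule foldr_word_lin[OF 0(1)]) (use cfam_lin[OF p] in auto)
    show ?case using N[of qs] 0 lin_zero[OF l] by auto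
  next
    case (Suc j)
    have l: "lin (foldr (\<lambda>(i, n). x i (int n)) qs)"
      by (rule foldr_word_lin[OF Suc.prems(1)]) (use cfam_lin[OF p] in auto)
    have "foldr (\<lambda>(i, n). x i (int n)) qs (x i (int n) (powc (\<lambda>n. x i (int n)) j (l - n) v)) = 0" if "n \<in> {1..l}" for n
      using Suc.IH[of "qs @ [(i, n)]" "l - n"] Suc.prems that by auto
    then show ?case by (simp add: lin_sum[OF l])
  qed
  from this[of "[]"] have "expc sc (\<lambda>n. x i (int n)) l v = 0" if "N \<le> l" for l
    using that by (auto simp: expc_def)
  then have "{r. EP (x i) r v \<noteq> 0} \<subseteq> {0..int N}"
  proof (intro subsetI CollectI)
    fix r assume "r \<in> {r. EP (x i) r v \<noteq> 0}"
    then have r: "EP (x i) r v \<noteq> 0" by simp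
    then have "r \<ge> 0" by (rule EP_nz)
    moreover have "nat r < N"
    proof (rule ccontr)
      assume "\<not> nat r < N"
      then have "expc sc (\<lambda>n. x i (int n)) (nat r) v = 0"
        using \<open>\<And>l. N \<le> l \<Longrightarrow> expc sc (\<lambda>n. x i (int n)) l v = 0\<close>[of "nat r"] by simp
      then show False using r by (simp add: EP_def Ez_def split: if_splits)
    qed
    ultimately show "r \<in> {0..int N}" by auto
  qed
  then show "finite {r. EP (x i) r v \<noteq> 0}" by (rule finite_subset) simp
qed

section \<open>Contractions of sums and of rescaled families\<close>

lemma brk_sum:
  assumes "brk a b \<beta>" "brk c b \<gamma>" "fam b"
  shows "brk (\<lambda>n v. a n v + c n v) b (\<lambda>n. \<beta> n + \<gamma> n)"
  using assms fam_lin[OF assms(3)] by (auto simp: brk_def lin_add scale_left_distrib)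

lemma brk_sum_right:
  assumes "brk b a \<beta>" "brk b c \<gamma>" "fam b"
  shows "brk b (\<lambda>n v. a n v + c n v) (\<lambda>n. \<beta> n + \<gamma> n)"
  using assms fam_lin[OF assms(3)] by (auto simp: brk_def lin_add scale_left_distrib)

lemma brk_scale:
  assumes "brk a b \<beta>" "fam a" "fam b"
  shows "brk (\<lambda>n v. sc (k n) (a n v)) (\<lambda>n v. sc (l n) (b n v)) (\<lambda>n. k (int n) * l (- int n) * \<beta> n)"
  using assms(1) fam_lin[OF assms(2)] fam_lin[OF assms(3)]
  by (auto simp: brk_def lin_sc scale_right_distrib mult_ac)

lemma brk_cong: "brk a b \<beta> \<Longrightarrow> (\<And>n. n > 0 \<Longrightarrow> \<beta> n = \<gamma> n) \<Longrightarrow> brk a b \<gamma>"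
  by (auto simp: brk_def)

lemma fam_zero: "fam (\<lambda>n v. 0)"
proof -
  have "EP (\<lambda>n v. 0) r v = (if r = 0 then v else 0)" for r v
    unfolding EP_def by (rule Ez_trivial) simp
  then have "finite {r. EP (\<lambda>n v. 0) r v \<noteq> 0}" for v
    by (auto intro: finite_subset[of _ "{0}"])
  then show ?thesis by (auto simp: fam_def cfam_def lin_const0)
qed

definition xfam :: "'i set \<Rightarrow> ('i \<Rightarrow> int \<Rightarrow> 'v \<Rightarrow> 'v) \<Rightarrow> ('i \<Rightarrow> 'i \<Rightarrow> nat \<Rightarrow> complex) \<Rightarrow> bool" where
  "xfam I x \<beta> \<longleftrightarrow> (\<forall>i\<in>I. fam (x i) \<and> (\<forall>j\<in>I. comm2 (x i) (x j) \<and> brk (x i) (x j) (\<beta> i j)))"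

lemma osc_sum_Nil: "osc_sum h sc x [] = (\<lambda>n v. 0)"
  and osc_sum_Cons: "osc_sum h sc x ((i, e) # ps) = (\<lambda>n v. sh h e (x i) n v + osc_sum h sc x ps n v)"
  and osc_sum_append: "osc_sum h sc x (ps @ rs) = (\<lambda>n v. osc_sum h sc x ps n v + osc_sum h sc x rs n v)"
  by (auto simp: osc_sum_def sh_def fun_eq_iff)

lemma osc_sum_mset:
  assumes "mset ps = mset rs" shows "osc_sum h sc x ps = osc_sum h sc x rs"
proof -
  have "mset (map f ps) = mset (map f rs)" for f :: "_ \<Rightarrow> 'v" using assms by simp
  then show ?thesis unfolding osc_sum_def fun_eq_iff by (metis sum_mset_sum_list)
qed

text \<open>Pairing of the oscillators of :\<Prod> X_i(q^e z): with those of :\<Prod> X_j(q^e' w):,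
  where only the differences of the shifts matter.\<close>

definition pairing :: "complex \<Rightarrow> ('i \<Rightarrow> 'i \<Rightarrow> nat \<Rightarrow> complex) \<Rightarrow> ('i \<times> complex) list \<Rightarrow> ('i \<times> complex) list \<Rightarrow> nat \<Rightarrow> complex" where
  "pairing h \<beta> ps rs n = (\<Sum>(i, e)\<leftarrow>ps. \<Sum>(j, e')\<leftarrow>rs. qp h (of_nat n * (e' - e)) * \<beta> i j n)"

lemma comm2_add: "fam b \<Longrightarrow> comm2 a b \<Longrightarrow> comm2 c b \<Longrightarrow> comm2 (\<lambda>n v. a n v + c n v) b"
  using fam_lin[of b] by (auto simp: comm2_def lin_add)

lemma comm2_zero: "fam b \<Longrightarrow> comm2 (\<lambda>n v. 0) b"
  using fam_lin[of b] by (auto simp: comm2_def lin_zero)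

text \<open>Both claims go through one induction: adding the head to the tail gives a good family
  because the two commute, and that is the second claim for the tail.\<close>

lemma os_fam:
  assumes x: "xfam I x \<beta>" and ps: "fst ` set ps \<subseteq> I"
  shows "fam (osc_sum h sc x ps) \<and> (\<forall>b. fam b \<and> (\<forall>i\<in>I. comm2 (x i) b) \<longrightarrow> comm2 (osc_sum h sc x ps) b)"
  using ps
proof (induction ps)
  case Nil
  show ?case by (auto simp: osc_sum_Nil fam_zero comm2_zero)
next
  case (Cons p ps)
  obtain i e where p: "p = (i, e)" by force
  have i: "i \<in> I" "fam (x i)" using Cons.prems x by (auto simp: p xfam_def)
  have IH: "fam (osc_sum h sc x ps)" "\<And>b. fam b \<Longrightarrow> (\<forall>i\<in>I. comm2 (x i) b) \<Longrightarrow> comm2 (osc_sum h sc x ps) b"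
    using Cons by auto
  have c: "comm2 (sh h e (x i)) b" if "fam b" "\<forall>i\<in>I. comm2 (x i) b" for b
    by (rule comm2_sh[OF that(1) i(2)]) (use that i in auto)
  have "comm2 (osc_sum h sc x ps) (x j)" if "j \<in> I" for j
    using IH(2)[of "x j"] that x by (auto simp: xfam_def)
  then have "comm2 (sh h e (x i)) (osc_sum h sc x ps)"
    using c[OF IH(1)] comm2_sym by blast
  then have "fam (\<lambda>n v. sh h e (x i) n v + osc_sum h sc x ps n v)"
    by (rule fam_add[OF fam_sh[OF i(2)] IH(1)])
  moreover have "comm2 (\<lambda>n v. sh h e (x i) n v + osc_sum h sc x ps n v) b" if "fam b" "\<forall>i\<in>I. comm2 (x i) b" for b
    by (rule comm2_add[OF that(1) c[OF that] IH(2)[OF that]])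
  ultimately show ?case unfolding p osc_sum_Cons by blast
qed

lemma os_comm2:
  assumes x: "xfam I x \<beta>" and ps: "fst ` set ps \<subseteq> I" and rs: "fst ` set rs \<subseteq> I"
  shows "comm2 (osc_sum h sc x ps) (osc_sum h sc x rs)"
proof -
  have "comm2 (osc_sum h sc x rs) (x i)" if "i \<in> I" for i
    using os_fam[OF x rs, of h] that x by (auto simp: xfam_def)
  then show ?thesis using os_fam[OF x ps, of h] os_fam[OF x rs, of h] comm2_sym by blast
qed

lemma os_brk_right:
  assumes x: "xfam I x \<beta>" and rs: "fst ` set rs \<subseteq> I" and a: "fam a" "\<And>j. j \<in> I \<Longrightarrow> brk a (x j) (\<gamma> j)"
  shows "brk a (osc_sum h sc x rs) (\<lambda>n. \<Sum>(j, e')\<leftarrow>rs. qp h (of_nat n * e') * \<gamma> j n)"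
  using rs
proof (induction rs)
  case Nil
  show ?case using fam_lin[OF a(1)] by (auto simp: brk_def osc_sum_Nil lin_zero)
next
  case (Cons p rs)
  obtain j e where p: "p = (j, e)" by force
  have j: "j \<in> I" "fam (x j)" using Cons.prems x by (auto simp: p xfam_def)
  have "brk a (sh h e (x j)) (\<lambda>n. qp h (of_nat n * e) * \<gamma> j n)"
    using brk_scale[OF a(2)[OF j(1)] a(1) j(2), of "\<lambda>_. 1" "\<lambda>n. qp h (- of_int n * e)"]
    by (simp add: sh_def[abs_def])
  then show ?case unfolding p osc_sum_Cons
    by (rule brk_cong[OF brk_sum_right[OF _ Cons.IH a(1)]]) (use Cons.prems in auto)
qed

lemma os_brk_left:
  assumes x: "xfam I x \<beta>" and ps: "fst ` set ps \<subseteq> I" and b: "fam b" "\<And>i. i \<in> I \<Longrightarrow> brk (x i) b (\<gamma> i)"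
  shows "brk (osc_sum h sc x ps) b (\<lambda>n. \<Sum>(i, e)\<leftarrow>ps. qp h (- of_nat n * e) * \<gamma> i n)"
  using ps
proof (induction ps)
  case Nil
  show ?case using fam_lin[OF b(1)] by (auto simp: brk_def osc_sum_Nil lin_zero)
next
  case (Cons p ps)
  obtain i e where p: "p = (i, e)" by force
  have i: "i \<in> I" "fam (x i)" using Cons.prems x by (auto simp: p xfam_def)
  have "brk (sh h e (x i)) b (\<lambda>n. qp h (- of_nat n * e) * \<gamma> i n)"
    using brk_scale[OF b(2)[OF i(1)] i(2) b(1), of "\<lambda>n. qp h (- of_int n * e)" "\<lambda>_. 1"]
    by (simp add: sh_def[abs_def])
  then show ?case unfolding p osc_sum_Cons
    by (rule brk_cong[OF brk_sum[OF _ Cons.IH b(1)]]) (use Cons.prems in auto)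
qed

lemma os_brk:
  assumes x: "xfam I x \<beta>" and ps: "fst ` set ps \<subseteq> I" and rs: "fst ` set rs \<subseteq> I"
  shows "brk (osc_sum h sc x ps) (osc_sum h sc x rs) (pairing h \<beta> ps rs)"
proof -
  have "brk (x i) (osc_sum h sc x rs) (\<lambda>n. \<Sum>(j, e')\<leftarrow>rs. qp h (of_nat n * e') * \<beta> i j n)" if "i \<in> I" for i
    by (rule os_brk_right[OF x rs]) (use x that in \<open>auto simp: xfam_def\<close>)
  then have "brk (osc_sum h sc x ps) (osc_sum h sc x rs)
    (\<lambda>n. \<Sum>(i, e)\<leftarrow>ps. qp h (- of_nat n * e) * (\<Sum>(j, e')\<leftarrow>rs. qp h (of_nat n * e') * \<beta> i j n))"
    by (rule os_brk_left[OF x ps conjunct1[OF os_fam[OF x rs]]])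
  moreover have "qp h (of_nat n * (e' - e)) = qp h (- of_nat n * e) * qp h (of_nat n * e')" for n e e'
    by (simp add: qp_add[symmetric] right_diff_distrib)
  ultimately show ?thesis
    by (auto simp: pairing_def sum_list_const_mult split_def mult.assoc elim!: brk_cong)
qed

subsection \<open>Zero modes\<close>

definition epsl :: "'i dquiver \<Rightarrow> 'i list \<Rightarrow> 'i list \<Rightarrow> int" where
  "epsl Q is js = (\<Sum>i\<leftarrow>is. \<Sum>j\<leftarrow>js. eps Q i j)"

lemma eps_anti: "eps Q j i = - eps Q i j" by (simp add: eps_def)

lemma epsl_Cons: "epsl Q (i # is) js = (\<Sum>j\<leftarrow>js. eps Q i j) + epsl Q is js" by (simp add: epsl_def)

lemma epsl_anti: "epsl Q js is = - epsl Q is js"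
proof (induction js)
  case (Cons j js)
  have "(\<Sum>i\<leftarrow>is. (\<Sum>j\<leftarrow>j # js. eps Q i j)) = (\<Sum>i\<leftarrow>is. eps Q i j) + epsl Q is js"
    by (simp add: sum_list_addf epsl_def)
  moreover have "(\<Sum>i\<leftarrow>is. eps Q j i) = - (\<Sum>i\<leftarrow>is. eps Q i j)"
    unfolding uminus_sum_list_map by (intro arg_cong[where f = sum_list] map_cong refl) (simp add: comp_def, rule eps_anti)
  ultimately show ?case using Cons by (simp add: epsl_def)
qed (simp add: epsl_def)

definition zok :: "complex \<Rightarrow> 'i dquiver \<Rightarrow> ('i \<Rightarrow> 'v \<Rightarrow> 'v) \<Rightarrow> bool" where
  "zok h Q X \<longleftrightarrow> (\<forall>i\<in>verts Q. lin (X i)) \<and>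
    (\<forall>i\<in>verts Q. \<forall>j\<in>verts Q. \<forall>v. X i (X j v) = sc (qp h (2 * of_int (eps Q i j))) (X j (X i v)))"

lemma zok_lin: "zok h Q X \<Longrightarrow> i \<in> verts Q \<Longrightarrow> lin (X i)"
  unfolding zok_def by blast

lemma zok_swap: "zok h Q X \<Longrightarrow> i \<in> verts Q \<Longrightarrow> j \<in> verts Q \<Longrightarrow>
    X i (X j v) = sc (qp h (2 * of_int (eps Q i j))) (X j (X i v))"
  unfolding zok_def by blast

lemma zprod_lin: "zok h Q X \<Longrightarrow> set is \<subseteq> verts Q \<Longrightarrow> lin (zprod h sc Q X is)"
proof (induction "is")
  case Nil
  have "zprod h sc Q X [] = (\<lambda>v. v)" by (simp add: fun_eq_iff)
  then show ?case by (simp add: lin_id)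
next
  case (Cons i "is")
  have "lin (\<lambda>v. X i (zprod h sc Q X is v))"
    by (rule lin_comp) (use Cons zok_lin in auto)
  moreover have "zprod h sc Q X (i # is) = (\<lambda>v. sc (qp h (- of_int (\<Sum>j\<leftarrow>is. eps Q i j))) (X i (zprod h sc Q X is v)))"
    by (simp add: fun_eq_iff)
  ultimately show ?case by (simp add: lin_scale)
qed

text \<open>Moving X_i into an ordered monomial costs q^\<epsilon>, half of the exponent 2
  \<epsilon> of the commutation relation; \<open>epsl\<close> adds these up.\<close>

lemma zprod_append:
  assumes z: "zok h Q X" and i: "set is \<subseteq> verts Q" and j: "set js \<subseteq> verts Q"
  shows "zprod h sc Q X is (zprod h sc Q X js v) = sc (qp h (of_int (epsl Q is js))) (zprod h sc Q X (is @ js) v)"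
  using i
proof (induction "is")
  case (Cons i "is")
  have l: "lin (X i)" using zok_lin[OF z] Cons.prems by auto
  have "qp h (- of_int (\<Sum>j\<leftarrow>is. eps Q i j)) * qp h (of_int (epsl Q is js)) =
    qp h (of_int (epsl Q (i # is) js)) * qp h (- of_int (\<Sum>j\<leftarrow>is @ js. eps Q i j))"
    by (simp add: qp_add[symmetric] epsl_Cons)
  then show ?case using Cons by (simp only: zprod.simps append_Cons lin_sc[OF l] scale_scale set_simps insert_subset)
qed (simp add: epsl_def)

lemma zprod_swap1:
  assumes z: "zok h Q X" and i: "set is \<subseteq> verts Q" and j: "j \<in> verts Q"
  shows "X j (zprod h sc Q X is v) = sc (qp h (2 * of_int (\<Sum>i\<leftarrow>is. eps Q j i))) (zprod h sc Q X is (X j v))"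
  using i
proof (induction "is")
  case (Cons i "is")
  have l: "lin (X i)" "lin (X j)" using zok_lin[OF z] Cons.prems j by auto
  have "X j (X i u) = sc (qp h (2 * of_int (eps Q j i))) (X i (X j u))" for u
    by (rule zok_swap[OF z]) (use Cons.prems j in auto)
  moreover have "qp h (2 * of_int (\<Sum>i\<leftarrow>i # is. eps Q j i)) = qp h (2 * of_int (eps Q j i)) * qp h (2 * of_int (\<Sum>i\<leftarrow>is. eps Q j i))"
    by (simp add: qp_add[symmetric] distrib_left)
  ultimately show ?case using Cons
    by (simp only: zprod.simps lin_sc[OF l(1)] lin_sc[OF l(2)] scale_scale set_simps insert_subset mult_ac)
qed simp

text \<open>Commuting the two monomials costs q^(2 \<epsilon>), ordering the two products costs
  q^\<epsilon> and q^(- \<epsilon>); these cancel, so a Weyl ordered monomial does not depend on the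
  order of its letters.\<close>

lemma zprod_swap:
  assumes z: "zok h Q X" and i: "set is \<subseteq> verts Q" and j: "set js \<subseteq> verts Q"
  shows "zprod h sc Q X (is @ js) v = zprod h sc Q X (js @ is) v"
proof -
  have "zprod h sc Q X js (zprod h sc Q X is v) = sc (qp h (2 * of_int (epsl Q js is))) (zprod h sc Q X is (zprod h sc Q X js v))"
    using j
  proof (induction js)
    case Nil
    show ?case using zprod_lin[OF z i] by (simp add: epsl_def)
  next
    case (Cons j js)
    have l: "lin (X j)" using zok_lin[OF z] Cons.prems by auto
    show ?case using Cons zprod_swap1[OF z i, of j "zprod h sc Q X js v"] zprod_lin[OF z i]
      by (simp add: lin_sc l epsl_Cons qp_add distrib_left mult_ac)
  qed
  then have "sc (qp h (of_int (epsl Q js is))) (zprod h sc Q X (js @ is) v) =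
     sc (qp h (2 * of_int (epsl Q js is)) * qp h (of_int (epsl Q is js))) (zprod h sc Q X (is @ js) v)"
    using zprod_append[OF z i j, of v] zprod_append[OF z j i, of v] by simp
  moreover have "qp h (2 * of_int (epsl Q js is)) * qp h (of_int (epsl Q is js)) = qp h (of_int (epsl Q js is))"
    by (simp add: qp_add[symmetric] epsl_anti[of Q "is" js])
  ultimately show ?thesis by simp
qed

lemma zprod_mset:
  assumes z: "zok h Q X" and m: "mset is = mset js" and i: "set is \<subseteq> verts Q"
  shows "zprod h sc Q X is v = zprod h sc Q X js v"
  using m i
proof (induction "is" arbitrary: js)
  case (Cons i "is")
  then have "i \<in> set js" by (metis list.set_intros(1) set_mset_mset)
  then obtain as bs where js: "js = as @ i # bs" by (meson split_list)
  have s: "set js \<subseteq> verts Q" using Cons.prems by (metis set_mset_mset)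
  have m: "mset is = mset (bs @ as)" using Cons.prems js by simp
  have "(\<Sum>j\<leftarrow>is. eps Q i j) = (\<Sum>j\<leftarrow>bs @ as. eps Q i j)"
    using m by (metis mset_map sum_mset_sum_list)
  then have "zprod h sc Q X (i # is) v = zprod h sc Q X ((i # bs) @ as) v"
    using Cons.IH[OF m] Cons.prems by (simp del: map_append sum_list.append)
  also have "\<dots> = zprod h sc Q X js v"
    unfolding js by (rule zprod_swap[OF z]) (use s js in auto)
  finally show ?case .
qed simp

lemma zprod_comm:
  assumes "lin T" "\<And>i v. i \<in> set is \<Longrightarrow> T (X i v) = X i (T v)"
  shows "T (zprod h sc Q X is v) = zprod h sc Q X is (T v)"
  using assms(2) by (induction "is") (auto simp: lin_sc[OF assms(1)])

end

subsection \<open>Currents of the seed algebra\<close>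

definition pr :: "complex \<Rightarrow> 'i dquiver \<Rightarrow> ('i \<times> complex) list \<Rightarrow> ('i \<times> complex) list \<Rightarrow> complex" where
  "pr H Q ps rs = (\<Sum>(i, e)\<leftarrow>ps. \<Sum>(j, e')\<leftarrow>rs. qp H (e' - e) * Cmat H Q i j)"

text \<open>Demanded for every H: at H = n h it gives the n-th coefficient of the logarithm of the
  contraction, so one identity between finite exponential sums fixes the whole function
  \<open>rat h as bs\<close>.\<close>

definition con :: "'i dquiver \<Rightarrow> ('i \<times> complex) list \<Rightarrow> ('i \<times> complex) list \<Rightarrow> complex list \<Rightarrow> complex list \<Rightarrow> bool" where
  "con Q ps rs as bs \<longleftrightarrow> (\<forall>H. pr H Q ps rs = (\<Sum>b\<leftarrow>bs. qp H b) - (\<Sum>a\<leftarrow>as. qp H a))"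

definition shl :: "complex \<Rightarrow> ('i \<times> complex) list \<Rightarrow> ('i \<times> complex) list" where
  "shl e ps = map (\<lambda>(i, e'). (i, e + e')) ps"

section \<open>Algebra of the contraction functions\<close>

lemma co_rat_shift: "qp h (e * of_int l) * co (rat h as bs) l = co (rat h (map ((+) e) as) (map ((+) e) bs)) l"
proof (cases "l < 0")
  case False
  have s: "fps_compose F (fps_const c * fps_X) = Abs_fps (\<lambda>n. c ^ n * fps_nth F n)" for F and c :: complex
    by (simp add: fps_compose_linear)
  \<comment> \<open>The substitution of q^e x for x, a ring homomorphism, hence determined here by
    its values on the linear factors and on their inverses.\<close>
  define S where "S F = Abs_fps (\<lambda>n. qp h e ^ n * fps_nth F n)" for F
  have m: "S (F * G) = S F * S G" for F G
    unfolding S_def s[symmetric] by (rule fps_compose_mult_distrib) simp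
  have l: "S (lin1 (qp h a)) = lin1 (qp h (e + a))" for a
    by (auto simp: S_def fps_eq_iff lin1_nth qp_add)
  have g: "S (geo (qp h a)) = geo (qp h (e + a))" for a
    by (auto simp: S_def fps_eq_iff geo_def qp_add power_mult_distrib)
  have o: "S 1 = 1" by (auto simp: S_def fps_eq_iff)
  have "S (\<Prod>a\<leftarrow>as. lin1 (qp h a)) = (\<Prod>a\<leftarrow>map ((+) e) as. lin1 (qp h a))"
    by (induction as) (simp_all add: m l o)
  moreover have "S (\<Prod>a\<leftarrow>bs. geo (qp h a)) = (\<Prod>a\<leftarrow>map ((+) e) bs. geo (qp h a))"
    by (induction bs) (simp_all add: m g o)
  ultimately have "S (rat h as bs) = rat h (map ((+) e) as) (map ((+) e) bs)"
    by (simp add: rat_def m)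
  then have "fps_nth (S (rat h as bs)) (nat l) = fps_nth (rat h (map ((+) e) as) (map ((+) e) bs)) (nat l)" by simp
  moreover have "qp h e ^ nat l = qp h (e * of_int l)" using False by (simp add: qp_pow mult.commute)
  ultimately show ?thesis using False by (simp add: co_def S_def)
qed (simp add: co_def)

lemma rat_Cons_num: "rat h (a # as) bs = lin1 (qp h a) * rat h as bs"
  by (simp add: rat_def mult.assoc)

lemma rat_cancel: "lin1 (qp h a) * rat h as (a # bs) = rat h as bs"
proof -
  have "lin1 (qp h a) * rat h as (a # bs) = (lin1 (qp h a) * geo (qp h a)) * rat h as bs"
    unfolding rat_def list.map prod_list.Cons by (simp only: mult_ac)
  then show ?thesis by (simp add: lin1_geo)
qed

lemma rat_Nil: "rat h [] [] = 1" by (simp add: rat_def)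

lemma rat_inverse: "rat h as bs * rat h bs as = 1"
proof -
  have "(\<Prod>a\<leftarrow>as. lin1 (qp h a)) * (\<Prod>a\<leftarrow>as. geo (qp h a)) = 1" for as
  proof (induction as)
    case (Cons a as)
    have "(\<Prod>a\<leftarrow>a # as. lin1 (qp h a)) * (\<Prod>a\<leftarrow>a # as. geo (qp h a)) =
      (lin1 (qp h a) * geo (qp h a)) * ((\<Prod>a\<leftarrow>as. lin1 (qp h a)) * (\<Prod>a\<leftarrow>as. geo (qp h a)))"
      by (simp add: mult_ac)
    then show ?case by (simp only: Cons lin1_geo mult_1_left)
  qed simp
  moreover have "rat h as bs * rat h bs as = ((\<Prod>a\<leftarrow>as. lin1 (qp h a)) * (\<Prod>a\<leftarrow>as. geo (qp h a))) *
      ((\<Prod>a\<leftarrow>bs. lin1 (qp h a)) * (\<Prod>a\<leftarrow>bs. geo (qp h a)))"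
    unfolding rat_def by (simp only: mult_ac)
  ultimately show ?thesis by simp
qed

lemma co_mult: "co (F * G) l = (\<Sum>i\<in>{0..l}. co F i * co G (l - i))"
proof (cases "l < 0")
  case False
  have "(\<Sum>i\<in>{0..l}. co F i * co G (l - i)) = (\<Sum>i=0..nat l. co F (int i) * co G (l - int i))"
    by (rule sum.reindex_bij_witness[where i = int and j = nat]) (use False in auto)
  also have "\<dots> = (\<Sum>i=0..nat l. fps_nth F i * fps_nth G (nat l - i))"
    by (intro sum.cong refl) (use False in \<open>auto simp: co_def nat_diff_distrib\<close>)
  finally show ?thesis using False by (simp add: co_def fps_mult_nth)
qed (simp add: co_def)

context cvs
begin

text \<open>Multiplying by F and then by G equals multiplying by G F. The support of
  \<open>N\<close> bounds the index above and the power series bound it below, so the double sum is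
  finite.\<close>

lemma Sum_any_conv:
  assumes N: "finite {j::int. N j \<noteq> 0}"
  shows "Sum_any (\<lambda>j. sc (co G j) (Sum_any (\<lambda>l. sc (co F l) (N (j + l))))) = Sum_any (\<lambda>m. sc (co (G * F) m) (N m))"
proof -
  obtain B where B: "\<And>m. N m \<noteq> 0 \<Longrightarrow> m \<le> B"
  proof
    fix m assume "N m \<noteq> 0"
    then show "m \<le> Max (insert 0 {j. N j \<noteq> 0})" using N by (intro Max_ge) auto
  qed
  have i: "Sum_any (\<lambda>l. sc (co F l) (N (j + l))) = (\<Sum>l\<in>{0..B - j}. sc (co F l) (N (j + l)))" for j
  proof (rule Sum_any.expand_superset, simp, rule subsetI)
    fix l assume "l \<in> {l. sc (co F l) (N (j + l)) \<noteq> 0}"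
    then have "co F l \<noteq> 0" "N (j + l) \<noteq> 0" by auto
    then show "l \<in> {0..B - j}" using B[of "j + l"] by (auto simp: co_def split: if_splits)
  qed
  have "Sum_any (\<lambda>j. sc (co G j) (Sum_any (\<lambda>l. sc (co F l) (N (j + l))))) =
     (\<Sum>j\<in>{0..B}. \<Sum>l\<in>{0..B - j}. sc (co G j * co F l) (N (j + l)))"
  proof -
    have "Sum_any (\<lambda>j. sc (co G j) (\<Sum>l\<in>{0..B - j}. sc (co F l) (N (j + l)))) =
      (\<Sum>j\<in>{0..B}. sc (co G j) (\<Sum>l\<in>{0..B - j}. sc (co F l) (N (j + l))))"
    proof (rule Sum_any.expand_superset, simp, rule subsetI)
      fix j assume "j \<in> {j. sc (co G j) (\<Sum>l\<in>{0..B - j}. sc (co F l) (N (j + l))) \<noteq> 0}"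
      then have "co G j \<noteq> 0" "\<not> B < j" by auto
      then show "j \<in> {0..B}" by (simp add: co_def split: if_splits)
    qed
    then show ?thesis unfolding i by (simp add: scale_sum_right)
  qed
  also have "\<dots> = (\<Sum>m\<in>{0..B}. \<Sum>j\<in>{0..m}. sc (co G j * co F (m - j)) (N m))"
    unfolding sum.Sigma[OF finite_atLeastAtMost_int ballI[OF finite_atLeastAtMost_int]]
    by (rule sum.reindex_bij_witness[where i = "\<lambda>(m, j). (j, m - j)" and j = "\<lambda>(j, l). (j + l, j)"]) auto
  also have "\<dots> = (\<Sum>m\<in>{0..B}. sc (co (G * F) m) (N m))"
    by (simp add: co_mult scale_sum_left)
  also have "\<dots> = Sum_any (\<lambda>m. sc (co (G * F) m) (N m))"
  proof (rule Sum_any.expand_superset[symmetric], simp, rule subsetI)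
    fix m assume "m \<in> {m. sc (co (G * F) m) (N m) \<noteq> 0}"
    then have "co (G * F) m \<noteq> 0" "N m \<noteq> 0" by auto
    then show "m \<in> {0..B}" using B[of m] by (auto simp: co_def split: if_splits)
  qed
  finally show ?thesis .
qed

end

locale seed = cvs sc for sc :: "complex \<Rightarrow> 'v::ab_group_add \<Rightarrow> 'v" +
  fixes h :: complex and Q :: "'i dquiver" and M :: "('i, 'v) seed_ops"
  assumes sm: "seed_module h sc Q M"
begin

abbreviation os :: "('i \<times> complex) list \<Rightarrow> int \<Rightarrow> 'v \<Rightarrow> 'v" where "os \<equiv> osc_sum h sc (osc M)"
abbreviation zp :: "'i list \<Rightarrow> 'v \<Rightarrow> 'v" where "zp \<equiv> zprod h sc Q (zer M)"
abbreviation okl :: "('i \<times> complex) list \<Rightarrow> bool" where "okl ps \<equiv> fst ` set ps \<subseteq> verts Q"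

lemmas smD1 = conjunct1[OF sm[unfolded seed_module_def]]
lemmas sm_smooth = conjunct1[OF conjunct2[OF sm[unfolded seed_module_def]]]
lemmas smD3 = conjunct2[OF conjunct2[OF sm[unfolded seed_module_def]], THEN bspec, THEN bspec, THEN spec]

lemma zer_lin: "i \<in> verts Q \<Longrightarrow> lin (zer M i)"
  and osc_lin: "i \<in> verts Q \<Longrightarrow> n \<noteq> 0 \<Longrightarrow> lin (osc M i n)"
  using smD1 by simp_all

lemma zok: "zok h Q (zer M)"
  unfolding zok_def by (intro conjI ballI allI zer_lin conjunct1[OF smD3])

lemma zer_osc: "i \<in> verts Q \<Longrightarrow> j \<in> verts Q \<Longrightarrow> n \<noteq> 0 \<Longrightarrow> zer M i (osc M j n v) = osc M j n (zer M i v)"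
  by (rule conjunct1[OF conjunct2[OF smD3], THEN spec, THEN mp])

lemma osc_neg: "i \<in> verts Q \<Longrightarrow> j \<in> verts Q \<Longrightarrow> n < 0 \<Longrightarrow> m < 0 \<Longrightarrow> osc M i n (osc M j m v) = osc M j m (osc M i n v)"
  by (rule conjunct2[OF conjunct2[OF conjunct2[OF smD3]], THEN spec, THEN spec, THEN mp]) simp_all

lemma osc_brk:
  assumes "i \<in> verts Q" "j \<in> verts Q" "n > 0" "m \<noteq> 0"
  shows "osc M i n (osc M j m v) - osc M j m (osc M i n v) =
      (if n + m = 0 then sc (Cmat (of_int n * h) Q i j / of_int n) v else 0)"
  using conjunct1[OF conjunct2[OF conjunct2[OF smD3[OF assms(1,2)]]], rule_format, of n m v] assms(3,4) by simp

lemma osc_pos: "i \<in> verts Q \<Longrightarrow> j \<in> verts Q \<Longrightarrow> n > 0 \<Longrightarrow> m > 0 \<Longrightarrow> osc M i n (osc M j m v) = osc M j m (osc M i n v)"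
  using osc_brk[of i j n m v] by simp

lemma osc_br:
  assumes "i \<in> verts Q" "j \<in> verts Q" "n > 0" "m > 0"
  shows "osc M i (int n) (osc M j (- int m) v) = osc M j (- int m) (osc M i (int n) v) +
    (if n = m then sc (Cmat (of_nat n * h) Q i j / of_nat n) v else 0)"
  using osc_brk[of i j "int n" "- int m" v] assms by (auto simp: diff_eq_eq add.commute)

lemma osc_fam: assumes i: "i \<in> verts Q" shows "fam (osc M i)"
proof (rule fam_smooth)
  show "smooth {i} (osc M)"
    by (rule smooth_mono[OF sm_smooth]) (use i in simp)
  show "cfam (\<lambda>n. osc M i (int n))" "cfam (\<lambda>n. osc M i (- int n))"
    unfolding cfam_def using osc_lin[OF i] osc_pos[OF i i] osc_neg[OF i i] by simp_all
qed

lemma osc_comm2: "i \<in> verts Q \<Longrightarrow> j \<in> verts Q \<Longrightarrow> comm2 (osc M i) (osc M j)"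
  unfolding comm2_def by (simp add: osc_pos[of i j] osc_neg[of i j])

lemma xf: "xfam (verts Q) (osc M) (\<lambda>i j n. Cmat (of_nat n * h) Q i j / of_nat n)"
  unfolding xfam_def brk_def by (intro ballI conjI allI impI osc_fam osc_comm2 osc_br; (elim conjE)?; assumption)

lemma os_fam': "okl ps \<Longrightarrow> fam (os ps)"
  using os_fam[OF xf] by blast

lemma os_comm2': "okl ps \<Longrightarrow> okl rs \<Longrightarrow> comm2 (os ps) (os rs)"
  using os_comm2[OF xf] by blast

lemma con_contr:
  assumes "con Q ps rs as bs"
  shows "contr (pairing h (\<lambda>i j n. Cmat (of_nat n * h) Q i j / of_nat n) ps rs) (rat h as bs)"
proof (rule contr_cong[OF contr_rat])
  fix n :: nat
  have q: "qp h (of_nat n * x) = qp (of_nat n * h) x" for x by (simp add: qp_def mult_ac)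
  have "pairing h (\<lambda>i j n. Cmat (of_nat n * h) Q i j / of_nat n) ps rs n = pr (of_nat n * h) Q ps rs / of_nat n"
    unfolding pairing_def pr_def q split_def divide_inverse mult.assoc[symmetric] sum_list_mult_const ..
  then show "((\<Sum>b\<leftarrow>bs. qp (of_nat n * h) b) - (\<Sum>a\<leftarrow>as. qp (of_nat n * h) a)) / of_nat n =
      pairing h (\<lambda>i j n. Cmat (of_nat n * h) Q i j / of_nat n) ps rs n"
    using assms by (simp add: con_def)
qed

text \<open>Labelled by the exponent of z, that is, by minus the mode number, in agreement with
  \<open>bexp\<close>.\<close>

definition cur :: "('i \<times> complex) list \<Rightarrow> int \<Rightarrow> 'v \<Rightarrow> 'v" where
  "cur ps c v = zp (map fst ps) (bexp sc (os ps) c v)"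

text \<open>The coefficient of z^c w^d in :A(z) B(w):, zero modes included.\<close>

definition NN :: "('i \<times> complex) list \<Rightarrow> ('i \<times> complex) list \<Rightarrow> int \<Rightarrow> int \<Rightarrow> 'v \<Rightarrow> 'v" where
  "NN ps rs c d v = zp (map fst (ps @ rs)) (BB (os ps) (os rs) c d v)"

abbreviation ep :: "('i \<times> complex) list \<Rightarrow> ('i \<times> complex) list \<Rightarrow> complex" where
  "ep ps rs \<equiv> of_int (epsl Q (map fst ps) (map fst rs))"

lemma ep_anti: "ep rs ps = - ep ps rs"
  by (subst epsl_anti) simp

lemma nprod_cur: "nprod h sc Q M ps n = cur ps (- n)"
  by (simp add: fun_eq_iff nprod_def cur_def)

lemma zp_lin: "okl ps \<Longrightarrow> lin (zp (map fst ps))"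
  by (rule zprod_lin[OF zok]) simp

lemma cur_lin: "okl ps \<Longrightarrow> lin (cur ps c)"
proof -
  assume o: "okl ps"
  have "lin (\<lambda>v. zp (map fst ps) (bexp sc (os ps) c v))"
    by (rule lin_comp[OF zp_lin[OF o] bexp_lin[OF os_fam'[OF o]]])
  then show ?thesis by (simp add: cur_def[abs_def])
qed

lemma zp_osc: assumes "set is \<subseteq> verts Q" "okl ps" "n \<noteq> 0" shows "zp is (os ps n v) = os ps n (zp is v)"
proof -
  have l: "lin (zp is)" by (rule zprod_lin[OF zok assms(1)])
  have "zp is (osc M j n v) = osc M j n (zp is v)" if "j \<in> verts Q" for j v
    by (rule zprod_comm[symmetric, OF osc_lin]) (use that assms zer_osc in auto)
  moreover have "fst p \<in> verts Q" if "p \<in> set ps" for p using assms(2) that by auto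
  ultimately show ?thesis
    unfolding osc_sum_def lin_sum_list[OF l] split_def lin_sc[OF l]
    by (intro arg_cong[where f = sum_list] map_cong refl) simp
qed

lemma zp_bexp:
  assumes rs: "okl rs" and ps: "okl ps"
  shows "zp (map fst rs) (bexp sc (os ps) c v) = bexp sc (os ps) c (zp (map fst rs) v)"
proof -
  have "set (map fst rs) \<subseteq> verts Q" using rs by simp
  note z = zp_osc[OF this ps]
  show ?thesis by (rule bexp_comm[where a = "os ps" and T = "zp (map fst rs)", OF os_fam'[OF ps] zp_lin[OF rs] z])
qed

lemma NN_fin:
  assumes "okl ps" "okl rs" shows "finite {j. NN ps rs (c + j) (d - j) v \<noteq> 0}"
proof (rule finite_subset)
  show "{j. NN ps rs (c + j) (d - j) v \<noteq> 0} \<subseteq> {j. BB (os ps) (os rs) (c + j) (d - j) v \<noteq> 0}"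
  proof
    fix j assume j: "j \<in> {j. NN ps rs (c + j) (d - j) v \<noteq> 0}"
    have "zp (map fst (ps @ rs)) 0 = 0" by (rule lin_zero[OF zp_lin]) (use assms in auto)
    then show "j \<in> {j. BB (os ps) (os rs) (c + j) (d - j) v \<noteq> 0}"
      using j unfolding NN_def by (intro CollectI notI) simp
  qed
  show "finite {j. BB (os ps) (os rs) (c + j) (d - j) v \<noteq> 0}"
    by (rule BB_fin[OF os_fam'[OF assms(1)] os_fam'[OF assms(2)] os_comm2'[OF assms]])
qed

lemma NN_sym: assumes "okl ps" "okl rs" shows "NN ps rs c d v = NN rs ps d c v"
proof -
  have "zp (map fst (ps @ rs)) u = zp (map fst (rs @ ps)) u" for u
    unfolding map_append by (rule zprod_swap[OF zok]) (use assms in auto)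
  then show ?thesis
    unfolding NN_def by (simp only: BB_sym[OF os_fam' os_fam' os_comm2', OF assms assms])
qed

lemma cur_prod:
  assumes ps: "okl ps" and rs: "okl rs" and c: "con Q ps rs as bs"
  shows "cur ps c (cur rs d v) = sc (qp h (ep ps rs)) (Sum_any (\<lambda>l. sc (co (rat h as bs) l) (NN ps rs (c + l) (d - l) v)))"
proof -
  have "cur ps c (cur rs d v) = zp (map fst ps) (zp (map fst rs) (bexp sc (os ps) c (bexp sc (os rs) d v)))"
    by (simp add: cur_def zp_bexp[OF rs ps])
  also have "\<dots> = sc (qp h (ep ps rs)) (zp (map fst (ps @ rs)) (bexp sc (os ps) c (bexp sc (os rs) d v)))"
    unfolding map_append by (rule zprod_append[OF zok]) (use ps rs in auto)
  also have "bexp sc (os ps) c (bexp sc (os rs) d v) = Sum_any (\<lambda>l. sc (co (rat h as bs) l) (BB (os ps) (os rs) (c + l) (d - l) v))"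
    by (rule bexp_prod[OF os_fam'[OF ps] os_fam'[OF rs] os_comm2'[OF ps rs] os_brk[OF xf ps rs] con_contr[OF c]])
  also have "zp (map fst (ps @ rs)) \<dots> = Sum_any (\<lambda>l. sc (co (rat h as bs) l) (NN ps rs (c + l) (d - l) v))"
  proof -
    have l: "lin (zp (map fst (ps @ rs)))" by (rule zp_lin) (use ps rs in auto)
    have "finite {x. sc (co (rat h as bs) x) (BB (os ps) (os rs) (c + x) (d - x) v) \<noteq> 0}"
      by (rule finite_subset[OF _ BB_fin[OF os_fam'[OF ps] os_fam'[OF rs] os_comm2'[OF ps rs], of c d v]]) auto
    from lin_Sum_any[OF l this] show ?thesis by (simp only: lin_sc[OF l] NN_def)
  qed
  finally show ?thesis .
qed

text \<open>The other order of the factors, written in the same modes \<open>NN ps rs\<close>: the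
  contraction is now a series in z/w, hence the index - l. Both orders thus become expansions over
  one index.\<close>

lemma cur_prod_rev:
  assumes ps: "okl ps" and rs: "okl rs" and c: "con Q rs ps as bs"
  shows "cur rs d (cur ps c v) = sc (qp h (- ep ps rs)) (Sum_any (\<lambda>l. sc (co (rat h as bs) (- l)) (NN ps rs (c + l) (d - l) v)))"
proof -
  have "cur rs d (cur ps c v) = sc (qp h (ep rs ps)) (Sum_any (\<lambda>l. sc (co (rat h as bs) l) (NN rs ps (d + l) (c - l) v)))"
    by (rule cur_prod[OF rs ps c])
  also have "Sum_any (\<lambda>l. sc (co (rat h as bs) l) (NN rs ps (d + l) (c - l) v)) =
      Sum_any (\<lambda>l. sc (co (rat h as bs) (- l)) (NN ps rs (c + l) (d - l) v))"
    by (subst Sum_any_reflect[of _ 0, symmetric]) (simp add: NN_sym[OF rs ps])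
  finally show ?thesis by (simp only: ep_anti[of rs ps])
qed

lemma cur_prod0:
  assumes ps: "okl ps" and rs: "okl rs" and c: "con Q ps rs [] []"
  shows "cur ps c (cur rs d v) = sc (qp h (ep ps rs)) (NN ps rs c d v)"
proof -
  have "sc (co 1 l) (NN ps rs (c + l) (d - l) v) = (if l = 0 then NN ps rs (c + l) (d - l) v else 0)" for l
    by (auto simp: co_1)
  then show ?thesis by (simp add: cur_prod[OF ps rs c] rat_Nil)
qed

lemma cur_prod_rev0:
  assumes ps: "okl ps" and rs: "okl rs" and c: "con Q rs ps [] []"
  shows "cur rs d (cur ps c v) = sc (qp h (- ep ps rs)) (NN ps rs c d v)"
  by (simp add: cur_prod0[OF rs ps c] NN_sym[OF rs ps] ep_anti[of rs ps])

lemma fin_scNN: "okl ps \<Longrightarrow> okl rs \<Longrightarrow> finite {l. sc (\<phi> l) (NN ps rs (c + l) (d - l) v) \<noteq> 0}"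
  by (rule finite_subset[OF _ NN_fin[of ps rs c d v]]) auto

lemma sc_NN: "okl ps \<Longrightarrow> okl rs \<Longrightarrow> sc k (Sum_any (\<lambda>l. sc (x l) (NN ps rs (c + l) (d - l) v))) =
    Sum_any (\<lambda>l. sc (k * x l) (NN ps rs (c + l) (d - l) v))"
  by (subst sc_Sum_any[OF fin_scNN]) simp_all

lemma add_NN: "okl ps \<Longrightarrow> okl rs \<Longrightarrow>
    Sum_any (\<lambda>l. sc (x l) (NN ps rs (c + l) (d - l) v)) + Sum_any (\<lambda>l. sc (y l) (NN ps rs (c + l) (d - l) v)) =
    Sum_any (\<lambda>l. sc (x l + y l) (NN ps rs (c + l) (d - l) v))"
  by (subst Sum_any.distrib[symmetric, OF fin_scNN fin_scNN]) (simp_all add: scale_left_distrib)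

lemma diff_NN: "okl ps \<Longrightarrow> okl rs \<Longrightarrow>
    Sum_any (\<lambda>l. sc (x l) (NN ps rs (c + l) (d - l) v)) - Sum_any (\<lambda>l. sc (y l) (NN ps rs (c + l) (d - l) v)) =
    Sum_any (\<lambda>l. sc (x l - y l) (NN ps rs (c + l) (d - l) v))"
  unfolding diff_eq_eq by (subst add_NN) simp_all

text \<open>Multiplication by \<delta>(q^b w/z) specializes to z = q^b w. The factor q^(- c b)
  appears because the coefficient q^(b l) is normalized at l = 0, where the exponent of z in
  \<open>NN\<close> is c.\<close>

lemma NN_delta:
  assumes ps: "okl ps" and rs: "okl rs"
  shows "Sum_any (\<lambda>l. sc (qp h (b * of_int l)) (NN ps rs (c + l) (d - l) v)) =
    sc (qp h (- of_int c * b)) (cur (shl b ps @ rs) (c + d) v)"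
proof -
  have m: "map fst (shl b ps @ rs) = map fst (ps @ rs)" by (simp add: shl_def split_def)
  have o: "os (shl b ps @ rs) n v = sh h b (os ps) n v + os rs n v" for n v
    by (simp add: osc_sum_def sh_def shl_def split_def comp_def sum_list_const_mult scale_sum_right)
      (induction ps, auto simp: scale_right_distrib qp_add[symmetric] algebra_simps)
  have l: "lin (zp (map fst (ps @ rs)))" by (rule zp_lin) (use ps rs in auto)
  note BBf = BB_fin[OF os_fam'[OF ps] os_fam'[OF rs] os_comm2'[OF ps rs]]
  have "cur (shl b ps @ rs) (c + d) v = zp (map fst (ps @ rs)) (bexp sc (\<lambda>n v. sh h b (os ps) n v + os rs n v) (c + d) v)"
    unfolding cur_def m o[abs_def] ..
  also have "\<dots> = zp (map fst (ps @ rs)) (Sum_any (\<lambda>l. sc (qp h (of_int (c + l) * b)) (BB (os ps) (os rs) (c + l) (d - l) v)))"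
    by (simp only: BB_delta[OF os_fam'[OF ps] os_fam'[OF rs] os_comm2'[OF ps rs]])
  also have "\<dots> = Sum_any (\<lambda>l. sc (qp h (of_int (c + l) * b)) (NN ps rs (c + l) (d - l) v))"
  proof -
    have "finite {x. sc (qp h (of_int (c + x) * b)) (BB (os ps) (os rs) (c + x) (d - x) v) \<noteq> 0}"
      by (rule finite_subset[OF _ BBf[of c d v]]) auto
    from lin_Sum_any[OF l this] show ?thesis by (simp only: lin_sc[OF l] NN_def)
  qed
  also have "\<dots> = sc (qp h (of_int c * b)) (Sum_any (\<lambda>l. sc (qp h (b * of_int l)) (NN ps rs (c + l) (d - l) v)))"
  proof -
    have "qp h (of_int (c + l) * b) = qp h (of_int c * b) * qp h (b * of_int l)" for l
      by (simp add: qp_add[symmetric] algebra_simps)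
    then show ?thesis by (simp only: sc_NN[OF ps rs])
  qed
  finally have "sc (qp h (- of_int c * b)) (cur (shl b ps @ rs) (c + d) v) =
     sc (qp h (- of_int c * b) * qp h (of_int c * b)) (Sum_any (\<lambda>l. sc (qp h (b * of_int l)) (NN ps rs (c + l) (d - l) v)))" by simp
  then show ?thesis by (simp add: qp_add[symmetric])
qed

lemma cur_mset:
  assumes "mset ps = mset rs" "okl ps" shows "cur ps c v = cur rs c v"
proof -
  have "mset (map fst ps) = mset (map fst rs)" using assms(1) by simp
  then show ?thesis unfolding cur_def osc_sum_mset[OF assms(1)]
    by (rule zprod_mset[OF zok]) (use assms in auto)
qed

lemma cur_comm0:
  assumes ps: "okl ps" and rs: "okl rs" and c: "con Q ps rs [] []" "con Q rs ps [] []" and e: "epsl Q (map fst ps) (map fst rs) = 0"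
  shows "cur ps c (cur rs d v) = cur rs d (cur ps c v)"
  by (simp add: cur_prod[OF ps rs c(1)] cur_prod_rev[OF ps rs c(2)] e rat_Nil co_1)

text \<open>The condition on a - b says that q^\<epsilon> (1 - q^a x) / (1 - q^b x) and the function
  from the other order are the same rational function, so the commutator is the delta function at
  the pole. The nonzero terms of [E, F] arise in this way.\<close>

lemma cur_comm_pole:
  assumes ps: "okl ps" and rs: "okl rs" and c: "con Q ps rs [a] [b]" "con Q rs ps [- a] [- b]" and e: "a - b = - 2 * ep ps rs"
  shows "cur ps c (cur rs d v) - cur rs d (cur ps c v) =
    sc ((qp h (ep ps rs) - qp h (- ep ps rs)) * qp h (- of_int c * b)) (cur (shl b ps @ rs) (c + d) v)"
proof -
  let ?N = "\<lambda>l. NN ps rs (c + l) (d - l) v"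
  have co: "qp h (ep ps rs) * co (rat h [a] [b]) l - qp h (- ep ps rs) * co (rat h [- a] [- b]) (- l) =
     (qp h (ep ps rs) - qp h (- ep ps rs)) * qp h (b * of_int l)" for l
  proof -
    have q: "qp h (ep ps rs) * qp h (a - b) = qp h (- ep ps rs)" by (simp add: qp_add[symmetric] e)
    have "qp h (ep ps rs) * (co (rat h [a] [b]) l - qp h (a - b) * co (rat h [- a] [- b]) (- l)) =
      (qp h (ep ps rs) - qp h (ep ps rs) * qp h (a - b)) * qp h (b * of_int l)"
      unfolding co_pole by (simp add: algebra_simps)
    then show ?thesis unfolding q right_diff_distrib mult.assoc[symmetric] q by simp
  qed
  have "cur ps c (cur rs d v) - cur rs d (cur ps c v) = Sum_any (\<lambda>l. sc ((qp h (ep ps rs) - qp h (- ep ps rs)) * qp h (b * of_int l)) (?N l))"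
    unfolding cur_prod[OF ps rs c(1)] cur_prod_rev[OF ps rs c(2)] sc_NN[OF ps rs] diff_NN[OF ps rs] co ..
  also have "\<dots> = sc (qp h (ep ps rs) - qp h (- ep ps rs)) (Sum_any (\<lambda>l. sc (qp h (b * of_int l)) (?N l)))"
    by (rule sc_NN[OF ps rs, symmetric])
  finally show ?thesis unfolding NN_delta[OF ps rs] by simp
qed

text \<open>The coefficient of z^c w^d in (1 - q^\<kappa> w/z) A(z) B(w) - (q^\<kappa> - w/z) B(w)
  A(z); \<kappa> = 2 and \<kappa> = - 2 give the relations of E and of F, divided by z.\<close>

definition quad :: "complex \<Rightarrow> ('i \<times> complex) list \<Rightarrow> ('i \<times> complex) list \<Rightarrow> int \<Rightarrow> int \<Rightarrow> 'v \<Rightarrow> 'v" where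
  "quad \<kappa> ps rs c d v = cur ps c (cur rs d v) - sc (qp h \<kappa>) (cur ps (c + 1) (cur rs (d - 1) v))
    - (sc (qp h \<kappa>) (cur rs d (cur ps c v)) - cur rs (d - 1) (cur ps (c + 1) v))"

text \<open>With x = w/z the second factor is q^\<kappa> - x = - x (1 - q^\<kappa> / x), so both
  orders carry the same linear factor and the second one is read at index 1 - l.\<close>

lemma quad_eq:
  assumes ps: "okl ps" and rs: "okl rs" and c: "con Q ps rs as bs" "con Q rs ps as' bs'"
  shows "quad \<kappa> ps rs c d v = Sum_any (\<lambda>l. sc (qp h (ep ps rs) * co (lin1 (qp h \<kappa>) * rat h as bs) l
     + qp h (- ep ps rs) * co (lin1 (qp h \<kappa>) * rat h as' bs') (1 - l)) (NN ps rs (c + l) (d - l) v))"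
proof -
  let ?N = "\<lambda>l. NN ps rs (c + l) (d - l) v" and ?f = "co (rat h as bs)" and ?g = "co (rat h as' bs')"
  note f = fin_scNN[OF ps rs]
  have 1: "Sum_any (\<lambda>l. sc (k l) (NN ps rs (c + 1 + l) (d - 1 - l) v)) = Sum_any (\<lambda>l. sc (k (l - 1)) (?N l))" for k
    by (subst Sum_any_shift[of _ "-1", symmetric]) (simp add: algebra_simps)
  have i: "- (l - 1) = 1 - l" for l :: int by simp
  have e: "qp h (ep ps rs) * ?f l - qp h \<kappa> * (qp h (ep ps rs) * ?f (l - 1)) - (qp h \<kappa> * (qp h (- ep ps rs) * ?g (- l)) - qp h (- ep ps rs) * ?g (1 - l)) =
     qp h (ep ps rs) * co (lin1 (qp h \<kappa>) * rat h as bs) l + qp h (- ep ps rs) * co (lin1 (qp h \<kappa>) * rat h as' bs') (1 - l)" for l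
    by (simp add: co_lin1_mult) (simp add: algebra_simps)
  show ?thesis
    unfolding quad_def cur_prod[OF ps rs c(1)] cur_prod_rev[OF ps rs c(2)] 1 sc_NN[OF ps rs] diff_NN[OF ps rs] i e ..
qed

text \<open>If the linear factor leaves no pole, both orders give the polynomial q^\<epsilon> - q^(-
  \<epsilon>) x, with opposite signs.\<close>

lemma quad_nopole:
  assumes ps: "okl ps" and rs: "okl rs" and c: "con Q ps rs as bs" "con Q rs ps as' bs'"
    and f: "lin1 (qp h \<kappa>) * rat h as bs = rat h [- 2 * ep ps rs] []"
    and g: "lin1 (qp h \<kappa>) * rat h as' bs' = rat h [2 * ep ps rs] []"
  shows "quad \<kappa> ps rs c d v = 0"
proof -
  have "qp h (ep ps rs) * qp h (- 2 * ep ps rs) = qp h (- ep ps rs)" "qp h (- ep ps rs) * qp h (2 * ep ps rs) = qp h (ep ps rs)"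
    by (simp_all add: qp_add[symmetric])
  then have "qp h (ep ps rs) * co (lin1 (qp h (- 2 * ep ps rs))) l + qp h (- ep ps rs) * co (lin1 (qp h (2 * ep ps rs))) (1 - l) = 0" for l
    by (auto simp: co_lin1)
  then show ?thesis unfolding quad_eq[OF ps rs c] f g by (simp add: rat_Cons_num rat_Nil)
qed

text \<open>One pole survives. The delta function at x = q^(- b) turns the remaining factor 1 - q^(-
  s) x into the number 1 - q^(- s - b). Such terms cancel only in pairs.\<close>

lemma quad_pole:
  assumes ps: "okl ps" and rs: "okl rs" and c: "con Q ps rs as bs" "con Q rs ps as' bs'"
    and f: "lin1 (qp h \<kappa>) * rat h as bs = rat h [- s, a] [b]"
    and g: "lin1 (qp h \<kappa>) * rat h as' bs' = rat h [s, - a] [- b]"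
    and e: "a - b = s - 2 * ep ps rs"
  shows "quad \<kappa> ps rs c d v = sc (qp h (ep ps rs) * (1 - qp h (a - b)) * (1 - qp h (- s - b)) * qp h (- of_int c * b))
    (cur (shl b ps @ rs) (c + d) v)"
proof -
  let ?R = "co (rat h [a] [b])" and ?R' = "co (rat h [- a] [- b])" and ?E = "ep ps rs"
  have "qp h ?E * co (lin1 (qp h (- s)) * rat h [a] [b]) l + qp h (- ?E) * co (lin1 (qp h s) * rat h [- a] [- b]) (1 - l)
    = (qp h ?E * (1 - qp h (a - b)) * (1 - qp h (- s - b))) * qp h (b * of_int l)" for l
  proof -
    have q: "qp h (- ?E) * qp h s = qp h ?E * qp h (a - b)" "qp h (- ?E) = qp h ?E * qp h (- s) * qp h (a - b)"
      by (simp_all add: qp_add[symmetric] e)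
    have i: "1 - l - 1 = - l" "1 - l = - (l - 1)" by simp_all
    have "qp h ?E * co (lin1 (qp h (- s)) * rat h [a] [b]) l + qp h (- ?E) * co (lin1 (qp h s) * rat h [- a] [- b]) (1 - l)
      = qp h ?E * ?R l - qp h ?E * qp h (- s) * ?R (l - 1) + qp h (- ?E) * ?R' (1 - l) - (qp h (- ?E) * qp h s) * ?R' (- l)"
      by (simp add: co_lin1_mult algebra_simps)
    also have "\<dots> = qp h ?E * ?R l - qp h ?E * qp h (- s) * ?R (l - 1) + (qp h ?E * qp h (- s) * qp h (a - b)) * ?R' (- (l - 1)) -
        (qp h ?E * qp h (a - b)) * ?R' (- l)"
      using q i(2) by simp
    also have "\<dots> = qp h ?E * (?R l - qp h (a - b) * ?R' (- l)) - qp h ?E * qp h (- s) * (?R (l - 1) - qp h (a - b) * ?R' (- (l - 1)))"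
      by (simp add: right_diff_distrib mult.assoc)
    also have "\<dots> = qp h ?E * (1 - qp h (a - b)) * (qp h (b * of_int l) - qp h (- s) * qp h (b * of_int (l - 1)))"
      unfolding co_pole by (simp add: algebra_simps)
    also have "qp h (- s) * qp h (b * of_int (l - 1)) = qp h (- s - b) * qp h (b * of_int l)"
      by (simp add: qp_add[symmetric] algebra_simps)
    finally show ?thesis by (simp add: algebra_simps)
  qed
  then show ?thesis unfolding quad_eq[OF ps rs c] f g rat_Cons_num[of h _ "[_]"]
    by (simp only: sc_NN[OF ps rs, symmetric] NN_delta[OF ps rs] scale_scale)
qed

text \<open>Without a contraction in the order B A the modes of B A are those of the normally
  ordered product, so A B is directly an expansion in B A. The prefactor is the quotient of
  q^\<epsilon> by q^(- \<epsilon>).\<close>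

lemma cur_psi:
  assumes ps: "okl ps" and rs: "okl rs" and c: "con Q ps rs as bs" "con Q rs ps [] []"
  shows "cur ps c (cur rs d v) = sc (qp h (2 * ep ps rs)) (Sum_any (\<lambda>l. sc (co (rat h as bs) l) (cur rs (d - l) (cur ps (c + l) v))))"
proof -
  have r: "cur rs d (cur ps c v) = sc (qp h (- ep ps rs)) (NN ps rs c d v)" for c d
    by (rule cur_prod_rev0[OF ps rs c(2)])
  have "qp h (2 * ep ps rs) * (x * qp h (- ep ps rs)) = qp h (ep ps rs) * x" for x
    unfolding mult.left_commute[of _ x] by (simp add: qp_add[symmetric] mult.commute)
  then show ?thesis
    unfolding cur_prod[OF ps rs c(1)] r scale_scale sc_NN[OF ps rs] by (simp only:)
qed

text \<open>Here the contraction sits in the order B A and has to be divided out: the inverse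
  function has numerator and denominator exchanged.\<close>

lemma cur_psi':
  assumes ps: "okl ps" and rs: "okl rs" and c: "con Q ps rs [] []" "con Q rs ps as bs"
  shows "cur ps c (cur rs d v) = sc (qp h (2 * ep ps rs)) (Sum_any (\<lambda>l. sc (co (rat h bs as) l) (cur rs (d + l) (cur ps (c - l) v))))"
proof -
  let ?E = "ep ps rs"
  let ?N = "\<lambda>l. NN ps rs (c - l) (d + l) v"
  have "finite {l. NN ps rs (c + - l) (d - - l) v \<noteq> 0}"
    using finite_vimageI[OF NN_fin[OF ps rs, of c d v], of uminus] by (simp add: vimage_def)
  then have fin: "finite {l. ?N l \<noteq> 0}" by simp
  have r: "cur rs (d + j) (cur ps (c - j) v) = sc (qp h (- ?E)) (Sum_any (\<lambda>l. sc (co (rat h as bs) l) (?N (j + l))))" for j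
    unfolding cur_prod_rev[OF ps rs c(2)]
    by (subst Sum_any_reflect[of _ 0, symmetric]) (simp add: algebra_simps)
  have "Sum_any (\<lambda>l. sc (co (rat h bs as) l) (cur rs (d + l) (cur ps (c - l) v))) =
     sc (qp h (- ?E)) (Sum_any (\<lambda>l. sc (co (rat h bs as) l) (Sum_any (\<lambda>i. sc (co (rat h as bs) i) (?N (l + i))))))"
  \<comment> \<open>If the support is infinite, both sums take the default value 0, so the equation
    holds in that case as well.\<close>
  proof (cases "finite {l. sc (co (rat h bs as) l) (Sum_any (\<lambda>i. sc (co (rat h as bs) i) (?N (l + i)))) \<noteq> 0}")
    case True
    then show ?thesis by (simp add: r sc_Sum_any mult.left_commute mult.commute)
  next
    case False
    then have "\<not> finite {l. sc (co (rat h bs as) l) (cur rs (d + l) (cur ps (c - l) v)) \<noteq> 0}"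
      by (simp add: r)
    then show ?thesis using False by (simp only: Sum_any.infinite not_False_eq_True scale_zero_right)
  qed
  also have "\<dots> = sc (qp h (- ?E)) (NN ps rs c d v)"
  proof -
    have "sc (co 1 m) (?N m) = (if m = 0 then ?N m else 0)" for m by (auto simp: co_1)
    then show ?thesis by (simp add: Sum_any_conv[OF fin] rat_inverse)
  qed
  also have "sc (qp h (2 * ?E)) \<dots> = sc (qp h ?E) (NN ps rs c d v)"
    by (simp add: qp_add[symmetric])
  also have "\<dots> = cur ps c (cur rs d v)" by (simp add: cur_prod0[OF ps rs c(1)])
  finally show ?thesis ..
qed

end

subsection \<open>The relations of the quantum affine algebra\<close>

lemma inverse_lin1: "inverse (lin1 c) = geo c"
  by (rule fps_inverse_unique) (rule lin1_geo)

lemma inverse_rat: "inverse (rat h as bs) = rat h bs as"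
  by (rule fps_inverse_unique) (rule rat_inverse)

lemma inverse_const_qp: "inverse (fps_const (qp h a)) = fps_const (qp h (- a))"
  by (simp add: qp_minus fps_const_inverse)

text \<open>Normalizing numerator and denominator to constant term 1 leaves the factor q^2, which on
  the side of the currents comes from the zero modes.\<close>

lemma G_inf_rat: "G_inf h (qp h a) = fps_const (qp h 2) * rat h [- 2 - a] [2 - a]"
proof -
  have n: "fps_const (qp h 2 * qp h a) - fps_X = fps_const (qp h (2 + a)) * lin1 (qp h (- 2 - a))"
    unfolding lin1_def right_diff_distrib mult.assoc[symmetric] fps_const_mult qp_add[symmetric] by simp
  have d: "fps_const (qp h a) - fps_const (qp h 2) * fps_X = fps_const (qp h a) * lin1 (qp h (2 - a))"
    unfolding lin1_def right_diff_distrib mult.assoc[symmetric] fps_const_mult qp_add[symmetric] by simp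
  have i: "inverse (fps_const (qp h a)) = fps_const (qp h (- a))"
    by (simp add: qp_minus fps_const_inverse)
  have "G_inf h (qp h a) = fps_const (qp h (2 + a)) * lin1 (qp h (- 2 - a)) * (fps_const (qp h (- a)) * geo (qp h (2 - a)))"
    unfolding G_inf_def n d by (subst fps_divide_unit) (simp_all add: fps_inverse_mult i inverse_lin1 lin1_nth)
  also have "\<dots> = fps_const (qp h (2 + a) * qp h (- a)) * (lin1 (qp h (- 2 - a)) * geo (qp h (2 - a)))"
    unfolding fps_const_mult[symmetric] by (simp only: mult_ac)
  also have "qp h (2 + a) * qp h (- a) = qp h 2" by (simp add: qp_add[symmetric])
  finally show ?thesis by (simp add: rat_def)
qed

lemma G_zero_rat: "G_zero h (qp h a) = fps_const (qp h (- 2)) * rat h [2 + a] [a - 2]"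
proof -
  have n: "fps_const (qp h 2 * qp h a) * fps_X - 1 = fps_const (- 1) * lin1 (qp h (2 + a))"
    by (simp add: lin1_def qp_add fps_const_neg[symmetric] del: fps_const_neg)
  have d: "fps_const (qp h a) * fps_X - fps_const (qp h 2) = fps_const (- qp h 2) * lin1 (qp h (a - 2))"
  proof -
    have "qp h 2 * qp h (a - 2) = qp h a" by (simp add: qp_add[symmetric])
    moreover have "fps_const (- c) = - fps_const c" for c :: complex by simp
    ultimately show ?thesis
      unfolding lin1_def right_diff_distrib mult.assoc[symmetric] fps_const_mult by (simp del: fps_const_neg)
  qed
  have i: "inverse (fps_const (- qp h 2)) = fps_const (- qp h (- 2))"
    by (simp add: qp_minus fps_const_inverse)
  have "G_zero h (qp h a) = fps_const (- 1) * lin1 (qp h (2 + a)) * (fps_const (- qp h (- 2)) * geo (qp h (a - 2)))"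
    unfolding G_zero_def n d by (subst fps_divide_unit) (simp_all add: fps_inverse_mult i inverse_lin1 lin1_nth)
  also have "\<dots> = fps_const (- 1 * - qp h (- 2)) * (lin1 (qp h (2 + a)) * geo (qp h (a - 2)))"
    unfolding fps_const_mult[symmetric] by (simp only: mult_ac)
  finally show ?thesis by (simp add: rat_def)
qed

lemma co_const: "co (fps_const c * F) l = c * co F l" by (simp add: co_def)
lemma co_nat: "co F (int n) = fps_nth F n" by (simp add: co_def)

context seed
begin

text \<open>A list in the left kernel of C contracts with nothing to its right. The points of
  \<open>P_+\<close> are such a list, those of \<open>P_-\<close> the mirror case; hence each of the
  two \<psi> currents contracts with another current in one order only.\<close>

lemma con_left:
  assumes "\<And>H j. j \<in> verts Q \<Longrightarrow> (\<Sum>(i, e)\<leftarrow>ps. qp H (- e) * Cmat H Q i j) = 0" and rs: "okl rs"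
  shows "con Q ps rs [] []"
  unfolding con_def
proof
  fix H
  have "pr H Q ps rs = (\<Sum>(j, e')\<leftarrow>rs. qp H e' * (\<Sum>(i, e)\<leftarrow>ps. qp H (- e) * Cmat H Q i j))"
    unfolding pr_def
    by (induction ps) (auto simp: sum_list_addf[symmetric] split_def distrib_left qp_add[symmetric] mult.assoc[symmetric])
  also have "\<dots> = (\<Sum>p\<leftarrow>rs. 0)"
    unfolding split_def using assms(1)[unfolded split_def] rs
    by (intro arg_cong[where f = sum_list] map_cong refl) auto
  finally show "pr H Q ps rs = (\<Sum>b\<leftarrow>[]. qp H b) - (\<Sum>a\<leftarrow>[]. qp H a)" by simp
qed

lemma con_right:
  assumes "\<And>H i. i \<in> verts Q \<Longrightarrow> (\<Sum>(j, e)\<leftarrow>rs. qp H e * Cmat H Q i j) = 0" and ps: "okl ps"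
  shows "con Q ps rs [] []"
  unfolding con_def
proof
  fix H
  have e: "(\<Sum>(j, e')\<leftarrow>rs. qp H (e' - e) * Cmat H Q i j) = qp H (- e) * (\<Sum>(j, e)\<leftarrow>rs. qp H e * Cmat H Q i j)" for i e
    unfolding sum_list_const_mult[symmetric]
    by (intro arg_cong[where f = sum_list] map_cong refl) (auto simp: qp_add[symmetric] mult.assoc[symmetric])
  have "pr H Q ps rs = (\<Sum>p\<leftarrow>ps. 0)"
    unfolding pr_def e unfolding split_def using assms(1)[unfolded split_def] ps
    by (intro arg_cong[where f = sum_list] map_cong refl) auto
  then show "pr H Q ps rs = (\<Sum>b\<leftarrow>[]. qp H b) - (\<Sum>a\<leftarrow>[]. qp H a)" by simp
qed

lemma cur_shl: assumes "okl ps" shows "cur (shl b ps) t v = sc (qp h (b * of_int t)) (cur ps t v)"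
proof -
  have m: "map fst (shl b ps) = map fst ps" by (simp add: shl_def split_def)
  have "os (shl b ps) n v = sh h b (os ps) n v" for n v
    by (simp add: osc_sum_def sh_def shl_def split_def comp_def)
      (induction ps, auto simp: scale_right_distrib qp_add[symmetric] algebra_simps)
  then have "os (shl b ps) = sh h b (os ps)" by (simp add: fun_eq_iff)
  then show ?thesis unfolding cur_def m
    by (simp add: bexp_sh[OF os_fam'[OF assms]] lin_sc[OF zp_lin[OF assms]] mult.commute)
qed

text \<open>Applies to \<psi>^+, whose creation oscillators act by zero on a reduced module.\<close>

lemma cur_annihilating:
  assumes ps: "okl ps" and z: "\<And>n v. n < 0 \<Longrightarrow> os ps n v = 0"
  shows "cur ps c v = zp (map fst ps) (EP (os ps) (- c) v)"
proof -
  have "EM (os ps) i u = (if i = 0 then u else 0)" for i u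
    unfolding EM_def by (rule Ez_trivial) (simp add: z)
  then have "EM (os ps) (c + r) (EP (os ps) r v) = (if r = - c then EP (os ps) r v else 0)" for r by auto
  then show ?thesis by (simp add: cur_def bexp_eq[OF os_fam'[OF ps]])
qed

lemma cur_creating:
  assumes ps: "okl ps" and z: "\<And>n v. n > 0 \<Longrightarrow> os ps n v = 0"
  shows "cur ps c v = zp (map fst ps) (EM (os ps) c v)"
proof -
  have "EP (os ps) i u = (if i = 0 then u else 0)" for i u
    unfolding EP_def by (rule Ez_trivial) (simp add: z)
  moreover have "EM (os ps) i 0 = 0" for i by (rule lin_zero[OF EM_lin[OF os_fam'[OF ps]]])
  ultimately have "EM (os ps) (c + r) (EP (os ps) r v) = (if r = 0 then EM (os ps) (c + r) v else 0)" for r by auto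
  then show ?thesis by (simp add: cur_def bexp_eq[OF os_fam'[OF ps]])
qed

section \<open>Sums over the terms of a path\<close>

definition Scur :: "('i \<times> complex) list list \<Rightarrow> int \<Rightarrow> 'v \<Rightarrow> 'v" where
  "Scur As c v = (\<Sum>A\<leftarrow>As. cur A c v)"

lemma Scur_lin: "(\<And>A. A \<in> set As \<Longrightarrow> okl A) \<Longrightarrow> lin (Scur As c)"
  using lin_Sum_list[of As "\<lambda>A. cur A c"] cur_lin by (simp add: Scur_def[abs_def])

lemma Scur_Scur:
  assumes "\<And>A. A \<in> set As \<Longrightarrow> okl A"
  shows "Scur As c (Scur Bs d v) = (\<Sum>A\<leftarrow>As. \<Sum>B\<leftarrow>Bs. cur A c (cur B d v))"
proof -
  have "cur A c (\<Sum>B\<leftarrow>Bs. cur B d v) = (\<Sum>B\<leftarrow>Bs. cur A c (cur B d v))" if "A \<in> set As" for A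
    by (rule lin_sum_list[OF cur_lin[OF assms[OF that]]])
  then show ?thesis unfolding Scur_def by (intro arg_cong[where f = sum_list] map_cong refl)
qed

lemma sum_list_swap: "(\<Sum>A\<leftarrow>As. \<Sum>B\<leftarrow>Bs. (f A B :: 'v)) = (\<Sum>B\<leftarrow>Bs. \<Sum>A\<leftarrow>As. f A B)"
  by (induction As) (simp_all add: sum_list_addf)

lemma sc_sum_list: "sc c (\<Sum>x\<leftarrow>xs. f x) = (\<Sum>x\<leftarrow>xs. sc c (f x))"
  by (induction xs) (simp_all add: scale_right_distrib)

lemma diff_sum_list: "(\<Sum>x\<leftarrow>xs. (f x :: 'v)) - (\<Sum>x\<leftarrow>xs. g x) = (\<Sum>x\<leftarrow>xs. f x - g x)"
  by (induction xs) (simp_all add: algebra_simps)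

lemma Scur_quad:
  assumes "\<And>A. A \<in> set As \<Longrightarrow> okl A" and z: "\<And>c d v. (\<Sum>A\<leftarrow>As. \<Sum>B\<leftarrow>As. quad \<kappa> A B c d v) = 0"
  shows "Scur As c (Scur As d v) - sc (qp h \<kappa>) (Scur As (c + 1) (Scur As (d - 1) v))
    = sc (qp h \<kappa>) (Scur As d (Scur As c v)) - Scur As (d - 1) (Scur As (c + 1) v)"
proof -
  have S: "Scur As a (Scur As b v) = (\<Sum>A\<leftarrow>As. \<Sum>B\<leftarrow>As. cur A a (cur B b v))" for a b
    by (rule Scur_Scur) (rule assms(1))
  have s: "Scur As a (Scur As b v) = (\<Sum>A\<leftarrow>As. \<Sum>B\<leftarrow>As. cur B a (cur A b v))" for a b
    unfolding S by (rule sum_list_swap)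
  have "Scur As c (Scur As d v) - sc (qp h \<kappa>) (Scur As (c + 1) (Scur As (d - 1) v))
     - (sc (qp h \<kappa>) (Scur As d (Scur As c v)) - Scur As (d - 1) (Scur As (c + 1) v)) = 0"
    unfolding s[of d c] s[of "d - 1" "c + 1"] S[of c d] S[of "c + 1" "d - 1"] sc_sum_list diff_sum_list quad_def[symmetric] z ..
  then show ?thesis by simp
qed

lemma Sum_any_psi:
  assumes "\<And>l. l > int m \<Longrightarrow> f l = 0"
  shows "Sum_any (\<lambda>l. sc (co G l) (f l)) = (\<Sum>l\<le>m. sc (fps_nth G l) (f (int l)))"
proof -
  have "Sum_any (\<lambda>l. sc (co G l) (f l)) = (\<Sum>l\<in>int ` {..m}. sc (co G l) (f l))"
  proof (rule Sum_any.expand_superset, simp, rule subsetI)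
    fix l assume "l \<in> {l. sc (co G l) (f l) \<noteq> 0}"
    then have "co G l \<noteq> 0" "f l \<noteq> 0" by auto
    then have "0 \<le> l" "l \<le> int m" using assms[of l] by (auto simp: co_def not_less[symmetric] split: if_splits)
    then show "l \<in> int ` {..m}" by (intro image_eqI[of _ _ "nat l"]) auto
  qed
  then show ?thesis by (simp add: sum.reindex co_nat)
qed

text \<open>One statement for \<psi>^+ against \<psi>^-, E and F: \<open>a\<close> and
  \<open>f\<close> are the spectral shifts of \<psi>^+ and of the other current, \<open>K\<close> is
  its prefactor. The difference f - a moves the zeros and poles of the contraction to those of
  \<open>G\<close>. The sum stops at m because the modes of \<psi>^+ with negative index
  vanish.\<close>

lemma psi_plus:
  assumes ps: "okl ps" and v0: "\<And>c v. c > 0 \<Longrightarrow> cur ps c v = 0"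
    and Bs: "\<And>B. B \<in> set Bs \<Longrightarrow> okl B \<and> con Q ps B as bs \<and> con Q B ps [] [] \<and> ep ps B = e"
    and G: "G = fps_const (qp h (2 * e)) * rat h (map ((+) (f - a)) as) (map ((+) (f - a)) bs)"
  shows "sc (qp h (- of_int (int m) * a)) (cur ps (- int m) (sc K (sc (qp h (- of_int n * f)) (Scur Bs (- n) v)))) =
    (\<Sum>l\<le>m. sc (fps_nth G l) (sc K (sc (qp h (- of_int (n + int l) * f)) (Scur Bs (- (n + int l))
       (sc (qp h (- of_int (int (m - l)) * a)) (cur ps (- int (m - l)) v))))))"
proof -
  have l: "lin (cur ps c)" for c by (rule cur_lin[OF ps])
  have lS: "lin (Scur Bs c)" for c by (rule Scur_lin) (use Bs in auto)
  have "cur ps (- int m) (Scur Bs (- n) v) = sc (qp h (2 * e)) (\<Sum>B\<leftarrow>Bs. \<Sum>l\<le>m. sc (fps_nth (rat h as bs) l) (cur B (- (n + int l)) (cur ps (- int (m - l)) v)))"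
    unfolding Scur_def lin_sum_list[OF l] sc_sum_list
  proof (intro arg_cong[where f = sum_list] map_cong refl)
    fix B assume B: "B \<in> set Bs"
    have "cur ps (- int m) (cur B (- n) v) = sc (qp h (2 * ep ps B)) (Sum_any (\<lambda>l. sc (co (rat h as bs) l) (cur B (- n - l) (cur ps (- int m + l) v))))"
      by (rule cur_psi) (use ps Bs[OF B] in auto)
    also have "Sum_any (\<lambda>l. sc (co (rat h as bs) l) (cur B (- n - l) (cur ps (- int m + l) v))) =
        (\<Sum>l\<le>m. sc (fps_nth (rat h as bs) l) (cur B (- n - int l) (cur ps (- int m + int l) v)))"
    proof (rule Sum_any_psi)
      fix l assume "l > int m"
      then have "cur ps (- int m + l) v = 0" by (intro v0) simp
      then show "cur B (- n - l) (cur ps (- int m + l) v) = 0" using lin_zero[OF cur_lin] Bs[OF B] by simp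
    qed
    also have "\<dots> = (\<Sum>l\<le>m. sc (fps_nth (rat h as bs) l) (cur B (- (n + int l)) (cur ps (- int (m - l)) v)))"
      by (intro sum.cong refl) (auto simp: of_nat_diff)
    finally show "cur ps (- int m) (cur B (- n) v) = sc (qp h (2 * e)) (\<Sum>l\<le>m. sc (fps_nth (rat h as bs) l) (cur B (- (n + int l)) (cur ps (- int (m - l)) v)))"
      using Bs[OF B] by simp
  qed
  also have "(\<Sum>B\<leftarrow>Bs. \<Sum>l\<le>m. sc (fps_nth (rat h as bs) l) (cur B (- (n + int l)) (cur ps (- int (m - l)) v))) =
     (\<Sum>l\<le>m. sc (fps_nth (rat h as bs) l) (Scur Bs (- (n + int l)) (cur ps (- int (m - l)) v)))"
    by (induction Bs) (simp_all add: Scur_def scale_right_distrib sum.distrib)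
  finally have *: "cur ps (- int m) (Scur Bs (- n) v) = sc (qp h (2 * e))
     (\<Sum>l\<le>m. sc (fps_nth (rat h as bs) l) (Scur Bs (- (n + int l)) (cur ps (- int (m - l)) v)))" .
  have g: "qp h (- of_int (int m) * a) * (K * (qp h (- of_int n * f) * (qp h (2 * e) * fps_nth (rat h as bs) l))) =
      fps_nth G l * (K * (qp h (- of_int (n + int l) * f) * qp h (- of_int (int (m - l)) * a)))" if "l \<le> m" for l
  proof -
    have "fps_nth G l = qp h (2 * e) * (qp h ((f - a) * of_int (int l)) * fps_nth (rat h as bs) l)"
      unfolding G co_nat[symmetric] co_const co_rat_shift ..
    moreover have "qp h (- of_int (int m) * a) * qp h (- of_int n * f) =
      qp h ((f - a) * of_int (int l)) * (qp h (- of_int (n + int l) * f) * qp h (- of_int (int (m - l)) * a))"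
      using that unfolding qp_add[symmetric] by (simp add: of_nat_diff algebra_simps)
    ultimately show ?thesis by (simp add: mult_ac)
  qed
  show ?thesis
    unfolding lin_sc[OF l] lin_sc[OF lS] * scale_scale scale_sum_right
    by (intro sum.cong refl) (simp only: g atMost_iff mult.assoc)
qed

lemma psi_minus:
  assumes ps: "okl ps" and v0: "\<And>c v. c < 0 \<Longrightarrow> cur ps c v = 0"
    and Bs: "\<And>B. B \<in> set Bs \<Longrightarrow> okl B \<and> con Q ps B [] [] \<and> con Q B ps as bs \<and> ep ps B = e"
    and G: "G = fps_const (qp h (2 * e)) * rat h (map ((+) (a - f)) bs) (map ((+) (a - f)) as)"
  shows "sc (qp h (- of_int (- int m) * a)) (cur ps (- (- int m)) (sc K (sc (qp h (- of_int n * f)) (Scur Bs (- n) v)))) =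
    (\<Sum>l\<le>m. sc (fps_nth G l) (sc K (sc (qp h (- of_int (n - int l) * f)) (Scur Bs (- (n - int l))
       (sc (qp h (- of_int (- int (m - l)) * a)) (cur ps (- (- int (m - l))) v))))))"
proof -
  have l: "lin (cur ps c)" for c by (rule cur_lin[OF ps])
  have lS: "lin (Scur Bs c)" for c by (rule Scur_lin) (use Bs in auto)
  have "cur ps (- (- int m)) (Scur Bs (- n) v) = sc (qp h (2 * e)) (\<Sum>B\<leftarrow>Bs. \<Sum>l\<le>m. sc (fps_nth (rat h bs as) l) (cur B (- (n - int l)) (cur ps (- (- int (m - l))) v)))"
    unfolding Scur_def lin_sum_list[OF l] sc_sum_list
  proof (intro arg_cong[where f = sum_list] map_cong refl)
    fix B assume B: "B \<in> set Bs"
    have "cur ps (int m) (cur B (- n) v) = sc (qp h (2 * ep ps B)) (Sum_any (\<lambda>l. sc (co (rat h bs as) l) (cur B (- n + l) (cur ps (int m - l) v))))"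
      by (rule cur_psi') (use ps Bs[OF B] in auto)
    also have "Sum_any (\<lambda>l. sc (co (rat h bs as) l) (cur B (- n + l) (cur ps (int m - l) v))) =
        (\<Sum>l\<le>m. sc (fps_nth (rat h bs as) l) (cur B (- n + int l) (cur ps (int m - int l) v)))"
    proof (rule Sum_any_psi)
      fix l assume "l > int m"
      then have "cur ps (int m - l) v = 0" by (intro v0) simp
      then show "cur B (- n + l) (cur ps (int m - l) v) = 0" using lin_zero[OF cur_lin] Bs[OF B] by simp
    qed
    also have "\<dots> = (\<Sum>l\<le>m. sc (fps_nth (rat h bs as) l) (cur B (- (n - int l)) (cur ps (- (- int (m - l))) v)))"
      by (intro sum.cong refl) (auto simp: of_nat_diff)
    finally show "cur ps (- (- int m)) (cur B (- n) v) = sc (qp h (2 * e)) (\<Sum>l\<le>m. sc (fps_nth (rat h bs as) l) (cur B (- (n - int l)) (cur ps (- (- int (m - l))) v)))"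
      using Bs[OF B] by simp
  qed
  also have "(\<Sum>B\<leftarrow>Bs. \<Sum>l\<le>m. sc (fps_nth (rat h bs as) l) (cur B (- (n - int l)) (cur ps (- (- int (m - l))) v))) =
     (\<Sum>l\<le>m. sc (fps_nth (rat h bs as) l) (Scur Bs (- (n - int l)) (cur ps (- (- int (m - l))) v)))"
    by (induction Bs) (simp_all add: Scur_def scale_right_distrib sum.distrib)
  finally have *: "cur ps (- (- int m)) (Scur Bs (- n) v) = sc (qp h (2 * e))
     (\<Sum>l\<le>m. sc (fps_nth (rat h bs as) l) (Scur Bs (- (n - int l)) (cur ps (- (- int (m - l))) v)))" .
  have g: "qp h (- of_int (- int m) * a) * (K * (qp h (- of_int n * f) * (qp h (2 * e) * fps_nth (rat h bs as) l))) =
      fps_nth G l * (K * (qp h (- of_int (n - int l) * f) * qp h (- of_int (- int (m - l)) * a)))" if "l \<le> m" for l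
  proof -
    have "fps_nth G l = qp h (2 * e) * (qp h ((a - f) * of_int (int l)) * fps_nth (rat h bs as) l)"
      unfolding G co_nat[symmetric] co_const co_rat_shift ..
    moreover have "qp h (- of_int (- int m) * a) * qp h (- of_int n * f) =
      qp h ((a - f) * of_int (int l)) * (qp h (- of_int (n - int l) * f) * qp h (- of_int (- int (m - l)) * a))"
      using that unfolding qp_add[symmetric] by (simp add: of_nat_diff algebra_simps)
    ultimately show ?thesis by (simp add: mult_ac)
  qed
  show ?thesis
    unfolding lin_sc[OF l] lin_sc[OF lS] * scale_scale scale_sum_right
    by (intro sum.cong refl) (simp only: g atMost_iff mult.assoc)
qed

lemma cur_self_comm:
  assumes "okl ps" "con Q ps ps [] []" shows "cur ps c (cur ps d v) = cur ps d (cur ps c v)"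
  using cur_prod0[OF assms(1) assms(1,2)] NN_sym[OF assms(1,1)] by simp

text \<open>Collects what depends on the quiver: the contractions of \<psi>^\<plusminus> with each
  term, the quadratic sums, and the commutator of E with F. After the shifts 2 + k, 2 + k/2 and -
  k/2 these contractions are the expansions of G, of its inverse and of the quotient of two G at the
  arguments prescribed by the level.\<close>

lemma Uq_criterion:
  assumes nz: "qp h 1 - qp h (- 1) \<noteq> 0"
    and PM: "okl PM" "\<And>n v. n < 0 \<Longrightarrow> os PM n v = 0" and PP: "okl PP" "\<And>n v. n > 0 \<Longrightarrow> os PP n v = 0"
    and bij: "\<And>v. zp (map fst PM) (zp (map fst PP) v) = v" "\<And>v. zp (map fst PP) (zp (map fst PM) v) = v"
    and self: "con Q PM PM [] []" "con Q PP PP [] []"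
    and MP: "con Q PM PP [0, 4 + 2 * k] [4, 2 * k]" "con Q PP PM [] []" "ep PM PP = 0"
    and As: "\<And>A. A \<in> set As \<Longrightarrow> okl A"
      "\<And>A. A \<in> set As \<Longrightarrow> con Q PM A [0] [4] \<and> con Q A PM [] [] \<and> ep PM A = 1"
      "\<And>A. A \<in> set As \<Longrightarrow> con Q PP A [] [] \<and> con Q A PP [- 2] [2] \<and> ep PP A = - 1"
    and Bs: "\<And>A. A \<in> set Bs \<Longrightarrow> okl A"
      "\<And>A. A \<in> set Bs \<Longrightarrow> con Q PM A [2] [- 2] \<and> con Q A PM [] [] \<and> ep PM A = - 1"
      "\<And>A. A \<in> set Bs \<Longrightarrow> con Q PP A [] [] \<and> con Q A PP [2 * k + 4] [2 * k] \<and> ep PP A = 1"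
    and EE: "\<And>c d v. (\<Sum>A\<leftarrow>As. \<Sum>B\<leftarrow>As. quad 2 A B c d v) = 0"
    and FF: "\<And>c d v. (\<Sum>A\<leftarrow>Bs. \<Sum>B\<leftarrow>Bs. quad (- 2) A B c d v) = 0"
    and EF: "\<And>c d v. Scur As c (Scur Bs d v) - Scur Bs d (Scur As c v) = sc (qp h 1 - qp h (- 1))
       (sc (qp h (- (2 * k + 2) * of_int d)) (cur PP (c + d) v) - sc (qp h (2 * of_int c)) (cur PM (c + d) v))"
  shows "Uq_sl2_relations h k sc
     (\<lambda>n v. sc (1 / (qp h 1 - qp h (- 1))) (Scur As (- n) v))
     (\<lambda>n v. sc (- 1 / (qp h 1 - qp h (- 1))) (sc (qp h (- of_int n * (2 + k))) (Scur Bs (- n) v)))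
     (\<lambda>n v. sc (qp h (- of_int n * (2 + k / 2))) (cur PM (- n) v))
     (\<lambda>n v. sc (qp h (- of_int n * (- k / 2))) (cur PP (- n) v))"
    (is "Uq_sl2_relations h k sc ?E ?F ?P ?R")
proof -
  define K where "K = 1 / (qp h 1 - qp h (- 1))"
  have lA: "lin (Scur As c)" for c by (rule Scur_lin) (rule As(1))
  have lB: "lin (Scur Bs c)" for c by (rule Scur_lin) (rule Bs(1))
  have lM: "lin (cur PM c)" and lP: "lin (cur PP c)" for c by (auto intro!: cur_lin PM PP)
  have zM: "lin (zp (map fst PM))" and zP: "lin (zp (map fst PP))" by (auto intro!: zp_lin PM PP)
  have cM: "cur PM c v = zp (map fst PM) (EP (os PM) (- c) v)" for c v by (rule cur_annihilating[OF PM])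
  have cP: "cur PP c v = zp (map fst PP) (EM (os PP) c v)" for c v by (rule cur_creating[OF PP])
  have M0: "cur PM c v = 0" if "c > 0" for c v using that lin_zero[OF zM] by (simp add: cM)
  have P0: "cur PP c v = 0" if "c < 0" for c v using that lin_zero[OF zP] by (simp add: cP)
  have lins: "lin (?E n)" "lin (?F n)" "lin (?P n)" "lin (?R n)" for n
    by (intro lin_scale lA lB lM lP)+
  have H: "\<exists>H. (\<forall>n. lin (H n)) \<and> (\<forall>m<0. \<forall>v. ?P m v = 0 \<and> ?R (- m) v = 0) \<and>
        (\<forall>m v. ?P (int m) v = ?P 0 (expc sc (\<lambda>n u. sc (1 / (qp h 1 - qp h (-1))) (H (int n) u)) m v)) \<and>
        (\<forall>m v. ?R (- int m) v = ?R 0 (expc sc (\<lambda>n u. sc (1 / (qp h 1 - qp h (-1))) (H (- int n) u)) m v))"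
  proof -
    \<comment> \<open>The logarithm of \<psi>^\<plusminus>: its oscillators shifted to its argument.
      The factor q - q^(-1) undoes the normalization in the defining relation.\<close>
    define H where "H n u = (if n > 0 then sc (qp h 1 - qp h (- 1)) (sc (qp h (- of_int n * (2 + k / 2))) (os PM n u))
       else if n < 0 then sc (qp h 1 - qp h (- 1)) (sc (qp h (- of_int n * (- k / 2))) (os PP n u)) else 0)" for n u
    have lH: "lin (H n)" for n
    proof -
      have "lin (os PM n)" "lin (os PP n)" if "n \<noteq> 0"
        using fam_lin[OF os_fam'[OF PM(1)] that] fam_lin[OF os_fam'[OF PP(1)] that] by auto
      then show ?thesis unfolding H_def
        by (cases n "0 :: int" rule: linorder_cases) (auto intro!: lin_scale lin_const0)
    qed
    have p: "qp h (- (2 + k / 2)) ^ n = qp h (- of_int (int n) * (2 + k / 2))"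
      "qp h (- k / 2) ^ n = qp h (- of_int (- int n) * (- k / 2))" for n
      by (simp_all add: qp_pow algebra_simps)
    have e1: "expc sc (\<lambda>n u. sc (1 / (qp h 1 - qp h (-1))) (H (int n) u)) m v =
      sc (qp h (- (2 + k / 2)) ^ m) (expc sc (\<lambda>n. os PM (int n)) m v)" for m v
    proof -
      have "Ez (\<lambda>n u. sc (1 / (qp h 1 - qp h (-1))) (H (int n) u)) (int m) v =
        Ez (\<lambda>n u. sc (qp h (- (2 + k / 2)) ^ n) (os PM (int n) u)) (int m) v"
        by (rule Ez_cong, unfold p) (use nz in \<open>simp add: H_def\<close>)
      also have "\<dots> = sc (qp h (- (2 + k / 2)) ^ nat (int m)) (Ez (\<lambda>n. os PM (int n)) (int m) v)"
        by (rule Ez_scale) (use os_fam'[OF PM(1)] in \<open>simp add: fam_def\<close>)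
      finally show ?thesis by (simp add: Ez_def)
    qed
    have e2: "expc sc (\<lambda>n u. sc (1 / (qp h 1 - qp h (-1))) (H (- int n) u)) m v =
      sc (qp h (- k / 2) ^ m) (expc sc (\<lambda>n. os PP (- int n)) m v)" for m v
    proof -
      have "Ez (\<lambda>n u. sc (1 / (qp h 1 - qp h (-1))) (H (- int n) u)) (int m) v =
        Ez (\<lambda>n u. sc (qp h (- k / 2) ^ n) (os PP (- int n) u)) (int m) v"
        by (rule Ez_cong, unfold p) (use nz in \<open>simp add: H_def\<close>)
      also have "\<dots> = sc (qp h (- k / 2) ^ nat (int m)) (Ez (\<lambda>n. os PP (- int n)) (int m) v)"
        by (rule Ez_scale) (use os_fam'[OF PP(1)] in \<open>simp add: fam_def\<close>)
      finally show ?thesis by (simp add: Ez_def)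
    qed
    have ep: "EP (os PM) (int m) v = expc sc (\<lambda>n. os PM (int n)) m v" "EM (os PP) (int m) v = expc sc (\<lambda>n. os PP (- int n)) m v" for m v
      by (simp_all add: EP_def EM_def Ez_def)
    show ?thesis
    proof (intro exI[of _ H] conjI allI impI)
      show "lin (H n)" for n by (rule lH)
      show "?P m v = 0" "?R (- m) v = 0" if "m < 0" for m v using that by (simp_all add: M0 P0)
      show "?P (int m) v = ?P 0 (expc sc (\<lambda>n u. sc (1 / (qp h 1 - qp h (-1))) (H (int n) u)) m v)" for m v
        unfolding e1 p by (simp add: cM ep lin_sc[OF zM])
      show "?R (- int m) v = ?R 0 (expc sc (\<lambda>n u. sc (1 / (qp h 1 - qp h (-1))) (H (- int n) u)) m v)" for m v
        unfolding e2 p by (simp add: cP ep lin_sc[OF zP])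
    qed
  qed
  have inv: "?P 0 (?R 0 v) = v" "?R 0 (?P 0 v) = v" for v
    by (simp_all add: cM cP bij)
  have comm: "?P m (?P n v) = ?P n (?P m v)" "?R m (?R n v) = ?R n (?R m v)" for m n v
    by (simp_all add: lin_sc[OF lM] lin_sc[OF lP] mult.commute cur_self_comm[OF PM(1) self(1)] cur_self_comm[OF PP(1) self(2)])
  have PR: "?P (int m) (?R (- int n) v) = (\<Sum>l\<le>min m n. sc (fps_nth (G_inf h (qp h k) / G_inf h (qp h (- k))) l)
           (?R (- int (n - l)) (?P (int (m - l)) v)))" for m n v
  proof -
    have G: "G_inf h (qp h k) / G_inf h (qp h (- k)) =
      fps_const (qp h (2 * 0)) * rat h (map ((+) ((- k / 2) - (2 + k / 2))) [0, 4 + 2 * k]) (map ((+) ((- k / 2) - (2 + k / 2))) [4, 2 * k])"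
    proof -
      have "G_inf h (qp h k) / G_inf h (qp h (- k)) = G_inf h (qp h k) * inverse (G_inf h (qp h (- k)))"
        by (rule fps_divide_unit) (simp add: G_inf_rat rat_def lin1_nth geo_def)
      also have "\<dots> = (fps_const (qp h 2) * fps_const (qp h (- 2))) * (rat h [- 2 - k] [2 - k] * rat h [2 + k] [- 2 + k])"
        unfolding G_inf_rat fps_inverse_mult inverse_rat inverse_const_qp
        by (simp only: mult_ac minus_minus diff_minus_eq_add add.commute[of _ k] diff_conv_add_uminus)
      also have "rat h [- 2 - k] [2 - k] * rat h [2 + k] [- 2 + k] = rat h [- 2 - k, 2 + k] [2 - k, - 2 + k]"
        by (simp add: rat_def mult_ac)
      moreover have "- k / 2 - (2 + k / 2) = - 2 - k" by (simp add: field_simps)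
      ultimately show ?thesis by (simp add: qp_add[symmetric] minus_diff_commute)
    qed
    have "?P (int m) (?R (- int n) v) = (\<Sum>l\<le>m. sc (fps_nth (G_inf h (qp h k) / G_inf h (qp h (- k))) l)
       (?R (- int n + int l) (?P (int (m - l)) v)))"
      using psi_plus[OF PM(1) M0 _ G, of "[PP]" m 1 "- int n" v] MP PP by (simp add: Scur_def)
    \<comment> \<open>For l > n the mode of \<psi>^- has positive index and vanishes.\<close>
    also have "\<dots> = (\<Sum>l\<le>min m n. sc (fps_nth (G_inf h (qp h k) / G_inf h (qp h (- k))) l)
           (?R (- int (n - l)) (?P (int (m - l)) v)))"
      by (rule sum.mono_neutral_cong_right) (auto simp: P0 of_nat_diff)
    finally show ?thesis .
  qed
  have PE: "?P (int m) (?E n v) = (\<Sum>l\<le>m. sc (fps_nth (G_inf h (qp h (k / 2))) l) (?E (n + int l) (?P (int (m - l)) v)))" for m n v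
  proof -
    have G: "G_inf h (qp h (k / 2)) = fps_const (qp h (2 * 1)) * rat h (map ((+) (0 - (2 + k / 2))) [0]) (map ((+) (0 - (2 + k / 2))) [4])"
      by (simp add: G_inf_rat)
    have As': "okl B \<and> con Q PM B [0] [4] \<and> con Q B PM [] [] \<and> ep PM B = 1" if "B \<in> set As" for B
      using As[OF that] by blast
    show ?thesis using psi_plus[OF PM(1) M0 As' G, where m = m and K = K and n = n and v = v]
      unfolding mult_zero_right qp_0 scale_one K_def .
  qed
  have RE: "?R (- int m) (?E n v) = (\<Sum>l\<le>m. sc (fps_nth (G_zero h (qp h (- k / 2))) l) (?E (n - int l) (?R (- int (m - l)) v)))" for m n v
  proof -
    have G: "G_zero h (qp h (- k / 2)) = fps_const (qp h (2 * - 1)) * rat h (map ((+) (- k / 2 - 0)) [2]) (map ((+) (- k / 2 - 0)) [- 2])"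
      by (simp add: G_zero_rat)
    have As': "okl B \<and> con Q PP B [] [] \<and> con Q B PP [- 2] [2] \<and> ep PP B = - 1" if "B \<in> set As" for B
      using As[OF that] by blast
    show ?thesis using psi_minus[OF PP(1) P0 As' G, where m = m and K = K and n = n and v = v]
      unfolding mult_zero_right qp_0 scale_one K_def .
  qed
  have PF: "?P (int m) (?F n v) = (\<Sum>l\<le>m. sc (fps_nth (inverse (G_inf h (qp h (- k / 2)))) l) (?F (n + int l) (?P (int (m - l)) v)))" for m n v
  proof -
    have G: "inverse (G_inf h (qp h (- k / 2))) = fps_const (qp h (2 * - 1)) * rat h (map ((+) (2 + k - (2 + k / 2))) [2]) (map ((+) (2 + k - (2 + k / 2))) [- 2])"
      unfolding G_inf_rat fps_inverse_mult inverse_rat inverse_const_qp by (simp add: field_simps)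
    have Bs': "okl B \<and> con Q PM B [2] [- 2] \<and> con Q B PM [] [] \<and> ep PM B = - 1" if "B \<in> set Bs" for B
      using Bs[OF that] by blast
    show ?thesis by (rule psi_plus[OF PM(1) M0 Bs' G])
  qed
  have RF: "?R (- int m) (?F n v) = (\<Sum>l\<le>m. sc (fps_nth (inverse (G_zero h (qp h (k / 2)))) l) (?F (n - int l) (?R (- int (m - l)) v)))" for m n v
  proof -
    have G: "inverse (G_zero h (qp h (k / 2))) = fps_const (qp h (2 * 1)) * rat h (map ((+) (- k / 2 - (2 + k))) [2 * k]) (map ((+) (- k / 2 - (2 + k))) [2 * k + 4])"
      unfolding G_zero_rat fps_inverse_mult inverse_rat inverse_const_qp by (simp add: field_simps)
    have Bs': "okl B \<and> con Q PP B [] [] \<and> con Q B PP [2 * k + 4] [2 * k] \<and> ep PP B = 1" if "B \<in> set Bs" for B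
      using Bs[OF that] by blast
    show ?thesis by (rule psi_minus[OF PP(1) P0 Bs' G])
  qed
  have EEr: "?E (m + 1) (?E n v) - sc (qp h 2) (?E m (?E (n + 1) v)) = sc (qp h 2) (?E n (?E (m + 1) v)) - ?E (n + 1) (?E m v)" for m n v
  proof -
    have a: "- (m + 1) + 1 = - m" "- n - 1 = - (n + 1)" by simp_all
    have "sc (K * K) (Scur As (- (m + 1)) (Scur As (- n) v) - sc (qp h 2) (Scur As (- m) (Scur As (- (n + 1)) v)))
      = sc (K * K) (sc (qp h 2) (Scur As (- n) (Scur As (- (m + 1)) v)) - Scur As (- (n + 1)) (Scur As (- m) v))"
      using Scur_quad[OF As(1) EE, of "- (m + 1)" "- n" v] unfolding a by simp
    then show ?thesis unfolding K_def[symmetric] lin_sc[OF lA] by (simp add: scale_right_diff_distrib mult_ac)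
  qed
  have FFr: "?F (m + 1) (?F n v) - sc (qp h (- 2)) (?F m (?F (n + 1) v)) = sc (qp h (- 2)) (?F n (?F (m + 1) v)) - ?F (n + 1) (?F m v)" for m n v
  proof -
    have a: "- (m + 1) + 1 = - m" "- n - 1 = - (n + 1)" by simp_all
    define t where "t = qp h (- of_int (m + n + 1) * (2 + k))"
    have t: "qp h (- of_int (m + 1) * (2 + k)) * qp h (- of_int n * (2 + k)) = t" "qp h (- of_int m * (2 + k)) * qp h (- of_int (n + 1) * (2 + k)) = t"
      "qp h (- of_int n * (2 + k)) * qp h (- of_int (m + 1) * (2 + k)) = t" "qp h (- of_int (n + 1) * (2 + k)) * qp h (- of_int m * (2 + k)) = t"
      unfolding t_def qp_add[symmetric] by (simp_all add: algebra_simps)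
    have c: "- K * (x * (- K * y)) = K * K * (x * y)" for x y by simp
    have K': "- 1 / (qp h 1 - qp h (- 1)) = - K" by (simp add: K_def)
    have "sc (K * K * t) (Scur Bs (- (m + 1)) (Scur Bs (- n) v) - sc (qp h (- 2)) (Scur Bs (- m) (Scur Bs (- (n + 1)) v)))
      = sc (K * K * t) (sc (qp h (- 2)) (Scur Bs (- n) (Scur Bs (- (m + 1)) v)) - Scur Bs (- (n + 1)) (Scur Bs (- m) v))"
      using Scur_quad[OF Bs(1) FF, of "- (m + 1)" "- n" v] unfolding a by simp
    then show ?thesis unfolding K' lin_sc[OF lB] scale_scale c t
      by (simp add: scale_right_diff_distrib mult_ac)
  qed
  have EFr: "sc (qp h 1 - qp h (-1)) (?E m (?F n v) - ?F n (?E m v)) =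
        sc (qp h (k * of_int m)) (rescale h sc (k / 2) ?P (m + n) v) - sc (qp h (- k * of_int m)) (rescale h sc (- k / 2) ?R (m + n) v)" for m n v
  proof -
    have K': "- 1 / (qp h 1 - qp h (- 1)) = - K" by (simp add: K_def)
    have K1: "(qp h 1 - qp h (- 1)) * K = 1" using nz by (simp add: K_def)
    define t where "t = qp h (- of_int n * (2 + k))"
    \<comment> \<open>The power q^(k m), the shift k/2 from the relation and the shift of \<psi>^+
      itself combine into the power in \<open>EF\<close>, up to the factor \<open>t\<close> that
      comes from the shift of F; \<open>q2\<close> is the same for \<psi>^-.\<close>
    have q1: "qp h (k * of_int m) * (qp h (- of_int (m + n) * (k / 2)) * qp h (- of_int (m + n) * (2 + k / 2))) = t * qp h (2 * of_int (- m))"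
      unfolding t_def qp_add[symmetric] by (simp add: algebra_simps)
    have q2: "qp h (- k * of_int m) * (qp h (- of_int (m + n) * (- k / 2)) * qp h (- of_int (m + n) * (- k / 2))) = t * qp h (- (2 * k + 2) * of_int (- n))"
      unfolding t_def qp_add[symmetric] by (simp add: algebra_simps)
    have s: "- m + - n = - (m + n)" by simp
    have "sc (qp h 1 - qp h (-1)) (?E m (?F n v) - ?F n (?E m v)) =
       sc ((qp h 1 - qp h (-1)) * K * (- K * t)) (Scur As (- m) (Scur Bs (- n) v) - Scur Bs (- n) (Scur As (- m) v))"
      unfolding K' K_def[symmetric] t_def[symmetric] lin_sc[OF lA] lin_sc[OF lB] by (simp add: scale_right_diff_distrib mult_ac)
    also have "\<dots> = sc (- (K * (qp h 1 - qp h (-1))) * t)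
       (sc (qp h (- (2 * k + 2) * of_int (- n))) (cur PP (- (m + n)) v) - sc (qp h (2 * of_int (- m))) (cur PM (- (m + n)) v))"
      unfolding EF K1 s by simp
    also have "\<dots> = sc (t * qp h (2 * of_int (- m))) (cur PM (- (m + n)) v) - sc (t * qp h (- (2 * k + 2) * of_int (- n))) (cur PP (- (m + n)) v)"
      using K1 by (simp add: mult.commute[of K] scale_right_diff_distrib)
    finally show ?thesis unfolding rescale_def scale_scale q1 q2 .
  qed
  show ?thesis
    unfolding Uq_sl2_relations_def
    by (intro conjI allI H lins inv comm PR PE RE PF RF EEr FFr EFr)
qed

end

subsection \<open>Contractions in the two quivers\<close>

text \<open>Entries at arbitrary H, since the contractions use them at every n h; expanding the
  prefactor q - q^(-1) brings them into the form of exponential sums.\<close>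

lemma Cmat_I:
  "Cmat H (Q_I k) 0 0 = 0 + qp H (2) - qp H (0)"
  "Cmat H (Q_I k) 0 1 = 0 + qp H (0) - qp H (- 2)"
  "Cmat H (Q_I k) 0 2 = 0 - qp H (0) + qp H (- 2)"
  "Cmat H (Q_I k) 0 3 = 0"
  "Cmat H (Q_I k) 1 0 = 0 - qp H (2) + qp H (0)"
  "Cmat H (Q_I k) 1 1 = 0 + qp H (2) - 2 * qp H (0) + qp H (- 2)"
  "Cmat H (Q_I k) 1 2 = 0 + qp H (0) - qp H (- 2) - qp H (- 2 * k - 2) + qp H (- 2 * k - 4)"
  "Cmat H (Q_I k) 1 3 = 0 + qp H (- 2 * k - 2) - qp H (- 2 * k - 4)"
  "Cmat H (Q_I k) 2 0 = 0 + qp H (2) - qp H (0)"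
  "Cmat H (Q_I k) 2 1 = 0 - qp H (2) + qp H (0) + qp H (2 * k + 4) - qp H (2 * k + 2)"
  "Cmat H (Q_I k) 2 2 = 0 + qp H (2) - 2 * qp H (0) + qp H (- 2)"
  "Cmat H (Q_I k) 2 3 = 0 - qp H (2) + qp H (0)"
  "Cmat H (Q_I k) 3 0 = 0"
  "Cmat H (Q_I k) 3 1 = 0 - qp H (2 * k + 4) + qp H (2 * k + 2)"
  "Cmat H (Q_I k) 3 2 = 0 + qp H (0) - qp H (- 2)"
  "Cmat H (Q_I k) 3 3 = 0 - qp H (0) + qp H (- 2)"
  by (simp_all add: Cmat_def cmat_def labels_def Q_I_def kind03_def algebra_simps minus_diff_commute qp_add[symmetric])

lemma eps_I:
  "eps (Q_I k) 0 0 = 0"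
  "eps (Q_I k) 0 1 = 1"
  "eps (Q_I k) 0 2 = -1"
  "eps (Q_I k) 0 3 = 0"
  "eps (Q_I k) 1 0 = -1"
  "eps (Q_I k) 1 1 = 0"
  "eps (Q_I k) 1 2 = 0"
  "eps (Q_I k) 1 3 = 1"
  "eps (Q_I k) 2 0 = 1"
  "eps (Q_I k) 2 1 = 0"
  "eps (Q_I k) 2 2 = 0"
  "eps (Q_I k) 2 3 = -1"
  "eps (Q_I k) 3 0 = 0"
  "eps (Q_I k) 3 1 = -1"
  "eps (Q_I k) 3 2 = 1"
  "eps (Q_I k) 3 3 = 0"
  by (simp_all add: eps_def labels_def Q_I_def)

lemma verts_I: "verts (Q_I k) = {0, 1, 2, 3}" by (simp add: Q_I_def)

lemma con_EE_I:
  "con (Q_I k) [(0, 0)] [(0, 0)] [0] [2]"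
  "con (Q_I k) [(0, 0)] [(0, 0), (1, 0)] [- 2] [2]"
  "con (Q_I k) [(0, 0), (1, 0)] [(0, 0)] [] []"
  "con (Q_I k) [(0, 0), (1, 0)] [(0, 0), (1, 0)] [0] [2]"
  unfolding con_def pr_def
  \<comment> \<open>The simplifier turns the vertex 1 into \<open>Suc 0\<close>, so the table is
    supplied in both forms.\<close>
  by (simp_all add: Cmat_I Cmat_I[simplified] algebra_simps minus_diff_commute qp_add[symmetric])

lemma con_FF_I:
  "con (Q_I k) [(3, 0)] [(3, 0)] [0] [- 2]"
  "con (Q_I k) [(3, 0)] [(3, 0), (2, 0)] [] []"
  "con (Q_I k) [(3, 0), (2, 0)] [(3, 0)] [2] [- 2]"
  "con (Q_I k) [(3, 0), (2, 0)] [(3, 0), (2, 0)] [0] [- 2]"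
  unfolding con_def pr_def
  by (simp_all add: Cmat_I Cmat_I[simplified] algebra_simps minus_diff_commute qp_add[symmetric])

lemma con_EF_I:
  "con (Q_I k) [(0, 0)] [(3, 0)] [] []"
  "con (Q_I k) [(3, 0)] [(0, 0)] [] []"
  "con (Q_I k) [(0, 0)] [(3, 0), (2, 0)] [0] [- 2]"
  "con (Q_I k) [(3, 0), (2, 0)] [(0, 0)] [0] [2]"
  "con (Q_I k) [(0, 0), (1, 0)] [(3, 0)] [- 2 * k - 4] [- 2 * k - 2]"
  "con (Q_I k) [(3, 0)] [(0, 0), (1, 0)] [2 * k + 4] [2 * k + 2]"
  "con (Q_I k) [(0, 0), (1, 0)] [(3, 0), (2, 0)] [] []"
  "con (Q_I k) [(3, 0), (2, 0)] [(0, 0), (1, 0)] [] []"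
  unfolding con_def pr_def
  by (simp_all add: Cmat_I Cmat_I[simplified] algebra_simps minus_diff_commute qp_add[symmetric])

lemma con_psi_I:
  "con (Q_I k) [(3, 0), (2, 0), (0, - 2)] [(0, 0)] [0] [4]"
  "con (Q_I k) [(0, 0)] [(0, 0), (1, 0), (3, 2 * k + 2)] [- 2] [2]"
  "con (Q_I k) [(3, 0), (2, 0), (0, - 2)] [(0, 0), (1, 0)] [0] [4]"
  "con (Q_I k) [(0, 0), (1, 0)] [(0, 0), (1, 0), (3, 2 * k + 2)] [- 2] [2]"
  "con (Q_I k) [(3, 0), (2, 0), (0, - 2)] [(3, 0)] [2] [- 2]"
  "con (Q_I k) [(3, 0)] [(0, 0), (1, 0), (3, 2 * k + 2)] [2 * k + 4] [2 * k]"
  "con (Q_I k) [(3, 0), (2, 0), (0, - 2)] [(3, 0), (2, 0)] [2] [- 2]"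
  "con (Q_I k) [(3, 0), (2, 0)] [(0, 0), (1, 0), (3, 2 * k + 2)] [2 * k + 4] [2 * k]"
  unfolding con_def pr_def
  by (simp_all add: Cmat_I Cmat_I[simplified] algebra_simps minus_diff_commute qp_add[symmetric])

lemma con_MP_I:
  "con (Q_I k) [(3, 0), (2, 0), (0, - 2)] [(0, 0), (1, 0), (3, 2 * k + 2)] [0, 2 * k + 4] [4, 2 * k]"
  unfolding con_def pr_def
  by (simp_all add: Cmat_I Cmat_I[simplified] algebra_simps minus_diff_commute qp_add[symmetric])

text \<open>The points of \<open>P_+\<close> form a left null vector of C at every H, so the
  annihilation half of \<psi>^- is central. Dually, the points of \<open>P_-\<close> form a right
  null vector and the creation half of \<psi>^+ is central.\<close>

lemma left_I:
  assumes "j \<in> {0, 1, 2, 3}"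
  shows "(\<Sum>(i, e)\<leftarrow>[(0, 0), (1, 0), (3, 2 * k + 2)]. qp H (- e) * Cmat H (Q_I k) i j) = 0"
  using assms by (auto simp: Cmat_I Cmat_I[simplified] algebra_simps minus_diff_commute qp_add[symmetric])

lemma right_I:
  assumes "i \<in> {0, 1, 2, 3}"
  shows "(\<Sum>(j, e)\<leftarrow>[(3, 0), (2, 0), (0, - 2)]. qp H e * Cmat H (Q_I k) i j) = 0"
  using assms by (auto simp: Cmat_I Cmat_I[simplified] algebra_simps minus_diff_commute qp_add[symmetric])

lemma Cmat_II:
  "Cmat H (Q_II k) 0 0 = 0 + qp H (2) - qp H (0)"
  "Cmat H (Q_II k) 0 1 = 0 - qp H (- 2 * k - 2) + qp H (- 2 * k - 4)"
  "Cmat H (Q_II k) 0 2 = 0"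
  "Cmat H (Q_II k) 0 3 = 0 + qp H (- 2 * k - 2) - qp H (- 2 * k - 4)"
  "Cmat H (Q_II k) 1 0 = 0 + qp H (2 * k + 4) - qp H (2 * k + 2)"
  "Cmat H (Q_II k) 1 1 = 0 + qp H (2) - 2 * qp H (0) + qp H (- 2)"
  "Cmat H (Q_II k) 1 2 = 0 + qp H (0) - qp H (- 2) - qp H (2 * k + 4) + qp H (2 * k + 2)"
  "Cmat H (Q_II k) 1 3 = 0 - qp H (2) + qp H (0)"
  "Cmat H (Q_II k) 2 0 = 0"
  "Cmat H (Q_II k) 2 1 = 0 - qp H (2) + qp H (0) + qp H (- 2 * k - 2) - qp H (- 2 * k - 4)"
  "Cmat H (Q_II k) 2 2 = 0 + qp H (2) - 2 * qp H (0) + qp H (- 2) - qp H (- 2 * k - 2) + qp H (- 2 * k - 4) + qp H (2 * k + 4) - qp H (2 * k + 2)"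
  "Cmat H (Q_II k) 2 3 = 0"
  "Cmat H (Q_II k) 3 0 = 0 - qp H (2 * k + 4) + qp H (2 * k + 2)"
  "Cmat H (Q_II k) 3 1 = 0 + qp H (0) - qp H (- 2)"
  "Cmat H (Q_II k) 3 2 = 0"
  "Cmat H (Q_II k) 3 3 = 0 - qp H (0) + qp H (- 2)"
  by (simp_all add: Cmat_def cmat_def labels_def Q_II_def kind03_def algebra_simps minus_diff_commute qp_add[symmetric])

lemma eps_II:
  "eps (Q_II k) 0 0 = 0"
  "eps (Q_II k) 0 1 = -1"
  "eps (Q_II k) 0 2 = 0"
  "eps (Q_II k) 0 3 = 1"
  "eps (Q_II k) 1 0 = 1"
  "eps (Q_II k) 1 1 = 0"
  "eps (Q_II k) 1 2 = 0"
  "eps (Q_II k) 1 3 = -1"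
  "eps (Q_II k) 2 0 = 0"
  "eps (Q_II k) 2 1 = 0"
  "eps (Q_II k) 2 2 = 0"
  "eps (Q_II k) 2 3 = 0"
  "eps (Q_II k) 3 0 = -1"
  "eps (Q_II k) 3 1 = 1"
  "eps (Q_II k) 3 2 = 0"
  "eps (Q_II k) 3 3 = 0"
  by (simp_all add: eps_def labels_def Q_II_def)

lemma verts_II: "verts (Q_II k) = {0, 1, 2, 3}" by (simp add: Q_II_def)

lemma con_EE_II:
  "con (Q_II k) [(0, 0)] [(0, 0)] [0] [2]"
  unfolding con_def pr_def
  by (simp_all add: Cmat_II Cmat_II[simplified] algebra_simps minus_diff_commute qp_add[symmetric])

text \<open>Number the terms of the path from 0. The linear factor with \<kappa> = - 2 removes all
  poles except for the terms 0, 3 and 1, 2, in both orders; these four pairs keep a pole with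
  exponent 2k + 2 or - 2k - 2.\<close>

lemma con_FF_II:
  "con (Q_II k) [(3, 0)] [(3, 0)] [0] [- 2]"
  "con (Q_II k) [(3, 0)] [(3, 0), (1, 0)] [] []"
  "con (Q_II k) [(3, 0)] [(3, 0), (1, 0), (2, 0)] [] []"
  "con (Q_II k) [(3, 0)] [(3, 0), (1, 0), (2, 0), (1, 2 * k + 2)] [2 * k] [2 * k + 2]"
  "con (Q_II k) [(3, 0), (1, 0)] [(3, 0)] [2] [- 2]"
  "con (Q_II k) [(3, 0), (1, 0)] [(3, 0), (1, 0)] [0] [- 2]"
  "con (Q_II k) [(3, 0), (1, 0)] [(3, 0), (1, 0), (2, 0)] [2 * k + 4] [2 * k + 2]"
  "con (Q_II k) [(3, 0), (1, 0)] [(3, 0), (1, 0), (2, 0), (1, 2 * k + 2)] [] []"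
  "con (Q_II k) [(3, 0), (1, 0), (2, 0)] [(3, 0)] [2] [- 2]"
  "con (Q_II k) [(3, 0), (1, 0), (2, 0)] [(3, 0), (1, 0)] [2, - 2 * k - 4] [- 2, - 2 * k - 2]"
  "con (Q_II k) [(3, 0), (1, 0), (2, 0)] [(3, 0), (1, 0), (2, 0)] [0] [- 2]"
  "con (Q_II k) [(3, 0), (1, 0), (2, 0)] [(3, 0), (1, 0), (2, 0), (1, 2 * k + 2)] [] []"
  "con (Q_II k) [(3, 0), (1, 0), (2, 0), (1, 2 * k + 2)] [(3, 0)] [2, - 2 * k] [- 2, - 2 * k - 2]"
  "con (Q_II k) [(3, 0), (1, 0), (2, 0), (1, 2 * k + 2)] [(3, 0), (1, 0)] [2] [- 2]"
  "con (Q_II k) [(3, 0), (1, 0), (2, 0), (1, 2 * k + 2)] [(3, 0), (1, 0), (2, 0)] [2] [- 2]"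
  "con (Q_II k) [(3, 0), (1, 0), (2, 0), (1, 2 * k + 2)] [(3, 0), (1, 0), (2, 0), (1, 2 * k + 2)] [0] [- 2]"
  unfolding con_def pr_def
  by (simp_all add: Cmat_II Cmat_II[simplified] algebra_simps minus_diff_commute qp_add[symmetric])

lemma con_EF_II:
  "con (Q_II k) [(0, 0)] [(3, 0)] [- 2 * k - 4] [- 2 * k - 2]"
  "con (Q_II k) [(3, 0)] [(0, 0)] [2 * k + 4] [2 * k + 2]"
  "con (Q_II k) [(0, 0)] [(3, 0), (1, 0)] [] []"
  "con (Q_II k) [(3, 0), (1, 0)] [(0, 0)] [] []"
  "con (Q_II k) [(0, 0)] [(3, 0), (1, 0), (2, 0)] [] []"
  "con (Q_II k) [(3, 0), (1, 0), (2, 0)] [(0, 0)] [] []"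
  "con (Q_II k) [(0, 0)] [(3, 0), (1, 0), (2, 0), (1, 2 * k + 2)] [0] [- 2]"
  "con (Q_II k) [(3, 0), (1, 0), (2, 0), (1, 2 * k + 2)] [(0, 0)] [0] [2]"
  unfolding con_def pr_def
  by (simp_all add: Cmat_II Cmat_II[simplified] algebra_simps minus_diff_commute qp_add[symmetric])

lemma con_psi_II:
  "con (Q_II k) [(3, 0), (1, 0), (2, 0), (1, 2 * k + 2), (0, - 2)] [(0, 0)] [0] [4]"
  "con (Q_II k) [(0, 0)] [(0, 0), (3, 2 * k + 2)] [- 2] [2]"
  "con (Q_II k) [(3, 0), (1, 0), (2, 0), (1, 2 * k + 2), (0, - 2)] [(3, 0)] [2] [- 2]"
  "con (Q_II k) [(3, 0)] [(0, 0), (3, 2 * k + 2)] [2 * k + 4] [2 * k]"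
  "con (Q_II k) [(3, 0), (1, 0), (2, 0), (1, 2 * k + 2), (0, - 2)] [(3, 0), (1, 0)] [2] [- 2]"
  "con (Q_II k) [(3, 0), (1, 0)] [(0, 0), (3, 2 * k + 2)] [2 * k + 4] [2 * k]"
  "con (Q_II k) [(3, 0), (1, 0), (2, 0), (1, 2 * k + 2), (0, - 2)] [(3, 0), (1, 0), (2, 0)] [2] [- 2]"
  "con (Q_II k) [(3, 0), (1, 0), (2, 0)] [(0, 0), (3, 2 * k + 2)] [2 * k + 4] [2 * k]"
  "con (Q_II k) [(3, 0), (1, 0), (2, 0), (1, 2 * k + 2), (0, - 2)] [(3, 0), (1, 0), (2, 0), (1, 2 * k + 2)] [2] [- 2]"
  "con (Q_II k) [(3, 0), (1, 0), (2, 0), (1, 2 * k + 2)] [(0, 0), (3, 2 * k + 2)] [2 * k + 4] [2 * k]"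
  unfolding con_def pr_def
  by (simp_all add: Cmat_II Cmat_II[simplified] algebra_simps minus_diff_commute qp_add[symmetric])

lemma con_MP_II:
  "con (Q_II k) [(3, 0), (1, 0), (2, 0), (1, 2 * k + 2), (0, - 2)] [(0, 0), (3, 2 * k + 2)] [0, 2 * k + 4] [4, 2 * k]"
  unfolding con_def pr_def
  by (simp_all add: Cmat_II Cmat_II[simplified] algebra_simps minus_diff_commute qp_add[symmetric])

lemma left_II:
  assumes "j \<in> {0, 1, 2, 3}"
  shows "(\<Sum>(i, e)\<leftarrow>[(0, 0), (3, 2 * k + 2)]. qp H (- e) * Cmat H (Q_II k) i j) = 0"
  using assms by (auto simp: Cmat_II Cmat_II[simplified] algebra_simps minus_diff_commute qp_add[symmetric])

lemma right_II:
  assumes "i \<in> {0, 1, 2, 3}"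
  shows "(\<Sum>(j, e)\<leftarrow>[(3, 0), (1, 0), (2, 0), (1, 2 * k + 2), (0, - 2)]. qp H e * Cmat H (Q_II k) i j) = 0"
  using assms by (auto simp: Cmat_II Cmat_II[simplified] algebra_simps minus_diff_commute qp_add[symmetric])

subsection \<open>The two realizations\<close>

lemma sum_indicator_list:
  assumes "finite V" "fst ` set rs \<subseteq> V"
  shows "(\<Sum>j\<in>V. f j * (\<Sum>(j', e)\<leftarrow>rs. if j' = j then g e else (0 :: complex))) = (\<Sum>(j', e)\<leftarrow>rs. g e * f j')"
  using assms(2)
proof (induction rs)
  case (Cons p rs)
  obtain j' e where p: "p = (j', e)" by force
  have "(\<Sum>j\<in>V. f j * (if j' = j then g e else 0)) = g e * f j'"
    using Cons.prems assms(1) by (simp add: p sum.delta' if_distrib[where f = "\<lambda>x. f _ * x"] mult.commute cong: if_cong)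
  then show ?case using Cons by (simp add: p distrib_left sum.distrib)
qed simp

context seed
begin

lemma sum_indicator_list_sc:
  assumes "finite V" "fst ` set rs \<subseteq> V"
  shows "(\<Sum>j\<in>V. sc (\<Sum>(j', e)\<leftarrow>rs. if j' = j then g e else 0) (u j)) = (\<Sum>(j', e)\<leftarrow>rs. sc (g e) (u j'))"
  using assms(2)
proof (induction rs)
  case (Cons p rs)
  obtain j' e where p: "p = (j', e)" by force
  have "(\<Sum>j\<in>V. sc (if j' = j then g e else 0) (u j)) = (\<Sum>j\<in>V. if j' = j then sc (g e) (u j) else 0)"
    by (intro sum.cong) auto
  then have "(\<Sum>j\<in>V. sc (if j' = j then g e else 0) (u j)) = sc (g e) (u j')"
    using Cons.prems assms(1) by (simp add: p sum.delta')
  then show ?case using Cons by (simp add: p scale_left_distrib sum.distrib)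
qed simp

text \<open>A right null vector of C gives a central combination of creation oscillators, which acts
  by zero on a reduced module. The shifts enter as q^e because the mode number is negative.\<close>

lemma reduced_right:
  assumes r: "reduced h sc Q M" and V: "finite (verts Q)" and rs: "okl rs"
    and z: "\<And>H i. i \<in> verts Q \<Longrightarrow> (\<Sum>(j, e)\<leftarrow>rs. qp H e * Cmat H Q i j) = 0" and n: "n < 0"
  shows "os rs n v = 0"
proof -
  define H where "H = of_int (- n) * h"
  \<comment> \<open>A path may visit a vertex several times, so the coefficient at j is a sum over
    its occurrences.\<close>
  define b where "b j = (\<Sum>(j', e)\<leftarrow>rs. if j' = j then qp H e else 0)" for j
  have "(\<Sum>j\<in>verts Q. Cmat (of_int (- n) * h) Q i j * b j) = 0" if "i \<in> verts Q" for i
    unfolding b_def sum_indicator_list[OF V rs] using z[OF that, of H] by (simp add: H_def)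
  moreover have "- n > 0" using n by simp
  ultimately have "(\<Sum>j\<in>verts Q. sc (b j) (osc M j (- (- n)) v)) = 0"
    using r unfolding reduced_def by blast
  then have "(\<Sum>(j', e)\<leftarrow>rs. sc (qp H e) (osc M j' n v)) = 0"
    unfolding b_def sum_indicator_list_sc[OF V rs] by simp
  moreover have "qp h (- of_int n * e) = qp H e" for e by (simp add: qp_def H_def mult_ac)
  ultimately show ?thesis unfolding osc_sum_def by simp
qed

lemma reduced_left:
  assumes r: "reduced h sc Q M" and V: "finite (verts Q)" and rs: "okl rs"
    and z: "\<And>H j. j \<in> verts Q \<Longrightarrow> (\<Sum>(i, e)\<leftarrow>rs. qp H (- e) * Cmat H Q i j) = 0" and n: "n > 0"
  shows "os rs n v = 0"
proof -
  define H where "H = of_int n * h"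
  define b where "b i = (\<Sum>(j', e)\<leftarrow>rs. if j' = i then qp H (- e) else 0)" for i
  have "(\<Sum>i\<in>verts Q. b i * Cmat (of_int n * h) Q i j) = 0" if "j \<in> verts Q" for j
    unfolding b_def mult.commute[of "sum_list _"] sum_indicator_list[OF V rs] using z[OF that, of H] by (simp add: H_def)
  then have "(\<Sum>j\<in>verts Q. sc (b j) (osc M j n v)) = 0"
    using r n unfolding reduced_def by blast
  then have "(\<Sum>(j', e)\<leftarrow>rs. sc (qp H (- e)) (osc M j' n v)) = 0"
    unfolding b_def sum_indicator_list_sc[OF V rs] by simp
  moreover have "qp h (- of_int n * e) = qp H (- e)" for e by (simp add: qp_def H_def mult_ac)
  ultimately show ?thesis unfolding osc_sum_def by simp
qed

lemma Sigma_cur_Scur: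
  assumes "map (\<lambda>j. take (Suc j) (path_points P)) [0..<length (snd P)] = As"
  shows "Sigma_cur h sc Q M P n = Scur As (- n)"
proof
  fix v
  have "Scur As (- n) v = (\<Sum>j\<leftarrow>[0..<length (snd P)]. cur (take (Suc j) (path_points P)) (- n) v)"
    unfolding assms[symmetric] Scur_def map_map comp_def ..
  then show "Sigma_cur h sc Q M P n v = Scur As (- n) v"
    by (simp add: Sigma_cur_def nprod_cur interv_sum_list_conv_sum_set_nat atLeast0LessThan)
qed

lemma Psi_cur_cur: "Psi_cur h sc Q M P n = cur (path_points P) (- n)"
  by (simp add: fun_eq_iff Psi_cur_def nprod_cur)

end

lemma points_I:
  "path_points (Pp_I k) = [(0, 0), (1, 0), (3, 2 * k + 2)]" "path_points Pm_I = [(3, 0), (2, 0), (0, - 2)]"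
  by (simp_all add: path_points_def Pp_I_def Pm_I_def)

lemma terms_I:
  "map (\<lambda>j. take (Suc j) (path_points (Pp_I k))) [0..<length (snd (Pp_I k))] = [[(0, 0)], [(0, 0), (1, 0)]]"
  "map (\<lambda>j. take (Suc j) (path_points Pm_I)) [0..<length (snd Pm_I)] = [[(3, 0)], [(3, 0), (2, 0)]]"
  unfolding points_I by (simp_all add: Pp_I_def Pm_I_def upt_rec)

lemma (in cvs) realization_I:
  assumes nz: "qp h 1 - qp h (- 1) \<noteq> 0"
  shows "free_field_realization h k sc (Q_I k) (Pp_I k) Pm_I"
proof -
  have "Uq_sl2_relations h k sc
     (\<lambda>n v. sc (1 / (qp h 1 - qp h (-1))) (Sigma_cur h sc (Q_I k) M (Pp_I k) n v))
     (\<lambda>n v. sc (- 1 / (qp h 1 - qp h (-1))) (rescale h sc (2 + k) (Sigma_cur h sc (Q_I k) M Pm_I) n v))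
     (rescale h sc (2 + k / 2) (Psi_cur h sc (Q_I k) M Pm_I))
     (rescale h sc (- k / 2) (Psi_cur h sc (Q_I k) M (Pp_I k)))"
    if sm: "seed_module h sc (Q_I k) M" and red: "reduced h sc (Q_I k) M"
      and one: "\<And>v. zprod h sc (Q_I k) (zer M) (map fst (path_points (Pp_I k)) @ map fst (path_points Pm_I)) v = v" for M
  proof -
    interpret S: seed sc h "(Q_I k)" M by unfold_locales (rule sm)
    let ?PM = "[(3, 0), (2, 0), (0, - 2)] :: (nat \<times> complex) list" and ?PP = "[(0, 0), (1, 0), (3, 2 * k + 2)] :: (nat \<times> complex) list"
    let ?As = "[[(0, 0)], [(0, 0), (1, 0)]] :: (nat \<times> complex) list list" and ?Bs = "[[(3, 0)], [(3, 0), (2, 0)]] :: (nat \<times> complex) list list"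
    note ok = verts_I
    note ev = epsl_def eps_I eps_I[simplified]
    have V: "finite (verts (Q_I k))" by (simp add: ok)
    have okM: "S.okl ?PM" and okP: "S.okl ?PP" by (simp_all add: ok)
    have left: "(\<Sum>(i, e)\<leftarrow>?PP. qp H (- e) * Cmat H (Q_I k) i j) = 0" if "j \<in> verts (Q_I k)" for H j
      by (rule left_I) (use that ok in simp)
    have right: "(\<Sum>(j, e)\<leftarrow>?PM. qp H e * Cmat H (Q_I k) i j) = 0" if "i \<in> verts (Q_I k)" for H i
      by (rule right_I) (use that ok in simp)
    have cl: "con (Q_I k) ?PP rs [] []" if "S.okl rs" for rs by (rule S.con_left[OF left that])
    have cr: "con (Q_I k) rs ?PM [] []" if "S.okl rs" for rs by (rule S.con_right[OF right that])
    have okA: "S.okl A" if "A \<in> set ?As" for A using that by (auto simp: ok)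
    have okB: "S.okl A" if "A \<in> set ?Bs" for A using that by (auto simp: ok)
    have ep0: "epsl (Q_I k) (map fst ?PP) (map fst ?PM) = 0" by (simp add: ev)
    have ww: "S.zp (map fst ?PP @ map fst ?PM) v = v" for v using one[of v] unfolding points_I .
    have mP: "set (map fst ?PP) \<subseteq> verts (Q_I k)" and mM: "set (map fst ?PM) \<subseteq> verts (Q_I k)" by (simp_all add: ok)
    \<comment> \<open>The two ordered monomials multiply without a power of q, so normalizing the
      total product to 1 makes them inverse to each other.\<close>
    have bij: "S.zp (map fst ?PP) (S.zp (map fst ?PM) v) = v" for v
      unfolding zprod_append[OF S.zok mP mM] ep0 using ww[of v] by simp
    have bij': "S.zp (map fst ?PM) (S.zp (map fst ?PP) v) = v" for v
      unfolding zprod_append[OF S.zok mM mP] epsl_anti[of _ "map fst ?PM"] ep0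
      using ww[of v] zprod_swap[OF S.zok mM mP, of v] by simp
    note cancel = rat_cancel
    note fold' = rat_Cons_num[symmetric]
    \<comment> \<open>In these eight cases the linear factor either cancels the pole of the
      contraction or, where there is no contraction, becomes the numerator.\<close>
    have qEE00: "S.quad (2) [(0, 0)] [(0, 0)] c d v = 0" for c d v
      by (rule S.quad_nopole[OF _ _ con_EE_I(1) con_EE_I(1)], simp add: ok, simp add: ok,
          subst cancel, simp add: ev, subst cancel, simp add: ev)
    have qEE01: "S.quad (2) [(0, 0)] [(0, 0), (1, 0)] c d v = 0" for c d v
      by (rule S.quad_nopole[OF _ _ con_EE_I(2) con_EE_I(3)], simp add: ok, simp add: ok,
          subst cancel, simp add: ev, subst fold', simp add: ev)
    have qEE10: "S.quad (2) [(0, 0), (1, 0)] [(0, 0)] c d v = 0" for c d v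
      by (rule S.quad_nopole[OF _ _ con_EE_I(3) con_EE_I(2)], simp add: ok, simp add: ok,
          subst fold', simp add: ev, subst cancel, simp add: ev)
    have qEE11: "S.quad (2) [(0, 0), (1, 0)] [(0, 0), (1, 0)] c d v = 0" for c d v
      by (rule S.quad_nopole[OF _ _ con_EE_I(4) con_EE_I(4)], simp add: ok, simp add: ok,
          subst cancel, simp add: ev, subst cancel, simp add: ev)
    have qFF00: "S.quad (-2) [(3, 0)] [(3, 0)] c d v = 0" for c d v
      by (rule S.quad_nopole[OF _ _ con_FF_I(1) con_FF_I(1)], simp add: ok, simp add: ok,
          subst cancel, simp add: ev, subst cancel, simp add: ev)
    have qFF01: "S.quad (-2) [(3, 0)] [(3, 0), (2, 0)] c d v = 0" for c d v
      by (rule S.quad_nopole[OF _ _ con_FF_I(2) con_FF_I(3)], simp add: ok, simp add: ok,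
          subst fold', simp add: ev, subst cancel, simp add: ev)
    have qFF10: "S.quad (-2) [(3, 0), (2, 0)] [(3, 0)] c d v = 0" for c d v
      by (rule S.quad_nopole[OF _ _ con_FF_I(3) con_FF_I(2)], simp add: ok, simp add: ok,
          subst cancel, simp add: ev, subst fold', simp add: ev)
    have qFF11: "S.quad (-2) [(3, 0), (2, 0)] [(3, 0), (2, 0)] c d v = 0" for c d v
      by (rule S.quad_nopole[OF _ _ con_FF_I(4) con_FF_I(4)], simp add: ok, simp add: ok,
          subst cancel, simp add: ev, subst cancel, simp add: ev)
    have EE: "(\<Sum>A\<leftarrow>?As. \<Sum>B\<leftarrow>?As. S.quad 2 A B c d v) = 0" for c d v
      by (simp only: list.map sum_list.Cons sum_list.Nil qEE00 qEE01 qEE10 qEE11 add_0_left add_0_right)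
    have FF: "(\<Sum>A\<leftarrow>?Bs. \<Sum>B\<leftarrow>?Bs. S.quad (- 2) A B c d v) = 0" for c d v
      by (simp only: list.map sum_list.Cons sum_list.Nil qFF00 qFF01 qFF10 qFF11 add_0_left add_0_right)
    have c00: "S.cur [(0, 0)] c (S.cur [(3, 0)] d v) = S.cur [(3, 0)] d (S.cur [(0, 0)] c v)" for c d v
      by (rule S.cur_comm0[OF _ _ con_EF_I(1) con_EF_I(2)]) (simp_all add: ok ev)
    have c01: "S.cur [(0, 0)] c (S.cur [(3, 0), (2, 0)] d v) - S.cur [(3, 0), (2, 0)] d (S.cur [(0, 0)] c v) =
      sc (- ((qp h 1 - qp h (- 1)) * qp h (2 * of_int c))) (S.cur ?PM (c + d) v)" for c d v
    proof -
      \<comment> \<open>At the pole z = q^(-2) w the factor X_0 lands on the missing last point of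
        \<open>P_-\<close>, so the delta term is \<psi>^+.\<close>
      have m: "S.cur (shl (- 2) [(0, 0)] @ [(3, 0), (2, 0)]) (c + d) v = S.cur ?PM (c + d) v"
        by (rule S.cur_mset) (simp_all add: ok shl_def algebra_simps)
      have con': "con (Q_I k) [(3, 0), (2, 0)] [(0, 0)] [- (0)] [- (- 2)]"
        using con_EF_I(4)[of k] by (simp add: algebra_simps minus_diff_commute)
      have "S.cur [(0, 0)] c (S.cur [(3, 0), (2, 0)] d v) - S.cur [(3, 0), (2, 0)] d (S.cur [(0, 0)] c v) =
        sc ((qp h (S.ep [(0, 0)] [(3, 0), (2, 0)]) - qp h (- S.ep [(0, 0)] [(3, 0), (2, 0)])) * qp h (- of_int c * (- 2)))
          (S.cur (shl (- 2) [(0, 0)] @ [(3, 0), (2, 0)]) (c + d) v)"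
        by (rule S.cur_comm_pole[OF _ _ con_EF_I(3) con']) (simp_all add: ok ev)
      then show ?thesis unfolding m by (simp add: ev algebra_simps)
    qed
    have c10: "S.cur [(0, 0), (1, 0)] c (S.cur [(3, 0)] d v) - S.cur [(3, 0)] d (S.cur [(0, 0), (1, 0)] c v) =
      sc ((qp h 1 - qp h (- 1)) * qp h (- (2 * k + 2) * of_int d)) (S.cur ?PP (c + d) v)" for c d v
    proof -
      \<comment> \<open>Here the pole completes \<open>P_+\<close>, with all points shifted by q^(-
        2k - 2) because its last factor X_3 sits at w.\<close>
      have "S.cur (shl (- 2 * k - 2) [(0, 0), (1, 0)] @ [(3, 0)]) (c + d) v = S.cur (shl (- 2 * k - 2) ?PP) (c + d) v"
        by (rule S.cur_mset) (simp_all add: ok shl_def algebra_simps)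
      then have m: "S.cur (shl (- 2 * k - 2) [(0, 0), (1, 0)] @ [(3, 0)]) (c + d) v = sc (qp h ((- 2 * k - 2) * of_int (c + d))) (S.cur ?PP (c + d) v)"
        by (simp only: S.cur_shl[OF okP])
      have con': "con (Q_I k) [(3, 0)] [(0, 0), (1, 0)] [- (- 2 * k - 4)] [- (- 2 * k - 2)]"
        using con_EF_I(6)[of k] by (simp add: algebra_simps minus_diff_commute)
      have "S.cur [(0, 0), (1, 0)] c (S.cur [(3, 0)] d v) - S.cur [(3, 0)] d (S.cur [(0, 0), (1, 0)] c v) =
        sc ((qp h (S.ep [(0, 0), (1, 0)] [(3, 0)]) - qp h (- S.ep [(0, 0), (1, 0)] [(3, 0)])) * qp h (- of_int c * (- 2 * k - 2)))
          (S.cur (shl (- 2 * k - 2) [(0, 0), (1, 0)] @ [(3, 0)]) (c + d) v)"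
        by (rule S.cur_comm_pole[OF _ _ con_EF_I(5) con']) (simp_all add: ok ev)
      moreover have "qp h (- of_int c * (- 2 * k - 2)) * qp h ((- 2 * k - 2) * of_int (c + d)) = qp h (- (2 * k + 2) * of_int d)"
        unfolding qp_add[symmetric] by (simp add: algebra_simps)
      ultimately show ?thesis unfolding m scale_scale mult.assoc by (simp add: ev)
    qed
    have c11: "S.cur [(0, 0), (1, 0)] c (S.cur [(3, 0), (2, 0)] d v) = S.cur [(3, 0), (2, 0)] d (S.cur [(0, 0), (1, 0)] c v)" for c d v
      by (rule S.cur_comm0[OF _ _ con_EF_I(7) con_EF_I(8)]) (simp_all add: ok ev)
    have EF: "S.Scur ?As c (S.Scur ?Bs d v) - S.Scur ?Bs d (S.Scur ?As c v) = sc (qp h 1 - qp h (- 1))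
       (sc (qp h (- (2 * k + 2) * of_int d)) (S.cur ?PP (c + d) v) - sc (qp h (2 * of_int c)) (S.cur ?PM (c + d) v))" for c d v
    proof -
      have SA: "S.Scur ?As c (S.Scur Bs d v) = (\<Sum>A\<leftarrow>?As. \<Sum>B\<leftarrow>Bs. S.cur A c (S.cur B d v))" for Bs
        by (rule S.Scur_Scur) (rule okA)
      have SB: "S.Scur ?Bs d (S.Scur As c v) = (\<Sum>A\<leftarrow>?Bs. \<Sum>B\<leftarrow>As. S.cur A d (S.cur B c v))" for As
        by (rule S.Scur_Scur) (rule okB)
      have "S.Scur ?As c (S.Scur ?Bs d v) - S.Scur ?Bs d (S.Scur ?As c v) = (S.cur [(0, 0)] c (S.cur [(3, 0), (2, 0)] d v) - S.cur [(3, 0), (2, 0)] d (S.cur [(0, 0)] c v)) + (S.cur [(0, 0), (1, 0)] c (S.cur [(3, 0)] d v) - S.cur [(3, 0)] d (S.cur [(0, 0), (1, 0)] c v))"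
        unfolding SA SB
        by (simp only: list.map sum_list.Cons sum_list.Nil c00 c11 add_0_left add_0_right) (simp del: One_nat_def add: algebra_simps)
      then show ?thesis unfolding c01 c10 by (simp add: scale_right_diff_distrib)
    qed
    have psiA: "con (Q_I k) ?PM A [0] [4] \<and> con (Q_I k) A ?PP [- 2] [2]" if "A \<in> set ?As" for A
      using that con_psi_I(1)[of k] con_psi_I(2)[of k] con_psi_I(3)[of k] con_psi_I(4)[of k] by auto
    have psiB: "con (Q_I k) ?PM A [2] [- 2] \<and> con (Q_I k) A ?PP [2 * k + 4] [2 * k]" if "A \<in> set ?Bs" for A
      using that con_psi_I(5)[of k] con_psi_I(6)[of k] con_psi_I(7)[of k] con_psi_I(8)[of k] by auto
    have epA: "S.ep ?PM A = 1 \<and> S.ep ?PP A = - 1" if "A \<in> set ?As" for A using that by (auto simp: ev)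
    have epB: "S.ep ?PM A = - 1 \<and> S.ep ?PP A = 1" if "A \<in> set ?Bs" for A using that by (auto simp: ev)
    have MP: "con (Q_I k) ?PM ?PP [0, 4 + 2 * k] [4, 2 * k]" using con_MP_I[of k] by (simp add: add.commute)
    have epMP: "S.ep ?PM ?PP = 0" using ep0 by (subst S.ep_anti) simp
    have "Uq_sl2_relations h k sc
     (\<lambda>n v. sc (1 / (qp h 1 - qp h (- 1))) (S.Scur ?As (- n) v))
     (\<lambda>n v. sc (- 1 / (qp h 1 - qp h (- 1))) (sc (qp h (- of_int n * (2 + k))) (S.Scur ?Bs (- n) v)))
     (\<lambda>n v. sc (qp h (- of_int n * (2 + k / 2))) (S.cur ?PM (- n) v))
     (\<lambda>n v. sc (qp h (- of_int n * (- k / 2))) (S.cur ?PP (- n) v))"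
    proof (rule S.Uq_criterion[OF nz okM S.reduced_right[OF red V okM right] okP S.reduced_left[OF red V okP left] bij' bij
          cr[OF okM] cl[OF okP] MP cl[OF okM] epMP okA _ _ okB _ _ EE FF EF])
      show "con (Q_I k) ?PM A [0] [4] \<and> con (Q_I k) A ?PM [] [] \<and> S.ep ?PM A = 1" if "A \<in> set ?As" for A
        by (intro conjI conjunct1[OF psiA[OF that]] cr[OF okA[OF that]] conjunct1[OF epA[OF that]])
      show "con (Q_I k) ?PP A [] [] \<and> con (Q_I k) A ?PP [- 2] [2] \<and> S.ep ?PP A = - 1" if "A \<in> set ?As" for A
        by (intro conjI conjunct2[OF psiA[OF that]] cl[OF okA[OF that]] conjunct2[OF epA[OF that]])
      show "con (Q_I k) ?PM A [2] [- 2] \<and> con (Q_I k) A ?PM [] [] \<and> S.ep ?PM A = - 1" if "A \<in> set ?Bs" for A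
        by (intro conjI conjunct1[OF psiB[OF that]] cr[OF okB[OF that]] conjunct1[OF epB[OF that]])
      show "con (Q_I k) ?PP A [] [] \<and> con (Q_I k) A ?PP [2 * k + 4] [2 * k] \<and> S.ep ?PP A = 1" if "A \<in> set ?Bs" for A
        by (intro conjI conjunct2[OF psiB[OF that]] cl[OF okB[OF that]] conjunct2[OF epB[OF that]])
    qed
    then show ?thesis
      unfolding rescale_def[abs_def] S.Psi_cur_cur S.Sigma_cur_Scur[OF terms_I(1)] S.Sigma_cur_Scur[OF terms_I(2)] points_I .
  qed
  moreover have "walk (Q_I k) (fst (Pp_I k)) (snd (Pp_I k))" "walk (Q_I k) (fst Pm_I) (snd Pm_I)"
    by (simp_all add: Pp_I_def Pm_I_def Q_I_def)
  moreover have "(\<Sum>j\<leftarrow>map fst (path_points (Pp_I k)) @ map fst (path_points Pm_I). eps (Q_I k) i j) = 0" if "i \<in> verts (Q_I k)" for i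
    using that unfolding points_I by (auto simp: verts_I eps_I eps_I[simplified])
  ultimately show ?thesis unfolding free_field_realization_def Let_def by blast
qed

lemma points_II:
  "path_points (Pp_II k) = [(0, 0), (3, 2 * k + 2)]" "path_points (Pm_II k) = [(3, 0), (1, 0), (2, 0), (1, 2 * k + 2), (0, - 2)]"
  by (simp_all add: path_points_def Pp_II_def Pm_II_def)

lemma terms_II:
  "map (\<lambda>j. take (Suc j) (path_points (Pp_II k))) [0..<length (snd (Pp_II k))] = [[(0, 0)]]"
  "map (\<lambda>j. take (Suc j) (path_points (Pm_II k))) [0..<length (snd (Pm_II k))] = [[(3, 0)], [(3, 0), (1, 0)], [(3, 0), (1, 0), (2, 0)], [(3, 0), (1, 0), (2, 0), (1, 2 * k + 2)]]"
  unfolding points_II by (simp_all add: Pp_II_def Pm_II_def upt_rec)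

lemma (in cvs) realization_II:
  assumes nz: "qp h 1 - qp h (- 1) \<noteq> 0"
  shows "free_field_realization h k sc (Q_II k) (Pp_II k) (Pm_II k)"
proof -
  have "Uq_sl2_relations h k sc
     (\<lambda>n v. sc (1 / (qp h 1 - qp h (-1))) (Sigma_cur h sc (Q_II k) M (Pp_II k) n v))
     (\<lambda>n v. sc (- 1 / (qp h 1 - qp h (-1))) (rescale h sc (2 + k) (Sigma_cur h sc (Q_II k) M (Pm_II k)) n v))
     (rescale h sc (2 + k / 2) (Psi_cur h sc (Q_II k) M (Pm_II k)))
     (rescale h sc (- k / 2) (Psi_cur h sc (Q_II k) M (Pp_II k)))"
    if sm: "seed_module h sc (Q_II k) M" and red: "reduced h sc (Q_II k) M"
      and one: "\<And>v. zprod h sc (Q_II k) (zer M) (map fst (path_points (Pp_II k)) @ map fst (path_points (Pm_II k))) v = v" for M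
  proof -
    interpret S: seed sc h "(Q_II k)" M by unfold_locales (rule sm)
    let ?PM = "[(3, 0), (1, 0), (2, 0), (1, 2 * k + 2), (0, - 2)] :: (nat \<times> complex) list" and ?PP = "[(0, 0), (3, 2 * k + 2)] :: (nat \<times> complex) list"
    let ?As = "[[(0, 0)]] :: (nat \<times> complex) list list" and ?Bs = "[[(3, 0)], [(3, 0), (1, 0)], [(3, 0), (1, 0), (2, 0)], [(3, 0), (1, 0), (2, 0), (1, 2 * k + 2)]] :: (nat \<times> complex) list list"
    note ok = verts_II
    note ev = epsl_def eps_II eps_II[simplified]
    have V: "finite (verts (Q_II k))" by (simp add: ok)
    have okM: "S.okl ?PM" and okP: "S.okl ?PP" by (simp_all add: ok)
    have left: "(\<Sum>(i, e)\<leftarrow>?PP. qp H (- e) * Cmat H (Q_II k) i j) = 0" if "j \<in> verts (Q_II k)" for H j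
      by (rule left_II) (use that ok in simp)
    have right: "(\<Sum>(j, e)\<leftarrow>?PM. qp H e * Cmat H (Q_II k) i j) = 0" if "i \<in> verts (Q_II k)" for H i
      by (rule right_II) (use that ok in simp)
    have cl: "con (Q_II k) ?PP rs [] []" if "S.okl rs" for rs by (rule S.con_left[OF left that])
    have cr: "con (Q_II k) rs ?PM [] []" if "S.okl rs" for rs by (rule S.con_right[OF right that])
    have okA: "S.okl A" if "A \<in> set ?As" for A using that by (auto simp: ok)
    have okB: "S.okl A" if "A \<in> set ?Bs" for A using that by (auto simp: ok)
    have ep0: "epsl (Q_II k) (map fst ?PP) (map fst ?PM) = 0" by (simp add: ev)
    have ww: "S.zp (map fst ?PP @ map fst ?PM) v = v" for v using one[of v] unfolding points_II .
    have mP: "set (map fst ?PP) \<subseteq> verts (Q_II k)" and mM: "set (map fst ?PM) \<subseteq> verts (Q_II k)" by (simp_all add: ok)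
    have bij: "S.zp (map fst ?PP) (S.zp (map fst ?PM) v) = v" for v
      unfolding zprod_append[OF S.zok mP mM] ep0 using ww[of v] by simp
    have bij': "S.zp (map fst ?PM) (S.zp (map fst ?PP) v) = v" for v
      unfolding zprod_append[OF S.zok mM mP] epsl_anti[of _ "map fst ?PM"] ep0
      using ww[of v] zprod_swap[OF S.zok mM mP, of v] by simp
    note cancel = rat_cancel
    note fold' = rat_Cons_num[symmetric]
    have qEE00: "S.quad (2) [(0, 0)] [(0, 0)] c d v = 0" for c d v
      by (rule S.quad_nopole[OF _ _ con_EE_II(1) con_EE_II(1)], simp add: ok, simp add: ok,
          subst cancel, simp add: ev, subst cancel, simp add: ev)
    have qFF00: "S.quad (-2) [(3, 0)] [(3, 0)] c d v = 0" for c d v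
      by (rule S.quad_nopole[OF _ _ con_FF_II(1) con_FF_II(1)], simp add: ok, simp add: ok,
          subst cancel, simp add: ev, subst cancel, simp add: ev)
    have qFF01: "S.quad (-2) [(3, 0)] [(3, 0), (1, 0)] c d v = 0" for c d v
      by (rule S.quad_nopole[OF _ _ con_FF_II(2) con_FF_II(5)], simp add: ok, simp add: ok,
          subst fold', simp add: ev, subst cancel, simp add: ev)
    have qFF02: "S.quad (-2) [(3, 0)] [(3, 0), (1, 0), (2, 0)] c d v = 0" for c d v
      by (rule S.quad_nopole[OF _ _ con_FF_II(3) con_FF_II(9)], simp add: ok, simp add: ok,
          subst fold', simp add: ev, subst cancel, simp add: ev)
    have qFF03: "S.quad (-2) [(3, 0)] [(3, 0), (1, 0), (2, 0), (1, 2 * k + 2)] c d v =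
      sc (qp h (2) * (1 - qp h (-2)) * (1 - qp h (- (2) - (2 * k + 2))) * qp h (- of_int c * (2 * k + 2)))
        (S.cur (shl (2 * k + 2) [(3, 0)] @ [(3, 0), (1, 0), (2, 0), (1, 2 * k + 2)]) (c + d) v)" for c d v
      by (subst S.quad_pole[where a = "2 * k" and b = "2 * k + 2" and s = "2", OF _ _ con_FF_II(4) con_FF_II(13)], simp add: ok, simp add: ok,
          subst fold', simp add: ev algebra_simps minus_diff_commute, subst cancel, simp add: ev algebra_simps minus_diff_commute,
          simp add: ev algebra_simps, simp add: ev)
    have qFF10: "S.quad (-2) [(3, 0), (1, 0)] [(3, 0)] c d v = 0" for c d v
      by (rule S.quad_nopole[OF _ _ con_FF_II(5) con_FF_II(2)], simp add: ok, simp add: ok,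
          subst cancel, simp add: ev, subst fold', simp add: ev)
    have qFF11: "S.quad (-2) [(3, 0), (1, 0)] [(3, 0), (1, 0)] c d v = 0" for c d v
      by (rule S.quad_nopole[OF _ _ con_FF_II(6) con_FF_II(6)], simp add: ok, simp add: ok,
          subst cancel, simp add: ev, subst cancel, simp add: ev)
    have qFF12: "S.quad (-2) [(3, 0), (1, 0)] [(3, 0), (1, 0), (2, 0)] c d v =
      sc (qp h (0) * (1 - qp h (2)) * (1 - qp h (- (2) - (2 * k + 2))) * qp h (- of_int c * (2 * k + 2)))
        (S.cur (shl (2 * k + 2) [(3, 0), (1, 0)] @ [(3, 0), (1, 0), (2, 0)]) (c + d) v)" for c d v
      by (subst S.quad_pole[where a = "2 * k + 4" and b = "2 * k + 2" and s = "2", OF _ _ con_FF_II(7) con_FF_II(10)], simp add: ok, simp add: ok,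
          subst fold', simp add: ev algebra_simps minus_diff_commute, subst cancel, simp add: ev algebra_simps minus_diff_commute,
          simp add: ev algebra_simps, simp add: ev)
    have qFF13: "S.quad (-2) [(3, 0), (1, 0)] [(3, 0), (1, 0), (2, 0), (1, 2 * k + 2)] c d v = 0" for c d v
      by (rule S.quad_nopole[OF _ _ con_FF_II(8) con_FF_II(14)], simp add: ok, simp add: ok,
          subst fold', simp add: ev, subst cancel, simp add: ev)
    have qFF20: "S.quad (-2) [(3, 0), (1, 0), (2, 0)] [(3, 0)] c d v = 0" for c d v
      by (rule S.quad_nopole[OF _ _ con_FF_II(9) con_FF_II(3)], simp add: ok, simp add: ok,
          subst cancel, simp add: ev, subst fold', simp add: ev)
    have qFF21: "S.quad (-2) [(3, 0), (1, 0), (2, 0)] [(3, 0), (1, 0)] c d v =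
      sc (qp h (0) * (1 - qp h (-2)) * (1 - qp h (- (-2) - (- 2 * k - 2))) * qp h (- of_int c * (- 2 * k - 2)))
        (S.cur (shl (- 2 * k - 2) [(3, 0), (1, 0), (2, 0)] @ [(3, 0), (1, 0)]) (c + d) v)" for c d v
      by (subst S.quad_pole[where a = "- 2 * k - 4" and b = "- 2 * k - 2" and s = "-2", OF _ _ con_FF_II(10) con_FF_II(7)], simp add: ok, simp add: ok,
          subst cancel, simp add: ev algebra_simps minus_diff_commute, subst fold', simp add: ev algebra_simps minus_diff_commute,
          simp add: ev algebra_simps, simp add: ev)
    have qFF22: "S.quad (-2) [(3, 0), (1, 0), (2, 0)] [(3, 0), (1, 0), (2, 0)] c d v = 0" for c d v
      by (rule S.quad_nopole[OF _ _ con_FF_II(11) con_FF_II(11)], simp add: ok, simp add: ok,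
          subst cancel, simp add: ev, subst cancel, simp add: ev)
    have qFF23: "S.quad (-2) [(3, 0), (1, 0), (2, 0)] [(3, 0), (1, 0), (2, 0), (1, 2 * k + 2)] c d v = 0" for c d v
      by (rule S.quad_nopole[OF _ _ con_FF_II(12) con_FF_II(15)], simp add: ok, simp add: ok,
          subst fold', simp add: ev, subst cancel, simp add: ev)
    have qFF30: "S.quad (-2) [(3, 0), (1, 0), (2, 0), (1, 2 * k + 2)] [(3, 0)] c d v =
      sc (qp h (-2) * (1 - qp h (2)) * (1 - qp h (- (-2) - (- 2 * k - 2))) * qp h (- of_int c * (- 2 * k - 2)))
        (S.cur (shl (- 2 * k - 2) [(3, 0), (1, 0), (2, 0), (1, 2 * k + 2)] @ [(3, 0)]) (c + d) v)" for c d v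
      by (subst S.quad_pole[where a = "- 2 * k" and b = "- 2 * k - 2" and s = "-2", OF _ _ con_FF_II(13) con_FF_II(4)], simp add: ok, simp add: ok,
          subst cancel, simp add: ev algebra_simps minus_diff_commute, subst fold', simp add: ev algebra_simps minus_diff_commute,
          simp add: ev algebra_simps, simp add: ev)
    have qFF31: "S.quad (-2) [(3, 0), (1, 0), (2, 0), (1, 2 * k + 2)] [(3, 0), (1, 0)] c d v = 0" for c d v
      by (rule S.quad_nopole[OF _ _ con_FF_II(14) con_FF_II(8)], simp add: ok, simp add: ok,
          subst cancel, simp add: ev, subst fold', simp add: ev)
    have qFF32: "S.quad (-2) [(3, 0), (1, 0), (2, 0), (1, 2 * k + 2)] [(3, 0), (1, 0), (2, 0)] c d v = 0" for c d v
      by (rule S.quad_nopole[OF _ _ con_FF_II(15) con_FF_II(12)], simp add: ok, simp add: ok,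
          subst cancel, simp add: ev, subst fold', simp add: ev)
    have qFF33: "S.quad (-2) [(3, 0), (1, 0), (2, 0), (1, 2 * k + 2)] [(3, 0), (1, 0), (2, 0), (1, 2 * k + 2)] c d v = 0" for c d v
      by (rule S.quad_nopole[OF _ _ con_FF_II(16) con_FF_II(16)], simp add: ok, simp add: ok,
          subst cancel, simp add: ev, subst cancel, simp add: ev)
    have EE: "(\<Sum>A\<leftarrow>?As. \<Sum>B\<leftarrow>?As. S.quad 2 A B c d v) = 0" for c d v
      by (simp only: list.map sum_list.Cons sum_list.Nil qEE00 add_0_left add_0_right)
    \<comment> \<open>Both pairs have their pole at z = q^(2k+2) w, and there the two products
      coincide: the factor X_1(q^(2k+2) w) belongs to the long term of one pair and to the left
      factor of the other. The residues are q^2 - 1 and 1 - q^2 times a common number.\<close>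
    have sum03: "S.quad (- 2) [(3, 0)] [(3, 0), (1, 0), (2, 0), (1, 2 * k + 2)] c d v + S.quad (- 2) [(3, 0), (1, 0)] [(3, 0), (1, 0), (2, 0)] c d v = 0" for c d v
    proof -
      have m: "S.cur (shl (2 * k + 2) [(3, 0), (1, 0)] @ [(3, 0), (1, 0), (2, 0)]) (c + d) v = S.cur (shl (2 * k + 2) [(3, 0)] @ [(3, 0), (1, 0), (2, 0), (1, 2 * k + 2)]) (c + d) v"
        by (rule S.cur_mset) (simp_all add: ok shl_def algebra_simps)
      have e: "qp h (2) * (1 - qp h (-2)) + qp h 0 * (1 - qp h (2)) = 0"
        by (simp add: algebra_simps qp_add[symmetric])
      have "(qp h (2) * (1 - qp h (-2))) * x * y + (qp h 0 * (1 - qp h (2))) * x * y = 0" for x y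
        unfolding distrib_right[symmetric] e by simp
      then show ?thesis unfolding qFF03 qFF12 m scale_left_distrib[symmetric] by (simp only: minus_minus scale_zero_left)
    qed
    have sum30: "S.quad (- 2) [(3, 0), (1, 0), (2, 0), (1, 2 * k + 2)] [(3, 0)] c d v + S.quad (- 2) [(3, 0), (1, 0), (2, 0)] [(3, 0), (1, 0)] c d v = 0" for c d v
    proof -
      have m: "S.cur (shl (- 2 * k - 2) [(3, 0), (1, 0), (2, 0)] @ [(3, 0), (1, 0)]) (c + d) v = S.cur (shl (- 2 * k - 2) [(3, 0), (1, 0), (2, 0), (1, 2 * k + 2)] @ [(3, 0)]) (c + d) v"
        by (rule S.cur_mset) (simp_all add: ok shl_def algebra_simps)
      have e: "qp h (-2) * (1 - qp h (2)) + qp h 0 * (1 - qp h (-2)) = 0"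
        by (simp add: algebra_simps qp_add[symmetric])
      have "(qp h (-2) * (1 - qp h (2))) * x * y + (qp h 0 * (1 - qp h (-2))) * x * y = 0" for x y
        unfolding distrib_right[symmetric] e by simp
      then show ?thesis unfolding qFF30 qFF21 m scale_left_distrib[symmetric] by (simp only: minus_minus scale_zero_left)
    qed
    have FF: "(\<Sum>A\<leftarrow>?Bs. \<Sum>B\<leftarrow>?Bs. S.quad (- 2) A B c d v) = 0" for c d v
    proof -
      have "(\<Sum>A\<leftarrow>?Bs. \<Sum>B\<leftarrow>?Bs. S.quad (- 2) A B c d v) =
        (S.quad (- 2) [(3, 0)] [(3, 0), (1, 0), (2, 0), (1, 2 * k + 2)] c d v + S.quad (- 2) [(3, 0), (1, 0)] [(3, 0), (1, 0), (2, 0)] c d v) +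
        (S.quad (- 2) [(3, 0), (1, 0), (2, 0), (1, 2 * k + 2)] [(3, 0)] c d v + S.quad (- 2) [(3, 0), (1, 0), (2, 0)] [(3, 0), (1, 0)] c d v)"
        by (simp only: list.map sum_list.Cons sum_list.Nil qFF00 qFF01 qFF02 qFF10 qFF11 qFF13 qFF20 qFF22 qFF23 qFF31 qFF32 qFF33 add_0_left add_0_right add.assoc) (simp only: add_ac)
      then show ?thesis unfolding sum03 sum30 by simp
    qed
    have c00: "S.cur [(0, 0)] c (S.cur [(3, 0)] d v) - S.cur [(3, 0)] d (S.cur [(0, 0)] c v) =
      sc ((qp h 1 - qp h (- 1)) * qp h (- (2 * k + 2) * of_int d)) (S.cur ?PP (c + d) v)" for c d v
    proof -
      have "S.cur (shl (- 2 * k - 2) [(0, 0)] @ [(3, 0)]) (c + d) v = S.cur (shl (- 2 * k - 2) ?PP) (c + d) v"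
        by (rule S.cur_mset) (simp_all add: ok shl_def algebra_simps)
      then have m: "S.cur (shl (- 2 * k - 2) [(0, 0)] @ [(3, 0)]) (c + d) v = sc (qp h ((- 2 * k - 2) * of_int (c + d))) (S.cur ?PP (c + d) v)"
        by (simp only: S.cur_shl[OF okP])
      have con': "con (Q_II k) [(3, 0)] [(0, 0)] [- (- 2 * k - 4)] [- (- 2 * k - 2)]"
        using con_EF_II(2)[of k] by (simp add: algebra_simps minus_diff_commute)
      have "S.cur [(0, 0)] c (S.cur [(3, 0)] d v) - S.cur [(3, 0)] d (S.cur [(0, 0)] c v) =
        sc ((qp h (S.ep [(0, 0)] [(3, 0)]) - qp h (- S.ep [(0, 0)] [(3, 0)])) * qp h (- of_int c * (- 2 * k - 2)))
          (S.cur (shl (- 2 * k - 2) [(0, 0)] @ [(3, 0)]) (c + d) v)"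
        by (rule S.cur_comm_pole[OF _ _ con_EF_II(1) con']) (simp_all add: ok ev)
      moreover have "qp h (- of_int c * (- 2 * k - 2)) * qp h ((- 2 * k - 2) * of_int (c + d)) = qp h (- (2 * k + 2) * of_int d)"
        unfolding qp_add[symmetric] by (simp add: algebra_simps)
      ultimately show ?thesis unfolding m scale_scale mult.assoc by (simp add: ev)
    qed
    have c01: "S.cur [(0, 0)] c (S.cur [(3, 0), (1, 0)] d v) = S.cur [(3, 0), (1, 0)] d (S.cur [(0, 0)] c v)" for c d v
      by (rule S.cur_comm0[OF _ _ con_EF_II(3) con_EF_II(4)]) (simp_all add: ok ev)
    have c02: "S.cur [(0, 0)] c (S.cur [(3, 0), (1, 0), (2, 0)] d v) = S.cur [(3, 0), (1, 0), (2, 0)] d (S.cur [(0, 0)] c v)" for c d v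
      by (rule S.cur_comm0[OF _ _ con_EF_II(5) con_EF_II(6)]) (simp_all add: ok ev)
    have c03: "S.cur [(0, 0)] c (S.cur [(3, 0), (1, 0), (2, 0), (1, 2 * k + 2)] d v) - S.cur [(3, 0), (1, 0), (2, 0), (1, 2 * k + 2)] d (S.cur [(0, 0)] c v) =
      sc (- ((qp h 1 - qp h (- 1)) * qp h (2 * of_int c))) (S.cur ?PM (c + d) v)" for c d v
    proof -
      have m: "S.cur (shl (- 2) [(0, 0)] @ [(3, 0), (1, 0), (2, 0), (1, 2 * k + 2)]) (c + d) v = S.cur ?PM (c + d) v"
        by (rule S.cur_mset) (simp_all add: ok shl_def algebra_simps)
      have con': "con (Q_II k) [(3, 0), (1, 0), (2, 0), (1, 2 * k + 2)] [(0, 0)] [- (0)] [- (- 2)]"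
        using con_EF_II(8)[of k] by (simp add: algebra_simps minus_diff_commute)
      have "S.cur [(0, 0)] c (S.cur [(3, 0), (1, 0), (2, 0), (1, 2 * k + 2)] d v) - S.cur [(3, 0), (1, 0), (2, 0), (1, 2 * k + 2)] d (S.cur [(0, 0)] c v) =
        sc ((qp h (S.ep [(0, 0)] [(3, 0), (1, 0), (2, 0), (1, 2 * k + 2)]) - qp h (- S.ep [(0, 0)] [(3, 0), (1, 0), (2, 0), (1, 2 * k + 2)])) * qp h (- of_int c * (- 2)))
          (S.cur (shl (- 2) [(0, 0)] @ [(3, 0), (1, 0), (2, 0), (1, 2 * k + 2)]) (c + d) v)"
        by (rule S.cur_comm_pole[OF _ _ con_EF_II(7) con']) (simp_all add: ok ev)
      then show ?thesis unfolding m by (simp add: ev algebra_simps)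
    qed
    have EF: "S.Scur ?As c (S.Scur ?Bs d v) - S.Scur ?Bs d (S.Scur ?As c v) = sc (qp h 1 - qp h (- 1))
       (sc (qp h (- (2 * k + 2) * of_int d)) (S.cur ?PP (c + d) v) - sc (qp h (2 * of_int c)) (S.cur ?PM (c + d) v))" for c d v
    proof -
      have SA: "S.Scur ?As c (S.Scur Bs d v) = (\<Sum>A\<leftarrow>?As. \<Sum>B\<leftarrow>Bs. S.cur A c (S.cur B d v))" for Bs
        by (rule S.Scur_Scur) (rule okA)
      have SB: "S.Scur ?Bs d (S.Scur As c v) = (\<Sum>A\<leftarrow>?Bs. \<Sum>B\<leftarrow>As. S.cur A d (S.cur B c v))" for As
        by (rule S.Scur_Scur) (rule okB)
      have "S.Scur ?As c (S.Scur ?Bs d v) - S.Scur ?Bs d (S.Scur ?As c v) = (S.cur [(0, 0)] c (S.cur [(3, 0)] d v) - S.cur [(3, 0)] d (S.cur [(0, 0)] c v)) + (S.cur [(0, 0)] c (S.cur [(3, 0), (1, 0), (2, 0), (1, 2 * k + 2)] d v) - S.cur [(3, 0), (1, 0), (2, 0), (1, 2 * k + 2)] d (S.cur [(0, 0)] c v))"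
        unfolding SA SB
        by (simp only: list.map sum_list.Cons sum_list.Nil c01 c02 add_0_left add_0_right) (simp del: One_nat_def add: algebra_simps)
      then show ?thesis unfolding c00 c03 by (simp add: scale_right_diff_distrib)
    qed
    have psiA: "con (Q_II k) ?PM A [0] [4] \<and> con (Q_II k) A ?PP [- 2] [2]" if "A \<in> set ?As" for A
      using that con_psi_II(1)[of k] con_psi_II(2)[of k] by auto
    have psiB: "con (Q_II k) ?PM A [2] [- 2] \<and> con (Q_II k) A ?PP [2 * k + 4] [2 * k]" if "A \<in> set ?Bs" for A
      using that con_psi_II(3)[of k] con_psi_II(4)[of k] con_psi_II(5)[of k] con_psi_II(6)[of k] con_psi_II(7)[of k] con_psi_II(8)[of k] con_psi_II(9)[of k] con_psi_II(10)[of k] by auto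
    have epA: "S.ep ?PM A = 1 \<and> S.ep ?PP A = - 1" if "A \<in> set ?As" for A using that by (auto simp: ev)
    have epB: "S.ep ?PM A = - 1 \<and> S.ep ?PP A = 1" if "A \<in> set ?Bs" for A using that by (auto simp: ev)
    have MP: "con (Q_II k) ?PM ?PP [0, 4 + 2 * k] [4, 2 * k]" using con_MP_II[of k] by (simp add: add.commute)
    have epMP: "S.ep ?PM ?PP = 0" using ep0 by (subst S.ep_anti) simp
    have "Uq_sl2_relations h k sc
     (\<lambda>n v. sc (1 / (qp h 1 - qp h (- 1))) (S.Scur ?As (- n) v))
     (\<lambda>n v. sc (- 1 / (qp h 1 - qp h (- 1))) (sc (qp h (- of_int n * (2 + k))) (S.Scur ?Bs (- n) v)))
     (\<lambda>n v. sc (qp h (- of_int n * (2 + k / 2))) (S.cur ?PM (- n) v))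
     (\<lambda>n v. sc (qp h (- of_int n * (- k / 2))) (S.cur ?PP (- n) v))"
    proof (rule S.Uq_criterion[OF nz okM S.reduced_right[OF red V okM right] okP S.reduced_left[OF red V okP left] bij' bij
          cr[OF okM] cl[OF okP] MP cl[OF okM] epMP okA _ _ okB _ _ EE FF EF])
      show "con (Q_II k) ?PM A [0] [4] \<and> con (Q_II k) A ?PM [] [] \<and> S.ep ?PM A = 1" if "A \<in> set ?As" for A
        by (intro conjI conjunct1[OF psiA[OF that]] cr[OF okA[OF that]] conjunct1[OF epA[OF that]])
      show "con (Q_II k) ?PP A [] [] \<and> con (Q_II k) A ?PP [- 2] [2] \<and> S.ep ?PP A = - 1" if "A \<in> set ?As" for A
        by (intro conjI conjunct2[OF psiA[OF that]] cl[OF okA[OF that]] conjunct2[OF epA[OF that]])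
      show "con (Q_II k) ?PM A [2] [- 2] \<and> con (Q_II k) A ?PM [] [] \<and> S.ep ?PM A = - 1" if "A \<in> set ?Bs" for A
        by (intro conjI conjunct1[OF psiB[OF that]] cr[OF okB[OF that]] conjunct1[OF epB[OF that]])
      show "con (Q_II k) ?PP A [] [] \<and> con (Q_II k) A ?PP [2 * k + 4] [2 * k] \<and> S.ep ?PP A = 1" if "A \<in> set ?Bs" for A
        by (intro conjI conjunct2[OF psiB[OF that]] cl[OF okB[OF that]] conjunct2[OF epB[OF that]])
    qed
    then show ?thesis
      unfolding rescale_def[abs_def] S.Psi_cur_cur S.Sigma_cur_Scur[OF terms_II(1)] S.Sigma_cur_Scur[OF terms_II(2)] points_II .
  qed
  moreover have "walk (Q_II k) (fst (Pp_II k)) (snd (Pp_II k))" "walk (Q_II k) (fst (Pm_II k)) (snd (Pm_II k))"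
    by (simp_all add: Pp_II_def Pm_II_def Q_II_def)
  moreover have "(\<Sum>j\<leftarrow>map fst (path_points (Pp_II k)) @ map fst (path_points (Pm_II k)). eps (Q_II k) i j) = 0" if "i \<in> verts (Q_II k)" for i
    using that unfolding points_II by (auto simp: verts_II eps_II eps_II[simplified])
  ultimately show ?thesis unfolding free_field_realization_def Let_def by blast
qed

subsection \<open>Diagonalizable operators\<close>

context cvs
begin

lemma eig_indep:
  assumes T: "lin T" and S: "finite S" and g: "\<And>x. x \<in> S \<Longrightarrow> T (g x) = sc x (g x)" and z: "(\<Sum>x\<in>S. g x) = 0"
  shows "\<forall>x\<in>S. g x = 0"
  using S g z
proof (induction S arbitrary: g rule: finite_induct)
  case (insert a S)
  define k where "k x = sc (x - a) (g x)" for x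
  have "T (\<Sum>x\<in>insert a S. g x) - sc a (\<Sum>x\<in>insert a S. g x) = (\<Sum>x\<in>insert a S. k x)"
    unfolding lin_sum[OF T] scale_sum_right sum_subtractf[symmetric] k_def
    by (rule sum.cong[OF refl]) (simp add: insert.prems(1) scale_left_diff_distrib)
  then have "(\<Sum>x\<in>S. k x) = 0"
    unfolding insert.prems(2) using insert.hyps by (simp add: lin_zero[OF T] k_def)
  moreover have "T (k x) = sc x (k x)" if "x \<in> S" for x
    using insert.prems(1)[of x] that by (simp add: k_def lin_sc[OF T] mult.commute)
  ultimately have "\<forall>x\<in>S. k x = 0" by (intro insert.IH)
  then have "\<forall>x\<in>S. g x = 0" using insert.hyps by (auto simp: k_def)
  then show ?case using insert.prems(2) insert.hyps by simp
qed simp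

lemma eigdec_sum: "eigdec sc T v f \<Longrightarrow> finite S \<Longrightarrow> {\<mu>. f \<mu> \<noteq> 0} \<subseteq> S \<Longrightarrow> v = (\<Sum>\<mu>\<in>S. f \<mu>)"
  unfolding eigdec_def by (metis (mono_tags, lifting) mem_Collect_eq sum.mono_neutral_left DiffD2)

lemma eigdec_unique:
  assumes T: "lin T" and f: "eigdec sc T v f" and g: "eigdec sc T v g"
  shows "f = g"
proof
  fix \<mu>
  define S where "S = insert \<mu> ({x. f x \<noteq> 0} \<union> {x. g x \<noteq> 0})"
  have S: "finite S" using f g by (auto simp: S_def eigdec_def)
  have "(\<Sum>x\<in>S. f x) = (\<Sum>x\<in>S. g x)"
    using eigdec_sum[OF f S] eigdec_sum[OF g S] by (auto simp: S_def)
  then have z: "(\<Sum>x\<in>S. f x - g x) = 0" by (simp add: sum_subtractf)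
  have e: "T (f x - g x) = sc x (f x - g x)" for x
    using f g by (simp add: eigdec_def lin_diff[OF T] scale_right_diff_distrib)
  have "\<forall>x\<in>S. f x - g x = 0" by (rule eig_indep[OF T S e z])
  then show "f \<mu> = g \<mu>" by (simp add: S_def)
qed

lemma eigcomp_eq: "lin T \<Longrightarrow> eigdec sc T v f \<Longrightarrow> eigcomp sc T v = f"
  unfolding eigcomp_def by (rule the_equality) (auto intro: eigdec_unique)

lemma eigdec_of_sum:
  assumes T: "lin T" and S: "finite S" and u: "\<And>i. i \<in> S \<Longrightarrow> T (u i) = sc (m i) (u i)" and v: "v = (\<Sum>i\<in>S. u i)"
  shows "eigdec sc T v (\<lambda>\<mu>. \<Sum>i\<in>{i\<in>S. m i = \<mu>}. u i)"
  unfolding eigdec_def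
proof (intro conjI allI)
  have sub: "{\<mu>. (\<Sum>i\<in>{i\<in>S. m i = \<mu>}. u i) \<noteq> 0} \<subseteq> m ` S"
    by (auto elim!: sum.not_neutral_contains_not_neutral)
  then show fin: "finite {\<mu>. (\<Sum>i\<in>{i\<in>S. m i = \<mu>}. u i) \<noteq> 0}" using S finite_subset by blast
  show "T (\<Sum>i\<in>{i\<in>S. m i = \<mu>}. u i) = sc \<mu> (\<Sum>i\<in>{i\<in>S. m i = \<mu>}. u i)" for \<mu>
    unfolding lin_sum[OF T] scale_sum_right by (rule sum.cong) (auto simp: u)
  have "(\<Sum>\<mu> | (\<Sum>i\<in>{i\<in>S. m i = \<mu>}. u i) \<noteq> 0. \<Sum>i\<in>{i\<in>S. m i = \<mu>}. u i) = (\<Sum>\<mu>\<in>m ` S. \<Sum>i\<in>{i\<in>S. m i = \<mu>}. u i)"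
    by (rule sum.mono_neutral_left) (use sub S in auto)
  also have "\<dots> = v" unfolding v by (rule sum.image_gen[OF S, symmetric])
  finally show "v = (\<Sum>\<mu> | (\<Sum>i\<in>{i\<in>S. m i = \<mu>}. u i) \<noteq> 0. \<Sum>i\<in>{i\<in>S. m i = \<mu>}. u i)" ..
qed

lemma diag_lin: "diagonalizable sc S T \<Longrightarrow> lin T" by (simp add: diagonalizable_def)

lemma diag_eigcomp: "diagonalizable sc S T \<Longrightarrow> eigdec sc T v (eigcomp sc T v)"
  unfolding diagonalizable_def using eigcomp_eq by metis

lemma diagD:
  assumes "diagonalizable sc S T"
  obtains I f where "finite I" "I \<subseteq> S" "\<And>\<mu>. T (f \<mu>) = sc \<mu> (f \<mu>)" "v = (\<Sum>\<mu>\<in>I. f \<mu>)"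
proof -
  obtain f where "eigdec sc T v f" "{\<mu>. f \<mu> \<noteq> 0} \<subseteq> S" using assms unfolding diagonalizable_def by blast
  then show thesis using that[of "{\<mu>. f \<mu> \<noteq> 0}" f] unfolding eigdec_def by blast
qed

text \<open>The slope \<open>a\<close> may vanish and eigenvalues may then merge, so eigenvectors
  are regrouped instead of relabelled. Slope 0 does occur below, for products of total charge
  0.\<close>

lemma diag_affine:
  assumes T: "diagonalizable sc S T" and T': "\<And>v. T' v = sc a (T v) + sc b v"
  shows "diagonalizable sc UNIV T'"
proof -
  have "T' = (\<lambda>v. sc a (T v) + sc b v)" using T' by auto
  then have l: "lin T'" using lin_plus[OF lin_scale[OF diag_lin[OF T]] lin_scale[OF lin_id]] by simp
  show ?thesis unfolding diagonalizable_def
  proof (intro conjI l allI)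
    fix v
    obtain I f where I: "finite I" and f: "\<And>\<mu>. T (f \<mu>) = sc \<mu> (f \<mu>)" and v: "v = (\<Sum>\<mu>\<in>I. f \<mu>)" using diagD[OF T, of v] by metis
    have "eigdec sc T' v (\<lambda>\<mu>. \<Sum>i\<in>{i\<in>I. a * i + b = \<mu>}. f i)"
      by (rule eigdec_of_sum[OF l I _ v]) (simp add: T' f scale_left_distrib)
    then show "\<exists>f. eigdec sc T' v f \<and> {\<mu>. f \<mu> \<noteq> 0} \<subseteq> UNIV" by blast
  qed
qed

lemma eig_single:
  assumes T: "lin T" and e: "T v = sc \<mu> v" shows "eigcomp sc T v = (\<lambda>\<nu>. if \<nu> = \<mu> then v else 0)"
proof -
  have "eigdec sc T v (\<lambda>\<nu>. if \<nu> = \<mu> then v else 0)"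
    unfolding eigdec_def by (cases "v = 0") (auto simp: e lin_zero[OF T])
  then show ?thesis by (rule eigcomp_eq[OF T])
qed

lemma opfun_eig: "lin T \<Longrightarrow> T v = sc \<mu> v \<Longrightarrow> opfun sc g T v = sc (g \<mu>) v"
  unfolding opfun_def by (cases "v = 0") (auto simp: eig_single)

lemma vop_eig:
  assumes T: "lin T" and e: "T v = sc \<mu> v" and a: "fam a" and U: "lin U"
  shows "vop sc U T a c v = (if c - \<mu> \<in> \<int> then U (bexp sc a \<lfloor>Re (c - \<mu>)\<rfloor> v) else 0)"
proof (cases "v = 0 \<or> c - \<mu> \<notin> \<int>")
  case True
  then have "{x. eigcomp sc T v x \<noteq> 0 \<and> c - x \<in> \<int>} = {}" by (auto simp: eig_single[OF T e])
  then have "vop sc U T a c v = 0" unfolding vop_def by (simp only: sum.empty)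
  then show ?thesis using True lin_zero[OF bexp_lin[OF a]] lin_zero[OF U] by auto
next
  case False
  then have "{x. eigcomp sc T v x \<noteq> 0 \<and> c - x \<in> \<int>} = {\<mu>}" by (auto simp: eig_single[OF T e])
  then show ?thesis unfolding vop_def using False by (simp add: eig_single[OF T e])
qed

lemma eigcomp_fin: "diagonalizable sc S T \<Longrightarrow> finite {\<mu>. eigcomp sc T v \<mu> \<noteq> 0}"
  using diag_eigcomp[of S T v] by (simp add: eigdec_def)

lemma eigcomp_add:
  assumes T: "diagonalizable sc S T"
  shows "eigcomp sc T (u + v) = (\<lambda>\<mu>. eigcomp sc T u \<mu> + eigcomp sc T v \<mu>)"
proof (rule eigcomp_eq[OF diag_lin[OF T]])
  let ?f = "eigcomp sc T u" and ?g = "eigcomp sc T v"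
  define S where "S = {\<mu>. ?f \<mu> \<noteq> 0} \<union> {\<mu>. ?g \<mu> \<noteq> 0}"
  have f: "eigdec sc T u ?f" and g: "eigdec sc T v ?g" by (rule diag_eigcomp[OF T])+
  have S: "finite S" using eigcomp_fin[OF T] by (simp add: S_def)
  have sub: "{\<mu>. ?f \<mu> + ?g \<mu> \<noteq> 0} \<subseteq> S" by (auto simp: S_def)
  have "u + v = (\<Sum>\<mu>\<in>S. ?f \<mu> + ?g \<mu>)"
    using eigdec_sum[OF f S] eigdec_sum[OF g S] by (auto simp: S_def sum.distrib)
  also have "\<dots> = (\<Sum>\<mu> | ?f \<mu> + ?g \<mu> \<noteq> 0. ?f \<mu> + ?g \<mu>)"
    by (rule sum.mono_neutral_right) (use S sub in auto)
  finally show "eigdec sc T (u + v) (\<lambda>\<mu>. ?f \<mu> + ?g \<mu>)"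
    using f g finite_subset[OF sub S] unfolding eigdec_def by (simp add: lin_add[OF diag_lin[OF T]] scale_right_distrib)
qed

lemma eigcomp_sc:
  assumes T: "diagonalizable sc S T"
  shows "eigcomp sc T (sc c v) = (\<lambda>\<mu>. sc c (eigcomp sc T v \<mu>))"
proof (rule eigcomp_eq[OF diag_lin[OF T]])
  let ?g = "eigcomp sc T v"
  have g: "eigdec sc T v ?g" by (rule diag_eigcomp[OF T])
  have sub: "{\<mu>. sc c (?g \<mu>) \<noteq> 0} \<subseteq> {\<mu>. ?g \<mu> \<noteq> 0}" by auto
  have "v = (\<Sum>\<mu> | ?g \<mu> \<noteq> 0. ?g \<mu>)" using g unfolding eigdec_def by blast
  then have "sc c v = sc c (\<Sum>\<mu> | ?g \<mu> \<noteq> 0. ?g \<mu>)" by (rule arg_cong)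
  then have "sc c v = (\<Sum>\<mu> | ?g \<mu> \<noteq> 0. sc c (?g \<mu>))" unfolding scale_sum_right .
  also have "\<dots> = (\<Sum>\<mu> | sc c (?g \<mu>) \<noteq> 0. sc c (?g \<mu>))"
    by (rule sum.mono_neutral_right) (use eigcomp_fin[OF T] sub in auto)
  finally show "eigdec sc T (sc c v) (\<lambda>\<mu>. sc c (?g \<mu>))"
    using g finite_subset[OF sub eigcomp_fin[OF T]] unfolding eigdec_def
    by (simp add: lin_sc[OF diag_lin[OF T]] mult.commute)
qed

lemma eig_map_lin:
  assumes T: "diagonalizable sc S T" and G: "\<And>\<mu>. lin (G \<mu>)"
  shows "lin (\<lambda>v. \<Sum>\<mu> | eigcomp sc T v \<mu> \<noteq> 0. G \<mu> (eigcomp sc T v \<mu>))"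
proof -
  have e: "(\<Sum>\<mu> | eigcomp sc T v \<mu> \<noteq> 0. G \<mu> (eigcomp sc T v \<mu>)) = Sum_any (\<lambda>\<mu>. G \<mu> (eigcomp sc T v \<mu>))" for v
    by (rule Sum_any.expand_superset[symmetric, OF eigcomp_fin[OF T]]) (auto simp: lin_zero[OF G])
  have fin: "finite {\<mu>. G \<mu> (eigcomp sc T v \<mu>) \<noteq> 0}" for v
    by (rule finite_subset[OF _ eigcomp_fin[OF T, of v]]) (auto simp: lin_zero[OF G])
  show ?thesis unfolding e lin_iff
    by (auto simp: eigcomp_add[OF T] eigcomp_sc[OF T] lin_add[OF G] lin_sc[OF G] Sum_any.distrib[OF fin fin] sc_Sum_any[OF fin])
qed

lemma opfun_lin: "diagonalizable sc S T \<Longrightarrow> lin (opfun sc g T)"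
  using eig_map_lin[of S T "\<lambda>\<mu> v. sc (g \<mu>) v"] lin_scale[OF lin_id] by (simp add: opfun_def[abs_def])

lemma vop_lin:
  assumes T: "diagonalizable sc S T" and a: "fam a" and U: "lin U"
  shows "lin (vop sc U T a c)"
proof -
  define G where "G \<mu> v = (if c - \<mu> \<in> \<int> then U (bexp sc a \<lfloor>Re (c - \<mu>)\<rfloor> v) else 0)" for \<mu> v
  have G: "lin (G \<mu>)" for \<mu>
    unfolding G_def by (cases "c - \<mu> \<in> \<int>") (simp_all add: lin_comp[OF U bexp_lin[OF a]] lin_const0)
  have "vop sc U T a c v = (\<Sum>\<mu> | eigcomp sc T v \<mu> \<noteq> 0. G \<mu> (eigcomp sc T v \<mu>))" for v
    unfolding vop_def
    by (rule sum.mono_neutral_cong_left) (use eigcomp_fin[OF T] in \<open>auto simp: G_def\<close>)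
  then have "vop sc U T a c = (\<lambda>v. \<Sum>\<mu> | eigcomp sc T v \<mu> \<noteq> 0. G \<mu> (eigcomp sc T v \<mu>))" by auto
  then show ?thesis using eig_map_lin[OF T G] by simp
qed

text \<open>Operators such as z^T are defined through eigencomponents; this turns identities between
  them into computations with numbers on eigenvectors.\<close>

lemma eig_ext:
  assumes T: "diagonalizable sc S T" and f: "lin f" and g: "lin g"
    and e: "\<And>\<mu> v. \<mu> \<in> S \<Longrightarrow> T v = sc \<mu> v \<Longrightarrow> f v = g v"
  shows "f v = g v"
proof -
  obtain I u where "finite I" "I \<subseteq> S" and u: "\<And>\<mu>. T (u \<mu>) = sc \<mu> (u \<mu>)" and v: "v = (\<Sum>\<mu>\<in>I. u \<mu>)"
    using diagD[OF T, of v] by metis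
  then have "f (u \<mu>) = g (u \<mu>)" if "\<mu> \<in> I" for \<mu> using e that by blast
  then show ?thesis unfolding v lin_sum[OF f] lin_sum[OF g] by (rule sum.cong[OF refl])
qed

text \<open>L - \<mu> commutes with T, so it maps the components of v to eigenvectors of T for
  distinct eigenvalues whose sum is 0; each component is therefore killed by it.\<close>

lemma eig_joint_dec:
  assumes T: "diagonalizable sc S T" and L: "lin L" and c: "\<And>v. L (T v) = T (L v)" and e: "L v = sc \<mu> v"
  obtains I u where "finite I" "I \<subseteq> S" "\<And>\<nu>. T (u \<nu>) = sc \<nu> (u \<nu>)" "\<And>\<nu>. L (u \<nu>) = sc \<mu> (u \<nu>)" "v = (\<Sum>\<nu>\<in>I. u \<nu>)"
proof -
  obtain u where u: "eigdec sc T v u" "{\<nu>. u \<nu> \<noteq> 0} \<subseteq> S" using T unfolding diagonalizable_def by blast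
  have lT: "lin T" by (rule diag_lin[OF T])
  define I where "I = {\<nu>. u \<nu> \<noteq> 0}"
  have I: "finite I" and v: "v = (\<Sum>\<nu>\<in>I. u \<nu>)" and Tu: "\<And>\<nu>. T (u \<nu>) = sc \<nu> (u \<nu>)"
    using u unfolding eigdec_def I_def by auto
  have "(\<Sum>\<nu>\<in>I. L (u \<nu>) - sc \<mu> (u \<nu>)) = 0"
    unfolding sum_subtractf lin_sum[OF L, symmetric] scale_sum_right[symmetric] v[symmetric] e by simp
  moreover have "T (L (u \<nu>) - sc \<mu> (u \<nu>)) = sc \<nu> (L (u \<nu>) - sc \<mu> (u \<nu>))" for \<nu>
    by (simp add: lin_diff[OF lT] lin_sc[OF lT] c[symmetric] Tu lin_sc[OF L] scale_right_diff_distrib mult.commute)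
  ultimately have "\<forall>\<nu>\<in>I. L (u \<nu>) - sc \<mu> (u \<nu>) = 0" by (intro eig_indep[OF lT I])
  then have "L (u \<nu>) = sc \<mu> (u \<nu>)" for \<nu> by (cases "\<nu> \<in> I") (auto simp: I_def lin_zero[OF L])
  then show thesis using that[OF I _ Tu _ v] u(2) I_def by blast
qed

lemma diag_eigval:
  assumes T: "diagonalizable sc S T" and e: "T v = sc \<mu> v" and v: "v \<noteq> 0" shows "\<mu> \<in> S"
proof -
  obtain f where f: "eigdec sc T v f" "{\<nu>. f \<nu> \<noteq> 0} \<subseteq> S" using T unfolding diagonalizable_def by blast
  have "f = (\<lambda>\<nu>. if \<nu> = \<mu> then v else 0)"
    using eigcomp_eq[OF diag_lin[OF T] f(1)] eig_single[OF diag_lin[OF T] e] by simp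
  then show ?thesis using f(2) v by auto
qed

end

subsection \<open>Currents in terms of fermions\<close>

text \<open>
  Vertex operators \<open>X\<^sub>i(z)\<close> that are products of fermions, with bosonization \<open>J\<close>, \<open>Y\<close>, \<open>y\<^sub>n\<close>, and of
  operators \<open>V\<^sub>i(z)\<close> commuting with the fermions; \<open>X\<^sub>k(z)\<close> itself is the case \<open>V\<^sub>k = 1\<close>. Both a
  fermionization and the result of its mutation are of this kind.
\<close>

locale frame = cvs sc for sc :: "complex \<Rightarrow> 'v::ab_group_add \<Rightarrow> 'v" +
  fixes h :: complex and Q :: "'i dquiver" and M :: "('i, 'v) seed_ops" and kk :: 'i
    and J Y Yi p :: "'v \<Rightarrow> 'v" and V :: "'i \<Rightarrow> 'v \<Rightarrow> 'v" and sg cc :: "'i \<Rightarrow> complex"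
    and y :: "int \<Rightarrow> 'v \<Rightarrow> 'v" and w :: "'i \<Rightarrow> int \<Rightarrow> 'v \<Rightarrow> 'v" and ga :: "'i \<Rightarrow> int \<Rightarrow> complex"
    and bw :: "'i \<Rightarrow> 'i \<Rightarrow> nat \<Rightarrow> complex"
  assumes dJ: "diagonalizable sc UNIV J" and dp: "diagonalizable sc UNIV p"
    and dD: "diagonalizable sc \<int> (\<lambda>v. J v - p v)"
    and Ylin: "lin Y" and Vlin: "i \<in> verts Q \<Longrightarrow> lin (V i)"
    and YYi: "Y (Yi v) = v" and YiY: "Yi (Y v) = v" and JY: "J (Y v) = Y (J v + v)"
    and Jp: "J (p v) = p (J v)" and Yp: "Y (p v) = p (Y v)"
    and eps1: "i \<in> verts Q \<Longrightarrow> eps Q i kk \<in> {- 1, 0, 1}"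
    and zer: "i \<in> verts Q \<Longrightarrow> zer M i v = sc (sg i) (weyl h sc J Y Yi (eps Q i kk) (cc i) (V i v))"
    and VJ: "i \<in> verts Q \<Longrightarrow> V i (J v) = J (V i v)" and VY: "i \<in> verts Q \<Longrightarrow> V i (Y v) = Y (V i v)"
    and pV: "i \<in> verts Q \<Longrightarrow> p (V i v) = V i (p v + sc (of_int (eps Q i kk)) v)"
    and ysm: "smooth {kk} (\<lambda>_. y)" and ypc: "cfam (\<lambda>n. y (int n))" and ymc: "cfam (\<lambda>n. y (- int n))"
    and wx: "xfam (verts Q) w bw"
    and Jy: "n \<noteq> 0 \<Longrightarrow> J (y n v) = y n (J v)" and Yy: "n \<noteq> 0 \<Longrightarrow> Y (y n v) = y n (Y v)"
    and py: "n \<noteq> 0 \<Longrightarrow> p (y n v) = y n (p v)"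
    and Jw: "i \<in> verts Q \<Longrightarrow> n \<noteq> 0 \<Longrightarrow> J (w i n v) = w i n (J v)"
    and Yw: "i \<in> verts Q \<Longrightarrow> n \<noteq> 0 \<Longrightarrow> Y (w i n v) = w i n (Y v)"
    and pw: "i \<in> verts Q \<Longrightarrow> n \<noteq> 0 \<Longrightarrow> p (w i n v) = w i n (p v)"
    and Vy: "i \<in> verts Q \<Longrightarrow> n \<noteq> 0 \<Longrightarrow> V i (y n v) = y n (V i v)"
    and Vw: "i \<in> verts Q \<Longrightarrow> j \<in> verts Q \<Longrightarrow> n \<noteq> 0 \<Longrightarrow> V i (w j n v) = w j n (V i v)"
    and yw: "i \<in> verts Q \<Longrightarrow> n \<noteq> 0 \<Longrightarrow> m \<noteq> 0 \<Longrightarrow> y n (w i m v) = w i m (y n v)"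
    and yy: "brk y y (\<lambda>n. (qp h (of_nat n) - qp h (- of_nat n))\<^sup>2 / of_nat n)"
    and osc: "i \<in> verts Q \<Longrightarrow> n \<noteq> 0 \<Longrightarrow>
      osc M i n v = w i n v + sc (ga i n / (qp h (of_int n) - qp h (- of_int n))) (y n v)"
    and qn: "n \<noteq> 0 \<Longrightarrow> qp h (of_int n) - qp h (- of_int n) \<noteq> 0"
begin

lemma Jlin: "lin J" and plin: "lin p" using dJ dp by (auto intro: diag_lin)

lemma Yilin: "lin Yi"
  unfolding lin_iff using YYi YiY lin_add[OF Ylin] lin_sc[OF Ylin] by metis

lemma JYi: "J (Yi v) = Yi (J v) - Yi v"
proof -
  have "Y (J (Yi v) + Yi v) = J v" using JY[of "Yi v"] by (simp add: YYi)
  then have "J (Yi v) + Yi v = Yi (J v)" using YiY by metis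
  then show ?thesis by (simp add: eq_diff_eq)
qed

lemma Yiy: "n \<noteq> 0 \<Longrightarrow> Yi (y n v) = y n (Yi v)" using Yy YYi YiY by metis
lemma Yiw: "i \<in> verts Q \<Longrightarrow> n \<noteq> 0 \<Longrightarrow> Yi (w i n v) = w i n (Yi v)" using Yw YYi YiY by metis
lemma VYi: "i \<in> verts Q \<Longrightarrow> V i (Yi v) = Yi (V i v)" using VY YYi YiY by metis

definition Ypow :: "int \<Rightarrow> 'v \<Rightarrow> 'v" where
  "Ypow e = (if 0 \<le> e then Y else Yi) ^^ nat \<bar>e\<bar>"

lemma Ypow_simps [simp]: "Ypow 0 v = v" "Ypow 1 v = Y v" "Ypow (- 1) v = Yi v"
  by (simp_all add: Ypow_def)

lemma Y_Ypow: "Y (Ypow e v) = Ypow (e + 1) v"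
proof (cases "0 \<le> e")
  case True
  then have "nat \<bar>e + 1\<bar> = Suc (nat \<bar>e\<bar>)" by simp
  then show ?thesis using True by (simp add: Ypow_def)
next
  case False
  then have n: "nat \<bar>e\<bar> = Suc (nat \<bar>e + 1\<bar>)" by simp
  show ?thesis
  proof (cases "e = - 1")
    case True then show ?thesis by (simp add: YYi)
  next
    case False
    then show ?thesis using \<open>\<not> 0 \<le> e\<close> unfolding Ypow_def n by (simp add: YYi)
  qed
qed

lemma Yi_Ypow: "Yi (Ypow e v) = Ypow (e - 1) v"
proof -
  have "Ypow e v = Y (Ypow (e - 1) v)" using Y_Ypow[of "e - 1" v] by simp
  then show ?thesis by (simp only: YiY)
qed

lemma Ypow_add: "d \<in> {- 1, 0, 1} \<Longrightarrow> Ypow d (Ypow e v) = Ypow (d + e) v"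
  by (auto simp: Y_Ypow Yi_Ypow add.commute)

lemma Ypow_lin: "lin (Ypow e)"
proof -
  have "lin ((if 0 \<le> e then Y else Yi) ^^ n)" for n
  proof (induction n)
    case 0 show ?case by (simp add: id_def lin_id)
  next
    case (Suc n)
    show ?case using lin_comp[OF _ Suc, of "if 0 \<le> e then Y else Yi"] Ylin Yilin by (auto simp: comp_def)
  qed
  then show ?thesis by (simp add: Ypow_def)
qed

lemma Ypow_comm:
  assumes "\<And>v. T (Y v) = Y (T v)" shows "T (Ypow e v) = Ypow e (T v)"
proof -
  have "T (Yi v) = Yi (T v)" for v using assms YYi YiY by metis
  then have "T (((if 0 \<le> e then Y else Yi) ^^ n) v) = ((if 0 \<le> e then Y else Yi) ^^ n) (T v)" for n
    using assms by (induction n arbitrary: v) auto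
  then show ?thesis by (simp add: Ypow_def)
qed

lemma J_Ypow: "J (Ypow e v) = Ypow e (J v) + sc (of_int e) (Ypow e v)"
proof (induction e arbitrary: v rule: int_induct[where k = 0])
  case (step1 i)
  have "J (Y (Ypow i v)) = Y (Ypow i (J v)) + (sc (of_int i) (Y (Ypow i v)) + Y (Ypow i v))"
    by (simp add: JY step1 lin_add[OF Ylin] lin_sc[OF Ylin])
  then show ?case by (simp add: Y_Ypow scale_left_distrib)
next
  case (step2 i)
  have "J (Yi (Ypow i v)) = Yi (Ypow i (J v)) + (sc (of_int i) (Yi (Ypow i v)) - Yi (Ypow i v))"
    by (simp add: JYi step2 lin_add[OF Yilin] lin_sc[OF Yilin])
  then show ?case by (simp add: Yi_Ypow scale_left_diff_distrib)
qed simp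

lemma J_Ypow_eig: "J v = sc \<mu> v \<Longrightarrow> J (Ypow e v) = sc (\<mu> + of_int e) (Ypow e v)"
  by (simp add: J_Ypow lin_sc[OF Ypow_lin] scale_left_distrib)

lemma V_eig: "i \<in> verts Q \<Longrightarrow> J v = sc \<mu> v \<Longrightarrow> J (V i v) = sc \<mu> (V i v)"
  by (simp add: VJ[symmetric] lin_sc[OF Vlin])

lemma zer_eig:
  assumes i: "i \<in> verts Q" and v: "J v = sc \<mu> v"
  shows "zer M i v = sc (sg i * qp h (cc i * (\<mu> + of_int (eps Q i kk) / 2))) (Ypow (eps Q i kk) (V i v))"
  unfolding zer[OF i] weyl_def opfun_eig[OF Jlin V_eig[OF i v]] Ypow_def[symmetric] lin_sc[OF Ypow_lin] by simp

fun VV :: "'i list \<Rightarrow> 'v \<Rightarrow> 'v" where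
  "VV [] v = v"
| "VV (i # is) v = V i (VV is v)"

definition Es :: "'i list \<Rightarrow> int" where "Es is = (\<Sum>i\<leftarrow>is. eps Q i kk)"

text \<open>The scalar of the ordered zero modes on a J-eigenvector: Weyl factors, signs and the
  powers q^(c J), each read at the eigenvalue already raised by the charges to its right. The half
  \<epsilon> is the ordering inside \<open>weyl\<close>.\<close>

fun Kc :: "'i list \<Rightarrow> complex \<Rightarrow> complex" where
  "Kc [] \<mu> = 1"
| "Kc (i # is) \<mu> = qp h (- of_int (\<Sum>j\<leftarrow>is. eps Q i j)) * sg i *
     qp h (cc i * (\<mu> + of_int (Es is) + of_int (eps Q i kk) / 2)) * Kc is \<mu>"

text \<open>The eigenvalue enters through a single exponential with the summed exponents, which
  later allows it to cancel.\<close>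

lemma Kc_shift: "Kc is \<mu> = Kc is 0 * qp h ((\<Sum>i\<leftarrow>is. cc i) * \<mu>)"
proof (induction "is")
  case (Cons i "is")
  have "qp h (cc i * (\<mu> + of_int (Es is) + of_int (eps Q i kk) / 2)) = qp h (cc i * (0 + of_int (Es is) + of_int (eps Q i kk) / 2)) * qp h (cc i * \<mu>)"
    "qp h ((\<Sum>i\<leftarrow>i # is. cc i) * \<mu>) = qp h (cc i * \<mu>) * qp h ((\<Sum>i\<leftarrow>is. cc i) * \<mu>)"
    by (simp_all add: qp_add[symmetric] algebra_simps)
  then show ?case using Cons by simp
qed simp

lemma VV_lin: "set is \<subseteq> verts Q \<Longrightarrow> lin (VV is)"
proof (induction "is")
  case Nil
  have "VV [] = (\<lambda>v. v)" by auto
  then show ?case by (simp add: lin_id)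
next
  case (Cons i "is")
  have "VV (i # is) = (\<lambda>v. V i (VV is v))" by auto
  then show ?case using Cons lin_comp[OF Vlin, of i "VV is"] by simp
qed

lemma VV_eig: "set is \<subseteq> verts Q \<Longrightarrow> J v = sc \<mu> v \<Longrightarrow> J (VV is v) = sc \<mu> (VV is v)"
  by (induction "is") (auto intro: V_eig)

lemma VV_comm: "set is \<subseteq> verts Q \<Longrightarrow> (\<And>i v. i \<in> verts Q \<Longrightarrow> V i (T v) = T (V i v)) \<Longrightarrow> VV is (T v) = T (VV is v)"
  by (induction "is") auto

lemma zprod_eig:
  assumes "set is \<subseteq> verts Q" and v: "J v = sc \<mu> v"
  shows "zprod h sc Q (zer M) is v = sc (Kc is \<mu>) (Ypow (Es is) (VV is v))"
  using assms(1)
proof (induction "is")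
  case (Cons i "is")
  have i: "i \<in> verts Q" and s: "set is \<subseteq> verts Q" using Cons.prems by auto
  let ?u = "Ypow (Es is) (VV is v)"
  have Ju: "J (sc (Kc is \<mu>) ?u) = sc (\<mu> + of_int (Es is)) (sc (Kc is \<mu>) ?u)"
    by (simp add: lin_sc[OF Jlin] J_Ypow_eig[OF VV_eig[OF s v]] mult.commute)
  have "V i ?u = Ypow (Es is) (V i (VV is v))" by (rule Ypow_comm) (rule VY[OF i])
  then have "Ypow (eps Q i kk) (V i ?u) = Ypow (Es (i # is)) (VV (i # is) v)"
    by (simp add: Ypow_add[OF eps1[OF i]] Es_def)
  then show ?case using Cons.IH[OF s]
    by (simp add: zer_eig[OF i Ju] lin_sc[OF Vlin[OF i]] lin_sc[OF Ypow_lin] mult_ac)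
qed (simp add: Es_def)

text \<open>Oscillators of the fermion of charge e: e = 1 is Psi, e = - 1 is Psi*, and e = 0 is
  trivial.\<close>

definition A0 :: "int \<Rightarrow> int \<Rightarrow> 'v \<Rightarrow> 'v" where
  "A0 e n v = sc (of_int e / (qp h (of_int n) - qp h (- of_int n))) (y n v)"

lemma fam_scaled: "fam (\<lambda>n v. sc (k n) (y n v))"
proof -
  have "smooth {kk} (\<lambda>_ n v. sc (k n) (y n v))"
    by (rule smooth_comb[OF ysm, where k = "\<lambda>_ _ n. k (int n)"]) (use cfam_lin[OF ypc] in simp_all)
  then show ?thesis
    by (rule fam_smooth[where x = "\<lambda>_ n v. sc (k n) (y n v)"]) (rule cfam_scale[OF ypc] cfam_scale[OF ymc])+
qed

lemma yfam: "fam y" using fam_scaled[of "\<lambda>_. 1"] by simp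

lemma ylin: "n \<noteq> 0 \<Longrightarrow> lin (y n)" by (rule fam_lin[OF yfam])
lemma wlin: "i \<in> verts Q \<Longrightarrow> n \<noteq> 0 \<Longrightarrow> lin (w i n)"
  using wx fam_lin[of "w i"] by (auto simp: xfam_def)

lemma ycomm: "comm2 y y"
  unfolding comm2_def using ypc ymc
  unfolding cfam_def by (metis nonneg_int_cases less_imp_le of_nat_0_less_iff)

lemma A0fam: "fam (A0 e)" unfolding A0_def[abs_def] by (rule fam_scaled)

lemma A0lin: "n \<noteq> 0 \<Longrightarrow> lin (A0 e n)" by (rule fam_lin[OF A0fam])

lemma A0comm: "comm2 (A0 d) (A0 e)"
  using ycomm ylin unfolding comm2_def A0_def by (auto simp: lin_sc mult.commute)

text \<open>The contraction is thus (1 - x)^(d e): equal fermions vanish at coinciding points,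
  opposite ones have a simple pole there.\<close>

lemma A0brk: "brk (A0 d) (A0 e) (\<lambda>n. - of_int (d * e) / of_nat n)"
proof -
  have "brk (A0 d) (A0 e) (\<lambda>n. of_int d / (qp h (of_int (int n)) - qp h (- of_int (int n))) *
      (of_int e / (qp h (of_int (- int n)) - qp h (- of_int (- int n)))) * ((qp h (of_nat n) - qp h (- of_nat n))\<^sup>2 / of_nat n))"
    unfolding A0_def[abs_def] by (rule brk_scale[OF yy yfam yfam])
  then show ?thesis
  proof (rule brk_cong)
    fix n :: nat assume "n > 0"
    then have "qp h (of_nat n) - qp h (- of_nat n) \<noteq> 0" using qn[of "int n"] by simp
    moreover from this have "qp h (- of_nat n) - qp h (of_nat n) \<noteq> 0" by simp
    \<comment> \<open>The denominator is odd in n, which is the source of the minus sign.\<close>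
    moreover have "x \<noteq> 0 \<Longrightarrow> - x = z \<Longrightarrow> d' / x * (e' / z) * (x\<^sup>2 / m) = - (d' * e') / m" for x z d' e' m :: complex
      by (auto simp: power2_eq_square field_simps)
    ultimately show "of_int d / (qp h (of_int (int n)) - qp h (- of_int (int n))) *
      (of_int e / (qp h (of_int (- int n)) - qp h (- of_int (- int n)))) * ((qp h (of_nat n) - qp h (- of_nat n))\<^sup>2 / of_nat n) =
      - of_int (d * e) / of_nat n"
      by simp
  qed
qed

section \<open>Splitting a current into a fermion and residual oscillators\<close>

abbreviation W :: "('i \<times> complex) list \<Rightarrow> int \<Rightarrow> 'v \<Rightarrow> 'v" where "W \<equiv> osc_sum h sc w"
abbreviation okl :: "('i \<times> complex) list \<Rightarrow> bool" where "okl ps \<equiv> fst ` set ps \<subseteq> verts Q"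

lemma Wfam: "okl ps \<Longrightarrow> fam (W ps)" using os_fam[OF wx] by blast

lemma comW:
  assumes T: "lin T" and c: "\<And>i v. i \<in> verts Q \<Longrightarrow> T (w i n v) = w i n (T v)" and ps: "okl ps"
  shows "T (W ps n v) = W ps n (T v)"
proof -
  have "fst q \<in> verts Q" if "q \<in> set ps" for q using ps that by auto
  then show ?thesis
    unfolding osc_sum_def lin_sum_list[OF T] split_def lin_sc[OF T]
    by (intro arg_cong[where f = sum_list] map_cong refl) (simp add: c)
qed

lemma A0W: "okl ps \<Longrightarrow> n \<noteq> 0 \<Longrightarrow> m \<noteq> 0 \<Longrightarrow> A0 e n (W ps m v) = W ps m (A0 e n v)"
  by (rule comW[OF A0lin]) (simp_all add: A0_def yw lin_sc wlin)

lemma A0Wcomm2: "okl ps \<Longrightarrow> comm2 (A0 e) (W ps)" and A0Wbrk: "okl ps \<Longrightarrow> brk (A0 e) (W ps) (\<lambda>_. 0)"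
  by (auto simp: comm2_def brk_def A0W)

lemma WA0brk: "okl ps \<Longrightarrow> brk (W ps) (A0 e) (\<lambda>_. 0)"
  by (auto simp: brk_def A0W)

text \<open>The exponent c of z ranges over all complex numbers, since the eigenvalues of J are
  arbitrary.\<close>

definition Phi :: "int \<Rightarrow> complex \<Rightarrow> 'v \<Rightarrow> 'v" where
  "Phi e c v = (if e = 1 then fermi h sc J Y y c v else fermi_star h sc J Yi y c v)"

lemma Phi_vop:
  assumes "e = 1 \<or> e = - 1"
  shows "Phi e c = vop sc (Ypow e) (\<lambda>v. sc (of_int e) (J v) + sc (1/2) v) (A0 e) c"
proof -
  have 1: "A0 1 = (\<lambda>n v. sc (1 / (qp h (of_int n) - qp h (- of_int n))) (y n v))"
    "A0 (- 1) = (\<lambda>n v. sc (- 1 / (qp h (of_int n) - qp h (- of_int n))) (y n v))"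
    by (simp_all add: A0_def fun_eq_iff)
  have 2: "Ypow 1 = Y" "Ypow (- 1) = Yi" by (simp_all add: fun_eq_iff)
  have 3: "(\<lambda>v. sc (1/2) v - J v) = (\<lambda>v. sc (of_int (- 1)) (J v) + sc (1/2) v)" by (simp add: fun_eq_iff)
  show ?thesis using assms
    by (auto simp: fun_eq_iff Phi_def fermi_def fermi_star_def 1 2 3 simp del: Ypow_simps of_int_minus)
qed

lemma diagT: "diagonalizable sc UNIV (\<lambda>v. sc (of_int e) (J v) + sc (1/2) v)"
  by (rule diag_affine[OF dJ]) simp

lemma Phi_lin: "e = 1 \<or> e = - 1 \<Longrightarrow> lin (Phi e c)"
  by (subst Phi_vop, assumption) (rule vop_lin[OF diagT A0fam Ypow_lin])

lemma Phi_eig: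
  assumes e: "e = 1 \<or> e = - 1" and u: "J u = sc \<mu> u"
  shows "Phi e c u = (if c - (of_int e * \<mu> + 1/2) \<in> \<int>
    then Ypow e (bexp sc (A0 e) \<lfloor>Re (c - (of_int e * \<mu> + 1/2))\<rfloor> u) else 0)"
proof -
  have "sc (of_int e) (J u) + sc (1/2) u = sc (of_int e * \<mu> + 1/2) u" by (simp add: u scale_left_distrib)
  then show ?thesis
    unfolding Phi_vop[OF e] by (rule vop_eig[OF diag_lin[OF diagT] _ A0fam Ypow_lin])
qed

lemma zer_lin: "i \<in> verts Q \<Longrightarrow> lin (zer M i)"
proof -
  assume i: "i \<in> verts Q"
  have "lin (\<lambda>v. sc (sg i) (Ypow (eps Q i kk) (opfun sc (\<lambda>\<mu>. qp h (cc i * (\<mu> + of_int (eps Q i kk) / 2))) J (V i v))))"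
    by (intro lin_scale lin_comp[OF Ypow_lin lin_comp[OF opfun_lin[OF dJ] Vlin[OF i]]])
  moreover have "zer M i = (\<lambda>v. sc (sg i) (Ypow (eps Q i kk) (opfun sc (\<lambda>\<mu>. qp h (cc i * (\<mu> + of_int (eps Q i kk) / 2))) J (V i v))))"
    by (simp add: fun_eq_iff zer[OF i] weyl_def Ypow_def)
  ultimately show ?thesis by simp
qed

lemma zprod_linF: "set is \<subseteq> verts Q \<Longrightarrow> lin (zprod h sc Q (zer M) is)"
proof (induction "is")
  case Nil
  have "zprod h sc Q (zer M) [] = (\<lambda>v. v)" by (simp add: fun_eq_iff)
  then show ?case by (simp add: lin_id)
next
  case (Cons i "is")
  have "lin (\<lambda>v. zer M i (zprod h sc Q (zer M) is v))"
    by (rule lin_comp) (use Cons zer_lin in auto)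
  moreover have "zprod h sc Q (zer M) (i # is) = (\<lambda>v. sc (qp h (- of_int (\<Sum>j\<leftarrow>is. eps Q i j))) (zer M i (zprod h sc Q (zer M) is v)))"
    by (simp add: fun_eq_iff)
  ultimately show ?case by (simp add: lin_scale)
qed

abbreviation D :: "'v \<Rightarrow> 'v" where "D \<equiv> \<lambda>v. J v - p v"

text \<open>The exponent of q, per unit of D, that the arguments of the factors contribute through
  the power of z at the zero modes.\<close>

definition kap :: "('i \<times> complex) list \<Rightarrow> complex" where
  "kap ps = (\<Sum>(i, e)\<leftarrow>ps. e * of_int (eps Q i kk))"

text \<open>The fermions of a product of several X_i collapse to charge \<open>Es\<close> at the
  single argument q^a z: Psi and Psi* at equal arguments cancel in the oscillators.\<close>

definition gacond :: "('i \<times> complex) list \<Rightarrow> complex \<Rightarrow> bool" where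
  "gacond ps a \<longleftrightarrow> (\<forall>n. n \<noteq> 0 \<longrightarrow> (\<Sum>(i, e)\<leftarrow>ps. qp h (- of_int n * e) * ga i n) = of_int (Es (map fst ps)) * qp h (- of_int n * a))"

lemma os_split:
  assumes ps: "okl ps" and g: "gacond ps a" and n: "n \<noteq> 0"
  shows "osc_sum h sc (osc M) ps n v = sh h a (A0 (Es (map fst ps))) n v + W ps n v"
proof -
  have "osc_sum h sc (osc M) ps n v = W ps n v + sc ((\<Sum>(i, e)\<leftarrow>ps. qp h (- of_int n * e) * ga i n) / (qp h (of_int n) - qp h (- of_int n))) (y n v)"
    using ps
  proof (induction ps)
    case (Cons q ps)
    then show ?case
      by (cases q) (simp add: osc_sum_def osc[OF _ n] scale_right_distrib scale_left_distrib add_divide_distrib)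
  qed (simp add: osc_sum_def)
  then show ?thesis using g n by (simp add: gacond_def sh_def A0_def)
qed

lemma bexp_split:
  assumes ps: "okl ps" and g: "gacond ps a"
  shows "bexp sc (osc_sum h sc (osc M) ps) t v = Sum_any (\<lambda>j. sc (qp h (of_int (t - j) * a)) (bexp sc (A0 (Es (map fst ps))) (t - j) (bexp sc (W ps) j v)))"
    and "finite {j. bexp sc (A0 (Es (map fst ps))) (t - j) (bexp sc (W ps) j v) \<noteq> 0}"
    and "fam (osc_sum h sc (osc M) ps)"
proof -
  let ?A = "A0 (Es (map fst ps))"
  have c: "comm2 (sh h a ?A) (W ps)" by (rule comm2_sh[OF Wfam[OF ps] A0fam A0Wcomm2[OF ps]])
  have b: "brk (sh h a ?A) (W ps) (\<lambda>_. 0)"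
    using A0W[OF ps] fam_lin[OF Wfam[OF ps]] by (auto simp: brk_def sh_def lin_sc)
  have "bexp sc (osc_sum h sc (osc M) ps) t v = bexp sc (\<lambda>n v. sh h a ?A n v + W ps n v) t v"
    by (rule bexp_cong) (rule os_split[OF ps g])
  then show "bexp sc (osc_sum h sc (osc M) ps) t v = Sum_any (\<lambda>j. sc (qp h (of_int (t - j) * a)) (bexp sc ?A (t - j) (bexp sc (W ps) j v)))"
    unfolding bexp_add0[OF fam_sh[OF A0fam] Wfam[OF ps] c b] bexp_sh[OF A0fam] .
  show "finite {j. bexp sc ?A (t - j) (bexp sc (W ps) j v) \<noteq> 0}"
    by (rule bexp_add0_fin[OF A0fam Wfam[OF ps] A0Wcomm2[OF ps] A0Wbrk[OF ps]])
  have "fam (\<lambda>n v. sh h a ?A n v + W ps n v)" by (rule fam_add[OF fam_sh[OF A0fam] Wfam[OF ps] c])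
  then show "fam (osc_sum h sc (osc M) ps)"
    by (rule fam_cong[rotated]) (rule os_split[OF ps g, symmetric])
qed

lemma nprodD_lin:
  assumes ps: "okl ps" and g: "gacond ps a" shows "lin (nprodD h sc Q kk D M ps n)"
  unfolding nprodD_def
proof (rule vop_lin)
  show "diagonalizable sc UNIV (\<lambda>v. sc (of_int (\<Sum>(i, e)\<leftarrow>ps. eps Q i kk)) (D v))"
    by (rule diag_affine[OF dD, where a = "of_int (\<Sum>(i, e)\<leftarrow>ps. eps Q i kk)" and b = 0]) simp
  show "fam (osc_sum h sc (osc M) ps)" by (rule bexp_split(3)[OF ps g])
  show "lin (zprod h sc Q (zer M) (map fst ps) \<circ> opfun sc (\<lambda>\<mu>. qp h (\<mu> * (\<Sum>(i, e)\<leftarrow>ps. e * of_int (eps Q i kk)))) D)"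
    unfolding comp_def by (rule lin_comp[OF zprod_linF opfun_lin[OF dD]]) (use ps in auto)
qed

lemma com_bexp:
  assumes T: "lin T" and y: "\<And>n v. n \<noteq> 0 \<Longrightarrow> T (y n v) = y n (T v)"
    and w: "\<And>i n v. i \<in> verts Q \<Longrightarrow> n \<noteq> 0 \<Longrightarrow> T (w i n v) = w i n (T v)" and ps: "okl ps"
  shows "T (bexp sc (A0 e) c v) = bexp sc (A0 e) c (T v)" "T (bexp sc (W ps) c v) = bexp sc (W ps) c (T v)"
  using bexp_comm[OF A0fam T, of e] bexp_comm[OF Wfam[OF ps] T] comW[OF T _ ps] w
  by (simp_all add: A0_def lin_sc[OF T] y)

lemma J_bexp: "J (bexp sc (A0 e) c v) = bexp sc (A0 e) c (J v)"
  by (rule com_bexp(1)[OF Jlin, where ps = "[]"]) (simp_all add: Jy Jw)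
lemma J_bexpW: "okl ps \<Longrightarrow> J (bexp sc (W ps) c v) = bexp sc (W ps) c (J v)"
  by (rule com_bexp(2)[OF Jlin]) (simp_all add: Jy Jw)

lemma p_bexp: "p (bexp sc (A0 e) c v) = bexp sc (A0 e) c (p v)"
  by (rule com_bexp(1)[OF plin, where ps = "[]"]) (simp_all add: py pw)

lemma Y_bexp: "Y (bexp sc (A0 e) c v) = bexp sc (A0 e) c (Y v)"
  by (rule com_bexp(1)[OF Ylin, where ps = "[]"]) (simp_all add: Yy Yw)
lemma Y_bexpW: "okl ps \<Longrightarrow> Y (bexp sc (W ps) c v) = bexp sc (W ps) c (Y v)"
  by (rule com_bexp(2)[OF Ylin]) (simp_all add: Yy Yw)

lemma Yi_bexp: "Yi (bexp sc (A0 e) c v) = bexp sc (A0 e) c (Yi v)"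
  by (rule com_bexp(1)[OF Yilin, where ps = "[]"]) (simp_all add: Yiy Yiw)
lemma Yi_bexpW: "okl ps \<Longrightarrow> Yi (bexp sc (W ps) c v) = bexp sc (W ps) c (Yi v)"
  by (rule com_bexp(2)[OF Yilin]) (simp_all add: Yiy Yiw)

lemma VV_bexp: "okl rs \<Longrightarrow> set is \<subseteq> verts Q \<Longrightarrow> VV is (bexp sc (A0 e) c v) = bexp sc (A0 e) c (VV is v)"
  by (rule VV_comm, assumption, rule com_bexp(1)[where ps = rs], simp_all add: Vlin Vy Vw)

text \<open>The hypothesis \<open>k\<close> balances the powers of q from the zero modes of the X_i,
  from the power of z and from the argument of the fermion. The resulting factor contains \<pi> but
  neither \<mu> nor N, so the formula can be restated without reference to the eigenvalue of
  J.\<close>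

lemma frame_cur_joint:
  assumes ps: "okl ps" and g: "gacond ps a" and vJ: "J v = sc \<mu> v" and vp: "p v = sc \<pi> v"
    and k: "kap ps + (\<Sum>i\<leftarrow>map fst ps. cc i) = a * of_int (Es (map fst ps))" and N: "\<mu> - \<pi> = of_int N"
  defines "E \<equiv> Es (map fst ps)"
  shows "nprodD h sc Q kk D M ps n v = Sum_any (\<lambda>j. sc (Kc (map fst ps) 0 * qp h (a * (- of_int n + of_int E * \<pi> - of_int j) - kap ps * \<pi>))
     (Ypow E (bexp sc (A0 E) (- n - E * N - j) (VV (map fst ps) (bexp sc (W ps) j v)))))"
    and "finite {j. Ypow E (bexp sc (A0 E) (- n - E * N - j) (VV (map fst ps) (bexp sc (W ps) j v))) \<noteq> 0}"
proof -
  let ?is = "map fst ps"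
  have s: "set ?is \<subseteq> verts Q" using ps by simp
  define t where "t = - n - E * N"
  have fin: "finite {j. bexp sc (A0 E) (t - j) (bexp sc (W ps) j v) \<noteq> 0}" unfolding E_def by (rule bexp_split(2)[OF ps g])
  have lYV: "lin (\<lambda>v. Ypow E (VV ?is v))" by (rule lin_comp[OF Ypow_lin VV_lin[OF s]])
  have move: "Ypow E (bexp sc (A0 E) c (VV ?is u)) = Ypow E (VV ?is (bexp sc (A0 E) c u))" for c u
    using VV_bexp[OF ps s] by simp
  show "finite {j. Ypow E (bexp sc (A0 E) (- n - E * N - j) (VV ?is (bexp sc (W ps) j v))) \<noteq> 0}"
    unfolding t_def[symmetric] move by (rule finite_subset[OF _ fin]) (auto simp: lin_zero[OF lYV])
  define B where "B = bexp sc (osc_sum h sc (osc M) ps) t v"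
  have E': "(\<Sum>(i, e)\<leftarrow>ps. eps Q i kk) = E" by (simp add: E_def Es_def split_def comp_def)
  have Te: "sc (of_int E) (D v) = sc (of_int E * of_int N) v"
    by (simp add: vJ vp scale_left_diff_distrib[symmetric] N)
  have Tl: "lin (\<lambda>v. sc (of_int E) (D v))" by (intro lin_scale lin_minus Jlin plin)
  have Ul: "lin (zprod h sc Q (zer M) ?is \<circ> opfun sc (\<lambda>\<mu>. qp h (\<mu> * kap ps)) D)"
    unfolding comp_def by (rule lin_comp[OF zprod_linF[OF s] opfun_lin[OF dD]])
  \<comment> \<open>The exponent left for the oscillators is an integer because D has the integer
    eigenvalue N.\<close>
  have cI: "complex_of_int (- n) - of_int E * of_int N = of_int t" by (simp add: t_def)
  have "nprodD h sc Q kk D M ps n v = vop sc (zprod h sc Q (zer M) ?is \<circ> opfun sc (\<lambda>\<mu>. qp h (\<mu> * kap ps)) D)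
     (\<lambda>v. sc (of_int E) (D v)) (osc_sum h sc (osc M) ps) (of_int (- n)) v"
    unfolding nprodD_def E' kap_def[symmetric] by simp
  also have "\<dots> = zprod h sc Q (zer M) ?is (opfun sc (\<lambda>\<mu>. qp h (\<mu> * kap ps)) D B)"
    unfolding vop_eig[OF Tl Te bexp_split(3)[OF ps g] Ul] cI by (simp add: B_def)
  finally have 1: "nprodD h sc Q kk D M ps n v = zprod h sc Q (zer M) ?is (opfun sc (\<lambda>\<mu>. qp h (\<mu> * kap ps)) D B)" .
  have osJ: "T (osc_sum h sc (osc M) ps m u) = osc_sum h sc (osc M) ps m (T u)"
    if T: "lin T" and y: "\<And>n v. n \<noteq> 0 \<Longrightarrow> T (y n v) = y n (T v)"
    and w: "\<And>i n v. i \<in> verts Q \<Longrightarrow> n \<noteq> 0 \<Longrightarrow> T (w i n v) = w i n (T v)" and m: "m \<noteq> 0" for T m u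
  proof -
    have "T (W ps m u) = W ps m (T u)" by (rule comW[OF T _ ps]) (rule w, assumption, rule m)
    then show ?thesis unfolding os_split[OF ps g m] lin_add[OF T] by (simp add: sh_def A0_def lin_sc[OF T] y[OF m])
  qed
  have JB: "J B = sc \<mu> B" unfolding B_def
    by (subst bexp_comm[OF bexp_split(3)[OF ps g] Jlin osJ[OF Jlin Jy Jw]]) (simp_all add: vJ lin_sc[OF bexp_lin[OF bexp_split(3)[OF ps g]]])
  have pB: "p B = sc \<pi> B" unfolding B_def
    by (subst bexp_comm[OF bexp_split(3)[OF ps g] plin osJ[OF plin py pw]]) (simp_all add: vp lin_sc[OF bexp_lin[OF bexp_split(3)[OF ps g]]])
  have "D B = sc (of_int N) B" by (simp add: JB pB scale_left_diff_distrib[symmetric] N)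
  then have 2: "opfun sc (\<lambda>\<mu>. qp h (\<mu> * kap ps)) D B = sc (qp h (of_int N * kap ps)) B"
    by (rule opfun_eig[OF diag_lin[OF dD]])
  have "nprodD h sc Q kk D M ps n v = sc (qp h (of_int N * kap ps) * Kc ?is \<mu>) (Ypow E (VV ?is B))"
    unfolding 1 2 lin_sc[OF zprod_linF[OF s]] zprod_eig[OF s JB] E_def by simp
  also have "B = Sum_any (\<lambda>j. sc (qp h (of_int (t - j) * a)) (bexp sc (A0 E) (t - j) (bexp sc (W ps) j v)))"
    unfolding B_def E_def by (rule bexp_split(1)[OF ps g])
  also have "sc (qp h (of_int N * kap ps) * Kc ?is \<mu>) (Ypow E (VV ?is \<dots>)) =
     Sum_any (\<lambda>j. sc (qp h (of_int N * kap ps) * Kc ?is \<mu>) (Ypow E (VV ?is (sc (qp h (of_int (t - j) * a)) (bexp sc (A0 E) (t - j) (bexp sc (W ps) j v))))))"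
    by (rule lin_Sum_any[OF lin_scale[OF lYV]]) (rule finite_subset[OF _ fin], auto)
  also have "\<dots> = Sum_any (\<lambda>j. sc (Kc ?is 0 * qp h (a * (- of_int n + of_int E * \<pi> - of_int j) - kap ps * \<pi>))
     (Ypow E (bexp sc (A0 E) (- n - E * N - j) (VV ?is (bexp sc (W ps) j v)))))"
  proof (rule Sum_any.cong)
    fix j
    have C: "(\<Sum>i\<leftarrow>?is. cc i) = a * of_int E - kap ps" using k by (simp add: E_def algebra_simps)
    have "of_int N * kap ps + (\<Sum>i\<leftarrow>?is. cc i) * \<mu> + of_int (t - j) * a = a * (- of_int n + of_int E * \<pi> - of_int j) - kap ps * \<pi>"
      unfolding N[symmetric] C t_def of_int_diff of_int_mult of_int_minus by (simp add: algebra_simps)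
    note ex = this
    have "qp h (of_int N * kap ps) * Kc ?is \<mu> * qp h (of_int (t - j) * a) =
        Kc ?is 0 * qp h (a * (- of_int n + of_int E * \<pi> - of_int j) - kap ps * \<pi>)"
      unfolding Kc_shift[of ?is \<mu>] ex[symmetric] qp_add by (simp only: mult_ac)
    then show "sc (qp h (of_int N * kap ps) * Kc ?is \<mu>) (Ypow E (VV ?is (sc (qp h (of_int (t - j) * a)) (bexp sc (A0 E) (t - j) (bexp sc (W ps) j v)))))
       = sc (Kc ?is 0 * qp h (a * (- of_int n + of_int E * \<pi> - of_int j) - kap ps * \<pi>))
     (Ypow E (bexp sc (A0 E) (- n - E * N - j) (VV ?is (bexp sc (W ps) j v))))"
      unfolding lin_sc[OF VV_lin[OF s]] lin_sc[OF Ypow_lin] scale_scale t_def[symmetric] move by simp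
  qed
  finally show "nprodD h sc Q kk D M ps n v = Sum_any (\<lambda>j. sc (Kc ?is 0 * qp h (a * (- of_int n + of_int E * \<pi> - of_int j) - kap ps * \<pi>))
     (Ypow E (bexp sc (A0 E) (- n - E * N - j) (VV ?is (bexp sc (W ps) j v)))))" .
qed

text \<open>The zero mode of a fermion carries z^(e J + 1/2); the 1/2 in the index cancels this
  half, and the integrality of J - p leaves an integer for the oscillators.\<close>

lemma Phi_index:
  assumes e: "e = 1 \<or> e = - 1" and u: "J u = sc \<mu> u" and N: "\<mu> - \<pi> = of_int N"
  shows "Phi e (- of_int n + of_int e * \<pi> - of_int j + 1/2) u = Ypow e (bexp sc (A0 e) (- n - e * N - j) u)"
proof -
  have "\<mu> = \<pi> + of_int N" using N by (simp add: algebra_simps)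
  define m where "m = - n - e * N - j"
  have m: "complex_of_int m = - of_int n - of_int e * of_int N - of_int j" by (simp add: m_def)
  then have eq: "- of_int n + of_int e * \<pi> - of_int j + 1/2 - (of_int e * \<mu> + 1/2) = of_int m"
    unfolding \<open>\<mu> = \<pi> + of_int N\<close> m by (simp add: algebra_simps)
  show ?thesis unfolding Phi_eig[OF e u] eq m_def[symmetric] by simp
qed

lemma joint_integer:
  assumes "J u = sc \<mu> u" "p u = sc \<pi> u" "u \<noteq> 0"
  obtains N where "\<mu> - \<pi> = of_int N"
proof -
  have "D u = sc (\<mu> - \<pi>) u" using assms by (simp add: scale_left_diff_distrib)
  from diag_eigval[OF dD this assms(3)] show thesis using that by (auto simp: Ints_def)
qed

lemma frame_cur:
  assumes ps: "okl ps" and g: "gacond ps a" and vp: "p v = sc \<pi> v"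
    and k: "kap ps + (\<Sum>i\<leftarrow>map fst ps. cc i) = a * of_int E" and E: "E = Es (map fst ps)" "E = 1 \<or> E = - 1"
  shows "nprodD h sc Q kk D M ps n v = Sum_any (\<lambda>j. sc (Kc (map fst ps) 0 * qp h (a * (- of_int n + of_int E * \<pi> - of_int j) - kap ps * \<pi>))
     (Phi E (- of_int n + of_int E * \<pi> - of_int j + 1/2) (VV (map fst ps) (bexp sc (W ps) j v))))" (is "_ = Sum_any (\<lambda>j. ?G j v)")
    and "finite {j. Phi E (- of_int n + of_int E * \<pi> - of_int j + 1/2) (VV (map fst ps) (bexp sc (W ps) j v)) \<noteq> 0}"
proof -
  have s: "set (map fst ps) \<subseteq> verts Q" using ps by simp
  let ?P = "\<lambda>j v. Phi E (- of_int n + of_int E * \<pi> - of_int j + 1/2) (VV (map fst ps) (bexp sc (W ps) j v))"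
  obtain I u where I: "finite I" and Ju: "\<And>\<nu>. J (u \<nu>) = sc \<nu> (u \<nu>)" and pu: "\<And>\<nu>. p (u \<nu>) = sc \<pi> (u \<nu>)" and v: "v = (\<Sum>\<nu>\<in>I. u \<nu>)"
    using eig_joint_dec[OF dJ plin Jp[symmetric] vp] by metis
  have Pl: "lin (?P j)" for j
    by (rule lin_comp[OF Phi_lin[OF E(2)] lin_comp[OF VV_lin[OF s] bexp_lin[OF Wfam[OF ps]]]])
  have JVW: "J (VV (map fst ps) (bexp sc (W ps) j (u \<nu>))) = sc \<nu> (VV (map fst ps) (bexp sc (W ps) j (u \<nu>)))" for j \<nu>
    by (rule VV_eig[OF s]) (simp add: J_bexpW[OF ps] Ju lin_sc[OF bexp_lin[OF Wfam[OF ps]]])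
  have each: "nprodD h sc Q kk D M ps n (u \<nu>) = Sum_any (\<lambda>j. ?G j (u \<nu>)) \<and> finite {j. ?P j (u \<nu>) \<noteq> 0}" for \<nu>
  \<comment> \<open>Only for a nonzero component is the difference of the two eigenvalues known to
    be an integer.\<close>
  proof (cases "u \<nu> = 0")
    case True
    have z: "?P j 0 = 0" for j by (rule lin_zero[OF Pl])
    show ?thesis unfolding True lin_zero[OF nprodD_lin[OF ps g]] z by simp
  next
    case False
    then obtain N where N: "\<nu> - \<pi> = of_int N" using joint_integer[OF Ju pu] by blast
    show ?thesis
      using frame_cur_joint[OF ps g Ju pu k[unfolded E(1)] N, of n] unfolding Phi_index[OF E(2) JVW N] E(1)[symmetric] by blast
  qed
  have fin: "finite {j. ?P j v \<noteq> 0}"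
  proof (rule finite_subset)
    show "{j. ?P j v \<noteq> 0} \<subseteq> (\<Union>\<nu>\<in>I. {j. ?P j (u \<nu>) \<noteq> 0})"
      unfolding v lin_sum[OF Pl] by (auto elim: sum.not_neutral_contains_not_neutral)
  qed (use I each in blast)
  then show "finite {j. ?P j v \<noteq> 0}" .
  have "nprodD h sc Q kk D M ps n v = (\<Sum>\<nu>\<in>I. Sum_any (\<lambda>j. ?G j (u \<nu>)))"
    unfolding v lin_sum[OF nprodD_lin[OF ps g]] by (rule sum.cong[OF refl]) (use each in blast)
  also have "\<dots> = Sum_any (\<lambda>j. \<Sum>\<nu>\<in>I. ?G j (u \<nu>))"
  proof (rule Sum_any_sum[symmetric, OF I])
    show "finite {j. ?G j (u \<nu>) \<noteq> 0}" for \<nu>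
      by (rule finite_subset[OF _ conjunct2[OF each[of \<nu>]]]) auto
  qed
  also have "\<dots> = Sum_any (\<lambda>j. ?G j v)" unfolding v lin_sum[OF Pl] scale_sum_right ..
  finally show "nprodD h sc Q kk D M ps n v = Sum_any (\<lambda>j. ?G j v)" .
qed

lemma bexp_A0_0: "bexp sc (A0 0) c v = (if c = 0 then v else 0)"
proof -
  have "EP (A0 0) i u = (if i = 0 then u else 0)" "EM (A0 0) i u = (if i = 0 then u else 0)" for i u
    unfolding EP_def EM_def by (rule Ez_trivial, simp add: A0_def)+
  then have "EM (A0 0) (c + r) (EP (A0 0) r v) = (if r = 0 then (if c = 0 then v else 0) else 0)" for r by auto
  then show ?thesis by (simp add: bexp_eq[OF A0fam])
qed

lemma frame_cur0:
  assumes ps: "okl ps" and g: "gacond ps a" and vp: "p v = sc \<pi> v"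
    and k: "kap ps + (\<Sum>i\<leftarrow>map fst ps. cc i) = 0" and E: "Es (map fst ps) = 0"
  shows "nprodD h sc Q kk D M ps n v = sc (Kc (map fst ps) 0 * qp h (- kap ps * \<pi>)) (VV (map fst ps) (bexp sc (W ps) (- n) v))" (is "_ = ?G v")
proof -
  have s: "set (map fst ps) \<subseteq> verts Q" using ps by simp
  obtain I u where I: "finite I" and Ju: "\<And>\<nu>. J (u \<nu>) = sc \<nu> (u \<nu>)" and pu: "\<And>\<nu>. p (u \<nu>) = sc \<pi> (u \<nu>)" and v: "v = (\<Sum>\<nu>\<in>I. u \<nu>)"
    using eig_joint_dec[OF dJ plin Jp[symmetric] vp] by metis
  have Gl: "lin ?G" by (intro lin_scale lin_comp[OF VV_lin[OF s] bexp_lin[OF Wfam[OF ps]]])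
  have "nprodD h sc Q kk D M ps n (u \<nu>) = ?G (u \<nu>)" for \<nu>
  proof (cases "u \<nu> = 0")
    case True
    then show ?thesis by (simp only: lin_zero[OF nprodD_lin[OF ps g]] lin_zero[OF Gl])
  next
    case False
    then obtain N where N: "\<nu> - \<pi> = of_int N" using joint_integer[OF Ju pu] by blast
    have k': "kap ps + (\<Sum>i\<leftarrow>map fst ps. cc i) = a * of_int (Es (map fst ps))" using k E by simp
    have "nprodD h sc Q kk D M ps n (u \<nu>) = Sum_any (\<lambda>j. if j = - n then ?G (u \<nu>) else 0)"
      unfolding frame_cur_joint(1)[OF ps g Ju pu k' N] E bexp_A0_0
      by (rule Sum_any.cong) simp
    then show ?thesis by simp
  qed
  then show ?thesis unfolding v lin_sum[OF nprodD_lin[OF ps g]] lin_sum[OF Gl] by simp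
qed

text \<open>For J in Z + 1/2 both fermions have integer powers of z only; at other exponents their
  coefficients vanish.\<close>

lemma Phi_half:
  assumes u: "J u = sc (of_int N + 1/2) u"
  shows "Phi (- 1) (of_int c) u = Yi (bexp sc (A0 (- 1)) (c + N) u)"
    and "Phi 1 (of_int c) u = Y (bexp sc (A0 1) (c - N - 1) u)"
    and "e = 1 \<or> e = - 1 \<Longrightarrow> d \<notin> \<int> \<Longrightarrow> Phi e d u = 0"
proof -
  have 1: "of_int c - (of_int (- 1) * (of_int N + 1/2) + 1/2) = (of_int (c + N) :: complex)"
    "of_int c - (of_int 1 * (of_int N + 1/2) + 1/2) = (of_int (c - N - 1) :: complex)" by (simp_all add: field_simps)
  show "Phi (- 1) (of_int c) u = Yi (bexp sc (A0 (- 1)) (c + N) u)" "Phi 1 (of_int c) u = Y (bexp sc (A0 1) (c - N - 1) u)"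
    using Phi_eig[OF _ u, of "- 1" "of_int c"] Phi_eig[OF _ u, of 1 "of_int c"] unfolding 1 by simp_all
  assume e: "e = 1 \<or> e = - 1" and d: "d \<notin> \<int>"
  have "d - (of_int e * (of_int N + 1/2) + 1/2) \<notin> \<int>"
  proof
    assume "d - (of_int e * (of_int N + 1/2) + 1/2) \<in> \<int>"
    moreover have "of_int e * (of_int N + 1/2) + 1/2 \<in> (\<int> :: complex set)"
    proof -
      have "of_int 1 * (of_int N + 1/2) + 1/2 = (of_int (N + 1) :: complex)" "of_int (- 1) * (of_int N + 1/2) + 1/2 = (of_int (- N) :: complex)"
        by (simp_all add: field_simps)
      then show ?thesis using e by (metis Ints_of_int)
    qed
    ultimately have "d - (of_int e * (of_int N + 1/2) + 1/2) + (of_int e * (of_int N + 1/2) + 1/2) \<in> \<int>" by (rule Ints_add)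
    then show False using d by simp
  qed
  then show "Phi e d u = 0" unfolding Phi_eig[OF e u] by simp
qed

lemma A0_self:
  "bexp sc (A0 (- 1)) c (bexp sc (A0 (- 1)) d v) = BB (A0 (- 1)) (A0 (- 1)) c d v - BB (A0 (- 1)) (A0 (- 1)) (c + 1) (d - 1) v"
proof -
  let ?a = "A0 (- 1)" and ?B = "\<lambda>l. BB (A0 (- 1)) (A0 (- 1)) (c + l) (d - l) v"
  have "contr (\<lambda>n. - of_int (- 1 * - 1) / of_nat n) (lin1 1)" using contr_lin1[of 1] by simp
  from bexp_prod[OF A0fam A0fam A0comm A0brk this]
  have "bexp sc ?a c (bexp sc ?a d v) = Sum_any (\<lambda>l. sc (co (lin1 1) l) (?B l))" .
  also have "\<dots> = (\<Sum>l\<in>{0, 1}. sc (co (lin1 1) l) (?B l))"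
    by (rule Sum_any.expand_superset) (auto simp: co_lin1 split: if_splits)
  finally show ?thesis by (simp add: co_lin1)
qed

text \<open>The two expansions of 1/(1 - x) add up to \<delta>(x), and at coinciding points the
  oscillators of Psi and Psi* cancel. The offsets by 1 are the shifts of J caused by Y and its
  inverse.\<close>

lemma A0_mixed:
  "bexp sc (A0 (- 1)) (c + 1) (bexp sc (A0 1) d v) + bexp sc (A0 1) (d + 1) (bexp sc (A0 (- 1)) c v) = (if c + d + 1 = 0 then v else 0)"
proof -
  let ?B = "\<lambda>l. BB (A0 (- 1)) (A0 1) (c + 1 + l) (d - l) v"
  have F: "contr (\<lambda>n. - of_int (- 1 * 1) / of_nat n) (geo 1)" "contr (\<lambda>n. - of_int (1 * - 1) / of_nat n) (geo 1)"
    using contr_geo[of 1] by simp_all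
  have fin: "finite {l. ?B l \<noteq> 0}" by (rule BB_fin[OF A0fam A0fam A0comm])
  have f: "finite {l. sc (k l) (?B l) \<noteq> 0}" for k by (rule finite_subset[OF _ fin]) auto
  have "bexp sc (A0 1) (d + 1) (bexp sc (A0 (- 1)) c v) = Sum_any (\<lambda>l. sc (co (geo 1) l) (BB (A0 1) (A0 (- 1)) (d + 1 + l) (c - l) v))"
    by (rule bexp_prod[OF A0fam A0fam A0comm A0brk F(2)])
  also have "\<dots> = Sum_any (\<lambda>l. sc (co (geo 1) (- 1 - l)) (?B l))"
    by (subst Sum_any_reflect[of _ "- 1", symmetric]) (simp add: BB_sym[OF A0fam A0fam A0comm, of 1] algebra_simps)
  finally have 1: "bexp sc (A0 1) (d + 1) (bexp sc (A0 (- 1)) c v) = Sum_any (\<lambda>l. sc (co (geo 1) (- 1 - l)) (?B l))" .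
  have 2: "bexp sc (A0 (- 1)) (c + 1) (bexp sc (A0 1) d v) = Sum_any (\<lambda>l. sc (co (geo 1) l) (?B l))"
    by (rule bexp_prod[OF A0fam A0fam A0comm A0brk F(1)])
  \<comment> \<open>One expansion covers l >= 0 and the other l <= - 1, so every index occurs
    exactly once.\<close>
  have "sc (co (geo 1) l) (?B l) + sc (co (geo 1) (- 1 - l)) (?B l) = ?B l" for l
    by (auto simp: co_geo)
  then have "bexp sc (A0 (- 1)) (c + 1) (bexp sc (A0 1) d v) + bexp sc (A0 1) (d + 1) (bexp sc (A0 (- 1)) c v) = Sum_any ?B"
    unfolding 1 2 by (subst Sum_any.distrib[symmetric, OF f f]) simp
  also have "\<dots> = bexp sc (\<lambda>n v. sh h 0 (A0 (- 1)) n v + A0 1 n v) (c + 1 + d) v"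
    using BB_delta[OF A0fam A0fam A0comm, where e = 0 and h = h and c = "c + 1" and d = d and v = v] by simp
  also have "\<dots> = bexp sc (A0 0) (c + 1 + d) v"
    by (rule bexp_cong) (simp add: sh_def A0_def scale_left_distrib[symmetric])
  finally show ?thesis by (simp add: bexp_A0_0 algebra_simps)
qed

text \<open>Psi* occurs only at exponent 0, which is the coefficient picked by the contour integral
  of the screening current.\<close>

lemma anticommutators:
  assumes u: "J u = sc (of_int N + 1/2) u"
  shows "Phi (- 1) 0 (Phi (- 1) c u) + Phi (- 1) c (Phi (- 1) 0 u) = 0"
    and "Phi (- 1) 0 (Phi 1 c u) + Phi 1 c (Phi (- 1) 0 u) = (if c = 0 then u else 0)"
proof -
  have 0: "Phi (- 1) 0 w = Yi (bexp sc (A0 (- 1)) N' w)" if "J w = sc (of_int N' + 1/2) w" for w N'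
    using Phi_half(1)[OF that, of 0] by simp
  have Jm: "J (Yi (bexp sc (A0 e) d u)) = sc (of_int (N - 1) + 1/2) (Yi (bexp sc (A0 e) d u))"
    and Jp: "J (Y (bexp sc (A0 e) d u)) = sc (of_int (N + 1) + 1/2) (Y (bexp sc (A0 e) d u))" for e d
  proof -
    have w: "J (bexp sc (A0 e) d u) = sc (of_int N + 1/2) (bexp sc (A0 e) d u)"
      by (simp only: J_bexp u lin_sc[OF bexp_lin[OF A0fam]])
    have m: "of_int (N - 1) + 1/2 = of_int N + 1/2 - (1 :: complex)" and q: "of_int (N + 1) + 1/2 = of_int N + 1/2 + (1 :: complex)"
      by simp_all
    show "J (Yi (bexp sc (A0 e) d u)) = sc (of_int (N - 1) + 1/2) (Yi (bexp sc (A0 e) d u))"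
      unfolding m JYi w lin_sc[OF Yilin] scale_left_diff_distrib[of _ 1] scale_one ..
    show "J (Y (bexp sc (A0 e) d u)) = sc (of_int (N + 1) + 1/2) (Y (bexp sc (A0 e) d u))"
      unfolding q JY w lin_add[OF Ylin] lin_sc[OF Ylin] scale_left_distrib[of _ 1] scale_one ..
  qed
  have nz: "Phi e 0 0 = 0" "Phi e c 0 = 0" if "e = 1 \<or> e = - 1" for e by (simp_all add: lin_zero[OF Phi_lin[OF that]])
  note Yb = Y_bexp Yi_bexp
  consider (int) C where "c = of_int C" | (nint) "c \<notin> \<int>" by (auto simp: Ints_def)
  note cs = this
  show "Phi (- 1) 0 (Phi (- 1) c u) + Phi (- 1) c (Phi (- 1) 0 u) = 0"
  proof (cases rule: cs)
    case int
    have "Phi (- 1) 0 (Phi (- 1) c u) = Yi (Yi (bexp sc (A0 (- 1)) (N - 1) (bexp sc (A0 (- 1)) (C + N) u)))"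
      unfolding int Phi_half(1)[OF u] 0[OF Jm] by (simp add: Yb)
    moreover have "Phi (- 1) c (Phi (- 1) 0 u) = Yi (Yi (bexp sc (A0 (- 1)) (C + N - 1) (bexp sc (A0 (- 1)) N u)))"
      unfolding int 0[OF u] Phi_half(1)[OF Jm] by (simp add: Yb add_diff_eq)
    moreover have "bexp sc (A0 (- 1)) (N - 1) (bexp sc (A0 (- 1)) (C + N) u) + bexp sc (A0 (- 1)) (C + N - 1) (bexp sc (A0 (- 1)) N u) = 0"
      unfolding A0_self using BB_sym[OF A0fam A0fam A0comm, of "- 1" "- 1"] by simp
    ultimately show ?thesis by (simp add: lin_add[OF Yilin, symmetric] lin_zero[OF Yilin])
  next
    case nint
    then show ?thesis using Phi_half(3)[OF u _ nint] Phi_half(3)[OF Jm _ nint] 0[OF u] nz by simp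
  qed
  show "Phi (- 1) 0 (Phi 1 c u) + Phi 1 c (Phi (- 1) 0 u) = (if c = 0 then u else 0)"
  proof (cases rule: cs)
    case int
    have "Phi (- 1) 0 (Phi 1 c u) = bexp sc (A0 (- 1)) (N + 1) (bexp sc (A0 1) (C - N - 1) u)"
      unfolding int Phi_half(2)[OF u] 0[OF Jp] by (simp add: Yb[symmetric] YiY)
    moreover have "Phi 1 c (Phi (- 1) 0 u) = bexp sc (A0 1) (C - N - 1 + 1) (bexp sc (A0 (- 1)) N u)"
      unfolding int 0[OF u] Phi_half(2)[OF Jm] by (simp add: Yb[symmetric] YYi)
    ultimately show ?thesis using A0_mixed[of N "C - N - 1" u] by (simp add: int)
  next
    case nint
    then have "c \<noteq> 0" by auto
    then show ?thesis using Phi_half(3)[OF u _ nint] Phi_half(3)[OF Jm _ nint] 0[OF u] nz by simp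
  qed
qed

end

subsection \<open>The frame of a fermionization\<close>

lemma qp_times: "qp (c * h) e = qp h (c * e)" by (simp add: qp_def mult_ac)

locale fermi_seed = cvs sc for sc :: "complex \<Rightarrow> 'v::ab_group_add \<Rightarrow> 'v" +
  fixes h :: complex and Q :: "'i dquiver" and M :: "('i, 'v) seed_ops" and kk :: 'i and \<Phi> :: "('i, 'v) fermi_ops"
  assumes fe: "fermionization h sc Q kk M \<Phi>" and finV: "finite (verts Q)"
    and epsV: "i \<in> verts Q \<Longrightarrow> eps Q i kk \<in> {- 1, 0, 1}"
    and qnz: "n \<noteq> 0 \<Longrightarrow> qp h (of_int n) - qp h (- of_int n) \<noteq> 0"
begin

lemma kV: "kk \<in> verts Q" and kU: "vkind Q kk = Unfrozen" and kL: "labels Q kk kk = {#}" and smM: "seed_module h sc Q M"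
  using fe by (simp_all add: fermionization_def)

sublocale s: seed sc h Q M by unfold_locales (rule smM)

text \<open>The value at \<open>kk\<close> makes the residual oscillators of X_k vanish: X_k is a
  product of fermions with V_k = 1 and fits the same scheme as its neighbours.\<close>

definition gf :: "'i \<Rightarrow> int \<Rightarrow> complex" where
  "gf i n = (if i = kk then qp h (of_int n) - qp h (- of_int n) else fermi_coeff h Q kk i n)"

definition wf :: "'i \<Rightarrow> int \<Rightarrow> 'v \<Rightarrow> 'v" where
  "wf i n v = osc M i n v - sc (gf i n / (qp h (of_int n) - qp h (- of_int n))) (osc M kk n v)"

definition Vf :: "'i \<Rightarrow> 'v \<Rightarrow> 'v" where "Vf i = (if i = kk then (\<lambda>v. v) else fV \<Phi> i)"

definition ccf :: "'i \<Rightarrow> complex" where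
  "ccf i = (if i = kk then - 2 else (\<Sum>e\<in>#labels Q i kk. 1 + e) + (\<Sum>e\<in>#labels Q kk i. 1 + e))"

text \<open>Contraction of the V_i alone. The fermion parts of X_i and X_j contract to -
  \<open>gf i n\<close> times \<open>gf j (- n)\<close> over n, the sign coming from the odd
  denominators q^n - q^(-n), and this is taken off C.\<close>

definition bwf :: "'i \<Rightarrow> 'i \<Rightarrow> nat \<Rightarrow> complex" where
  "bwf i j n = (Cmat (of_nat n * h) Q i j + gf i (int n) * gf j (- int n)) / of_nat n"

lemma wf_v_osc: "i \<noteq> kk \<Longrightarrow> wf i n v = v_osc h sc Q kk M i n v" by (simp add: wf_def gf_def v_osc_def)

text \<open>The row and the column of C at a vertex without loop are divisible by q^n - q^(-n), with
  the fermion coefficients as quotients. This is what permits splitting off fermions so that the V_j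
  commute with them.\<close>

lemma Cmat_k:
  shows "Cmat (of_nat n * h) Q i kk = gf i (int n) * (qp h (of_nat n) - qp h (- of_nat n))"
    and "Cmat (of_nat n * h) Q kk j = - gf j (- int n) * (qp h (of_nat n) - qp h (- of_nat n))"
  unfolding Cmat_def cmat_def gf_def fermi_coeff_def qp_times[where c = "of_nat n" and h = h]
  by (cases "i = kk"; simp add: kU kL algebra_simps minus_diff_commute; cases "j = kk"; simp add: kU kL algebra_simps minus_diff_commute)
    (cases "j = kk"; simp add: kU kL algebra_simps minus_diff_commute)

text \<open>The bracket for all signs at once; the relations of a seed module state it for n > 0 and
  for two negative indices.\<close>

definition ka :: "'i \<Rightarrow> 'i \<Rightarrow> int \<Rightarrow> int \<Rightarrow> complex" where
  "ka i j n m = (if n + m \<noteq> 0 then 0 else if n > 0 then Cmat (of_int n * h) Q i j / of_int n else - (Cmat (of_int m * h) Q j i / of_int m))"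

lemma osc_com:
  assumes i: "i \<in> verts Q" and j: "j \<in> verts Q" and n: "n \<noteq> 0" and m: "m \<noteq> 0"
  shows "osc M i n (osc M j m v) = osc M j m (osc M i n v) + sc (ka i j n m) v"
proof -
  consider "n > 0" | "n < 0" "m > 0" | "n < 0" "m < 0" using n m by linarith
  then show ?thesis
  proof cases
    case 1
    then show ?thesis using s.osc_brk[OF i j 1 m, of v] by (auto simp: ka_def algebra_simps)
  next
    case 2
    then show ?thesis using s.osc_brk[OF j i 2(2) n, of v] by (auto simp: ka_def algebra_simps)
  next
    case 3
    then show ?thesis using s.osc_neg[OF i j 3, of v] by (simp add: ka_def)
  qed
qed

lemma ka_k: "i \<in> verts Q \<Longrightarrow> n \<noteq> 0 \<Longrightarrow> m \<noteq> 0 \<Longrightarrow>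
    ka i kk n m = gf i n / (qp h (of_int n) - qp h (- of_int n)) * ka kk kk n m"
proof -
  assume n: "n \<noteq> 0" and m: "m \<noteq> 0"
  have gk: "gf kk l = qp h (of_int l) - qp h (- of_int l)" for l by (simp add: gf_def)
  consider "n + m \<noteq> 0" | "n > 0" "m = - n" | "m > 0" "n = - m" using n by linarith
  then show ?thesis
  proof cases
    case 2
    then obtain l where "n = int l" "l > 0" using zero_less_imp_eq_int by auto
    then show ?thesis using Cmat_k(1)[of l i] Cmat_k(1)[of l kk] qnz[of "int l"] 2 by (simp add: ka_def gk)
  next
    case 3
    then obtain l where l: "m = int l" "l > 0" using zero_less_imp_eq_int by auto
    define b where "b = qp h (of_nat l) - qp h (- of_nat l)"
    have b: "b \<noteq> 0" "qp h (- of_nat l) - qp h (of_nat l) = - b" using qnz[of "int l"] l by (simp_all add: b_def)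
    show ?thesis using Cmat_k(2)[of l i] Cmat_k(2)[of l kk] l 3 b by (simp add: ka_def gk b_def[symmetric])
  qed (simp add: ka_def)
qed

lemma wf_k: "n \<noteq> 0 \<Longrightarrow> wf kk n v = 0"
  unfolding wf_def using qnz[of n] by (simp add: gf_def)

lemma wf_lin: assumes "i \<in> verts Q" "n \<noteq> 0" shows "lin (wf i n)"
  unfolding wf_def[abs_def] by (intro lin_minus lin_scale s.osc_lin assms kV)

text \<open>The subtracted multiple of x_k has the same bracket with x_k as x_i has, so the
  difference commutes with it.\<close>

lemma y_wf:
  assumes i: "i \<in> verts Q" and n: "n \<noteq> 0" and m: "m \<noteq> 0"
  shows "osc M kk n (wf i m v) = wf i m (osc M kk n v)"
proof -
  have "wf i m (osc M kk n v) = osc M kk n (wf i m v) + sc (ka i kk m n - gf i m / (qp h (of_int m) - qp h (- of_int m)) * ka kk kk m n) v"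
    unfolding wf_def lin_diff[OF s.osc_lin[OF kV n]] lin_sc[OF s.osc_lin[OF kV n]] osc_com[OF i kV m n] osc_com[OF kV kV m n]
    by (simp add: scale_right_distrib scale_left_diff_distrib)
  then show ?thesis unfolding ka_k[OF i m n] by simp
qed

lemma wf_com:
  assumes i: "i \<in> verts Q" and j: "j \<in> verts Q" and n: "n \<noteq> 0" and m: "m \<noteq> 0"
  shows "wf i n (wf j m v) = wf j m (wf i n v) + sc (ka i j n m - gf j m / (qp h (of_int m) - qp h (- of_int m)) * ka i kk n m) v"
proof -
  let ?s = "gf i n / (qp h (of_int n) - qp h (- of_int n))" and ?t = "gf j m / (qp h (of_int m) - qp h (- of_int m))"
  have "osc M i n (wf j m v) = wf j m (osc M i n v) + sc (ka i j n m - ?t * ka i kk n m) v"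
    unfolding wf_def lin_diff[OF s.osc_lin[OF i n]] lin_sc[OF s.osc_lin[OF i n]] osc_com[OF i j n m] osc_com[OF i kV n m]
    by (simp add: scale_right_distrib scale_left_diff_distrib)
  then show ?thesis
    unfolding wf_def[of i n "wf j m v"] wf_def[of i n v] lin_diff[OF wf_lin[OF j m]] lin_sc[OF wf_lin[OF j m]] y_wf[OF j n m]
    by simp
qed

lemma wf_smooth: "smooth (verts Q) wf"
proof (rule smooth_comb[OF s.sm_smooth])
  show "lin (osc M i (int n))" if "i \<in> verts Q" "n > 0" for i n by (rule s.osc_lin) (use that in auto)
  show "wf j (int n) v = (\<Sum>i\<in>verts Q. sc ((if i = j then 1 else 0) - (if i = kk then gf j (int n) / (qp h (of_int (int n)) - qp h (- of_int (int n))) else 0)) (osc M i (int n) v))"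
    if "j \<in> verts Q" "n > 0" for j n v
  proof -
    have d: "sc (if b then c else 0) u = (if b then sc c u else 0)" for b c u by simp
    show ?thesis using that kV
      unfolding scale_left_diff_distrib sum_subtractf d by (simp add: finV wf_def)
  qed
qed

lemma wf_same: "i \<in> verts Q \<Longrightarrow> j \<in> verts Q \<Longrightarrow> n \<noteq> 0 \<Longrightarrow> m \<noteq> 0 \<Longrightarrow> n + m \<noteq> 0 \<Longrightarrow> wf i n (wf j m v) = wf j m (wf i n v)"
  by (subst wf_com, assumption+) (simp add: ka_def)

lemma wf_fam: assumes i: "i \<in> verts Q" shows "fam (wf i)"
proof (rule fam_smooth[OF smooth_mono[OF wf_smooth]])
  show "{i} \<subseteq> verts Q" using i by simp
  have "wf i n (wf i m v) = wf i m (wf i n v)" if "n \<noteq> 0" "m \<noteq> 0" "n + m \<noteq> 0" for n m v by (rule wf_same[OF i i that])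
  then show "cfam (\<lambda>n. wf i (int n))" "cfam (\<lambda>n. wf i (- int n))" unfolding cfam_def by (simp_all add: wf_lin[OF i])
qed

lemma bwf_ka: "i \<in> verts Q \<Longrightarrow> n > 0 \<Longrightarrow>
   ka i j (int n) (- int n) - gf j (- int n) / (qp h (of_int (- int n)) - qp h (- of_int (- int n))) * ka i kk (int n) (- int n) = bwf i j n"
proof -
  assume n: "n > 0"
  define b where "b = qp h (of_nat n) - qp h (- of_nat n)"
  have b: "b \<noteq> 0" using qnz[of "int n"] n by (simp add: b_def)
  have e: "qp h (of_int (- int n)) - qp h (- of_int (- int n)) = - b" by (simp add: b_def)
  have k: "ka i j (int n) (- int n) = Cmat (of_nat n * h) Q i j / of_nat n" "ka i kk (int n) (- int n) = gf i (int n) * b / of_nat n"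
    using n by (simp_all add: ka_def Cmat_k b_def)
  show ?thesis unfolding e k bwf_def using b n by (simp add: add_divide_distrib)
qed

lemma wf_x: "xfam (verts Q) wf bwf"
  unfolding xfam_def
proof (intro ballI conjI)
  fix i j assume i: "i \<in> verts Q" and j: "j \<in> verts Q"
  show "fam (wf i)" by (rule wf_fam[OF i])
  show "comm2 (wf i) (wf j)" unfolding comm2_def using wf_same[OF i j] by simp
  show "brk (wf i) (wf j) (bwf i j)" unfolding brk_def
  proof (intro allI impI, elim conjE)
    fix m n :: nat and v assume m: "m > 0" and n: "n > 0"
    show "wf i (int m) (wf j (- int n) v) = wf j (- int n) (wf i (int m) v) + (if m = n then sc (bwf i j m) v else 0)"
    proof (cases "m = n")
      case True
      then show ?thesis using wf_com[OF i j, of "int n" "- int n" v] n bwf_ka[OF i n, of j] by simp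
    next
      case False
      then show ?thesis using wf_same[OF i j, of "int m" "- int n" v] m n by simp
    qed
  qed
qed

text \<open>The sign - 1 at \<open>kk\<close> and the value - 2 of \<open>ccf\<close> there come
  from X_k = - q^(-2 J).\<close>

sublocale f: frame sc h Q M kk "fJ \<Phi>" "fY \<Phi>" "fYinv \<Phi>" "fp \<Phi>" Vf "\<lambda>i. if i = kk then - 1 else 1" ccf "osc M kk" wf gf bwf
proof (rule frame.intro[OF cvs_axioms frame_axioms.intro])
  note F = fe[unfolded fermionization_def]
  show "diagonalizable sc UNIV (fJ \<Phi>)" "diagonalizable sc UNIV (fp \<Phi>)" "diagonalizable sc \<int> (\<lambda>v. fJ \<Phi> v - fp \<Phi> v)" "lin (fY \<Phi>)"
    using F by simp_all
  show "fY \<Phi> (fYinv \<Phi> v) = v" "fYinv \<Phi> (fY \<Phi> v) = v" "fJ \<Phi> (fY \<Phi> v) = fY \<Phi> (fJ \<Phi> v + v)"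
    "fJ \<Phi> (fp \<Phi> v) = fp \<Phi> (fJ \<Phi> v)" "fY \<Phi> (fp \<Phi> v) = fp \<Phi> (fY \<Phi> v)" for v
    using F by simp_all
  have lV: "lin (fV \<Phi> i)" if "i \<in> verts Q" "i \<noteq> kk" for i using F that by simp
  have lJ: "lin (fJ \<Phi>)" and lp: "lin (fp \<Phi>)" and lY: "lin (fY \<Phi>)" using F by (simp_all add: diagonalizable_def)
  have FJ: "fJ \<Phi> (osc M i n v) = osc M i n (fJ \<Phi> v)" and FY: "fY \<Phi> (osc M i n v) = osc M i n (fY \<Phi> v)"
    and Fp: "fp \<Phi> (osc M i n v) = osc M i n (fp \<Phi> v)" if "i \<in> verts Q" "n \<noteq> 0" for i n v
    using F that by simp_all
  have FV: "fV \<Phi> j (osc M i n v) = osc M i n (fV \<Phi> j v)" if "j \<in> verts Q" "j \<noteq> kk" "i \<in> verts Q" "n \<noteq> 0" for i j n v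
    using F that by simp
  show "lin (Vf i)" if "i \<in> verts Q" for i using lV that by (simp add: Vf_def lin_id)
  show "eps Q i kk \<in> {- 1, 0, 1}" if "i \<in> verts Q" for i by (rule epsV[OF that])
  show "zer M i v = sc (if i = kk then - 1 else 1) (weyl h sc (fJ \<Phi>) (fY \<Phi>) (fYinv \<Phi>) (eps Q i kk) (ccf i) (Vf i v))" if "i \<in> verts Q" for i v
  proof (cases "i = kk")
    case True
    have "zer M kk v = - opfun sc (\<lambda>\<mu>. qp h (-2 * \<mu>)) (fJ \<Phi>) v" using F by simp
    then show ?thesis using True by (simp add: weyl_def eps_def ccf_def Vf_def)
  next
    case False
    then show ?thesis using F that by (simp add: ccf_def Vf_def)
  qed
  show "Vf i (fJ \<Phi> v) = fJ \<Phi> (Vf i v)" "Vf i (fY \<Phi> v) = fY \<Phi> (Vf i v)" if "i \<in> verts Q" for i v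
    using F that by (auto simp: Vf_def)
  show "fp \<Phi> (Vf i v) = Vf i (fp \<Phi> v + sc (of_int (eps Q i kk)) v)" if "i \<in> verts Q" for i v
    using F that by (auto simp: Vf_def eps_def)
  show "smooth {kk} (\<lambda>_. osc M kk)"
  proof (rule smooth_comb[OF smooth_mono[OF s.sm_smooth], where I = "{kk}" and k = "\<lambda>_ _ _. 1"])
    show "{kk} \<subseteq> verts Q" using kV by simp
  qed (use s.osc_lin kV in auto)
  show "cfam (\<lambda>n. osc M kk (int n))" "cfam (\<lambda>n. osc M kk (- int n))"
    using s.osc_fam[OF kV] by (simp_all add: fam_def)
  show "xfam (verts Q) wf bwf" by (rule wf_x)
  show "fJ \<Phi> (osc M kk n v) = osc M kk n (fJ \<Phi> v)" "fY \<Phi> (osc M kk n v) = osc M kk n (fY \<Phi> v)" "fp \<Phi> (osc M kk n v) = osc M kk n (fp \<Phi> v)"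
    if "n \<noteq> 0" for n v using FJ FY Fp kV that by simp_all
  show "fJ \<Phi> (wf i n v) = wf i n (fJ \<Phi> v)" "fY \<Phi> (wf i n v) = wf i n (fY \<Phi> v)" "fp \<Phi> (wf i n v) = wf i n (fp \<Phi> v)"
    if "i \<in> verts Q" "n \<noteq> 0" for i n v
    unfolding wf_def lin_diff[OF lJ] lin_sc[OF lJ] lin_diff[OF lY] lin_sc[OF lY] lin_diff[OF lp] lin_sc[OF lp]
    using FJ FY Fp kV that by simp_all
  show "Vf i (osc M kk n v) = osc M kk n (Vf i v)" if "i \<in> verts Q" "n \<noteq> 0" for i n v
    using FV kV that by (simp add: Vf_def)
  show "Vf i (wf j n v) = wf j n (Vf i v)" if "i \<in> verts Q" "j \<in> verts Q" "n \<noteq> 0" for i j n v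
    using FV kV that by (cases "i = kk") (simp_all add: Vf_def wf_def lin_diff[OF lV] lin_sc[OF lV])
  show "osc M kk n (wf i m v) = wf i m (osc M kk n v)" if "i \<in> verts Q" "n \<noteq> 0" "m \<noteq> 0" for i n m v
    by (rule y_wf[OF that])
  show "brk (osc M kk) (osc M kk) (\<lambda>n. (qp h (of_nat n) - qp h (- of_nat n))\<^sup>2 / of_nat n)"
    unfolding brk_def using s.osc_br[OF kV kV] by (simp add: Cmat_k gf_def power2_eq_square)
  show "osc M i n v = wf i n v + sc (gf i n / (qp h (of_int n) - qp h (- of_int n))) (osc M kk n v)" for i n v
    by (simp add: wf_def)
  show "qp h (of_int n) - qp h (- of_int n) \<noteq> 0" if "n \<noteq> 0" for n by (rule qnz[OF that])
qed

end

subsection \<open>The fermionic screening charge\<close>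

context frame
begin

lemma joint_ext:
  assumes S: "diagonalizable sc S J" and f: "lin f" and g: "lin g"
    and e: "\<And>\<mu> \<pi> v. \<mu> \<in> S \<Longrightarrow> J v = sc \<mu> v \<Longrightarrow> p v = sc \<pi> v \<Longrightarrow> f v = g v"
  shows "f v = g v"
proof (rule eig_ext[OF S f g])
  fix \<mu> v assume m: "\<mu> \<in> S" and v: "J v = sc \<mu> v"
  obtain I u where I: "finite I" and u: "\<And>\<nu>. p (u \<nu>) = sc \<nu> (u \<nu>)" "\<And>\<nu>. J (u \<nu>) = sc \<mu> (u \<nu>)" and v: "v = (\<Sum>\<nu>\<in>I. u \<nu>)"
    using eig_joint_dec[OF dp Jlin Jp v] by metis
  show "f v = g v" unfolding v lin_sum[OF f] lin_sum[OF g] by (rule sum.cong[OF refl]) (rule e[OF m u(2) u(1)])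
qed

lemma p_Phi:
  assumes u: "J u = sc \<mu> u" "p u = sc \<pi> u" and e: "e = 1 \<or> e = - 1" shows "p (Phi e c u) = sc \<pi> (Phi e c u)"
proof -
  have "p (Ypow e (bexp sc (A0 e) m u)) = sc \<pi> (Ypow e (bexp sc (A0 e) m u))" for m
    using e Ypow_comm[of p e] by (simp add: Yp[symmetric] p_bexp u lin_sc[OF bexp_lin[OF A0fam]] lin_sc[OF Ypow_lin])
  then show ?thesis unfolding Phi_eig[OF e u(1)] by (simp add: lin_zero[OF plin])
qed

lemma VV_Phi:
  assumes s: "set is \<subseteq> verts Q" and u: "J u = sc \<mu> u" and e: "e = 1 \<or> e = - 1" and rs: "okl rs"
  shows "VV is (bexp sc (W rs) j (Phi e c u)) = Phi e c (VV is (bexp sc (W rs) j u))"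
proof -
  have b: "J (bexp sc (W rs) j u) = sc \<mu> (bexp sc (W rs) j u)" by (simp add: J_bexpW[OF rs] u lin_sc[OF bexp_lin[OF Wfam[OF rs]]])
  have YW: "Ypow e (bexp sc (W rs) j x) = bexp sc (W rs) j (Ypow e x)" for x
    using e Y_bexpW[OF rs] Yi_bexpW[OF rs] by auto
  have YV: "VV is (Ypow e x) = Ypow e (VV is x)" for x
    using e VV_comm[OF s, of Y] VV_comm[OF s, of Yi] VY VYi by auto
  have AW: "bexp sc (A0 e) m (bexp sc (W rs) j x) = bexp sc (W rs) j (bexp sc (A0 e) m x)" for m x
    unfolding bexp_prod0[OF A0fam Wfam[OF rs] A0Wcomm2[OF rs] A0Wbrk[OF rs]]
      bexp_prod0[OF Wfam[OF rs] A0fam comm2_sym[OF A0Wcomm2[OF rs]] WA0brk[OF rs]]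
    by (rule BB_sym[OF A0fam Wfam[OF rs] A0Wcomm2[OF rs]])
  have nV: "VV is 0 = 0" by (rule lin_zero[OF VV_lin[OF s]])
  show ?thesis
    unfolding Phi_eig[OF e u] Phi_eig[OF e VV_eig[OF s b]]
    by (simp add: YW[symmetric] YV AW[symmetric] VV_bexp[OF rs s] lin_zero[OF bexp_lin[OF Wfam[OF rs]]] nV)
qed

text \<open>What the anticommutator of Psi* with Psi leaves in a term of charge 1: the fermion
  exponent must be 0, which selects at most one j.\<close>

definition screen_rest :: "('i \<times> complex) list \<Rightarrow> complex \<Rightarrow> complex \<Rightarrow> int \<Rightarrow> 'v \<Rightarrow> 'v" where
  "screen_rest ps b \<pi> n v = Sum_any (\<lambda>j. if - of_int n + \<pi> - of_int j + 1/2 = (0 :: complex)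
     then sc b (VV (map fst ps) (bexp sc (W ps) j v)) else 0)"

text \<open>Such a term is a fermion times operators commuting with the fermions, so it anticommutes
  with the charge, except that a term with Psi leaves the contribution of the delta
  function.\<close>

lemma screen:
  assumes ps: "okl ps" and g: "gacond ps a" and k: "kap ps + (\<Sum>i\<leftarrow>map fst ps. cc i) = a * of_int E"
    and E: "E = Es (map fst ps)" "E = 1 \<or> E = - 1" and u: "J u = sc \<mu> u" "p u = sc \<pi> u" and half: "\<mu> - 1/2 \<in> \<int>"
  shows "Phi (- 1) 0 (nprodD h sc Q kk D M ps n u) = - nprodD h sc Q kk D M ps n (Phi (- 1) 0 u) +
     (if E = 1 then screen_rest ps (Kc (map fst ps) 0 * qp h (- a / 2 - kap ps * \<pi>)) \<pi> n u else 0)"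
proof -
  have s: "set (map fst ps) \<subseteq> verts Q" using ps by simp
  let ?x = "\<lambda>j. VV (map fst ps) (bexp sc (W ps) j u)"
  let ?c = "\<lambda>j. - of_int n + of_int E * \<pi> - of_int j + 1/2"
  let ?K = "\<lambda>j. Kc (map fst ps) 0 * qp h (a * (- of_int n + of_int E * \<pi> - of_int j) - kap ps * \<pi>)"
  have m: "(- 1 :: int) = 1 \<or> (- 1 :: int) = - 1" by simp
  obtain N where "\<mu> - 1/2 = of_int N" using half by (auto simp: Ints_def)
  then have N: "\<mu> = of_int N + 1/2" by (simp add: algebra_simps)
  have bu: "J (bexp sc (W ps) j u) = sc \<mu> (bexp sc (W ps) j u)" for j
    by (simp add: J_bexpW[OF ps] u lin_sc[OF bexp_lin[OF Wfam[OF ps]]])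
  have xJ: "J (?x j) = sc (of_int N + 1/2) (?x j)" for j using VV_eig[OF s bu] N by simp
  have lP: "lin (Phi (- 1) 0)" by (rule Phi_lin) simp
  note c1 = frame_cur[OF ps g u(2) k E, of n] and c2 = frame_cur[OF ps g p_Phi[OF u m] k E, of n]
  have f1: "finite {j. sc (?K j) (Phi E (?c j) (?x j)) \<noteq> 0}" by (rule finite_subset[OF _ c1(2)]) auto
  have f1': "finite {j. Phi (- 1) 0 (sc (?K j) (Phi E (?c j) (?x j))) \<noteq> 0}"
    by (rule finite_subset[OF _ f1]) (auto simp: lin_zero[OF lP])
  have f2: "finite {j. sc (?K j) (Phi E (?c j) (Phi (- 1) 0 (?x j))) \<noteq> 0}"
    by (rule finite_subset[OF _ c2(2)[of 0, unfolded VV_Phi[OF s u(1) m ps]]]) auto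
  have "Phi (- 1) 0 (nprodD h sc Q kk D M ps n u) + nprodD h sc Q kk D M ps n (Phi (- 1) 0 u) =
     Sum_any (\<lambda>j. Phi (- 1) 0 (sc (?K j) (Phi E (?c j) (?x j))) + sc (?K j) (Phi E (?c j) (Phi (- 1) 0 (?x j))))"
    unfolding c1(1) c2(1) VV_Phi[OF s u(1) m ps] lin_Sum_any[OF lP f1] by (rule Sum_any.distrib[OF f1' f2, symmetric])
  also have "\<dots> = Sum_any (\<lambda>j. sc (?K j) (Phi (- 1) 0 (Phi E (?c j) (?x j)) + Phi E (?c j) (Phi (- 1) 0 (?x j))))"
    by (simp only: lin_sc[OF lP] scale_right_distrib)
  also have "\<dots> = (if E = 1 then screen_rest ps (Kc (map fst ps) 0 * qp h (- a / 2 - kap ps * \<pi>)) \<pi> n u else 0)"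
  proof (cases "E = 1")
    case True
    have "sc (?K j) (if ?c j = 0 then ?x j else 0) = (if - of_int n + \<pi> - of_int j + 1/2 = (0::complex) then sc (Kc (map fst ps) 0 * qp h (- a / 2 - kap ps * \<pi>)) (?x j) else 0)" for j
    proof (cases "?c j = 0")
      case t: True
      \<comment> \<open>At fermion exponent 0 the power of q no longer depends on n and j.\<close>
      then have "- of_int n + of_int E * \<pi> - of_int j = (- 1/2 :: complex)" by (simp add: eq_neg_iff_add_eq_0)
      then have "a * (- of_int n + of_int E * \<pi> - of_int j) - kap ps * \<pi> = - a / 2 - kap ps * \<pi>" by simp
      then show ?thesis using t True by simp
    qed (use True in simp)
    then show ?thesis unfolding True screen_rest_def anticommutators(2)[OF xJ] by (simp add: True)
  next
    case False
    then have E1: "E = - 1" using E(2) by simp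
    show ?thesis unfolding E1 anticommutators(1)[OF xJ] by simp
  qed
  finally show ?thesis by (simp add: eq_diff_eq[symmetric])
qed

lemma screen0:
  assumes ps: "okl ps" and g: "gacond ps a" and k: "kap ps + (\<Sum>i\<leftarrow>map fst ps. cc i) = 0"
    and E: "Es (map fst ps) = 0" and u: "J u = sc \<mu> u" "p u = sc \<pi> u"
  shows "Phi (- 1) 0 (nprodD h sc Q kk D M ps n u) = nprodD h sc Q kk D M ps n (Phi (- 1) 0 u)"
proof -
  have s: "set (map fst ps) \<subseteq> verts Q" using ps by simp
  have m: "(- 1 :: int) = 1 \<or> (- 1 :: int) = - 1" by simp
  show ?thesis
    unfolding frame_cur0[OF ps g u(2) k E] frame_cur0[OF ps g p_Phi[OF u m] k E] VV_Phi[OF s u(1) m ps]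
    by (rule lin_sc[OF Phi_lin[OF m]])
qed

text \<open>Since V_k = 1 and X_k has no residual oscillators, appending X_k to a product changes
  only the scalar in front; opposite scalars cancel.\<close>

lemma screen_rest_pair:
  assumes ps: "okl ps" and kk: "\<And>n v. n \<noteq> 0 \<Longrightarrow> w kk n v = 0" "\<And>v. V kk v = v" and b: "b + b' = 0"
  shows "screen_rest ps b \<pi> n u + screen_rest (ps @ [(kk, e)]) b' \<pi> n u = 0"
proof -
  have W': "bexp sc (W (ps @ [(kk, e)])) c v = bexp sc (W ps) c v" for c v
    by (rule bexp_cong) (simp add: osc_sum_append osc_sum_Cons osc_sum_Nil sh_def kk)
  have V': "VV (is @ [kk]) x = VV is x" for "is" x by (induction "is") (simp_all add: kk)
  have b': "b' = - b" using b by (simp add: eq_neg_iff_add_eq_0 add.commute)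
  have "screen_rest (ps @ [(kk, e)]) b' \<pi> n u = Sum_any (\<lambda>j. if - of_int n + \<pi> - of_int j + 1/2 = (0 :: complex)
     then sc (- b) (VV (map fst ps) (bexp sc (W ps) j u)) else 0)" unfolding screen_rest_def W' map_append list.map fst_conv V' b' by simp
  also have "\<dots> = - screen_rest ps b \<pi> n u"
  proof -
    \<comment> \<open>At most one j satisfies the condition, so the sum is a single term or empty,
      and the sign can be taken out.\<close>
    have u: "j = j'" if "- of_int n + \<pi> - of_int j + 1/2 = (0 :: complex)" "- of_int n + \<pi> - of_int j' + 1/2 = (0 :: complex)" for j j' :: int
    proof -
      have "complex_of_int j = of_int j'" using that by (simp add: algebra_simps)
      then show ?thesis by simp
    qed
    show ?thesis
    proof (cases "\<exists>j :: int. - of_int n + \<pi> - of_int j + 1/2 = (0 :: complex)")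
      case True
      then obtain j0 :: int where j0: "- of_int n + \<pi> - of_int j0 + 1/2 = (0 :: complex)" by blast
      have "(- of_int n + \<pi> - of_int j + 1/2 = (0 :: complex)) = (j = j0)" for j using u[OF _ j0] j0 by blast
      then show ?thesis unfolding screen_rest_def by (simp add: scale_minus_left)
    next
      case False
      then show ?thesis unfolding screen_rest_def by simp
    qed
  qed
  finally show ?thesis by simp
qed

end

text \<open>Keeps the vertex 1 a numeral, so that the tables of \<epsilon> and of the labels match
  directly.\<close>

declare One_nat_def [simp del]

lemma labels_I:
  "labels (Q_I k) 0 0 = {#}"
  "labels (Q_I k) 0 1 = {#0#}"
  "labels (Q_I k) 0 2 = {#}"
  "labels (Q_I k) 0 3 = {#}"
  "labels (Q_I k) 1 0 = {#}"
  "labels (Q_I k) 1 1 = {#}"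
  "labels (Q_I k) 1 2 = {#0#}"
  "labels (Q_I k) 1 3 = {#2 * k + 2#}"
  "labels (Q_I k) 2 0 = {#- 2#}"
  "labels (Q_I k) 2 1 = {#- 2 * k - 4#}"
  "labels (Q_I k) 2 2 = {#}"
  "labels (Q_I k) 2 3 = {#}"
  "labels (Q_I k) 3 0 = {#}"
  "labels (Q_I k) 3 1 = {#}"
  "labels (Q_I k) 3 2 = {#0#}"
  "labels (Q_I k) 3 3 = {#}"
  by (simp_all add: labels_def Q_I_def)

lemma labels_II:
  "labels (Q_II k) 0 0 = {#}"
  "labels (Q_II k) 0 1 = {#}"
  "labels (Q_II k) 0 2 = {#}"
  "labels (Q_II k) 0 3 = {#2 * k + 2#}"
  "labels (Q_II k) 1 0 = {#- 2 * k - 4#}"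
  "labels (Q_II k) 1 1 = {#}"
  "labels (Q_II k) 1 2 = {#0#}"
  "labels (Q_II k) 1 3 = {#}"
  "labels (Q_II k) 2 0 = {#}"
  "labels (Q_II k) 2 1 = {#2 * k + 2#}"
  "labels (Q_II k) 2 2 = {#- 2 * k - 4#}"
  "labels (Q_II k) 2 3 = {#}"
  "labels (Q_II k) 3 0 = {#}"
  "labels (Q_II k) 3 1 = {#0#}"
  "labels (Q_II k) 3 2 = {#}"
  "labels (Q_II k) 3 3 = {#}"
  by (simp_all add: labels_def Q_II_def)

context cvs
begin

lemma SigmaD_sum_list:
  "map (\<lambda>j. take (Suc j) (path_points P)) [0..<length (snd P)] = pss \<Longrightarrow>
   SigmaD_cur h sc Q i D M P n v = (\<Sum>ps\<leftarrow>pss. nprodD h sc Q i D M ps n v)"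
  by (auto simp: SigmaD_cur_def sum_list_distinct_conv_sum_set atLeast0LessThan comp_def)

lemma nprodD_terms_II:
  "SigmaD_cur h sc (Q_II k) 1 D M (Pp_II k) n v = nprodD h sc (Q_II k) 1 D M [(0, 0)] n v"
  "SigmaD_cur h sc (Q_II k) 1 D M (Pm_II k) n v =
     (nprodD h sc (Q_II k) 1 D M [(3, 0)] n v + nprodD h sc (Q_II k) 1 D M [(3, 0), (1, 0)] n v) +
     (nprodD h sc (Q_II k) 1 D M [(3, 0), (1, 0), (2, 0)] n v + nprodD h sc (Q_II k) 1 D M [(3, 0), (1, 0), (2, 0), (1, 2 * k + 2)] n v)"
  "PsiD_cur h sc (Q_II k) 1 D M (Pp_II k) n v = nprodD h sc (Q_II k) 1 D M [(0, 0), (3, 2 * k + 2)] n v"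
  "PsiD_cur h sc (Q_II k) 1 D M (Pm_II k) n v = nprodD h sc (Q_II k) 1 D M [(3, 0), (1, 0), (2, 0), (1, 2 * k + 2), (0, - 2)] n v"
  unfolding SigmaD_sum_list[OF terms_II(1)] SigmaD_sum_list[OF terms_II(2)] PsiD_cur_def points_II
  by (simp_all only: list.map sum_list_simps add_0_right add.assoc)

lemma fermionic_II:
  assumes nz: "\<And>n :: int. n \<noteq> 0 \<Longrightarrow> qp h (of_int n) - qp h (- of_int n) \<noteq> 0"
  shows "commutes_with_fermionic_screening h sc (Q_II k) 1 (Pp_II k)"
    and "commutes_with_fermionic_screening h sc (Q_II k) 1 (Pm_II k)"
proof -
  let ?Q = "Q_II k"
  have all: "supercommutes (fermi_star h sc (fJ \<Phi>) (fYinv \<Phi>) (osc M 1) 0) (SigmaD_cur h sc ?Q 1 (\<lambda>v. fJ \<Phi> v - fp \<Phi> v) M (Pp_II k)) \<and>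
    supercommutes (fermi_star h sc (fJ \<Phi>) (fYinv \<Phi>) (osc M 1) 0) (PsiD_cur h sc ?Q 1 (\<lambda>v. fJ \<Phi> v - fp \<Phi> v) M (Pp_II k)) \<and>
    supercommutes (fermi_star h sc (fJ \<Phi>) (fYinv \<Phi>) (osc M 1) 0) (SigmaD_cur h sc ?Q 1 (\<lambda>v. fJ \<Phi> v - fp \<Phi> v) M (Pm_II k)) \<and>
    supercommutes (fermi_star h sc (fJ \<Phi>) (fYinv \<Phi>) (osc M 1) 0) (PsiD_cur h sc ?Q 1 (\<lambda>v. fJ \<Phi> v - fp \<Phi> v) M (Pm_II k))"
    if fe: "fermionization h sc ?Q 1 M \<Phi>" and S: "diagonalizable sc {\<mu>. \<mu> - 1/2 \<in> \<int>} (fJ \<Phi>)"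
    for M :: "(nat, 'v) seed_ops" and \<Phi>
  proof -
    interpret fs: fermi_seed sc h ?Q M 1 \<Phi>
      by (rule fermi_seed.intro[OF cvs_axioms fermi_seed_axioms.intro])
        (use fe nz in \<open>auto simp: verts_II eps_II eps_II[simplified]\<close>)
    let ?c = "fs.f.Phi (- 1) 0"
    let ?T = "nprodD h sc ?Q 1 (\<lambda>v. fJ \<Phi> v - fp \<Phi> v) M"
    let ?D = "\<lambda>v. fJ \<Phi> v - fp \<Phi> v"
    have c: "fermi_star h sc (fJ \<Phi>) (fYinv \<Phi>) (osc M 1) 0 = ?c" by (simp add: fun_eq_iff fs.f.Phi_def)
    have lc: "lin ?c" by (rule fs.f.Phi_lin) simp
    note tab = verts_II eps_II eps_II[simplified] labels_def Q_II_def
    have ccs: "fs.ccf 0 = - 2 * k - 3" "fs.ccf 1 = - 2" "fs.ccf 2 = 2 * k + 4" "fs.ccf 3 = 1"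
      by (simp_all add: fs.ccf_def labels_II)
    \<comment> \<open>The last entry is the exponent of the argument of the remaining fermion.
      X_1(z) = - :Psi(q^(-1) z) Psi*(q z): moves Psi from q z to q^(-1) z, and its second
      occurrence, at q_3 z, moves Psi from q^(2k+3) z to q^(2k+1) z.\<close>
    have g0: "fs.f.gacond [(0, 0)] (2 * k + 3)" and g1: "fs.f.gacond [(3, 0)] 1" and g2: "fs.f.gacond [(3, 0), (1, 0)] (- 1)"
      and g3: "fs.f.gacond [(3, 0), (1, 0), (2, 0)] (2 * k + 3)" and g4: "fs.f.gacond [(3, 0), (1, 0), (2, 0), (1, 2 * k + 2)] (2 * k + 1)"
      and g5: "fs.f.gacond [(0, 0), (3, 2 * k + 2)] 0" and g6: "fs.f.gacond [(3, 0), (1, 0), (2, 0), (1, 2 * k + 2), (0, - 2)] 0"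
      unfolding fs.f.gacond_def fs.f.Es_def fs.gf_def fermi_coeff_def
      by (simp_all add: eps_II eps_II[simplified] labels_II algebra_simps minus_diff_commute qp_add[symmetric])
    have ok: "fs.f.okl [(0, 0)]" "fs.f.okl [(3, 0)]" "fs.f.okl [(3, 0), (1, 0)]" "fs.f.okl [(3, 0), (1, 0), (2, 0)]"
      "fs.f.okl [(3, 0), (1, 0), (2, 0), (1, 2 * k + 2)]" "fs.f.okl [(0, 0), (3, 2 * k + 2)]" "fs.f.okl [(3, 0), (1, 0), (2, 0), (1, 2 * k + 2), (0, - 2)]"
      by (simp_all add: verts_II)
    note ev = fs.f.kap_def fs.f.Es_def ccs eps_II eps_II[simplified] algebra_simps
    have k0: "fs.f.kap [(0, 0)] + (\<Sum>i\<leftarrow>map fst [(0, 0)]. fs.ccf i) = (2 * k + 3) * of_int (-1)" and e0: "-1 = fs.f.Es (map fst [(0, 0)])"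
      by (simp_all add: ev)
    have k1: "fs.f.kap [(3, 0)] + (\<Sum>i\<leftarrow>map fst [(3, 0)]. fs.ccf i) = (1) * of_int (1)" and e1: "1 = fs.f.Es (map fst [(3, 0)])"
      by (simp_all add: ev)
    have k2: "fs.f.kap [(3, 0), (1, 0)] + (\<Sum>i\<leftarrow>map fst [(3, 0), (1, 0)]. fs.ccf i) = (- 1) * of_int (1)" and e2: "1 = fs.f.Es (map fst [(3, 0), (1, 0)])"
      by (simp_all add: ev)
    have k3: "fs.f.kap [(3, 0), (1, 0), (2, 0)] + (\<Sum>i\<leftarrow>map fst [(3, 0), (1, 0), (2, 0)]. fs.ccf i) = (2 * k + 3) * of_int (1)" and e3: "1 = fs.f.Es (map fst [(3, 0), (1, 0), (2, 0)])"
      by (simp_all add: ev)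
    have k4: "fs.f.kap [(3, 0), (1, 0), (2, 0), (1, 2 * k + 2)] + (\<Sum>i\<leftarrow>map fst [(3, 0), (1, 0), (2, 0), (1, 2 * k + 2)]. fs.ccf i) = (2 * k + 1) * of_int (1)" and e4: "1 = fs.f.Es (map fst [(3, 0), (1, 0), (2, 0), (1, 2 * k + 2)])"
      by (simp_all add: ev)
    note lT = fs.f.nprodD_lin[OF ok(1) g0] fs.f.nprodD_lin[OF ok(2) g1] fs.f.nprodD_lin[OF ok(3) g2] fs.f.nprodD_lin[OF ok(4) g3]
      fs.f.nprodD_lin[OF ok(5) g4] fs.f.nprodD_lin[OF ok(6) g5] fs.f.nprodD_lin[OF ok(7) g6]
    have "?c (?T [(0, 0)] n v) = - ?T [(0, 0)] n (?c v)" for n v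
    proof (rule fs.f.joint_ext[OF S lin_comp[OF lc lT(1)] lin_uminus[OF lin_comp[OF lT(1) lc]]])
      fix \<mu> \<pi> u assume m: "\<mu> \<in> {\<mu>. \<mu> - 1/2 \<in> \<int>}" and u: "fJ \<Phi> u = sc \<mu> u" "fp \<Phi> u = sc \<pi> u"
      show "?c (?T [(0, 0)] n u) = - ?T [(0, 0)] n (?c u)"
        using fs.f.screen[OF ok(1) g0 k0 e0 _ u, of n] m by simp
    qed
    then have 1: "supercommutes ?c (SigmaD_cur h sc ?Q 1 ?D M (Pp_II k))"
      by (simp add: supercommutes_def nprodD_terms_II)
    have "?c (?T [(0, 0), (3, 2 * k + 2)] n v) = ?T [(0, 0), (3, 2 * k + 2)] n (?c v)" for n v
    proof (rule fs.f.joint_ext[OF S lin_comp[OF lc lT(6)] lin_comp[OF lT(6) lc]])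
      fix \<mu> \<pi> u assume u: "fJ \<Phi> u = sc \<mu> u" "fp \<Phi> u = sc \<pi> u"
      show "?c (?T [(0, 0), (3, 2 * k + 2)] n u) = ?T [(0, 0), (3, 2 * k + 2)] n (?c u)"
        by (rule fs.f.screen0[OF ok(6) g5 _ _ u]) (simp_all add: ev)
    qed
    then have 2: "supercommutes ?c (PsiD_cur h sc ?Q 1 ?D M (Pp_II k))"
      by (simp add: supercommutes_def nprodD_terms_II)
    have "?c (?T [(3, 0), (1, 0), (2, 0), (1, 2 * k + 2), (0, - 2)] n v) = ?T [(3, 0), (1, 0), (2, 0), (1, 2 * k + 2), (0, - 2)] n (?c v)" for n v
    proof (rule fs.f.joint_ext[OF S lin_comp[OF lc lT(7)] lin_comp[OF lT(7) lc]])
      fix \<mu> \<pi> u assume u: "fJ \<Phi> u = sc \<mu> u" "fp \<Phi> u = sc \<pi> u"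
      show "?c (?T [(3, 0), (1, 0), (2, 0), (1, 2 * k + 2), (0, - 2)] n u) = ?T [(3, 0), (1, 0), (2, 0), (1, 2 * k + 2), (0, - 2)] n (?c u)"
        by (rule fs.f.screen0[OF ok(7) g6 _ _ u]) (simp_all add: ev)
    qed
    then have 4: "supercommutes ?c (PsiD_cur h sc ?Q 1 ?D M (Pm_II k))"
      by (simp add: supercommutes_def nprodD_terms_II)
    let ?K = "\<lambda>ps a \<pi>. fs.f.Kc (map fst ps) 0 * qp h (- a / 2 - fs.f.kap ps * \<pi>)"
    let ?R = "\<lambda>ps a \<pi> n u. fs.f.screen_rest ps (?K ps a \<pi>) \<pi> n u"
    have pair: "?R ps a \<pi> n u + ?R (ps @ [(1, e)]) a' \<pi> n u = 0"
      if "fs.f.okl ps" "?K ps a \<pi> + ?K (ps @ [(1, e)]) a' \<pi> = 0" for ps a a' e \<pi> n u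
      by (rule fs.f.screen_rest_pair[OF that(1) fs.wf_k _ that(2)]) (simp_all add: fs.Vf_def)
    have q: "qp h a = qp h b * qp h c" if "a = b + c" for a b c by (simp add: that qp_add)
    \<comment> \<open>Appending X_1 multiplies the scalar at fermion exponent 0 by - 1, the sign in
      X_1 = - q^(-2 J). The last two terms of the path are paired in the same way.\<close>
    have p1: "?R [(3, 0)] 1 \<pi> n u + ?R [(3, 0), (1, 0)] (- 1) \<pi> n u = 0" for \<pi> n u
    proof -
      have "?K [(3, 0)] 1 \<pi> + ?K ([(3, 0)] @ [(1, 0)]) (- 1) \<pi> = 0"
        by (simp add: fs.f.Kc.simps fs.f.kap_def fs.f.Es_def ccs eps_II eps_II[simplified] qp_add[symmetric])
      from pair[OF ok(2) this] show ?thesis by simp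
    qed
    have p2: "?R [(3, 0), (1, 0), (2, 0)] (2 * k + 3) \<pi> n u + ?R [(3, 0), (1, 0), (2, 0), (1, 2 * k + 2)] (2 * k + 1) \<pi> n u = 0" for \<pi> n u
    proof -
      have "?K [(3, 0), (1, 0), (2, 0)] (2 * k + 3) \<pi> + ?K ([(3, 0), (1, 0), (2, 0)] @ [(1, 2 * k + 2)]) (2 * k + 1) \<pi> = 0"
        by (simp add: fs.f.Kc.simps fs.f.kap_def fs.f.Es_def ccs eps_II eps_II[simplified] qp_add[symmetric] field_simps)
      from pair[OF ok(4) this] show ?thesis by simp
    qed
    have lS: "lin (SigmaD_cur h sc ?Q 1 ?D M (Pm_II k) n)" for n
      using lin_plus[OF lin_plus[OF lT(2,3)] lin_plus[OF lT(4,5)], of n n n n] by (simp add: nprodD_terms_II[abs_def])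
    have "?c (SigmaD_cur h sc ?Q 1 ?D M (Pm_II k) n v) = - SigmaD_cur h sc ?Q 1 ?D M (Pm_II k) n (?c v)" for n v
    proof (rule fs.f.joint_ext[OF S lin_comp[OF lc lS] lin_uminus[OF lin_comp[OF lS lc]]])
      fix \<mu> \<pi> u assume m: "\<mu> \<in> {\<mu>. \<mu> - 1/2 \<in> \<int>}" and u: "fJ \<Phi> u = sc \<mu> u" "fp \<Phi> u = sc \<pi> u"
      then have hf: "\<mu> - 1/2 \<in> \<int>" by simp
      have h1: "?c (?T [(3, 0)] n u) = - ?T [(3, 0)] n (?c u) + ?R [(3, 0)] 1 \<pi> n u"
        using fs.f.screen[OF ok(2) g1 k1 e1 _ u hf, of n] by simp
      have h2: "?c (?T [(3, 0), (1, 0)] n u) = - ?T [(3, 0), (1, 0)] n (?c u) + ?R [(3, 0), (1, 0)] (- 1) \<pi> n u"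
        using fs.f.screen[OF ok(3) g2 k2 e2 _ u hf, of n] by simp
      have h3: "?c (?T [(3, 0), (1, 0), (2, 0)] n u) = - ?T [(3, 0), (1, 0), (2, 0)] n (?c u) + ?R [(3, 0), (1, 0), (2, 0)] (2 * k + 3) \<pi> n u"
        using fs.f.screen[OF ok(4) g3 k3 e3 _ u hf, of n] by simp
      have h4: "?c (?T [(3, 0), (1, 0), (2, 0), (1, 2 * k + 2)] n u) = - ?T [(3, 0), (1, 0), (2, 0), (1, 2 * k + 2)] n (?c u)
          + ?R [(3, 0), (1, 0), (2, 0), (1, 2 * k + 2)] (2 * k + 1) \<pi> n u"
        using fs.f.screen[OF ok(5) g4 k4 e4 _ u hf, of n] by simp
      have x: "a = - a' + r \<Longrightarrow> b = - b' + r' \<Longrightarrow> c = - c' + s \<Longrightarrow> d = - d' + s' \<Longrightarrow> r + r' = 0 \<Longrightarrow> s + s' = 0 \<Longrightarrow>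
          (a + b) + (c + d) = - ((a' + b') + (c' + d'))" for a a' b b' c c' d d' r r' s s' :: 'v
        by (simp add: eq_neg_iff_add_eq_0) 
      show "?c (SigmaD_cur h sc ?Q 1 ?D M (Pm_II k) n u) = - SigmaD_cur h sc ?Q 1 ?D M (Pm_II k) n (?c u)"
        unfolding nprodD_terms_II lin_add[OF lc] by (rule x[OF h1 h2 h3 h4 p1 p2])
    qed
    then have 3: "supercommutes ?c (SigmaD_cur h sc ?Q 1 ?D M (Pm_II k))" by (simp add: supercommutes_def)
    show ?thesis unfolding c using 1 2 3 4 by blast
  qed
  show "commutes_with_fermionic_screening h sc (Q_II k) 1 (Pp_II k)" "commutes_with_fermionic_screening h sc (Q_II k) 1 (Pm_II k)"
    unfolding commutes_with_fermionic_screening_def Let_def using all by blast+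
qed

end

subsection \<open>The screening charges at a vertex with a loop\<close>

locale loop_seed = seed sc h Q M for sc :: "complex \<Rightarrow> 'v::ab_group_add \<Rightarrow> 'v" and h Q and M :: "('i, 'v) seed_ops" +
  fixes kk :: 'i and s t :: complex and S s0 :: "'v \<Rightarrow> 'v"
  assumes ext: "loop_extension h sc Q kk s t M S s0" and kV: "kk \<in> verts Q" and s: "s \<noteq> 0"
    and sn: "n \<noteq> 0 \<Longrightarrow> qp h (of_int n * s) - qp h (- of_int n * s) \<noteq> 0"
    and e0: "j \<in> verts Q \<Longrightarrow> eps Q kk j = 0"
begin

lemma Slin: "lin S" and s0d: "diagonalizable sc UNIV s0" and s0S: "s0 (S v) = S (s0 v) + sc (2 * t / s) (S v)"
  and zk: "zer M kk v = opfun sc (\<lambda>\<mu>. qp h (-2 * s * \<mu>)) s0 v"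
  using ext by (simp_all add: loop_extension_def diff_eq_eq add.commute)

lemma s0_osc: "i \<in> verts Q \<Longrightarrow> n \<noteq> 0 \<Longrightarrow> s0 (osc M i n v) = osc M i n (s0 v)"
  and S_osc: "i \<in> verts Q \<Longrightarrow> n \<noteq> 0 \<Longrightarrow> S (osc M i n v) = osc M i n (S v)"
  and s0_zer: "i \<in> verts Q \<Longrightarrow> s0 (zer M i v) = zer M i (s0 v)"
  using ext by (simp_all add: loop_extension_def e0)

lemma S_zer: "j \<in> verts Q \<Longrightarrow> j \<noteq> kk \<Longrightarrow> S (zer M j v) =
   sc (if labels Q j kk \<noteq> {#} \<or> labels Q kk j \<noteq> {#} then qp h (-2 * t) else 1) (zer M j (S v))"
  using ext by (simp add: loop_extension_def)

lemma s0lin: "lin s0" by (rule diag_lin[OF s0d])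

lemma S_eig: "s0 v = sc \<mu> v \<Longrightarrow> s0 (S v) = sc (\<mu> + 2 * t / s) (S v)"
  by (simp add: s0S lin_sc[OF Slin] scale_left_distrib)

lemma zk_eig: "s0 v = sc \<mu> v \<Longrightarrow> zer M kk v = sc (qp h (-2 * s * \<mu>)) v"
  unfolding zk by (rule opfun_eig[OF s0lin])

text \<open>The extension prescribes how S passes the other X_j; the exchange with X_k follows from
  X_k = \<sigma>^(-2 \<open>s0\<close>) and the shift of \<open>s0\<close> by S.\<close>

lemma S_zk: "S (zer M kk v) = sc (qp h (4 * t)) (zer M kk (S v))"
proof (rule eig_ext[OF s0d lin_comp[OF Slin zer_lin[OF kV]] lin_scale[OF lin_comp[OF zer_lin[OF kV] Slin]]])
  fix \<mu> v assume v: "s0 v = sc \<mu> v"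
  have "4 * t + (- 2 * s * (\<mu> + 2 * t / s)) = - 2 * s * \<mu>" using s by (simp add: field_simps)
  then have "qp h (- 2 * s * \<mu>) = qp h (4 * t) * qp h (- 2 * s * (\<mu> + 2 * t / s))" by (simp add: qp_add[symmetric])
  then show "S (zer M kk v) = sc (qp h (4 * t)) (zer M kk (S v))"
    unfolding zk_eig[OF v] zk_eig[OF S_eig[OF v]] lin_sc[OF Slin] scale_scale by simp
qed

definition ls :: "int \<Rightarrow> complex" where "ls n = - 1 / (qp h (of_int n * s) - qp h (- of_int n * s))"

definition la :: "int \<Rightarrow> 'v \<Rightarrow> 'v" where "la n v = sc (ls n) (osc M kk n v)"

lemma la_eq: "la = (\<lambda>n v. sc (- 1 / (qp h (of_int n * s) - qp h (- of_int n * s))) (osc M kk n v))"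
  by (simp add: fun_eq_iff la_def ls_def)

lemma la_fam: "fam la"
proof -
  have "smooth {kk} (\<lambda>_. la)"
  proof (rule smooth_comb[OF smooth_mono[OF sm_smooth], where I = "{kk}"])
    show "{kk} \<subseteq> verts Q" using kV by simp
    show "lin (osc M i (int n))" if "i \<in> {kk}" "n > 0" for i n using that kV osc_lin by simp
    show "la (int n) v = (\<Sum>i\<in>{kk}. sc (ls (int n)) (osc M i (int n) v))" for n v
      by (simp add: la_def)
  qed
  then show ?thesis unfolding la_def[abs_def]
    by (rule fam_smooth[where x = "\<lambda>_ n v. sc (ls n) (osc M kk n v)"])
      (rule cfam_scale, use osc_fam[OF kV] in \<open>simp add: fam_def\<close>)+
qed

lemma la_comm2: "okl ps \<Longrightarrow> comm2 la (os ps)"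
proof -
  assume ps: "okl ps"
  have "comm2 (osc M i) la" if "i \<in> verts Q" for i
    using osc_comm2[OF that kV] osc_lin[OF that] by (auto simp: comm2_def la_def lin_sc)
  then show ?thesis using os_fam[OF xf ps] la_fam comm2_sym by blast
qed

lemma brk_la:
  assumes "j \<in> verts Q"
  shows "brk la (osc M j) (\<lambda>n. - Cmat (of_nat n * h) Q kk j / ((qp h (of_nat n * s) - qp h (- of_nat n * s)) * of_nat n))"
    and "brk (osc M j) la (\<lambda>n. Cmat (of_nat n * h) Q j kk / ((qp h (of_nat n * s) - qp h (- of_nat n * s)) * of_nat n))"
proof -
  have "brk la (osc M j) (\<lambda>n. ls (int n) * (Cmat (of_nat n * h) Q kk j / of_nat n))"
    unfolding brk_def la_def using osc_br[OF kV assms] osc_lin[OF assms] by (auto simp: lin_sc scale_right_distrib)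
  then show "brk la (osc M j) (\<lambda>n. - Cmat (of_nat n * h) Q kk j / ((qp h (of_nat n * s) - qp h (- of_nat n * s)) * of_nat n))"
    by (rule brk_cong) (simp add: ls_def)
  have "brk (osc M j) la (\<lambda>n. ls (- int n) * (Cmat (of_nat n * h) Q j kk / of_nat n))"
    unfolding brk_def la_def using osc_br[OF assms kV] osc_lin[OF assms] by (auto simp: lin_sc scale_right_distrib)
  then show "brk (osc M j) la (\<lambda>n. Cmat (of_nat n * h) Q j kk / ((qp h (of_nat n * s) - qp h (- of_nat n * s)) * of_nat n))"
  proof (rule brk_cong)
    fix n :: nat assume "n > 0"
    define d where "d = qp h (of_nat n * s) - qp h (- of_nat n * s)"
    have "ls (- int n) = - 1 / - d" by (simp add: ls_def d_def)
    then show "ls (- int n) * (Cmat (of_nat n * h) Q j kk / of_nat n) = Cmat (of_nat n * h) Q j kk / ((qp h (of_nat n * s) - qp h (- of_nat n * s)) * of_nat n)"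
      unfolding d_def[symmetric] by simp
  qed
qed

text \<open>The denominators \<sigma>^n - \<sigma>^(-n) of the screening oscillators are multiplied
  out, so that the condition can be asked at every H, even where they vanish. \<open>conr\<close> is
  for the opposite order of the factors.\<close>

definition conl :: "('i \<times> complex) list \<Rightarrow> complex list \<Rightarrow> complex list \<Rightarrow> bool" where
  "conl ps as bs \<longleftrightarrow> (\<forall>H. (\<Sum>(j, e)\<leftarrow>ps. qp H e * Cmat H Q kk j) =
     - (qp H s - qp H (- s)) * ((\<Sum>b\<leftarrow>bs. qp H b) - (\<Sum>a\<leftarrow>as. qp H a)))"

definition conr :: "('i \<times> complex) list \<Rightarrow> complex list \<Rightarrow> complex list \<Rightarrow> bool" where
  "conr ps as bs \<longleftrightarrow> (\<forall>H. (\<Sum>(j, e)\<leftarrow>ps. qp H (- e) * Cmat H Q j kk) =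
     (qp H s - qp H (- s)) * ((\<Sum>b\<leftarrow>bs. qp H b) - (\<Sum>a\<leftarrow>as. qp H a)))"

lemma sl_div: "(\<Sum>(j, e)\<leftarrow>ps. f j e * (g j / (c :: complex))) = (\<Sum>(j, e)\<leftarrow>ps. f j e * g j) / c"
  by (induction ps) (auto simp: add_divide_distrib)

lemma qps: "qp (of_nat n * h) e = qp h (of_nat n * e)" by (simp add: qp_def mult_ac)

lemma conl_contr:
  assumes c: "conl ps as bs" and ps: "okl ps"
  obtains \<beta> where "brk la (os ps) \<beta>" "contr \<beta> (rat h as bs)"
proof
  show "brk la (os ps) (\<lambda>n. \<Sum>(j, e)\<leftarrow>ps. qp h (of_nat n * e) * (- Cmat (of_nat n * h) Q kk j / ((qp h (of_nat n * s) - qp h (- of_nat n * s)) * of_nat n)))"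
    by (rule os_brk_right[OF xf ps la_fam brk_la(1)])
  show "contr (\<lambda>n. \<Sum>(j, e)\<leftarrow>ps. qp h (of_nat n * e) * (- Cmat (of_nat n * h) Q kk j / ((qp h (of_nat n * s) - qp h (- of_nat n * s)) * of_nat n))) (rat h as bs)"
  proof (rule contr_cong[OF contr_rat])
    fix n :: nat assume n: "n > 0"
    define d where "d = qp h (of_nat n * s) - qp h (- of_nat n * s)"
    have d: "d \<noteq> 0" using sn[of "int n"] n by (simp add: d_def)
    have m: "(\<Sum>(j, e)\<leftarrow>ps. qp h (of_nat n * e) * - Cmat (of_nat n * h) Q kk j) = - (\<Sum>(j, e)\<leftarrow>ps. qp (of_nat n * h) e * Cmat (of_nat n * h) Q kk j)"
      by (induction ps) (auto simp: qps)
    have "(\<Sum>(j, e)\<leftarrow>ps. qp (of_nat n * h) e * Cmat (of_nat n * h) Q kk j) = - d * ((\<Sum>b\<leftarrow>bs. qp (of_nat n * h) b) - (\<Sum>a\<leftarrow>as. qp (of_nat n * h) a))"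
      unfolding c[unfolded conl_def, rule_format] d_def qps[of n s] qps[of n "- s"] by simp
    then show "((\<Sum>b\<leftarrow>bs. qp (of_nat n * h) b) - (\<Sum>a\<leftarrow>as. qp (of_nat n * h) a)) / of_nat n =
      (\<Sum>(j, e)\<leftarrow>ps. qp h (of_nat n * e) * (- Cmat (of_nat n * h) Q kk j / ((qp h (of_nat n * s) - qp h (- of_nat n * s)) * of_nat n)))"
      unfolding sl_div d_def[symmetric] m using d n by simp
  qed
qed

lemma conr_contr:
  assumes c: "conr ps as bs" and ps: "okl ps"
  obtains \<beta> where "brk (os ps) la \<beta>" "contr \<beta> (rat h as bs)"
proof
  show "brk (os ps) la (\<lambda>n. \<Sum>(j, e)\<leftarrow>ps. qp h (- of_nat n * e) * (Cmat (of_nat n * h) Q j kk / ((qp h (of_nat n * s) - qp h (- of_nat n * s)) * of_nat n)))"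
    by (rule os_brk_left[OF xf ps la_fam brk_la(2)])
  show "contr (\<lambda>n. \<Sum>(j, e)\<leftarrow>ps. qp h (- of_nat n * e) * (Cmat (of_nat n * h) Q j kk / ((qp h (of_nat n * s) - qp h (- of_nat n * s)) * of_nat n))) (rat h as bs)"
  proof (rule contr_cong[OF contr_rat])
    fix n :: nat assume n: "n > 0"
    define d where "d = qp h (of_nat n * s) - qp h (- of_nat n * s)"
    have d: "d \<noteq> 0" using sn[of "int n"] n by (simp add: d_def)
    have m: "(\<Sum>(j, e)\<leftarrow>ps. qp h (- of_nat n * e) * Cmat (of_nat n * h) Q j kk) = (\<Sum>(j, e)\<leftarrow>ps. qp (of_nat n * h) (- e) * Cmat (of_nat n * h) Q j kk)"
      by (induction ps) (auto simp: qps)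
    have "(\<Sum>(j, e)\<leftarrow>ps. qp (of_nat n * h) (- e) * Cmat (of_nat n * h) Q j kk) = d * ((\<Sum>b\<leftarrow>bs. qp (of_nat n * h) b) - (\<Sum>a\<leftarrow>as. qp (of_nat n * h) a))"
      unfolding c[unfolded conr_def, rule_format] d_def qps[of n s] qps[of n "- s"] by simp
    then show "((\<Sum>b\<leftarrow>bs. qp (of_nat n * h) b) - (\<Sum>a\<leftarrow>as. qp (of_nat n * h) a)) / of_nat n =
      (\<Sum>(j, e)\<leftarrow>ps. qp h (- of_nat n * e) * (Cmat (of_nat n * h) Q j kk / ((qp h (of_nat n * s) - qp h (- of_nat n * s)) * of_nat n)))"
      unfolding sl_div d_def[symmetric] m using d n by simp
  qed
qed

abbreviation charge :: "'v \<Rightarrow> 'v" where "charge \<equiv> vop sc S (\<lambda>v. - s0 v - sc (t / s) v) la 0"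

lemma chd: "diagonalizable sc UNIV (\<lambda>v. - s0 v - sc (t / s) v)"
  by (rule diag_affine[OF s0d, where a = "- 1" and b = "- (t / s)"]) (simp add: scale_minus_left)

lemma charge_lin: "lin charge" by (rule vop_lin[OF chd la_fam Slin])

lemma charge_eig:
  assumes v: "s0 v = sc \<mu> v"
  shows "charge v = (if \<mu> + t / s \<in> \<int> then S (bexp sc la \<lfloor>Re (\<mu> + t / s)\<rfloor> v) else 0)"
proof -
  have "- s0 v - sc (t / s) v = sc (- \<mu> - t / s) v" by (simp add: v scale_left_diff_distrib scale_minus_left)
  from vop_eig[OF diag_lin[OF chd] this la_fam Slin, of 0] show ?thesis by (simp add: add.commute)
qed

lemma s0_os: "okl ps \<Longrightarrow> n \<noteq> 0 \<Longrightarrow> s0 (os ps n v) = os ps n (s0 v)" and S_os: "okl ps \<Longrightarrow> n \<noteq> 0 \<Longrightarrow> S (os ps n v) = os ps n (S v)"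
proof -
  assume ps: "okl ps" and n: "n \<noteq> 0"
  have c: "T (os ps n v) = os ps n (T v)" if T: "lin T" and c: "\<And>i v. i \<in> verts Q \<Longrightarrow> T (osc M i n v) = osc M i n (T v)" for T
    unfolding osc_sum_def lin_sum_list[OF T] split_def lin_sc[OF T]
    using ps by (intro arg_cong[where f = sum_list] map_cong refl) (auto simp: c)
  show "s0 (os ps n v) = os ps n (s0 v)" "S (os ps n v) = os ps n (S v)"
    by (rule c[OF s0lin s0_osc[OF _ n]] c[OF Slin S_osc[OF _ n]], assumption)+
qed

lemma zp_la: "set is \<subseteq> verts Q \<Longrightarrow> zp is (bexp sc la c v) = bexp sc la c (zp is v)"
proof -
  assume i: "set is \<subseteq> verts Q"
  show ?thesis
  proof (rule bexp_comm[OF la_fam zprod_lin[OF zok i]])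
    fix n :: int and v assume n: "n \<noteq> 0"
    have l: "lin (osc M kk n)" by (rule osc_lin[OF kV n])
    have "osc M kk n (zp is v) = zp is (osc M kk n v)"
      by (rule zprod_comm[OF l]) (use i zer_osc[OF _ kV n] in auto)
    then show "zp is (la n v) = la n (zp is v)" by (simp add: la_def lin_sc[OF zprod_lin[OF zok i]])
  qed
qed

lemma s0_cur: assumes ps: "okl ps" and v: "s0 v = sc \<mu> v" shows "s0 (cur ps c v) = sc \<mu> (cur ps c v)"
proof -
  have s: "set (map fst ps) \<subseteq> verts Q" using ps by simp
  have "s0 (cur ps c v) = cur ps c (s0 v)" unfolding cur_def
    by (subst zprod_comm[OF s0lin]) (use s s0_zer in \<open>auto simp: bexp_comm[OF os_fam'[OF ps] s0lin s0_os[OF ps]]\<close>)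
  then show ?thesis by (simp add: v lin_sc[OF cur_lin[OF ps]])
qed

text \<open>On an eigenvector of \<open>s0\<close> the coefficient of z^0 of the screening current
  is the coefficient N of its oscillator part. Both orders become expansions over the same modes;
  q^x is the cost of moving S through the zero modes.\<close>

lemma charge_prods:
  assumes ps: "okl ps" and v: "s0 v = sc \<mu> v" and N: "\<mu> + t / s = of_int N"
    and x: "\<And>u. S (zp (map fst ps) u) = sc (qp h x) (zp (map fst ps) (S u))"
    and cl: "conl ps as bs" and cr: "conr ps as' bs'"
  shows "charge (cur ps c v) - cur ps c (charge v) = zp (map fst ps) (S (Sum_any (\<lambda>l. sc (qp h x * co (rat h as bs) l - co (rat h as' bs') (- l)) (BB la (os ps) (N + l) (c - l) v))))"
proof -
  have s: "set (map fst ps) \<subseteq> verts Q" using ps by simp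
  obtain \<beta> where b: "brk la (os ps) \<beta>" "contr \<beta> (rat h as bs)" using conl_contr[OF cl ps] .
  obtain \<beta>' where b': "brk (os ps) la \<beta>'" "contr \<beta>' (rat h as' bs')" using conr_contr[OF cr ps] .
  let ?B = "\<lambda>l. BB la (os ps) (N + l) (c - l) v"
  have lz: "lin (zp (map fst ps))" by (rule zprod_lin[OF zok s])
  have fB: "finite {l. ?B l \<noteq> 0}" by (rule BB_fin[OF la_fam os_fam'[OF ps] la_comm2[OF ps]])
  have f: "finite {l. sc (k l) (?B l) \<noteq> 0}" for k by (rule finite_subset[OF _ fB]) auto
  have "charge (cur ps c v) = S (bexp sc la N (cur ps c v))"
    unfolding charge_eig[OF s0_cur[OF ps v]] N by simp
  also have "\<dots> = sc (qp h x) (zp (map fst ps) (S (bexp sc la N (bexp sc (os ps) c v))))"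
    unfolding cur_def zp_la[OF s, symmetric] x ..
  also have "bexp sc la N (bexp sc (os ps) c v) = Sum_any (\<lambda>l. sc (co (rat h as bs) l) (?B l))"
    by (rule bexp_prod[OF la_fam os_fam'[OF ps] la_comm2[OF ps] b])
  finally have 1: "charge (cur ps c v) = zp (map fst ps) (S (Sum_any (\<lambda>l. sc (qp h x * co (rat h as bs) l) (?B l))))"
    unfolding lin_sc[OF lz, symmetric] lin_sc[OF Slin, symmetric] by (simp add: sc_Sum_any[OF f])
  have "cur ps c (charge v) = zp (map fst ps) (S (bexp sc (os ps) c (bexp sc la N v)))"
    unfolding charge_eig[OF v] N cur_def by (simp add: bexp_comm[OF os_fam'[OF ps] Slin S_os[OF ps]])
  also have "bexp sc (os ps) c (bexp sc la N v) = Sum_any (\<lambda>l. sc (co (rat h as' bs') l) (BB (os ps) la (c + l) (N - l) v))"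
    by (rule bexp_prod[OF os_fam'[OF ps] la_fam comm2_sym[OF la_comm2[OF ps]] b'])
  also have "\<dots> = Sum_any (\<lambda>l. sc (co (rat h as' bs') (- l)) (?B l))"
    by (subst Sum_any_reflect[of _ 0, symmetric]) (simp add: BB_sym[OF os_fam'[OF ps] la_fam comm2_sym[OF la_comm2[OF ps]]])
  finally have 2: "cur ps c (charge v) = zp (map fst ps) (S (Sum_any (\<lambda>l. sc (co (rat h as' bs') (- l)) (?B l))))" .
  have "Sum_any (\<lambda>l. sc (qp h x * co (rat h as bs) l - co (rat h as' bs') (- l)) (?B l)) + Sum_any (\<lambda>l. sc (co (rat h as' bs') (- l)) (?B l))
      = Sum_any (\<lambda>l. sc (qp h x * co (rat h as bs) l) (?B l))"
    by (subst Sum_any.distrib[OF f f, symmetric]) (simp add: scale_left_distrib[symmetric])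
  then show ?thesis unfolding 1 2 lin_diff[OF lz, symmetric] lin_diff[OF Slin, symmetric] by (simp add: eq_diff_eq[symmetric])
qed

lemma charge_nonint:
  assumes ps: "okl ps" and v: "s0 v = sc \<mu> v" and N: "\<mu> + t / s \<notin> \<int>"
  shows "charge (cur ps c v) - cur ps c (charge v) = 0"
  using N by (simp add: charge_eig[OF v] charge_eig[OF s0_cur[OF ps v]] lin_zero[OF cur_lin[OF ps]])

lemma charge_regular:
  assumes ps: "okl ps" and x: "\<And>u. S (zp (map fst ps) u) = zp (map fst ps) (S u)"
    and cl: "conl ps [] []" and cr: "conr ps [] []"
  shows "charge (cur ps c v) = cur ps c (charge v)"
proof (rule eig_ext[OF s0d lin_comp[OF charge_lin cur_lin[OF ps]] lin_comp[OF cur_lin[OF ps] charge_lin]])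
  fix \<mu> v assume v: "s0 v = sc \<mu> v"
  show "charge (cur ps c v) = cur ps c (charge v)"
  proof (cases "\<mu> + t / s \<in> \<int>")
    case True
    then obtain N where N: "\<mu> + t / s = of_int N" by (auto simp: Ints_def)
    have "qp h 0 * co (rat h [] []) l - co (rat h [] []) (- l) = 0" for l by (simp add: rat_Nil co_1)
    then have "charge (cur ps c v) - cur ps c (charge v) = zp (map fst ps) (S 0)"
      using charge_prods[OF ps v N, of 0, OF _ cl cr] x by simp
    then show ?thesis using ps by (simp add: lin_zero[OF Slin] lin_zero[OF zprod_lin[OF zok]])
  qed (use charge_nonint[OF ps v] in simp)
qed

text \<open>The zero mode factor q^(b - a) makes the two orders expansions of one rational function,
  so only its pole contributes.\<close>

lemma charge_pole:
  assumes ps: "okl ps" and v: "s0 v = sc \<mu> v" and N: "\<mu> + t / s = of_int N"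
    and x: "\<And>u. S (zp (map fst ps) u) = sc (qp h (b - a)) (zp (map fst ps) (S u))"
    and cl: "conl ps [a] [b]" and cr: "conr ps [- a] [- b]"
  shows "charge (cur ps c v) - cur ps c (charge v) =
    sc ((qp h (b - a) - 1) * qp h (- of_int N * b)) (zp (map fst ps) (S (bexp sc (\<lambda>n v. sh h b la n v + os ps n v) (N + c) v)))"
proof -
  have s: "set (map fst ps) \<subseteq> verts Q" using ps by simp
  let ?B = "\<lambda>l. BB la (os ps) (N + l) (c - l) v"
  have lz: "lin (zp (map fst ps))" by (rule zprod_lin[OF zok s])
  have fB: "finite {l. ?B l \<noteq> 0}" by (rule BB_fin[OF la_fam os_fam'[OF ps] la_comm2[OF ps]])
  have f: "finite {l. sc (k l) (?B l) \<noteq> 0}" for k by (rule finite_subset[OF _ fB]) auto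
  have "qp h (b - a) * co (rat h [a] [b]) l - co (rat h [- a] [- b]) (- l) = (qp h (b - a) - 1) * qp h (- of_int N * b) * qp h (of_int (N + l) * b)" for l
  proof -
    have "qp h (b - a) * qp h (a - b) = 1" by (simp add: qp_add[symmetric])
    then have "qp h (b - a) * co (rat h [a] [b]) l - co (rat h [- a] [- b]) (- l) = qp h (b - a) * (co (rat h [a] [b]) l - qp h (a - b) * co (rat h [- a] [- b]) (- l))"
      by (simp add: right_diff_distrib mult.assoc[symmetric])
    also have "\<dots> = (qp h (b - a) - qp h (b - a) * qp h (a - b)) * qp h (b * of_int l)" unfolding co_pole by (simp add: right_diff_distrib left_diff_distrib)
    also have "qp h (b * of_int l) = qp h (- of_int N * b) * qp h (of_int (N + l) * b)" by (simp add: qp_add[symmetric] algebra_simps)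
    finally show ?thesis by (simp add: qp_add[symmetric] mult.assoc)
  qed
  then have "charge (cur ps c v) - cur ps c (charge v) =
     zp (map fst ps) (S (Sum_any (\<lambda>l. sc ((qp h (b - a) - 1) * qp h (- of_int N * b)) (sc (qp h (of_int (N + l) * b)) (?B l)))))"
    using charge_prods[OF ps v N x cl cr, of c] by simp
  also have "\<dots> = sc ((qp h (b - a) - 1) * qp h (- of_int N * b)) (zp (map fst ps) (S (Sum_any (\<lambda>l. sc (qp h (of_int (N + l) * b)) (?B l)))))"
    unfolding sc_Sum_any[OF f, symmetric] lin_sc[OF Slin] lin_sc[OF lz] ..
  finally show ?thesis unfolding BB_delta[OF la_fam os_fam'[OF ps] la_comm2[OF ps]] .
qed

text \<open>The operator \<open>X\<^sub>k(w)\<close> turns the screening current at one of the two poles into the one at the other pole.\<close>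

lemma charge_pair:
  assumes ps: "okl ps"
    and x: "\<And>u. S (zp (map fst ps) u) = sc (qp h (- 2 * t)) (zp (map fst ps) (S u))"
    and cl: "conl ps [s + 2 * t] [s]" and cr: "conr ps [- (s + 2 * t)] [- s]"
    and cl': "conl (ps @ [(kk, 0)]) [- (s + 2 * t)] [- s]" and cr': "conr (ps @ [(kk, 0)]) [- (- (s + 2 * t))] [- (- s)]"
  shows "charge (cur ps c v + cur (ps @ [(kk, 0)]) c v) = cur ps c (charge v) + cur (ps @ [(kk, 0)]) c (charge v)"
proof -
  let ?r = "ps @ [(kk, 0)]"
  have vs: "set (map fst ps) \<subseteq> verts Q" using ps by simp
  have r: "okl ?r" using ps kV by simp
  have lz: "lin (zp (map fst ps))" by (rule zprod_lin[OF zok vs])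
  have e: "epsl Q (map fst ps) [kk] = 0"
  proof -
    have "epsl Q [kk] (map fst ps) = 0" using vs by (induction ps) (auto simp: epsl_def e0)
    then show ?thesis using epsl_anti[of Q "map fst ps" "[kk]"] by simp
  qed
  have zr: "zp (map fst ?r) u = zp (map fst ps) (zer M kk u)" for u
    using zprod_append[OF zok vs, of "[kk]" u] kV e by simp
  have x': "S (zp (map fst ?r) u) = sc (qp h (2 * t)) (zp (map fst ?r) (S u))" for u
    unfolding zr x S_zk lin_sc[OF lz] by (simp add: qp_add[symmetric])
  have fm: "fam (\<lambda>n v. sh h s la n v + os ps n v)"
    by (rule fam_add[OF fam_sh[OF la_fam] os_fam'[OF ps] comm2_sh[OF os_fam'[OF ps] la_fam la_comm2[OF ps]]])
  have "charge (cur ps c v + cur ?r c v) = cur ps c (charge v) + cur ?r c (charge v)"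
  proof (rule eig_ext[OF s0d lin_comp[OF charge_lin lin_plus[OF cur_lin[OF ps] cur_lin[OF r]]] lin_plus[OF lin_comp[OF cur_lin[OF ps] charge_lin] lin_comp[OF cur_lin[OF r] charge_lin]]])
    fix \<mu> v assume v: "s0 v = sc \<mu> v"
    have "(charge (cur ps c v) - cur ps c (charge v)) + (charge (cur ?r c v) - cur ?r c (charge v)) = 0"
    proof (cases "\<mu> + t / s \<in> \<int>")
      case True
      then obtain N where N: "\<mu> + t / s = of_int N" by (auto simp: Ints_def)
      let ?b = "bexp sc (\<lambda>n v. sh h s la n v + os ps n v) (N + c) v"
      have d: "qp h (of_int n * s) - qp h (- of_int n * s) \<noteq> 0" if "n \<noteq> 0" for n using sn[OF that] .
      have "sh h (- s) la n u + os ?r n u = sh h s la n u + os ps n u" if n: "n \<noteq> 0" for n u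
      proof -
        define A B where "A = qp h (of_int n * s)" and "B = qp h (- of_int n * s)"
        have AB: "A - B \<noteq> 0" using d[OF n] by (simp add: A_def B_def)
        \<comment> \<open>On oscillators, S(q^(-s) w) times X_k(w) equals S(q^s w): with A =
          \<sigma>^n and B = \<sigma>^(-n) this is the identity A / (A - B) - 1 = B / (A -
          B).\<close>
        have "A * (- 1 / (A - B)) + 1 = B * (- 1 / (A - B))" using AB by (simp add: field_simps)
        then have "sc (A * (- 1 / (A - B))) (osc M kk n u) + sc 1 (osc M kk n u) = sc (B * (- 1 / (A - B))) (osc M kk n u)"
          unfolding scale_left_distrib[symmetric] by simp
        then have "sh h (- s) la n u + osc M kk n u = sh h s la n u" by (simp add: sh_def la_def ls_def A_def B_def)
        moreover have "os ?r n u = os ps n u + osc M kk n u" by (simp add: osc_sum_append osc_sum_Cons osc_sum_Nil sh_def)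
        ultimately show ?thesis by (simp add: ac_simps)
      qed
      then have b: "bexp sc (\<lambda>n v. sh h (- s) la n v + os ?r n v) (N + c) v = ?b" by (rule bexp_cong)
      have sb: "s0 ?b = sc \<mu> ?b"
      proof -
        have "s0 (sh h s la n u + os ps n u) = sh h s la n (s0 u) + os ps n (s0 u)" if "n \<noteq> 0" for n u
          using s0_osc[OF kV that] s0_os[OF ps that] by (simp add: lin_add[OF s0lin] sh_def la_def lin_sc[OF s0lin])
        then have "s0 ?b = bexp sc (\<lambda>n v. sh h s la n v + os ps n v) (N + c) (s0 v)" by (rule bexp_comm[OF fm s0lin])
        then show ?thesis by (simp add: v lin_sc[OF bexp_lin[OF fm]])
      qed
      have z: "zp (map fst ?r) (S ?b) = sc (qp h (- 2 * s * (\<mu> + 2 * t / s))) (zp (map fst ps) (S ?b))"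
        unfolding zr zk_eig[OF S_eig[OF sb]] lin_sc[OF lz] ..
      \<comment> \<open>The integer N fixes the eigenvalue, so X_k after S acts as q^(- 2 N s - 2
        t). This is the factor by which the two residues have to differ, up to sign, in order to
        cancel.\<close>
      have "s * \<mu> = of_int N * s - t" using arg_cong[OF N, of "\<lambda>x. s * x"] s by (simp add: distrib_left eq_diff_eq mult.commute)
      moreover have "s * (\<mu> + 2 * t / s) = s * \<mu> + 2 * t" using s by (simp add: distrib_left)
      ultimately have m: "- 2 * s * (\<mu> + 2 * t / s) = - 2 * (of_int N * s) - 2 * t" by (simp add: mult.assoc)
      have "charge (cur ps c v) - cur ps c (charge v) = sc ((qp h (- 2 * t) - 1) * qp h (- of_int N * s)) (zp (map fst ps) (S ?b))"
        using charge_pole[OF ps v N _ cl cr] x by simp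
      moreover have "charge (cur ?r c v) - cur ?r c (charge v) = sc ((qp h (2 * t) - 1) * qp h (of_int N * s)) (zp (map fst ?r) (S ?b))"
        using charge_pole[OF r v N _ cl' cr', of c] x' unfolding b by simp
      moreover have "(qp h (- 2 * t) - 1) * qp h (- of_int N * s) + (qp h (2 * t) - 1) * qp h (of_int N * s) * qp h (- 2 * (of_int N * s) - 2 * t) = 0"
        by (simp add: algebra_simps minus_diff_commute qp_add[symmetric])
      ultimately show ?thesis unfolding z m by (simp add: scale_left_distrib[symmetric])
    next
      case False
      then show ?thesis using charge_nonint[OF ps v] charge_nonint[OF r v] by simp
    qed
    then show "charge (cur ps c v + cur ?r c v) = cur ps c (charge v) + cur ?r c (charge v)"
      unfolding lin_add[OF charge_lin] by (simp add: add_eq_0_iff algebra_simps)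
  qed
  then show ?thesis .
qed

end

context cvs
begin

lemma loop_II:
  assumes nz: "\<And>n :: int. n \<noteq> 0 \<Longrightarrow> qp h (of_int n) - qp h (- of_int n) \<noteq> 0"
    and nz1: "\<And>n :: int. n \<noteq> 0 \<Longrightarrow> qp h (of_int n * (- k - 2)) - qp h (- of_int n * (- k - 2)) \<noteq> 0"
  shows "commutes_with_loop_screening h sc (Q_II k) 2 (- 2 * k - 4) (Pp_II k)"
    and "commutes_with_loop_screening h sc (Q_II k) 2 (- 2 * k - 4) (Pm_II k)"
proof -
  let ?Q = "Q_II k"
  have all: "supercommutes (loop_charge h sc s t S s0 (osc M 2)) (Sigma_cur h sc ?Q M (Pp_II k)) \<and>
      supercommutes (loop_charge h sc s t S s0 (osc M 2)) (Psi_cur h sc ?Q M (Pp_II k)) \<and>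
      supercommutes (loop_charge h sc s t S s0 (osc M 2)) (Sigma_cur h sc ?Q M (Pm_II k)) \<and>
      supercommutes (loop_charge h sc s t S s0 (osc M 2)) (Psi_cur h sc ?Q M (Pm_II k))"
    if ext: "loop_extension h sc ?Q 2 s t M S s0" and st: "s = 1 \<and> t = - k - 2 \<or> s = - k - 2 \<and> t = 1"
    for M :: "(nat, 'v) seed_ops" and S s0 s t
  proof -
    have "k + 2 \<noteq> 0"
    proof
      assume "k + 2 = 0"
      then have "- k - 2 = 0" by (simp add: add_eq_0_iff)
      then show False using nz1[of 1] by simp
    qed
    then have s0: "s \<noteq> 0" using st by (auto simp: add_eq_0_iff)
    have sm: "seed_module h sc ?Q M" using ext by (simp add: loop_extension_def)
    interpret L: loop_seed sc h ?Q M 2 s t S s0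
    proof (rule loop_seed.intro[OF seed.intro[OF cvs_axioms seed_axioms.intro[OF sm]] loop_seed_axioms.intro[OF ext]])
      show "2 \<in> verts ?Q" "s \<noteq> 0" by (simp_all add: verts_II s0)
      show "qp h (of_int n * s) - qp h (- of_int n * s) \<noteq> 0" if "n \<noteq> 0" for n using st nz[OF that] nz1[OF that] by auto
      show "eps ?Q 2 j = 0" if "j \<in> verts ?Q" for j using that by (auto simp: verts_II eps_II)
    qed
    have c: "loop_charge h sc s t S s0 (osc M 2) = L.charge" by (simp add: loop_charge_def L.la_eq)
    have ok: "L.okl [(0, 0)]" "L.okl [(0, 0), (3, 2 * k + 2)]" "L.okl [(3, 0)]" "L.okl [(3, 0), (1, 0)]"
      "L.okl [(3, 0), (1, 0), (2, 0), (1, 2 * k + 2)]" "L.okl [(3, 0), (1, 0), (2, 0), (1, 2 * k + 2), (0, - 2)]"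
      by (simp_all add: verts_II)
    have v: "0 \<in> verts ?Q" "1 \<in> verts ?Q" "2 \<in> verts ?Q" "3 \<in> verts ?Q" by (simp_all add: verts_II)
    have z: "S (zer M 0 u) = zer M 0 (S u)" "S (zer M 3 u) = zer M 3 (S u)" "S (zer M 1 u) = sc (qp h (- 2 * t)) (zer M 1 (S u))"
      "S (zer M 2 u) = sc (qp h (4 * t)) (zer M 2 (S u))" for u
      using L.S_zer[OF v(1)] L.S_zer[OF v(2)] L.S_zer[OF v(4)] L.S_zk by (simp_all add: labels_II)
    note zs = z lin_sc[OF L.Slin] lin_sc[OF L.zer_lin[OF v(1)]] lin_sc[OF L.zer_lin[OF v(2)]] lin_sc[OF L.zer_lin[OF v(3)]] lin_sc[OF L.zer_lin[OF v(4)]]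
      eps_II qp_add[symmetric]
    have x: "S (L.zp (map fst [(0, 0)]) u) = L.zp (map fst [(0, 0)]) (S u)"
      "S (L.zp (map fst [(0, 0), (3, 2 * k + 2)]) u) = L.zp (map fst [(0, 0), (3, 2 * k + 2)]) (S u)"
      "S (L.zp (map fst [(3, 0)]) u) = L.zp (map fst [(3, 0)]) (S u)"
      "S (L.zp (map fst [(3, 0), (1, 0)]) u) = sc (qp h (- 2 * t)) (L.zp (map fst [(3, 0), (1, 0)]) (S u))"
      "S (L.zp (map fst [(3, 0), (1, 0), (2, 0), (1, 2 * k + 2)]) u) = L.zp (map fst [(3, 0), (1, 0), (2, 0), (1, 2 * k + 2)]) (S u)"
      "S (L.zp (map fst [(3, 0), (1, 0), (2, 0), (1, 2 * k + 2), (0, - 2)]) u) = L.zp (map fst [(3, 0), (1, 0), (2, 0), (1, 2 * k + 2), (0, - 2)]) (S u)" for u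
      by (simp_all add: zs minus_diff_commute)
    note cs = L.conl_def L.conr_def Cmat_II algebra_simps minus_diff_commute qp_add[symmetric]
    have c0: "L.conl [(0, 0)] [] []" "L.conr [(0, 0)] [] []" "L.conl [(0, 0), (3, 2 * k + 2)] [] []" "L.conr [(0, 0), (3, 2 * k + 2)] [] []"
      "L.conl [(3, 0)] [] []" "L.conr [(3, 0)] [] []" "L.conl [(3, 0), (1, 0), (2, 0), (1, 2 * k + 2)] [] []" "L.conr [(3, 0), (1, 0), (2, 0), (1, 2 * k + 2)] [] []"
      "L.conl [(3, 0), (1, 0), (2, 0), (1, 2 * k + 2), (0, - 2)] [] []" "L.conr [(3, 0), (1, 0), (2, 0), (1, 2 * k + 2), (0, - 2)] [] []"
      by (simp_all add: cs)
    \<comment> \<open>Only the second and third term are singular; in the fourth one the second X_1,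
      at q_3 z, removes the pole. In terms of s and t the pole data have one form, so both charges
      of the vertex are treated together.\<close>
    have c1: "L.conl [(3, 0), (1, 0)] [s + 2 * t] [s] \<and> L.conr [(3, 0), (1, 0)] [- (s + 2 * t)] [- s] \<and>
      L.conl ([(3, 0), (1, 0)] @ [(2, 0)]) [- (s + 2 * t)] [- s] \<and> L.conr ([(3, 0), (1, 0)] @ [(2, 0)]) [- (- (s + 2 * t))] [- (- s)]"
      using st
    proof (elim disjE conjE)
      assume st: "s = 1" "t = - k - 2"
      show ?thesis unfolding L.conl_def L.conr_def unfolding st by (simp add: Cmat_II algebra_simps minus_diff_commute qp_add[symmetric])
    next
      assume st: "s = - k - 2" "t = 1"
      show ?thesis unfolding L.conl_def L.conr_def unfolding st by (simp add: Cmat_II algebra_simps minus_diff_commute qp_add[symmetric])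
    qed
    have reg: "L.charge (L.cur [(0, 0)] m v) = L.cur [(0, 0)] m (L.charge v)"
      "L.charge (L.cur [(0, 0), (3, 2 * k + 2)] m v) = L.cur [(0, 0), (3, 2 * k + 2)] m (L.charge v)"
      "L.charge (L.cur [(3, 0)] m v) = L.cur [(3, 0)] m (L.charge v)"
      "L.charge (L.cur [(3, 0), (1, 0), (2, 0), (1, 2 * k + 2)] m v) = L.cur [(3, 0), (1, 0), (2, 0), (1, 2 * k + 2)] m (L.charge v)"
      "L.charge (L.cur [(3, 0), (1, 0), (2, 0), (1, 2 * k + 2), (0, - 2)] m v) = L.cur [(3, 0), (1, 0), (2, 0), (1, 2 * k + 2), (0, - 2)] m (L.charge v)" for m v
      by (rule L.charge_regular[OF ok(1) x(1) c0(1,2)] L.charge_regular[OF ok(2) x(2) c0(3,4)] L.charge_regular[OF ok(3) x(3) c0(5,6)]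
          L.charge_regular[OF ok(5) x(5) c0(7,8)] L.charge_regular[OF ok(6) x(6) c0(9,10)])+
    have pole: "L.charge (L.cur [(3, 0), (1, 0)] m v + L.cur [(3, 0), (1, 0), (2, 0)] m v) =
        L.cur [(3, 0), (1, 0)] m (L.charge v) + L.cur [(3, 0), (1, 0), (2, 0)] m (L.charge v)" for m v
      using L.charge_pair[OF ok(4) x(4), of m v] c1 unfolding append.simps by blast
    have "L.charge (Sigma_cur h sc ?Q M (Pm_II k) n v) = Sigma_cur h sc ?Q M (Pm_II k) n (L.charge v)" for n v
    proof -
      have "Sigma_cur h sc ?Q M (Pm_II k) n v = L.cur [(3, 0)] (- n) v + ((L.cur [(3, 0), (1, 0)] (- n) v + L.cur [(3, 0), (1, 0), (2, 0)] (- n) v) +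
         L.cur [(3, 0), (1, 0), (2, 0), (1, 2 * k + 2)] (- n) v)" for v
        unfolding L.Sigma_cur_Scur[OF terms_II(2)] L.Scur_def by (simp add: add.assoc)
      then show ?thesis by (simp only: lin_add[OF L.charge_lin] reg pole)
        (simp only: lin_add[OF L.charge_lin, symmetric] pole)
    qed
    moreover have "Sigma_cur h sc ?Q M (Pp_II k) n v = L.cur [(0, 0)] (- n) v" for n v
      unfolding L.Sigma_cur_Scur[OF terms_II(1)] L.Scur_def by simp
    ultimately show ?thesis unfolding c supercommutes_def L.Psi_cur_cur points_II by (simp add: reg)
  qed
  have two: "(- 2 * k - 4) / 2 = - k - 2" by (simp add: field_simps)
  show "commutes_with_loop_screening h sc (Q_II k) 2 (- 2 * k - 4) (Pp_II k)" "commutes_with_loop_screening h sc (Q_II k) 2 (- 2 * k - 4) (Pm_II k)"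
    unfolding commutes_with_loop_screening_def two Let_def
  proof (safe intro!: ballI)
  qed (use all in \<open>auto\<close>)
qed

lemma screenings_II:
  assumes nz: "\<And>n :: int. n \<noteq> 0 \<Longrightarrow> qp h (of_int n) - qp h (- of_int n) \<noteq> 0"
    and nz1: "\<And>n :: int. n \<noteq> 0 \<Longrightarrow> qp h (of_int n * (- k - 2)) - qp h (- of_int n * (- k - 2)) \<noteq> 0"
  shows "commutes_with_screenings h sc (Q_II k) (Pp_II k)" "commutes_with_screenings h sc (Q_II k) (Pm_II k)"
proof -
  have main: "commutes_with_screenings h sc (Q_II k) P"
    if "commutes_with_fermionic_screening h sc (Q_II k) 1 P" "commutes_with_loop_screening h sc (Q_II k) 2 (- 2 * k - 4) P" for P
    unfolding commutes_with_screenings_def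
  proof (intro ballI impI)
    fix i assume "i \<in> verts (Q_II k)" "vkind (Q_II k) i = Unfrozen"
    then consider "i = 1" | "i = 2" by (auto simp: Q_II_def kind03_def split: if_splits)
    then show "(labels (Q_II k) i i = {#} \<longrightarrow> commutes_with_fermionic_screening h sc (Q_II k) i P) \<and>
        (\<forall>e. labels (Q_II k) i i = {#e#} \<longrightarrow> commutes_with_loop_screening h sc (Q_II k) i e P)"
      by cases (use that in \<open>simp_all add: labels_II\<close>)
  qed
  show "commutes_with_screenings h sc (Q_II k) (Pp_II k)" "commutes_with_screenings h sc (Q_II k) (Pm_II k)"
    by (rule main[OF fermionic_II(1)[OF nz] loop_II(1)[OF nz nz1]] main[OF fermionic_II(2)[OF nz] loop_II(2)[OF nz nz1]], assumption+)+
qed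

end

subsection \<open>Mutation of the vertex operators\<close>

context cvs
begin

text \<open>Only finitely many words in the \<open>y\<^sub>n\<close> do not kill \<open>v\<close>, so one bound for \<open>w\<close> serves all of them.\<close>

lemma smooth_join:
  fixes I :: "'i set" and k :: 'k
  assumes w: "smooth I w" and y: "smooth {k} (\<lambda>_. y)" and yl: "\<And>n. n > 0 \<Longrightarrow> lin (y (int n))" and wl: "\<And>i n. i \<in> I \<Longrightarrow> n > 0 \<Longrightarrow> lin (w i (int n))"
    and c: "\<And>i n m v. i \<in> I \<Longrightarrow> n > 0 \<Longrightarrow> m > 0 \<Longrightarrow> y (int n) (w i (int m) v) = w i (int m) (y (int n) v)"
  shows "smooth (insert None (Some ` I)) (\<lambda>j. case j of None \<Rightarrow> y | Some i \<Rightarrow> w i)"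
proof (rule smoothI)
  fix v
  let ?z = "\<lambda>j. case j of None \<Rightarrow> y | Some i \<Rightarrow> w i"
  let ?y = "\<lambda>ps. foldr (\<lambda>(i, n). y (int n)) ps" and ?w = "\<lambda>ps. foldr (\<lambda>(i, n). w i (int n)) ps"
  \<comment> \<open>The \<open>y\<close> commute with the \<open>w\<close>, so a mixed word equals
    the word of its \<open>w\<close> letters applied after the word of its \<open>y\<close>
    letters.\<close>
  define py where "py ps = map (\<lambda>(i, n). (k, n)) (filter (\<lambda>(i, n). i = None) ps)" for ps :: "('i option \<times> nat) list"
  define pw where "pw ps = map (\<lambda>(i, n). (the i, n)) (filter (\<lambda>(i, n). i \<noteq> None) ps)" for ps :: "('i option \<times> nat) list"
  have yw: "y (int n) (?w ps u) = ?w ps (y (int n) u)" if "set ps \<subseteq> I \<times> {1..}" "n > 0" for n ps u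
    using that by (induction ps) (auto simp: c)
  have split: "foldr (\<lambda>(i, n). ?z i (int n)) ps v = ?w (pw ps) (?y (py ps) v) \<and> set (pw ps) \<subseteq> I \<times> {1..} \<and> set (py ps) \<subseteq> {k} \<times> {1..}
     \<and> sum_list (map snd ps) = sum_list (map snd (pw ps)) + sum_list (map snd (py ps))"
    if "set ps \<subseteq> insert None (Some ` I) \<times> {1..}" for ps
    using that
  proof (induction ps)
    case (Cons q ps)
    obtain i n where q: "q = (i, n)" by (cases q)
    have IH: "foldr (\<lambda>(i, n). ?z i (int n)) ps v = ?w (pw ps) (?y (py ps) v)" "set (pw ps) \<subseteq> I \<times> {1..}" "set (py ps) \<subseteq> {k} \<times> {1..}"
     "sum_list (map snd ps) = sum_list (map snd (pw ps)) + sum_list (map snd (py ps))" using Cons by auto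
    show ?case
    proof (cases i)
      case None
      then have "n > 0" using Cons.prems q by auto
      then show ?thesis using None IH Cons.prems q yw[OF IH(2), of n] by (auto simp: py_def pw_def)
    next
      case (Some j)
      then show ?thesis using IH Cons.prems q by (auto simp: py_def pw_def)
    qed
  qed (simp add: py_def pw_def)
  obtain Ny where Ny: "\<And>ps. set ps \<subseteq> {k} \<times> {1..} \<Longrightarrow> Ny \<le> sum_list (map snd ps) \<Longrightarrow> ?y ps v = 0"
    using smoothD[OF y, of v] by metis
  \<comment> \<open>All letters have degree at least 1, so a word of total degree below
    \<open>Ny\<close> has both its length and its letters bounded by \<open>Ny\<close>.\<close>
  define F where "F = {ps :: ('k \<times> nat) list. set ps \<subseteq> {k} \<times> {1..Ny} \<and> length ps \<le> Ny}"
  have "finite F" unfolding F_def by (rule finite_lists_length_le) simp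
  have "\<forall>r :: ('k \<times> nat) list. \<exists>N. \<forall>ps. set ps \<subseteq> I \<times> {1..} \<longrightarrow> N \<le> sum_list (map snd ps) \<longrightarrow> ?w ps (?y r v) = 0"
  proof
    fix r :: "('k \<times> nat) list"
    show "\<exists>N. \<forall>ps. set ps \<subseteq> I \<times> {1..} \<longrightarrow> N \<le> sum_list (map snd ps) \<longrightarrow> ?w ps (?y r v) = 0"
    proof (rule smoothD[OF w, of "?y r v"])
      fix N assume a: "\<And>ps. set ps \<subseteq> I \<times> {1..} \<Longrightarrow> N \<le> sum_list (map snd ps) \<Longrightarrow> ?w ps (?y r v) = 0"
      show ?thesis by (rule exI[of _ N]) (intro allI impI a)
    qed
  qed
  from choice[OF this] obtain Nw where
    Nw: "\<forall>(r :: ('k \<times> nat) list) ps. set ps \<subseteq> I \<times> {1..} \<longrightarrow> Nw r \<le> sum_list (map snd ps) \<longrightarrow> ?w ps (?y r v) = 0" ..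
  define N where "N = Ny + (\<Sum>r\<in>F. Nw r)"
  have small: "ps \<in> F" if psk: "set ps \<subseteq> {k} \<times> {1..}" and psN: "sum_list (map snd ps) < Ny" for ps
  proof -
    have pos: "1 \<le> snd q \<and> fst q = k" if q: "q \<in> set ps" for q
    proof -
      have "q \<in> {k} \<times> {1..}" using q psk by (rule rev_subsetD)
      then show ?thesis by (cases q) simp
    qed
    have len: "(\<And>q. q \<in> set xs \<Longrightarrow> 1 \<le> snd q) \<Longrightarrow> length xs \<le> sum_list (map snd xs)" for xs :: "('k \<times> nat) list"
    proof (induction xs)
      case (Cons x xs)
      have "1 \<le> snd x" "length xs \<le> sum_list (map snd xs)" using Cons by simp_all
      then show ?case by simp
    qed simp
    have "snd q \<le> Ny" if "q \<in> set ps" for q using psN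
      using member_le_sum_list[of "snd q" "map snd ps"] that psN by simp
    then have "set ps \<subseteq> {k} \<times> {1..Ny}" using pos by (fastforce simp: mem_Times_iff)
    moreover have "length ps \<le> Ny" using len[of ps] pos psN by fastforce
    ultimately show ?thesis by (simp add: F_def)
  qed
  show "\<exists>N. \<forall>ps. set ps \<subseteq> insert None (Some ` I) \<times> {1..} \<longrightarrow> N \<le> sum_list (map snd ps) \<longrightarrow> foldr (\<lambda>(i, n). ?z i (int n)) ps v = 0"
  proof (intro exI[of _ N] allI impI)
    fix ps assume ps: "set ps \<subseteq> insert None (Some ` I) \<times> {1..}" "N \<le> sum_list (map snd ps)"
    note sp = split[OF ps(1)]
    show "foldr (\<lambda>(i, n). ?z i (int n)) ps v = 0"
    proof (cases "Ny \<le> sum_list (map snd (py ps))")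
      case True
      have "lin (?w (pw ps))" by (rule foldr_word_lin[where I = I]) (use sp wl in auto)
      then show ?thesis using sp Ny[of "py ps"] True lin_zero by auto
    next
      case False
      then have "py ps \<in> F" using small sp by simp
      then have "Nw (py ps) \<le> (\<Sum>r\<in>F. Nw r)" by (intro member_le_sum) (auto simp: \<open>finite F\<close>)
      then have "Nw (py ps) \<le> sum_list (map snd (pw ps))" using sp ps(2) False unfolding N_def by linarith
      then show ?thesis using sp Nw[rule_format, of "pw ps" "py ps"] by auto
    qed
  qed
qed

lemma opfun_bij:
  assumes T: "diagonalizable sc S T" and g: "\<And>\<mu>. g \<mu> \<noteq> 0" shows "bij (opfun sc g T)"
proof -
  have inv: "opfun sc f T (opfun sc f' T v) = v" if ff: "\<And>\<mu>. f \<mu> * f' \<mu> = 1" for f f' v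
  proof (rule eig_ext[OF T lin_comp[OF opfun_lin[OF T] opfun_lin[OF T]] lin_id])
    fix \<mu> u assume u: "T u = sc \<mu> u"
    then show "opfun sc f T (opfun sc f' T u) = u"
      by (simp add: opfun_eig[OF diag_lin[OF T] u] lin_sc[OF opfun_lin[OF T]] ff mult.commute[of "f' \<mu>"])
  qed
  show ?thesis
    by (rule o_bij[of "opfun sc (\<lambda>\<mu>. 1 / g \<mu>) T"]) (simp_all add: fun_eq_iff inv g)
qed

end

section \<open>Seed modules built from fermions and residual operators\<close>

context frame
begin

text \<open>X_i is V_i followed by invertible operators built from the fermions. This carries
  bijectivity from the old X_i to V_i, and from V_i to the new X_i.\<close>

lemma zer_bij:
  assumes i: "i \<in> verts Q" and s: "sg i \<noteq> 0" shows "bij (zer M i) \<longleftrightarrow> bij (V i)"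
proof -
  let ?A = "\<lambda>v. sc (sg i) (Ypow (eps Q i kk) (opfun sc (\<lambda>\<mu>. qp h (cc i * (\<mu> + of_int (eps Q i kk) / 2))) J v))"
  define A where "A = ?A"
  have z: "zer M i = A \<circ> V i" unfolding A_def by (simp add: fun_eq_iff zer[OF i] weyl_def Ypow_def)
  have 1: "bij (\<lambda>v. sc (sg i) v)"
    by (rule o_bij[of "\<lambda>v. sc (1 / sg i) v"]) (simp_all add: fun_eq_iff s)
  have 2: "bij (Ypow (eps Q i kk))"
    by (rule o_bij[of "Ypow (- eps Q i kk)"]) (use eps1[OF i] in \<open>auto simp: fun_eq_iff YYi YiY\<close>)
  have 3: "bij (opfun sc (\<lambda>\<mu>. qp h (cc i * (\<mu> + of_int (eps Q i kk) / 2))) J)" by (rule opfun_bij[OF dJ]) simp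
  have A: "bij A" using bij_comp[OF 3 bij_comp[OF 2 1]] by (simp add: comp_def A_def)
  show ?thesis
  proof
    assume "bij (zer M i)"
    then have "bij (inv A \<circ> (A \<circ> V i))" unfolding z by (rule bij_comp) (rule bij_imp_bij_inv[OF A])
    moreover have "inv A \<circ> (A \<circ> V i) = V i" using A by (simp add: fun_eq_iff bij_is_inj)
    ultimately show "bij (V i)" by simp
  next
    assume "bij (V i)"
    then show "bij (zer M i)" unfolding z by (rule bij_comp) (rule A)
  qed
qed

lemma zer_zer:
  assumes i: "i \<in> verts Q" and j: "j \<in> verts Q" and u: "J u = sc \<mu> u"
  shows "zer M i (zer M j u) = sc (sg i * sg j * qp h (cc i * (\<mu> + of_int (eps Q j kk) + of_int (eps Q i kk) / 2) + cc j * (\<mu> + of_int (eps Q j kk) / 2)))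
    (Ypow (eps Q i kk + eps Q j kk) (V i (V j u)))"
proof -
  have v: "J (Ypow (eps Q j kk) (V j u)) = sc (\<mu> + of_int (eps Q j kk)) (Ypow (eps Q j kk) (V j u))"
    by (rule J_Ypow_eig[OF V_eig[OF j u]])
  have "V i (Ypow (eps Q j kk) (V j u)) = Ypow (eps Q j kk) (V i (V j u))" by (rule Ypow_comm) (rule VY[OF i])
  then show ?thesis
    unfolding zer_eig[OF j u] lin_sc[OF zer_lin[OF i]] zer_eig[OF i v]
    by (simp add: Ypow_add[OF eps1[OF i]] qp_add mult_ac)
qed

lemma Ypow_inj: "Ypow e u = Ypow e v \<Longrightarrow> u = v"
proof -
  have inj: "inj Y" "inj Yi" using YYi YiY by (metis injI)+
  have "inj (Ypow e)" unfolding Ypow_def using inj by (auto intro: inj_fn)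
  then show "Ypow e u = Ypow e v \<Longrightarrow> u = v" by (simp add: inj_eq)
qed

text \<open>On a J-eigenvector both orders contain the same power of Y. Comparing the scalars turns
  the commutation of the X_i into one of the V_i, which the old and the new seed share.\<close>

lemma zer_V_rel:
  assumes i: "i \<in> verts Q" and j: "j \<in> verts Q" and s: "sg i \<noteq> 0" "sg j \<noteq> 0"
  shows "(\<forall>v. zer M i (zer M j v) = sc (qp h (2 * of_int (eps Q i j))) (zer M j (zer M i v))) \<longleftrightarrow>
    (\<forall>v. V i (V j v) = sc (qp h (2 * of_int (eps Q i j) - cc i * of_int (eps Q j kk) + cc j * of_int (eps Q i kk))) (V j (V i v)))"
    (is "?L \<longleftrightarrow> ?R")
proof -
  let ?r = "2 * of_int (eps Q i j) - cc i * of_int (eps Q j kk) + cc j * of_int (eps Q i kk)"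
  have key: "zer M i (zer M j u) = sc (qp h (2 * of_int (eps Q i j))) (zer M j (zer M i u)) \<longleftrightarrow> V i (V j u) = sc (qp h ?r) (V j (V i u))"
    if u: "J u = sc \<mu> u" for u \<mu>
  proof -
    define A where "A = sg i * sg j * qp h (cc i * (\<mu> + of_int (eps Q j kk) + of_int (eps Q i kk) / 2) + cc j * (\<mu> + of_int (eps Q j kk) / 2))"
    have A: "A \<noteq> 0" using s by (simp add: A_def)
    have e: "2 * of_int (eps Q i j) + (cc j * (\<mu> + of_int (eps Q i kk) + of_int (eps Q j kk) / 2) + cc i * (\<mu> + of_int (eps Q i kk) / 2)) =
       cc i * (\<mu> + of_int (eps Q j kk) + of_int (eps Q i kk) / 2) + cc j * (\<mu> + of_int (eps Q j kk) / 2) + ?r"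
      by (simp add: algebra_simps)
    have "qp h (2 * of_int (eps Q i j)) * (sg j * sg i * qp h (cc j * (\<mu> + of_int (eps Q i kk) + of_int (eps Q j kk) / 2) + cc i * (\<mu> + of_int (eps Q i kk) / 2)))
      = sg i * sg j * (qp h (2 * of_int (eps Q i j)) * qp h (cc j * (\<mu> + of_int (eps Q i kk) + of_int (eps Q j kk) / 2) + cc i * (\<mu> + of_int (eps Q i kk) / 2)))"
      by simp
    also have "\<dots> = A * qp h ?r" unfolding qp_add[symmetric] e A_def by (simp add: qp_add)
    finally have z: "sc (qp h (2 * of_int (eps Q i j))) (zer M j (zer M i u)) = sc A (Ypow (eps Q i kk + eps Q j kk) (sc (qp h ?r) (V j (V i u))))"
      unfolding zer_zer[OF j i u] scale_scale lin_sc[OF Ypow_lin] by (simp add: add.commute)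
    show ?thesis unfolding z unfolding zer_zer[OF i j u] A_def[symmetric]
      using A Ypow_inj by auto
  qed
  have lz: "lin (\<lambda>v. zer M a (zer M b v))" "lin (\<lambda>v. V a (V b v))" if "a \<in> verts Q" "b \<in> verts Q" for a b
    by (rule lin_comp[OF zer_lin[OF that(1)] zer_lin[OF that(2)]] lin_comp[OF Vlin[OF that(1)] Vlin[OF that(2)]])+
  show ?thesis
  proof
    assume ?L
    show ?R
    proof
      show "V i (V j v) = sc (qp h ?r) (V j (V i v))" for v
        by (rule eig_ext[OF dJ lz(2)[OF i j] lin_scale[OF lz(2)[OF j i]]]) (use key \<open>?L\<close> in blast)
    qed
  next
    assume ?R
    show ?L
    proof
      show "zer M i (zer M j v) = sc (qp h (2 * of_int (eps Q i j))) (zer M j (zer M i v))" for v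
        by (rule eig_ext[OF dJ lz(1)[OF i j] lin_scale[OF lz(1)[OF j i]]]) (use key \<open>?R\<close> in blast)
    qed
  qed
qed

lemma osc_lin': "i \<in> verts Q \<Longrightarrow> n \<noteq> 0 \<Longrightarrow> lin (osc M i n)"
proof -
  assume i: "i \<in> verts Q" and n: "n \<noteq> 0"
  have "osc M i n = (\<lambda>v. w i n v + sc (ga i n / (qp h (of_int n) - qp h (- of_int n))) (y n v))" by (simp add: fun_eq_iff osc[OF i n])
  then show ?thesis using lin_plus[OF wlin[OF i n] lin_scale[OF ylin[OF n]]] by simp
qed

text \<open>Residual operators with the right relations, combined with any fermions of the frame,
  give a seed module. \<open>C\<close> says that the contraction of the residual oscillators
  together with that of the fermions is the prescribed one.\<close>

lemma frame_seed_module: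
  assumes wsm: "smooth (verts Q) w" and fin: "finite (verts Q)" and sg: "\<And>i. sg i \<noteq> 0" and bij: "\<And>i. i \<in> verts Q \<Longrightarrow> bij (V i)"
    and VV: "\<And>i j v. i \<in> verts Q \<Longrightarrow> j \<in> verts Q \<Longrightarrow>
       V i (V j v) = sc (qp h (2 * of_int (eps Q i j) - cc i * of_int (eps Q j kk) + cc j * of_int (eps Q i kk))) (V j (V i v))"
    and C: "\<And>i j n. i \<in> verts Q \<Longrightarrow> j \<in> verts Q \<Longrightarrow> n > 0 \<Longrightarrow>
       bw i j n - ga i (int n) * ga j (- int n) / of_nat n = Cmat (of_nat n * h) Q i j / of_nat n"
  shows "seed_module h sc Q M"
  unfolding seed_module_def
proof (intro conjI ballI allI impI)
  let ?s = "\<lambda>i n. ga i n / (qp h (of_int n) - qp h (- of_int n))"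
  fix i assume i: "i \<in> verts Q"
  show "lin (zer M i)" by (rule zer_lin[OF i])
  show "bij (zer M i)" using zer_bij[OF i sg] bij[OF i] by blast
  show "lin (osc M i n)" if "n \<noteq> 0" for n by (rule osc_lin'[OF i that])
  fix j v assume j: "j \<in> verts Q"
  show "zer M i (zer M j v) = sc (qp h (2 * of_int (eps Q i j))) (zer M j (zer M i v))"
    using zer_V_rel[OF i j sg sg] VV[OF i j] by blast
  show "zer M i (osc M j n v) = osc M j n (zer M i v)" if n: "n \<noteq> 0" for n
  proof (rule eig_ext[OF dJ lin_comp[OF zer_lin[OF i] osc_lin'[OF j n]] lin_comp[OF osc_lin'[OF j n] zer_lin[OF i]]])
    fix \<mu> u assume u: "J u = sc \<mu> u"
    have oT: "T (osc M j n x) = osc M j n (T x)" if "lin T" "\<And>x. T (y n x) = y n (T x)" "\<And>x. T (w j n x) = w j n (T x)" for T x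
      unfolding osc[OF j n] using that by (simp add: lin_add lin_sc)
    have "J (osc M j n u) = sc \<mu> (osc M j n u)" using oT[OF Jlin Jy[OF n] Jw[OF j n], of u] by (simp add: u lin_sc[OF osc_lin'[OF j n]])
    note e = zer_eig[OF i this]
    show "zer M i (osc M j n u) = osc M j n (zer M i u)"
      unfolding e zer_eig[OF i u] lin_sc[OF osc_lin'[OF j n]] oT[OF Vlin[OF i] Vy[OF i n] Vw[OF i j n]]
      by (subst Ypow_comm[of "osc M j n"]) (rule oT[OF Ylin Yy[OF n] Yw[OF j n], symmetric], rule refl)
  qed
  have ww: "comm2 (w i) (w j)" "brk (w i) (w j) (bw i j)" using wx i j by (auto simp: xfam_def)
  have com: "osc M i n (osc M j m v) = w i n (w j m v) + sc (?s j m) (y m (w i n v)) + sc (?s i n) (y n (w j m v)) + sc (?s i n * ?s j m) (y n (y m v))"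
    "osc M j m (osc M i n v) = w j m (w i n v) + sc (?s j m) (y m (w i n v)) + sc (?s i n) (y n (w j m v)) + sc (?s i n * ?s j m) (y m (y n v))"
    if n: "n \<noteq> 0" and m: "m \<noteq> 0" for n m
    unfolding osc[OF i n] osc[OF j m] lin_add[OF wlin[OF i n]] lin_add[OF wlin[OF j m]] lin_sc[OF wlin[OF i n]] lin_sc[OF wlin[OF j m]]
      lin_add[OF ylin[OF n]] lin_add[OF ylin[OF m]] lin_sc[OF ylin[OF n]] lin_sc[OF ylin[OF m]] yw[OF i m n, symmetric] yw[OF j n m, symmetric]
    by (simp_all add: scale_right_distrib ac_simps)
  show "osc M i n (osc M j m v) - osc M j m (osc M i n v) = (if n + m = 0 then sc (Cmat (of_int n * h) Q i j / of_int n) v else 0)"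
    if nm: "n > 0 \<and> m \<noteq> 0" for n m
  proof (cases "m > 0")
    case True
    then show ?thesis using ww(1) ycomm nm com[of n m] by (simp add: comm2_def)
  next
    case False
    obtain n' where n': "n = int n'" "n' > 0" using nm zero_less_imp_eq_int by blast
    have "0 < - m" using nm False by linarith
    then obtain m' where "- m = int m'" "m' > 0" using zero_less_imp_eq_int by blast
    then have m': "m = - int m'" "m' > 0" by simp_all
    define d where "d = qp h (of_nat n') - qp h (- of_nat n')"
    have d: "d \<noteq> 0" using qn[of "int n'"] n' by (simp add: d_def)
    have "w i n (w j m v) = w j m (w i n v) + (if n' = m' then sc (bw i j n') v else 0)"
      using ww(2) n' m' by (simp add: brk_def)
    moreover have "y n (y m v) = y m (y n v) + (if n' = m' then sc (d\<^sup>2 / of_nat n') v else 0)"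
      using yy n' m' by (simp add: brk_def d_def)
    moreover have "n' = m' \<Longrightarrow> ?s i n * ?s j m * (d\<^sup>2 / of_nat n') = - (ga i n * ga j m / of_nat n')"
    proof -
      assume "n' = m'"
      then have "?s i n * ?s j m = (ga i n / d) * (ga j m / - d)" using n' m' by (simp add: d_def)
      then show ?thesis using d by (simp add: power2_eq_square)
    qed
    ultimately show ?thesis using com[of n m] nm n' m' C[OF i j n'(2)]
      by (auto simp: scale_right_distrib scale_left_diff_distrib[symmetric] scale_left_distrib[symmetric])
  qed
  show "osc M i n (osc M j m v) = osc M j m (osc M i n v)" if nm: "n < 0 \<and> m < 0" for n m
  proof -
    have "w i n (w j m v) = w j m (w i n v)" "y n (y m v) = y m (y n v)"
      using ww(1)[unfolded comm2_def, rule_format, of "- n" "- m"] ycomm[unfolded comm2_def, rule_format, of "- n" "- m"] nm by simp_all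
    then show ?thesis using com[of n m] nm by simp
  qed
next
  let ?z = "\<lambda>j. case j of None \<Rightarrow> y | Some i \<Rightarrow> w i"
  have "smooth (insert None (Some ` verts Q)) ?z"
    by (rule smooth_join[OF wsm ysm]) (use ylin wlin yw in auto)
  then show "smooth (verts Q) (osc M)"
  proof (rule smooth_comb)
    show "lin (?z i (int n))" if "i \<in> insert None (Some ` verts Q)" "n > 0" for i n using that ylin wlin by auto
    show "osc M j (int n) v = (\<Sum>i\<in>insert None (Some ` verts Q). sc (case i of None \<Rightarrow> ga j (int n) / (qp h (of_int (int n)) - qp h (- of_int (int n))) | Some i \<Rightarrow> if i = j then 1 else 0) (?z i (int n) v))"
      if j: "j \<in> verts Q" and n: "n > 0" for j n v
    proof -
      have "(\<Sum>i\<in>verts Q. sc (if i = j then 1 else 0) (w i (int n) v)) = (\<Sum>i\<in>verts Q. if i = j then w i (int n) v else 0)"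
        by (rule sum.cong) auto
      also have "\<dots> = w j (int n) v" using fin j by simp
      finally show ?thesis using fin n osc[OF j, of "int n" v] by (simp add: sum.reindex add.commute)
    qed
  qed
qed

text \<open>Terms that differ by factors X_k thus contain the same operator besides the fermion, and
  this operator can be compared between the two seeds.\<close>

lemma VV_strip:
  assumes kk: "\<And>n v. n \<noteq> 0 \<Longrightarrow> w kk n v = 0" "\<And>v. V kk v = v"
  shows "VV (map fst ps) (bexp sc (W ps) j v) = VV (filter (\<lambda>i. i \<noteq> kk) (map fst ps)) (bexp sc (W (filter (\<lambda>q. fst q \<noteq> kk) ps)) j v)"
proof -
  have 1: "VV is u = VV (filter (\<lambda>i. i \<noteq> kk) is) u" for "is" u by (induction "is") (auto simp: kk)
  have "W ps n u = W (filter (\<lambda>q. fst q \<noteq> kk) ps) n u" if "n \<noteq> 0" for n u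
    by (induction ps) (auto simp: osc_sum_def kk that)
  then have "bexp sc (W ps) j v = bexp sc (W (filter (\<lambda>q. fst q \<noteq> kk) ps)) j v" by (rule bexp_cong)
  then show ?thesis using 1 by simp
qed

text \<open>The scalar is rewritten as a function \<open>K\<close> of the fermion exponent c,
  because a mutated fermion arises by multiplying the mode at z^c by q^c - q^(-c) up to
  sign.\<close>

lemma frame_cur_nf:
  assumes ps: "okl ps" and g: "gacond ps a" and vp: "p v = sc \<pi> v"
    and k: "kap ps + (\<Sum>i\<leftarrow>map fst ps. cc i) = a * of_int E" and E: "E = Es (map fst ps)" "E = 1 \<or> E = - 1"
    and C: "C = - of_int n + of_int E * \<pi> + 1/2" and X: "\<And>j. VV (map fst ps) (bexp sc (W ps) j v) = X j"
    and K: "\<And>c. Kc (map fst ps) 0 * qp h (a * (c - 1/2) - kap ps * \<pi>) = K c"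
  shows "nprodD h sc Q kk D M ps n v = Sum_any (\<lambda>j. sc (K (C - of_int j)) (Phi E (C - of_int j) (X j)))"
    and "finite {j. Phi E (C - of_int j) (X j) \<noteq> 0}"
proof -
  have c: "- of_int n + of_int E * \<pi> - of_int j + 1/2 = C - of_int j" "- of_int n + of_int E * \<pi> - of_int j = (C - of_int j) - 1/2" for j
    unfolding C by simp_all
  show "nprodD h sc Q kk D M ps n v = Sum_any (\<lambda>j. sc (K (C - of_int j)) (Phi E (C - of_int j) (X j)))"
    unfolding frame_cur(1)[OF ps g vp k E] c X by (simp only: c K diff_add_cancel)
  show "finite {j. Phi E (C - of_int j) (X j) \<noteq> 0}"
    using frame_cur(2)[OF ps g vp k E, of n] unfolding c X diff_add_cancel .
qed

end

lemma (in cvs) Sum_any_sc_add: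
  "finite {j. P j \<noteq> 0} \<Longrightarrow> Sum_any (\<lambda>j. sc (a j) (P j)) + Sum_any (\<lambda>j. sc (b j) (P j)) = Sum_any (\<lambda>j. sc (a j + b j) (P j))"
proof -
  assume f: "finite {j. P j \<noteq> 0}"
  have f': "finite {j. sc (c j) (P j) \<noteq> 0}" for c by (rule finite_subset[OF _ f]) auto
  show ?thesis unfolding scale_left_distrib by (rule Sum_any.distrib[OF f' f', symmetric])
qed

subsection \<open>The mutation from the first realization to the second\<close>

lemma mutated_I:
  assumes nz: "qp h (2 * k + 4) \<noteq> 1"
  shows "\<exists>Q0. mutated h 1 (Q_I k) Q0 \<and> Q_II k = gauge_quiver 1 (2 * k + 3) Q0"
proof -
  \<comment> \<open>The quiver after mutation and before gauging. Of ten arrows two opposite pairs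
    disappear, one between 2 and 0 and one between 2 and 3. Gauging by q^(2k+3) = q q_3 turns the
    rest into the second quiver.\<close>
  define Q0 :: "nat dquiver" where "Q0 = \<lparr>verts = {0, 1, 2, 3}, vkind = kind03,
    arrows = {#(1, 0, - 1), (3, 1, - 2 * k - 3), (2, 1, - 1), (1, 2, 2 * k + 3), (0, 3, 2 * k + 2), (2, 2, - 2 * k - 4)#}\<rparr>"
  have rev: "reverse_at 1 (arrows (Q_I k)) = {#(1, 0, - 1), (3, 1, - 2 * k - 3), (3, 2, 0), (2, 0, - 2), (2, 1, - 1), (1, 2, 2 * k + 3)#}"
    by (simp add: reverse_at_def Q_I_def algebra_simps minus_diff_commute)
  have comp: "composed_at 1 {#(1 :: nat, 0, - 1), (3, 1, - 2 * k - 3), (3, 2, 0), (2, 0, - 2), (2, 1, - 1), (1, 2, 2 * k + 3)#} =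
     {#(0, 3, 2 * k + 2), (2, 3, - 2), (0, 2, 0), (2 :: nat, 2, - 2 * k - 4)#}"
    by (simp add: composed_at_def algebra_simps minus_diff_commute)
  have step1: "deletes_pair h (arrows Q0 + {#(2, 0, - 2), (0, 2, 0)#} + {#(3, 2, 0), (2, 3, - 2)#}) (arrows Q0 + {#(2, 0, - 2), (0, 2, 0)#})"
    unfolding deletes_pair_def by (intro exI conjI, rule refl) simp
  have step2: "deletes_pair h (arrows Q0 + {#(2, 0, - 2), (0, 2, 0)#}) (arrows Q0)"
    unfolding deletes_pair_def by (intro exI conjI, rule refl) simp
  have "reverse_at 1 (arrows (Q_I k)) + composed_at 1 (reverse_at 1 (arrows (Q_I k))) = arrows Q0 + {#(2, 0, - 2), (0, 2, 0)#} + {#(3, 2, 0), (2, 3, - 2)#}"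
    unfolding rev comp Q0_def by (simp add: add_mset_commute)
  then have del: "(deletes_pair h)\<^sup>*\<^sup>* (reverse_at 1 (arrows (Q_I k)) + composed_at 1 (reverse_at 1 (arrows (Q_I k)))) (arrows Q0)"
    using step1 step2 by (metis rtranclp.rtrancl_into_rtrancl rtranclp.rtrancl_refl)
  have fin: "\<not> deletes_pair h (arrows Q0) B" for B
  proof
    assume "deletes_pair h (arrows Q0) B"
    then obtain i j e1 e2 where e: "arrows Q0 = B + {#(i, j, e1), (j, i, e2)#}" and q: "qp h e1 * qp h e2 = qp h (- 2)"
      unfolding deletes_pair_def by blast
    have m: "(i, j, e1) \<in># arrows Q0" "(j, i, e2) \<in># arrows Q0" unfolding e by simp_all
    \<comment> \<open>The remaining opposite arrows between 1 and 2 would cancel only if q^(2k+4) =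
      1, that is, q_1 = 1.\<close>
    have ne: "qp h (- 1) * qp h (2 * k + 3) \<noteq> qp h (- 2)"
    proof
      assume "qp h (- 1) * qp h (2 * k + 3) = qp h (- 2)"
      then have "qp h (2 + (- 1 + (2 * k + 3))) = qp h (2 + - 2)" by (simp only: qp_add)
      moreover have "2 + (- 1 + (2 * k + 3)) = 2 * k + 4" by simp
      ultimately have "qp h (2 * k + 4) = qp h (2 + - 2)" by (simp only:)
      with nz show False by simp
    qed
    have ne': "qp h (2 * k + 3) * qp h (- 1) \<noteq> qp h (- 2)" using ne by (subst mult.commute[of "qp h (2 * k + 3)"])
    have "x \<in> {(1, 0, - 1), (3, 1, - 2 * k - 3), (2, 1, - 1), (1, 2, 2 * k + 3), (0, 3, 2 * k + 2), (2, 2, - 2 * k - 4)}"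
      if "x \<in># arrows Q0" for x using that unfolding Q0_def by simp
    note mm = this[OF m(1)] this[OF m(2)]
    \<comment> \<open>What is left is the loop at 2 paired with itself, but it occurs only
      once.\<close>
    have "i = 2 \<and> j = 2 \<and> e1 = - 2 * k - 4 \<and> e2 = - 2 * k - 4"
      using mm by (elim insertE emptyE; (simp; fail | use q ne ne' in \<open>simp only: prod.inject\<close>))
    then have "count (arrows Q0) (2, 2, - 2 * k - 4) \<ge> 2" unfolding e by simp
    then show False unfolding Q0_def by simp
  qed
  have "mutated h 1 (Q_I k) Q0"
    unfolding mutated_def Let_def using del fin by (simp add: verts_I labels_I Q0_def) (simp add: Q_I_def kind03_def)
  moreover have "Q_II k = gauge_quiver 1 (2 * k + 3) Q0"
    unfolding gauge_quiver_def Q0_def Q_II_def by (simp add: algebra_simps minus_diff_commute)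
  ultimately show ?thesis by blast
qed

context cvs
begin

lemma nprodD_terms_I:
  "SigmaD_cur h sc (Q_I k) 1 D M (Pp_I k) n v = nprodD h sc (Q_I k) 1 D M [(0, 0)] n v + nprodD h sc (Q_I k) 1 D M [(0, 0), (1, 0)] n v"
  "SigmaD_cur h sc (Q_I k) 1 D M Pm_I n v = nprodD h sc (Q_I k) 1 D M [(3, 0)] n v + nprodD h sc (Q_I k) 1 D M [(3, 0), (2, 0)] n v"
  "PsiD_cur h sc (Q_I k) 1 D M (Pp_I k) n v = nprodD h sc (Q_I k) 1 D M [(0, 0), (1, 0), (3, 2 * k + 2)] n v"
  "PsiD_cur h sc (Q_I k) 1 D M Pm_I n v = nprodD h sc (Q_I k) 1 D M [(3, 0), (2, 0), (0, - 2)] n v"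
  unfolding SigmaD_sum_list[OF terms_I(1)] SigmaD_sum_list[OF terms_I(2)] PsiD_cur_def points_I
  by (simp_all only: list.map sum_list_simps add_0_right add.assoc)

lemma mutation_ops:
  assumes nz: "\<And>n :: int. n \<noteq> 0 \<Longrightarrow> qp h (of_int n) - qp h (- of_int n) \<noteq> 0"
    and fm: "fermion_mutation h sc (Q_I k) 1 M \<Phi> J' Y' Yi' y"
  defines "M' \<equiv> gauge_ops h sc 1 (2 * k + 3) (mutated_ops h sc (Q_I k) 1 M \<Phi> J' Y' Yi' y)"
  shows "seed_module h sc (Q_II k) M'"
    and "SigmaD_cur h sc (Q_I k) 1 (\<lambda>v. fJ \<Phi> v - fp \<Phi> v) M (Pp_I k) = SigmaD_cur h sc (Q_II k) 1 (\<lambda>v. J' v + fp \<Phi> v) M' (Pp_II k)"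
    and "SigmaD_cur h sc (Q_I k) 1 (\<lambda>v. fJ \<Phi> v - fp \<Phi> v) M Pm_I = SigmaD_cur h sc (Q_II k) 1 (\<lambda>v. J' v + fp \<Phi> v) M' (Pm_II k)"
    and "PsiD_cur h sc (Q_I k) 1 (\<lambda>v. fJ \<Phi> v - fp \<Phi> v) M (Pp_I k) = PsiD_cur h sc (Q_II k) 1 (\<lambda>v. J' v + fp \<Phi> v) M' (Pp_II k)"
    and "PsiD_cur h sc (Q_I k) 1 (\<lambda>v. fJ \<Phi> v - fp \<Phi> v) M Pm_I = PsiD_cur h sc (Q_II k) 1 (\<lambda>v. J' v + fp \<Phi> v) M' (Pm_II k)"
proof -
  note F = fm[unfolded fermion_mutation_def]
  interpret fs: fermi_seed sc h "Q_I k" M 1 \<Phi>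
    by (rule fermi_seed.intro[OF cvs_axioms fermi_seed_axioms.intro])
      (use F nz in \<open>auto simp: verts_I eps_I\<close>)
  \<comment> \<open>Data of the mutated and gauged operators. The signs come from X_1 = - q^(-2
    \<open>J'\<close>) and from one factor - Psi for the arrow from 1 to each of 2 and 3, the
    exponents from the arguments of the new fermions, and q^(n (2k+3)) at vertex 1 from the
    gauging.\<close>
  define sg' :: "nat \<Rightarrow> complex" where "sg' i = (if i = 0 then 1 else - 1)" for i
  define cc' :: "nat \<Rightarrow> complex" where "cc' i = (if i = 1 then - 2 else if i = 0 then 0 else if i = 2 then 2 * k + 4 else - 2 * k - 2)" for i
  define ga' :: "nat \<Rightarrow> int \<Rightarrow> complex" where "ga' i n = (if i = 1 then qp h (of_int n * (2 * k + 3)) * (qp h (of_int n) - qp h (- of_int n))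
     else if i = 0 then - 1 else if i = 2 then 1 - qp h (of_int n * (2 * k + 4)) else qp h (of_int n * (2 * k + 2)))" for i n
  have lJ': "lin J'" and lY': "lin Y'" and ly: "n \<noteq> 0 \<Longrightarrow> lin (y n)" for n using F by (simp_all add: diagonalizable_def)
  have yy: "y n (y m v) - y m (y n v) = (if n + m = 0 then sc ((qp h (of_int n) - qp h (- of_int n))\<^sup>2 / of_int n) v else 0)"
    and Jy: "J' (y n v) = y n (J' v)" and Yy: "Y' (y n v) = y n (Y' v)" if "n \<noteq> 0" "m \<noteq> 0" for n m v
    using F that by simp_all
  have fam3: "f \<in> {J', Y'} \<union> {y n | n. n \<noteq> 0} \<Longrightarrow> f (fp \<Phi> v) = fp \<Phi> (f v) \<and>
        (\<forall>j\<in>verts (Q_I k) - {1}. f (fV \<Phi> j v) = fV \<Phi> j (f v) \<and>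
           (\<forall>n. n \<noteq> 0 \<longrightarrow> f (v_osc h sc (Q_I k) 1 M j n v) = v_osc h sc (Q_I k) 1 M j n (f v)))" for f v
    using F by blast
  have f3: "f (fp \<Phi> v) = fp \<Phi> (f v)" "i \<in> verts (Q_I k) \<Longrightarrow> f (fs.Vf i v) = fs.Vf i (f v)"
    "i \<in> verts (Q_I k) \<Longrightarrow> n \<noteq> 0 \<Longrightarrow> f (fs.wf i n v) = fs.wf i n (f v)"
    if f: "f \<in> {J', Y'} \<union> {y n | n. n \<noteq> 0}" for f v i n
  proof -
    have lf: "lin f" using f lJ' lY' ly by auto
    show "f (fp \<Phi> v) = fp \<Phi> (f v)" using fam3[OF f] by blast
    show "i \<in> verts (Q_I k) \<Longrightarrow> f (fs.Vf i v) = fs.Vf i (f v)" using fam3[OF f, of v] by (auto simp: fs.Vf_def)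
    show "i \<in> verts (Q_I k) \<Longrightarrow> n \<noteq> 0 \<Longrightarrow> f (fs.wf i n v) = fs.wf i n (f v)"
      using fam3[OF f, of v] by (cases "i = 1") (simp_all add: fs.wf_k lin_zero[OF lf] fs.wf_v_osc)
  qed
  have fJ: "J' \<in> {J', Y'} \<union> {y n | n. n \<noteq> 0}" and fY: "Y' \<in> {J', Y'} \<union> {y n | n. n \<noteq> 0}"
    and fy: "n \<noteq> 0 \<Longrightarrow> y n \<in> {J', Y'} \<union> {y n | n. n \<noteq> 0}" for n by blast+
  have vv: "verts (Q_II k) = verts (Q_I k)" by (simp add: verts_I verts_II)
  have ee: "eps (Q_II k) i 1 = - eps (Q_I k) i 1" if "i \<in> verts (Q_I k)" for i using that by (auto simp: verts_I eps_I eps_II)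
  have DD: "(\<lambda>v. J' v - - fp \<Phi> v) = (\<lambda>v. J' v + fp \<Phi> v)" by simp
  \<comment> \<open>Mutation reverses \<epsilon> at the vertex 1, so - p takes the place of p, in
    accordance with D = \<open>J'\<close> + p. The V_j and the residual oscillators are those of the
    old seed.\<close>
  interpret g: frame sc h "Q_II k" M' 1 J' Y' Yi' "\<lambda>v. - fp \<Phi> v" fs.Vf sg' cc' y fs.wf ga' fs.bwf
  proof (rule frame.intro[OF cvs_axioms frame_axioms.intro], unfold vv DD)
    show "diagonalizable sc UNIV J'" "diagonalizable sc \<int> (\<lambda>v. J' v + fp \<Phi> v)" "lin Y'" using F by simp_all
    show "diagonalizable sc UNIV (\<lambda>v. - fp \<Phi> v)" by (rule diag_affine[OF fs.f.dp, where a = "- 1" and b = 0]) (simp add: scale_minus_left)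
    show "lin (fs.Vf i)" if "i \<in> verts (Q_I k)" for i by (rule fs.f.Vlin[OF that])
    show "Y' (Yi' v) = v" "Yi' (Y' v) = v" "J' (Y' v) = Y' (J' v + v)" for v using F by simp_all
    show "J' (- fp \<Phi> v) = - fp \<Phi> (J' v)" "Y' (- fp \<Phi> v) = - fp \<Phi> (Y' v)" for v
      by (simp_all add: lin_neg[OF lJ'] lin_neg[OF lY'] f3(1)[OF fJ] f3(1)[OF fY])
    show "eps (Q_II k) i 1 \<in> {- 1, 0, 1}" if "i \<in> verts (Q_I k)" for i using that by (auto simp: verts_I eps_II)
    show "zer M' i v = sc (sg' i) (weyl h sc J' Y' Yi' (eps (Q_II k) i 1) (cc' i) (fs.Vf i v))" if "i \<in> verts (Q_I k)" for i v
    proof (cases "i = 1")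
      case True
      then show ?thesis by (simp add: M'_def gauge_ops_def mutated_ops_def sg'_def cc'_def fs.Vf_def weyl_def eps_II)
    next
      case False
      then have "i = 0 \<or> i = 2 \<or> i = 3" using that by (auto simp: verts_I)
      then show ?thesis
        by (elim disjE) (simp_all add: M'_def gauge_ops_def mutated_ops_def sg'_def cc'_def fs.Vf_def labels_I eps_I eps_II add.commute[of 4] minus_diff_commute)
    qed
    show "fs.Vf i (J' v) = J' (fs.Vf i v)" "fs.Vf i (Y' v) = Y' (fs.Vf i v)" if "i \<in> verts (Q_I k)" for i v
      using f3(2)[OF fJ that] f3(2)[OF fY that] by simp_all
    show "- fp \<Phi> (fs.Vf i v) = fs.Vf i (- fp \<Phi> v + sc (of_int (eps (Q_II k) i 1)) v)" if i: "i \<in> verts (Q_I k)" for i v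
      unfolding fs.f.pV[OF i] ee[OF i]
      by (simp add: lin_neg[OF fs.f.Vlin[OF i]] lin_add[OF fs.f.Vlin[OF i]] lin_diff[OF fs.f.Vlin[OF i]] lin_sc[OF fs.f.Vlin[OF i]] scale_minus_left)
    show "smooth {1} (\<lambda>_ :: nat. y)" using F by simp
    have same: "y n (y m v) = y m (y n v)" if "n \<noteq> 0" "m \<noteq> 0" "n + m \<noteq> 0" for n m v using yy[OF that(1,2), of v] that(3) by simp
    show "cfam (\<lambda>n. y (int n))" "cfam (\<lambda>n. y (- int n))" unfolding cfam_def using same ly by simp_all
    show "xfam (verts (Q_I k)) fs.wf fs.bwf" by (rule fs.wf_x)
    show "J' (y n v) = y n (J' v)" "Y' (y n v) = y n (Y' v)" if "n \<noteq> 0" for n v using Jy[OF that that] Yy[OF that that] by simp_all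
    show "- fp \<Phi> (y n v) = y n (- fp \<Phi> v)" if "n \<noteq> 0" for n v by (simp add: f3(1)[OF fy[OF that]] lin_neg[OF ly[OF that]])
    show "J' (fs.wf i n v) = fs.wf i n (J' v)" "Y' (fs.wf i n v) = fs.wf i n (Y' v)" if "i \<in> verts (Q_I k)" "n \<noteq> 0" for i n v
      by (rule f3(3)[OF fJ that] f3(3)[OF fY that])+
    show "- fp \<Phi> (fs.wf i n v) = fs.wf i n (- fp \<Phi> v)" if "i \<in> verts (Q_I k)" "n \<noteq> 0" for i n v
      by (simp add: fs.f.pw[OF that] lin_neg[OF fs.wf_lin[OF that]])
    show "fs.Vf i (y n v) = y n (fs.Vf i v)" if "i \<in> verts (Q_I k)" "n \<noteq> 0" for i n v
      using f3(2)[OF fy[OF that(2)] that(1)] by simp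
    show "fs.Vf i (fs.wf j n v) = fs.wf j n (fs.Vf i v)" if "i \<in> verts (Q_I k)" "j \<in> verts (Q_I k)" "n \<noteq> 0" for i j n v
      by (rule fs.f.Vw[OF that])
    show "y n (fs.wf i m v) = fs.wf i m (y n v)" if "i \<in> verts (Q_I k)" "n \<noteq> 0" "m \<noteq> 0" for i n m v
      by (rule f3(3)[OF fy[OF that(2)] that(1,3)])
    show "brk y y (\<lambda>n. (qp h (of_nat n) - qp h (- of_nat n))\<^sup>2 / of_nat n)"
      unfolding brk_def
    proof (intro allI impI, elim conjE)
      fix m n :: nat and v assume mn: "0 < m" "0 < n"
      show "y (int m) (y (- int n) v) = y (- int n) (y (int m) v) + (if m = n then sc ((qp h (of_nat m) - qp h (- of_nat m))\<^sup>2 / of_nat m) v else 0)"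
        using yy[of "int m" "- int n" v] mn by (auto simp: diff_eq_eq add.commute split: if_splits)
    qed
    show "osc M' i n v = fs.wf i n v + sc (ga' i n / (qp h (of_int n) - qp h (- of_int n))) (y n v)" if i: "i \<in> verts (Q_I k)" and n: "n \<noteq> 0" for i n v
    proof (cases "i = 1")
      case True
      then show ?thesis using fs.wf_k[OF n, of v] nz[OF n] by (simp add: M'_def gauge_ops_def mutated_ops_def ga'_def)
    next
      case False
      then have "i = 0 \<or> i = 2 \<or> i = 3" using that by (auto simp: verts_I)
      then show ?thesis
        by (elim disjE) (simp_all add: M'_def gauge_ops_def mutated_ops_def ga'_def fs.wf_v_osc labels_I algebra_simps)
    qed
    show "qp h (of_int n) - qp h (- of_int n) \<noteq> 0" if "n \<noteq> 0" for n by (rule nz[OF that])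
  qed
  have fcc: "fs.ccf 0 = 1" "fs.ccf 1 = - 2" "fs.ccf 2 = - 2 * k - 2" "fs.ccf 3 = 2 * k + 3"
    by (simp_all add: fs.ccf_def labels_I)
  have gcc: "cc' 0 = 0" "cc' 1 = - 2" "cc' 2 = 2 * k + 4" "cc' 3 = - 2 * k - 2" by (simp_all add: cc'_def)
  have "fs.Vf i (fs.Vf j v) = sc (qp h (2 * of_int (eps (Q_I k) i j) - fs.ccf i * of_int (eps (Q_I k) j 1) + fs.ccf j * of_int (eps (Q_I k) i 1))) (fs.Vf j (fs.Vf i v))"
    if ij: "i \<in> verts (Q_I k)" "j \<in> verts (Q_I k)" for i j v
  proof -
    have s: "(if a = (1::nat) then - 1 else 1 :: complex) \<noteq> 0" for a by simp
    show ?thesis using fs.f.zer_V_rel[OF ij s s] zok_swap[OF fs.s.zok ij] by blast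
  qed
  note Vrel = this
  show sm: "seed_module h sc (Q_II k) M'"
  proof (rule g.frame_seed_module, unfold vv)
    show "smooth (verts (Q_I k)) fs.wf" by (rule fs.wf_smooth)
    show "finite (verts (Q_I k))" by (simp add: verts_I)
    show "sg' i \<noteq> 0" for i by (simp add: sg'_def)
    show "bij (fs.Vf i)" if i: "i \<in> verts (Q_I k)" for i
    proof -
      have "(if i = (1::nat) then - 1 else 1 :: complex) \<noteq> 0" by simp
      from fs.f.zer_bij[OF i this] show ?thesis using fs.smM i by (simp add: seed_module_def)
    qed
    show "fs.Vf i (fs.Vf j v) = sc (qp h (2 * of_int (eps (Q_II k) i j) - cc' i * of_int (eps (Q_II k) j 1) + cc' j * of_int (eps (Q_II k) i 1))) (fs.Vf j (fs.Vf i v))"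
      if ij: "i \<in> verts (Q_I k)" "j \<in> verts (Q_I k)" for i j v
    proof -
      \<comment> \<open>The exponent in the commutation of V_i with V_j is the same computed from
        either seed, which confirms the new \<epsilon>.\<close>
      have "2 * of_int (eps (Q_I k) i j) - fs.ccf i * of_int (eps (Q_I k) j 1) + fs.ccf j * of_int (eps (Q_I k) i 1) =
         2 * of_int (eps (Q_II k) i j) - cc' i * of_int (eps (Q_II k) j 1) + cc' j * of_int (eps (Q_II k) i 1)"
        using ij unfolding verts_I by (elim insertE emptyE; simp add: fcc gcc eps_I eps_II)
      then show ?thesis using Vrel[OF ij, of v] by simp
    qed
    show "fs.bwf i j n - ga' i (int n) * ga' j (- int n) / of_nat n = Cmat (of_nat n * h) (Q_II k) i j / of_nat n"
      if ij: "i \<in> verts (Q_I k)" "j \<in> verts (Q_I k)" and n: "n > 0" for i j n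
    proof -
      \<comment> \<open>Replacing the old fermion contraction by the new one turns the old C into
        the new C, entry by entry.\<close>
      have "Cmat (of_nat n * h) (Q_I k) i j + fs.gf i (int n) * fs.gf j (- int n) - ga' i (int n) * ga' j (- int n) = Cmat (of_nat n * h) (Q_II k) i j"
        using ij unfolding verts_I
        by (elim insertE emptyE; simp add: Cmat_I Cmat_II fs.gf_def fermi_coeff_def labels_I ga'_def qp_times[where c = "of_nat n" and h = h];
            simp add: algebra_simps minus_diff_commute qp_add[symmetric])
      then show ?thesis by (simp add: fs.bwf_def diff_divide_distrib[symmetric])
    qed
  qed
  let ?T = "nprodD h sc (Q_I k) 1 (\<lambda>v. fJ \<Phi> v - fp \<Phi> v) M" and ?U = "nprodD h sc (Q_II k) 1 (\<lambda>v. J' v + fp \<Phi> v) M'"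
  have R1: "g.Phi (- 1) c v = sc (qp h c - qp h (- c)) (fs.f.Phi 1 c v)" and R2: "fs.f.Phi (- 1) c v = sc (qp h (- c) - qp h c) (g.Phi 1 c v)" for c v
    using F by (simp_all add: g.Phi_def fs.f.Phi_def)
  have fok: "fs.f.okl [(0, 0)]" "fs.f.okl [(0, 0), (1, 0)]" "fs.f.okl [(3, 0)]" "fs.f.okl [(3, 0), (2, 0)]"
    "fs.f.okl [(0, 0), (1, 0), (3, 2 * k + 2)]" "fs.f.okl [(3, 0), (2, 0), (0, - 2)]" by (simp_all add: verts_I)
  have gok: "g.okl [(0, 0)]" "g.okl [(3, 0)]" "g.okl [(3, 0), (1, 0)]" "g.okl [(3, 0), (1, 0), (2, 0)]" "g.okl [(3, 0), (1, 0), (2, 0), (1, 2 * k + 2)]"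
    "g.okl [(0, 0), (3, 2 * k + 2)]" "g.okl [(3, 0), (1, 0), (2, 0), (1, 2 * k + 2), (0, - 2)]" by (simp_all add: verts_II)
  have fg: "fs.f.gacond [(0, 0)] 1" "fs.f.gacond [(0, 0), (1, 0)] (- 1)" "fs.f.gacond [(3, 0)] (- 2 * k - 3)" "fs.f.gacond [(3, 0), (2, 0)] (- 1)"
    "fs.f.gacond [(0, 0), (1, 0), (3, 2 * k + 2)] 0" "fs.f.gacond [(3, 0), (2, 0), (0, - 2)] 0"
    unfolding fs.f.gacond_def fs.f.Es_def fs.gf_def fermi_coeff_def
    by (simp_all add: eps_I labels_I algebra_simps minus_diff_commute qp_add[symmetric])
  have gg: "g.gacond [(0, 0)] 0" "g.gacond [(3, 0)] (- 2 * k - 2)" "g.gacond [(3, 0), (1, 0)] (- 2 * k - 4)" "g.gacond [(3, 0), (1, 0), (2, 0)] 0"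
    "g.gacond [(3, 0), (1, 0), (2, 0), (1, 2 * k + 2)] (- 2)" "g.gacond [(0, 0), (3, 2 * k + 2)] 0" "g.gacond [(3, 0), (1, 0), (2, 0), (1, 2 * k + 2), (0, - 2)] 0"
    unfolding g.gacond_def g.Es_def ga'_def
    by (simp_all add: eps_II algebra_simps minus_diff_commute qp_add[symmetric])
  note fl = fs.f.nprodD_lin[OF fok(1) fg(1)] fs.f.nprodD_lin[OF fok(2) fg(2)] fs.f.nprodD_lin[OF fok(3) fg(3)] fs.f.nprodD_lin[OF fok(4) fg(4)]
    fs.f.nprodD_lin[OF fok(5) fg(5)] fs.f.nprodD_lin[OF fok(6) fg(6)]
  note gl = g.nprodD_lin[OF gok(1) gg(1), unfolded DD] g.nprodD_lin[OF gok(2) gg(2), unfolded DD] g.nprodD_lin[OF gok(3) gg(3), unfolded DD]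
    g.nprodD_lin[OF gok(4) gg(4), unfolded DD] g.nprodD_lin[OF gok(5) gg(5), unfolded DD] g.nprodD_lin[OF gok(6) gg(6), unfolded DD] g.nprodD_lin[OF gok(7) gg(7), unfolded DD]
  note fev = fs.f.kap_def fs.f.Es_def fcc eps_I algebra_simps
  note gev = g.kap_def g.Es_def gcc eps_II algebra_simps
  note nrm = qp_add[symmetric] algebra_simps add_divide_distrib diff_divide_distrib minus_diff_commute
  note fK = fs.f.Kc.simps fs.f.kap_def fs.f.Es_def fcc eps_I
  note gK = g.Kc.simps g.kap_def g.Es_def gcc eps_II sg'_def
  have V1: "fs.Vf 1 v = v" for v by (simp add: fs.Vf_def)
  have fst': "fs.f.VV (map fst ps) (bexp sc (fs.f.W ps) j v) = fs.f.VV (filter (\<lambda>i. i \<noteq> 1) (map fst ps)) (bexp sc (fs.f.W (filter (\<lambda>q. fst q \<noteq> 1) ps)) j v)" for ps j v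
    by (rule fs.f.VV_strip) (simp_all add: fs.wf_k V1)
  have gst': "g.VV (map fst ps) (bexp sc (g.W ps) j v) = g.VV (filter (\<lambda>i. i \<noteq> 1) (map fst ps)) (bexp sc (g.W (filter (\<lambda>q. fst q \<noteq> 1) ps)) j v)" for ps j v
    by (rule g.VV_strip) (simp_all add: fs.wf_k V1)
  let ?x0 = "\<lambda>v j. fs.f.VV [0] (bexp sc (fs.f.W [(0, 0)]) j v)"
  let ?x3 = "\<lambda>v j. fs.f.VV [3] (bexp sc (fs.f.W [(3, 0)]) j v)"
  let ?x32 = "\<lambda>v j. fs.f.VV [3, 2] (bexp sc (fs.f.W [(3, 0), (2, 0)]) j v)"
  \<comment> \<open>The charge and p change sign together, so the fermion exponent is the same on
    both sides: \<open>?CA\<close> for terms starting at X_0 and \<open>?CB\<close> for those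
    starting at X_3.\<close>
  let ?CA = "\<lambda>\<pi> n. - of_int n + \<pi> + 1/2" and ?CB = "\<lambda>\<pi> n. - of_int n - \<pi> + 1/2"
  have F1: "?T [(0, 0)] n v = Sum_any (\<lambda>j. sc ((\<lambda>c. qp h c) (?CA \<pi> n - of_int j)) (fs.f.Phi (1) (?CA \<pi> n - of_int j) (?x0 v j)))"
    and F1f: "finite {j. fs.f.Phi (1) (?CA \<pi> n - of_int j) (?x0 v j) \<noteq> 0}" if v: "fp \<Phi> v = sc \<pi> v" for v \<pi> n
  proof -
    have v': "- fp \<Phi> v = sc (- \<pi>) v" using v by (simp add: scale_minus_left)
    have k: "fs.f.kap [(0, 0)] + (\<Sum>i\<leftarrow>map fst [(0, 0)]. fs.ccf i) = (1) * of_int (1)" and e: "1 = fs.f.Es (map fst [(0, 0)])"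
      by (simp_all add: fev)
    have e': "(1 :: int) = 1 \<or> (1 :: int) = - 1" by simp
    have C: "?CA \<pi> n = - of_int n + of_int (1) * \<pi> + 1/2" by simp
    have X: "fs.f.VV (map fst [(0, 0)]) (bexp sc (fs.f.W [(0, 0)]) j v) = ?x0 v j" for j
      using fst'[of "[(0, 0)]" j v] by simp
    have K: "fs.f.Kc (map fst [(0, 0)]) 0 * qp h ((1) * (c - 1/2) - fs.f.kap [(0, 0)] * \<pi>) = (\<lambda>c. qp h c) c" for c
      by (simp add: fK nrm)
    note r = fs.f.frame_cur_nf[OF fok(1) fg(1) v k e e' C X K, unfolded DD]
    show "?T [(0, 0)] n v = Sum_any (\<lambda>j. sc ((\<lambda>c. qp h c) (?CA \<pi> n - of_int j)) (fs.f.Phi (1) (?CA \<pi> n - of_int j) (?x0 v j)))"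
      by (rule r(1))
    show "finite {j. fs.f.Phi (1) (?CA \<pi> n - of_int j) (?x0 v j) \<noteq> 0}" by (rule r(2))
  qed
  have F2: "?T [(0, 0), (1, 0)] n v = Sum_any (\<lambda>j. sc ((\<lambda>c. - qp h (- c)) (?CA \<pi> n - of_int j)) (fs.f.Phi (1) (?CA \<pi> n - of_int j) (?x0 v j)))" if v: "fp \<Phi> v = sc \<pi> v" for v \<pi> n
  proof -
    have v': "- fp \<Phi> v = sc (- \<pi>) v" using v by (simp add: scale_minus_left)
    have k: "fs.f.kap [(0, 0), (1, 0)] + (\<Sum>i\<leftarrow>map fst [(0, 0), (1, 0)]. fs.ccf i) = (- 1) * of_int (1)" and e: "1 = fs.f.Es (map fst [(0, 0), (1, 0)])"
      by (simp_all add: fev)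
    have e': "(1 :: int) = 1 \<or> (1 :: int) = - 1" by simp
    have C: "?CA \<pi> n = - of_int n + of_int (1) * \<pi> + 1/2" by simp
    have X: "fs.f.VV (map fst [(0, 0), (1, 0)]) (bexp sc (fs.f.W [(0, 0), (1, 0)]) j v) = ?x0 v j" for j
      using fst'[of "[(0, 0), (1, 0)]" j v] by simp
    have K: "fs.f.Kc (map fst [(0, 0), (1, 0)]) 0 * qp h ((- 1) * (c - 1/2) - fs.f.kap [(0, 0), (1, 0)] * \<pi>) = (\<lambda>c. - qp h (- c)) c" for c
      by (simp add: fK nrm)
    note r = fs.f.frame_cur_nf[OF fok(2) fg(2) v k e e' C X K, unfolded DD]
    show "?T [(0, 0), (1, 0)] n v = Sum_any (\<lambda>j. sc ((\<lambda>c. - qp h (- c)) (?CA \<pi> n - of_int j)) (fs.f.Phi (1) (?CA \<pi> n - of_int j) (?x0 v j)))"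
      by (rule r(1))
  qed
  have F3: "?T [(3, 0)] n v = Sum_any (\<lambda>j. sc ((\<lambda>c. qp h (- (2 * k + 3) * c)) (?CB \<pi> n - of_int j)) (fs.f.Phi (- 1) (?CB \<pi> n - of_int j) (?x3 v j)))" if v: "fp \<Phi> v = sc \<pi> v" for v \<pi> n
  proof -
    have v': "- fp \<Phi> v = sc (- \<pi>) v" using v by (simp add: scale_minus_left)
    have k: "fs.f.kap [(3, 0)] + (\<Sum>i\<leftarrow>map fst [(3, 0)]. fs.ccf i) = (- 2 * k - 3) * of_int (- 1)" and e: "- 1 = fs.f.Es (map fst [(3, 0)])"
      by (simp_all add: fev)
    have e': "(- 1 :: int) = 1 \<or> (- 1 :: int) = - 1" by simp
    have C: "?CB \<pi> n = - of_int n + of_int (- 1) * \<pi> + 1/2" by simp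
    have X: "fs.f.VV (map fst [(3, 0)]) (bexp sc (fs.f.W [(3, 0)]) j v) = ?x3 v j" for j
      using fst'[of "[(3, 0)]" j v] by simp
    have K: "fs.f.Kc (map fst [(3, 0)]) 0 * qp h ((- 2 * k - 3) * (c - 1/2) - fs.f.kap [(3, 0)] * \<pi>) = (\<lambda>c. qp h (- (2 * k + 3) * c)) c" for c
      by (simp add: fK nrm)
    note r = fs.f.frame_cur_nf[OF fok(3) fg(3) v k e e' C X K, unfolded DD]
    show "?T [(3, 0)] n v = Sum_any (\<lambda>j. sc ((\<lambda>c. qp h (- (2 * k + 3) * c)) (?CB \<pi> n - of_int j)) (fs.f.Phi (- 1) (?CB \<pi> n - of_int j) (?x3 v j)))"
      by (rule r(1))
  qed
  have F4: "?T [(3, 0), (2, 0)] n v = Sum_any (\<lambda>j. sc ((\<lambda>c. qp h (- k - 2 - c)) (?CB \<pi> n - of_int j)) (fs.f.Phi (- 1) (?CB \<pi> n - of_int j) (?x32 v j)))" if v: "fp \<Phi> v = sc \<pi> v" for v \<pi> n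
  proof -
    have v': "- fp \<Phi> v = sc (- \<pi>) v" using v by (simp add: scale_minus_left)
    have k: "fs.f.kap [(3, 0), (2, 0)] + (\<Sum>i\<leftarrow>map fst [(3, 0), (2, 0)]. fs.ccf i) = (- 1) * of_int (- 1)" and e: "- 1 = fs.f.Es (map fst [(3, 0), (2, 0)])"
      by (simp_all add: fev)
    have e': "(- 1 :: int) = 1 \<or> (- 1 :: int) = - 1" by simp
    have C: "?CB \<pi> n = - of_int n + of_int (- 1) * \<pi> + 1/2" by simp
    have X: "fs.f.VV (map fst [(3, 0), (2, 0)]) (bexp sc (fs.f.W [(3, 0), (2, 0)]) j v) = ?x32 v j" for j
      using fst'[of "[(3, 0), (2, 0)]" j v] by simp
    have K: "fs.f.Kc (map fst [(3, 0), (2, 0)]) 0 * qp h ((- 1) * (c - 1/2) - fs.f.kap [(3, 0), (2, 0)] * \<pi>) = (\<lambda>c. qp h (- k - 2 - c)) c" for c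
      by (simp add: fK nrm) (rule arg_cong[where f = "qp h"], simp)
    note r = fs.f.frame_cur_nf[OF fok(4) fg(4) v k e e' C X K, unfolded DD]
    show "?T [(3, 0), (2, 0)] n v = Sum_any (\<lambda>j. sc ((\<lambda>c. qp h (- k - 2 - c)) (?CB \<pi> n - of_int j)) (fs.f.Phi (- 1) (?CB \<pi> n - of_int j) (?x32 v j)))"
      by (rule r(1))
  qed
  have G1: "?U [(0, 0)] n v = Sum_any (\<lambda>j. sc ((\<lambda>c. 1) (?CA \<pi> n - of_int j)) (g.Phi (- 1) (?CA \<pi> n - of_int j) (?x0 v j)))" if v: "fp \<Phi> v = sc \<pi> v" for v \<pi> n
  proof -
    have v': "- fp \<Phi> v = sc (- \<pi>) v" using v by (simp add: scale_minus_left)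
    have k: "g.kap [(0, 0)] + (\<Sum>i\<leftarrow>map fst [(0, 0)]. cc' i) = (0) * of_int (- 1)" and e: "- 1 = g.Es (map fst [(0, 0)])"
      by (simp_all add: gev)
    have e': "(- 1 :: int) = 1 \<or> (- 1 :: int) = - 1" by simp
    have C: "?CA \<pi> n = - of_int n + of_int (- 1) * (- \<pi>) + 1/2" by simp
    have X: "g.VV (map fst [(0, 0)]) (bexp sc (g.W [(0, 0)]) j v) = ?x0 v j" for j
      using gst'[of "[(0, 0)]" j v] by simp
    have K: "g.Kc (map fst [(0, 0)]) 0 * qp h ((0) * (c - 1/2) - g.kap [(0, 0)] * (- \<pi>)) = (\<lambda>c. 1) c" for c
      by (simp add: gK nrm)
    note r = g.frame_cur_nf[OF gok(1) gg(1) v' k e e' C X K, unfolded DD]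
    show "?U [(0, 0)] n v = Sum_any (\<lambda>j. sc ((\<lambda>c. 1) (?CA \<pi> n - of_int j)) (g.Phi (- 1) (?CA \<pi> n - of_int j) (?x0 v j)))"
      by (rule r(1))
  qed
  have G2: "?U [(3, 0)] n v = Sum_any (\<lambda>j. sc ((\<lambda>c. - qp h (- (2 * k + 2) * c)) (?CB \<pi> n - of_int j)) (g.Phi (1) (?CB \<pi> n - of_int j) (?x3 v j)))"
    and G2f: "finite {j. g.Phi (1) (?CB \<pi> n - of_int j) (?x3 v j) \<noteq> 0}" if v: "fp \<Phi> v = sc \<pi> v" for v \<pi> n
  proof -
    have v': "- fp \<Phi> v = sc (- \<pi>) v" using v by (simp add: scale_minus_left)
    have k: "g.kap [(3, 0)] + (\<Sum>i\<leftarrow>map fst [(3, 0)]. cc' i) = (- 2 * k - 2) * of_int (1)" and e: "1 = g.Es (map fst [(3, 0)])"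
      by (simp_all add: gev)
    have e': "(1 :: int) = 1 \<or> (1 :: int) = - 1" by simp
    have C: "?CB \<pi> n = - of_int n + of_int (1) * (- \<pi>) + 1/2" by simp
    have X: "g.VV (map fst [(3, 0)]) (bexp sc (g.W [(3, 0)]) j v) = ?x3 v j" for j
      using gst'[of "[(3, 0)]" j v] by simp
    have K: "g.Kc (map fst [(3, 0)]) 0 * qp h ((- 2 * k - 2) * (c - 1/2) - g.kap [(3, 0)] * (- \<pi>)) = (\<lambda>c. - qp h (- (2 * k + 2) * c)) c" for c
      by (simp add: gK nrm)
    note r = g.frame_cur_nf[OF gok(2) gg(2) v' k e e' C X K, unfolded DD]
    show "?U [(3, 0)] n v = Sum_any (\<lambda>j. sc ((\<lambda>c. - qp h (- (2 * k + 2) * c)) (?CB \<pi> n - of_int j)) (g.Phi (1) (?CB \<pi> n - of_int j) (?x3 v j)))"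
      by (rule r(1))
    show "finite {j. g.Phi (1) (?CB \<pi> n - of_int j) (?x3 v j) \<noteq> 0}" by (rule r(2))
  qed
  have G3: "?U [(3, 0), (1, 0)] n v = Sum_any (\<lambda>j. sc ((\<lambda>c. qp h (- (2 * k + 4) * c)) (?CB \<pi> n - of_int j)) (g.Phi (1) (?CB \<pi> n - of_int j) (?x3 v j)))" if v: "fp \<Phi> v = sc \<pi> v" for v \<pi> n
  proof -
    have v': "- fp \<Phi> v = sc (- \<pi>) v" using v by (simp add: scale_minus_left)
    have k: "g.kap [(3, 0), (1, 0)] + (\<Sum>i\<leftarrow>map fst [(3, 0), (1, 0)]. cc' i) = (- 2 * k - 4) * of_int (1)" and e: "1 = g.Es (map fst [(3, 0), (1, 0)])"
      by (simp_all add: gev)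
    have e': "(1 :: int) = 1 \<or> (1 :: int) = - 1" by simp
    have C: "?CB \<pi> n = - of_int n + of_int (1) * (- \<pi>) + 1/2" by simp
    have X: "g.VV (map fst [(3, 0), (1, 0)]) (bexp sc (g.W [(3, 0), (1, 0)]) j v) = ?x3 v j" for j
      using gst'[of "[(3, 0), (1, 0)]" j v] by simp
    have K: "g.Kc (map fst [(3, 0), (1, 0)]) 0 * qp h ((- 2 * k - 4) * (c - 1/2) - g.kap [(3, 0), (1, 0)] * (- \<pi>)) = (\<lambda>c. qp h (- (2 * k + 4) * c)) c" for c
      by (simp add: gK nrm)
    note r = g.frame_cur_nf[OF gok(3) gg(3) v' k e e' C X K, unfolded DD]
    show "?U [(3, 0), (1, 0)] n v = Sum_any (\<lambda>j. sc ((\<lambda>c. qp h (- (2 * k + 4) * c)) (?CB \<pi> n - of_int j)) (g.Phi (1) (?CB \<pi> n - of_int j) (?x3 v j)))"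
      by (rule r(1))
  qed
  have G4: "?U [(3, 0), (1, 0), (2, 0)] n v = Sum_any (\<lambda>j. sc ((\<lambda>c. - qp h (- k - 2)) (?CB \<pi> n - of_int j)) (g.Phi (1) (?CB \<pi> n - of_int j) (?x32 v j)))"
    and G4f: "finite {j. g.Phi (1) (?CB \<pi> n - of_int j) (?x32 v j) \<noteq> 0}" if v: "fp \<Phi> v = sc \<pi> v" for v \<pi> n
  proof -
    have v': "- fp \<Phi> v = sc (- \<pi>) v" using v by (simp add: scale_minus_left)
    have k: "g.kap [(3, 0), (1, 0), (2, 0)] + (\<Sum>i\<leftarrow>map fst [(3, 0), (1, 0), (2, 0)]. cc' i) = (0) * of_int (1)" and e: "1 = g.Es (map fst [(3, 0), (1, 0), (2, 0)])"
      by (simp_all add: gev)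
    have e': "(1 :: int) = 1 \<or> (1 :: int) = - 1" by simp
    have C: "?CB \<pi> n = - of_int n + of_int (1) * (- \<pi>) + 1/2" by simp
    have X: "g.VV (map fst [(3, 0), (1, 0), (2, 0)]) (bexp sc (g.W [(3, 0), (1, 0), (2, 0)]) j v) = ?x32 v j" for j
      using gst'[of "[(3, 0), (1, 0), (2, 0)]" j v] by simp
    have K: "g.Kc (map fst [(3, 0), (1, 0), (2, 0)]) 0 * qp h ((0) * (c - 1/2) - g.kap [(3, 0), (1, 0), (2, 0)] * (- \<pi>)) = (\<lambda>c. - qp h (- k - 2)) c" for c
      by (simp add: gK nrm)
    note r = g.frame_cur_nf[OF gok(4) gg(4) v' k e e' C X K, unfolded DD]
    show "?U [(3, 0), (1, 0), (2, 0)] n v = Sum_any (\<lambda>j. sc ((\<lambda>c. - qp h (- k - 2)) (?CB \<pi> n - of_int j)) (g.Phi (1) (?CB \<pi> n - of_int j) (?x32 v j)))"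
      by (rule r(1))
    show "finite {j. g.Phi (1) (?CB \<pi> n - of_int j) (?x32 v j) \<noteq> 0}" by (rule r(2))
  qed
  have G5: "?U [(3, 0), (1, 0), (2, 0), (1, 2 * k + 2)] n v = Sum_any (\<lambda>j. sc ((\<lambda>c. qp h (- k - 2 - 2 * c)) (?CB \<pi> n - of_int j)) (g.Phi (1) (?CB \<pi> n - of_int j) (?x32 v j)))" if v: "fp \<Phi> v = sc \<pi> v" for v \<pi> n
  proof -
    have v': "- fp \<Phi> v = sc (- \<pi>) v" using v by (simp add: scale_minus_left)
    have k: "g.kap [(3, 0), (1, 0), (2, 0), (1, 2 * k + 2)] + (\<Sum>i\<leftarrow>map fst [(3, 0), (1, 0), (2, 0), (1, 2 * k + 2)]. cc' i) = (- 2) * of_int (1)" and e: "1 = g.Es (map fst [(3, 0), (1, 0), (2, 0), (1, 2 * k + 2)])"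
      by (simp_all add: gev)
    have e': "(1 :: int) = 1 \<or> (1 :: int) = - 1" by simp
    have C: "?CB \<pi> n = - of_int n + of_int (1) * (- \<pi>) + 1/2" by simp
    have X: "g.VV (map fst [(3, 0), (1, 0), (2, 0), (1, 2 * k + 2)]) (bexp sc (g.W [(3, 0), (1, 0), (2, 0), (1, 2 * k + 2)]) j v) = ?x32 v j" for j
      using gst'[of "[(3, 0), (1, 0), (2, 0), (1, 2 * k + 2)]" j v] by simp
    have K: "g.Kc (map fst [(3, 0), (1, 0), (2, 0), (1, 2 * k + 2)]) 0 * qp h ((- 2) * (c - 1/2) - g.kap [(3, 0), (1, 0), (2, 0), (1, 2 * k + 2)] * (- \<pi>)) = (\<lambda>c. qp h (- k - 2 - 2 * c)) c" for c
      by (simp add: gK nrm)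
    note r = g.frame_cur_nf[OF gok(5) gg(5) v' k e e' C X K, unfolded DD]
    show "?U [(3, 0), (1, 0), (2, 0), (1, 2 * k + 2)] n v = Sum_any (\<lambda>j. sc ((\<lambda>c. qp h (- k - 2 - 2 * c)) (?CB \<pi> n - of_int j)) (g.Phi (1) (?CB \<pi> n - of_int j) (?x32 v j)))"
      by (rule r(1))
  qed
  \<comment> \<open>The two terms carry q^c and - q^(-c) times a mode of the old Psi; their sum is
    the mode of the new Psi*, the single term in the second quiver.\<close>
  have A: "?T [(0, 0)] n v + ?T [(0, 0), (1, 0)] n v = ?U [(0, 0)] n v" for n v
  proof (rule eig_ext[OF fs.f.dp lin_plus[OF fl(1) fl(2)] gl(1)])
    fix \<pi> v assume v: "fp \<Phi> v = sc \<pi> v"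
    show "?T [(0, 0)] n v + ?T [(0, 0), (1, 0)] n v = ?U [(0, 0)] n v"
      unfolding F1[OF v] F2[OF v] G1[OF v] Sum_any_sc_add[OF F1f[OF v]] R1 by simp
  qed
  \<comment> \<open>Conversely, a term with the old Psi* splits into two terms with the new Psi,
    through the factor q^(-c) - q^c.\<close>
  have B: "?T [(3, 0)] n v = ?U [(3, 0)] n v + ?U [(3, 0), (1, 0)] n v" for n v
  proof (rule eig_ext[OF fs.f.dp fl(3) lin_plus[OF gl(2) gl(3)]])
    fix \<pi> v assume v: "fp \<Phi> v = sc \<pi> v"
    have "qp h (- (2 * k + 3) * c) * (qp h (- c) - qp h c) = - qp h (- (2 * k + 2) * c) + qp h (- (2 * k + 4) * c)" for c
      by (simp add: algebra_simps minus_diff_commute qp_add[symmetric])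
    then show "?T [(3, 0)] n v = ?U [(3, 0)] n v + ?U [(3, 0), (1, 0)] n v"
      unfolding F3[OF v] G2[OF v] G3[OF v] Sum_any_sc_add[OF G2f[OF v]] R2 scale_scale by (simp only:)
  qed
  have B': "?T [(3, 0), (2, 0)] n v = ?U [(3, 0), (1, 0), (2, 0)] n v + ?U [(3, 0), (1, 0), (2, 0), (1, 2 * k + 2)] n v" for n v
  proof (rule eig_ext[OF fs.f.dp fl(4) lin_plus[OF gl(4) gl(5)]])
    fix \<pi> v assume v: "fp \<Phi> v = sc \<pi> v"
    have "qp h (- k - 2 - c) * (qp h (- c) - qp h c) = - qp h (- k - 2) + qp h (- k - 2 - 2 * c)" for c
      by (simp add: algebra_simps minus_diff_commute qp_add[symmetric])
    then show "?T [(3, 0), (2, 0)] n v = ?U [(3, 0), (1, 0), (2, 0)] n v + ?U [(3, 0), (1, 0), (2, 0), (1, 2 * k + 2)] n v"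
      unfolding F4[OF v] G4[OF v] G5[OF v] Sum_any_sc_add[OF G4f[OF v]] R2 scale_scale by (simp only:)
  qed
  \<comment> \<open>Whole paths have charge 0, so only the scalars and the residual operators have
    to agree.\<close>
  have P1: "?T [(0, 0), (1, 0), (3, 2 * k + 2)] n v = ?U [(0, 0), (3, 2 * k + 2)] n v" for n v
  proof (rule eig_ext[OF fs.f.dp fl(5) gl(6)])
    fix \<pi> v assume v: "fp \<Phi> v = sc \<pi> v"
    have v': "- fp \<Phi> v = sc (- \<pi>) v" using v by (simp add: scale_minus_left)
    have k: "fs.f.kap [(0, 0), (1, 0), (3, 2 * k + 2)] + (\<Sum>i\<leftarrow>map fst [(0, 0), (1, 0), (3, 2 * k + 2)]. fs.ccf i) = 0" "fs.f.Es (map fst [(0, 0), (1, 0), (3, 2 * k + 2)]) = 0" by (simp_all add: fev)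
    have k': "g.kap [(0, 0), (3, 2 * k + 2)] + (\<Sum>i\<leftarrow>map fst [(0, 0), (3, 2 * k + 2)]. cc' i) = 0" "g.Es (map fst [(0, 0), (3, 2 * k + 2)]) = 0" by (simp_all add: gev)
    have K: "fs.f.Kc (map fst [(0, 0), (1, 0), (3, 2 * k + 2)]) 0 * qp h (- fs.f.kap [(0, 0), (1, 0), (3, 2 * k + 2)] * \<pi>) = g.Kc (map fst [(0, 0), (3, 2 * k + 2)]) 0 * qp h (- g.kap [(0, 0), (3, 2 * k + 2)] * (- \<pi>))"
      by (simp add: fK gK nrm)
    have X: "fs.f.VV (map fst [(0, 0), (1, 0), (3, 2 * k + 2)]) (bexp sc (fs.f.W [(0, 0), (1, 0), (3, 2 * k + 2)]) j v) = g.VV (map fst [(0, 0), (3, 2 * k + 2)]) (bexp sc (g.W [(0, 0), (3, 2 * k + 2)]) j v)" for j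
      unfolding fst'[of "[(0, 0), (1, 0), (3, 2 * k + 2)]"] gst'[of "[(0, 0), (3, 2 * k + 2)]"] by simp
    show "?T [(0, 0), (1, 0), (3, 2 * k + 2)] n v = ?U [(0, 0), (3, 2 * k + 2)] n v"
      unfolding fs.f.frame_cur0[OF fok(5) fg(5) v k] g.frame_cur0[OF gok(6) gg(6) v' k', unfolded DD] K X ..
  qed
  have P2: "?T [(3, 0), (2, 0), (0, - 2)] n v = ?U [(3, 0), (1, 0), (2, 0), (1, 2 * k + 2), (0, - 2)] n v" for n v
  proof (rule eig_ext[OF fs.f.dp fl(6) gl(7)])
    fix \<pi> v assume v: "fp \<Phi> v = sc \<pi> v"
    have v': "- fp \<Phi> v = sc (- \<pi>) v" using v by (simp add: scale_minus_left)
    have k: "fs.f.kap [(3, 0), (2, 0), (0, - 2)] + (\<Sum>i\<leftarrow>map fst [(3, 0), (2, 0), (0, - 2)]. fs.ccf i) = 0" "fs.f.Es (map fst [(3, 0), (2, 0), (0, - 2)]) = 0" by (simp_all add: fev)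
    have k': "g.kap [(3, 0), (1, 0), (2, 0), (1, 2 * k + 2), (0, - 2)] + (\<Sum>i\<leftarrow>map fst [(3, 0), (1, 0), (2, 0), (1, 2 * k + 2), (0, - 2)]. cc' i) = 0" "g.Es (map fst [(3, 0), (1, 0), (2, 0), (1, 2 * k + 2), (0, - 2)]) = 0" by (simp_all add: gev)
    have K: "fs.f.Kc (map fst [(3, 0), (2, 0), (0, - 2)]) 0 * qp h (- fs.f.kap [(3, 0), (2, 0), (0, - 2)] * \<pi>) = g.Kc (map fst [(3, 0), (1, 0), (2, 0), (1, 2 * k + 2), (0, - 2)]) 0 * qp h (- g.kap [(3, 0), (1, 0), (2, 0), (1, 2 * k + 2), (0, - 2)] * (- \<pi>))"
      by (simp add: fK gK nrm)
    have X: "fs.f.VV (map fst [(3, 0), (2, 0), (0, - 2)]) (bexp sc (fs.f.W [(3, 0), (2, 0), (0, - 2)]) j v) = g.VV (map fst [(3, 0), (1, 0), (2, 0), (1, 2 * k + 2), (0, - 2)]) (bexp sc (g.W [(3, 0), (1, 0), (2, 0), (1, 2 * k + 2), (0, - 2)]) j v)" for j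
      unfolding fst'[of "[(3, 0), (2, 0), (0, - 2)]"] gst'[of "[(3, 0), (1, 0), (2, 0), (1, 2 * k + 2), (0, - 2)]"] by simp
    show "?T [(3, 0), (2, 0), (0, - 2)] n v = ?U [(3, 0), (1, 0), (2, 0), (1, 2 * k + 2), (0, - 2)] n v"
      unfolding fs.f.frame_cur0[OF fok(6) fg(6) v k] g.frame_cur0[OF gok(7) gg(7) v' k', unfolded DD] K X ..
  qed
  show "SigmaD_cur h sc (Q_I k) 1 (\<lambda>v. fJ \<Phi> v - fp \<Phi> v) M (Pp_I k) = SigmaD_cur h sc (Q_II k) 1 (\<lambda>v. J' v + fp \<Phi> v) M' (Pp_II k)"
    "SigmaD_cur h sc (Q_I k) 1 (\<lambda>v. fJ \<Phi> v - fp \<Phi> v) M Pm_I = SigmaD_cur h sc (Q_II k) 1 (\<lambda>v. J' v + fp \<Phi> v) M' (Pm_II k)"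
    "PsiD_cur h sc (Q_I k) 1 (\<lambda>v. fJ \<Phi> v - fp \<Phi> v) M (Pp_I k) = PsiD_cur h sc (Q_II k) 1 (\<lambda>v. J' v + fp \<Phi> v) M' (Pp_II k)"
    "PsiD_cur h sc (Q_I k) 1 (\<lambda>v. fJ \<Phi> v - fp \<Phi> v) M Pm_I = PsiD_cur h sc (Q_II k) 1 (\<lambda>v. J' v + fp \<Phi> v) M' (Pm_II k)"
    by (intro ext, simp only: nprodD_terms_I nprodD_terms_II A B B' P1 P2)+
qed

lemma mutation_I_II:
  assumes nz: "\<And>n :: int. n \<noteq> 0 \<Longrightarrow> qp h (of_int n) - qp h (- of_int n) \<noteq> 0" and n1: "qp h (2 * k + 4) \<noteq> 1"
  shows "obtained_by_mutation h sc 1 (2 * k + 3) (Q_I k) (Pp_I k) Pm_I (Q_II k) (Pp_II k) (Pm_II k)"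
  unfolding obtained_by_mutation_def Let_def
proof (intro conjI mutated_I[OF n1] allI impI)
  fix M :: "(nat, 'v) seed_ops" and \<Phi> J' Y' Yi' y
  assume fm: "fermion_mutation h sc (Q_I k) 1 M \<Phi> J' Y' Yi' y"
  note m = mutation_ops[OF nz fm]
  let ?M' = "gauge_ops h sc 1 (2 * k + 3) (mutated_ops h sc (Q_I k) 1 M \<Phi> J' Y' Yi' y)"
  show "seed_module h sc (Q_II k) ?M'"
    and "SigmaD_cur h sc (Q_I k) 1 (\<lambda>v. fJ \<Phi> v - fp \<Phi> v) M (Pp_I k) = SigmaD_cur h sc (Q_II k) 1 (\<lambda>v. J' v + fp \<Phi> v) ?M' (Pp_II k)"
    and "SigmaD_cur h sc (Q_I k) 1 (\<lambda>v. fJ \<Phi> v - fp \<Phi> v) M Pm_I = SigmaD_cur h sc (Q_II k) 1 (\<lambda>v. J' v + fp \<Phi> v) ?M' (Pm_II k)"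
    and "PsiD_cur h sc (Q_I k) 1 (\<lambda>v. fJ \<Phi> v - fp \<Phi> v) M (Pp_I k) = PsiD_cur h sc (Q_II k) 1 (\<lambda>v. J' v + fp \<Phi> v) ?M' (Pp_II k)"
    and "PsiD_cur h sc (Q_I k) 1 (\<lambda>v. fJ \<Phi> v - fp \<Phi> v) M Pm_I = PsiD_cur h sc (Q_II k) 1 (\<lambda>v. J' v + fp \<Phi> v) ?M' (Pm_II k)"
    by (rule m, assumption)+
qed

end

theorem proposition3p13:
  fixes h k q q1 q2 q3 :: complex
    and sc :: "complex \<Rightarrow> 'v::ab_group_add \<Rightarrow> 'v"
  assumes vs: "vector_space sc"
    and q: "q = exp h" "q2 = q\<^sup>2"
    and k: "q3 = qp h (2 * k + 2)"
    and prod: "q1 * q2 * q3 = 1"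
    and gen: "generic q1 q2"
  shows "(qp h k)\<^sup>2 = q3 / q2 \<and>
    free_field_realization h k sc (Q_II k) (Pp_II k) (Pm_II k) \<and>
    commutes_with_screenings h sc (Q_II k) (Pp_II k) \<and>
    commutes_with_screenings h sc (Q_II k) (Pm_II k) \<and>
    free_field_realization h k sc (Q_I k) (Pp_I k) Pm_I \<and>
    obtained_by_mutation h sc 1 (2 * k + 3) (Q_I k) (Pp_I k) Pm_I (Q_II k) (Pp_II k) (Pm_II k)"
proof -
  interpret cvs sc by (rule cvs.intro[OF vs])
  have q2: "q2 = qp h 2" unfolding q qp_def by (simp add: exp_double)
  have "q1 * qp h (2 * k + 4) = 1" using prod unfolding q2 k by (simp add: mult.assoc qp_add[symmetric] add_ac)
  then have "q1 * (qp h (2 * k + 4) * qp h (- 2 * k - 4)) = qp h (- 2 * k - 4)" by (simp add: mult.assoc[symmetric])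
  then have q1: "q1 = qp h (- 2 * k - 4)" by (simp add: qp_add[symmetric])
  have pw: "qp h a powi n = qp h (of_int n * a)" for a n by (simp add: qp_def exp_power_int mult.assoc)
  \<comment> \<open>q_2 and q_1 are not roots of unity: the exponents (0, n) and (n, 0) in the
    genericity condition.\<close>
  have g2: "qp h (of_int n * 2) \<noteq> 1" and g1: "qp h (of_int n * (- 2 * k - 4)) \<noteq> 1" if "n \<noteq> 0" for n :: int
  proof -
    show "qp h (of_int n * 2) \<noteq> 1"
      using gen[unfolded generic_def, rule_format, of 0 n] that unfolding q2 pw by auto
    show "qp h (of_int n * (- 2 * k - 4)) \<noteq> 1"
      using gen[unfolded generic_def, rule_format, of n 0] that unfolding q1 pw by auto
  qed
  have sq: "qp h a - qp h (- a) \<noteq> 0" if "qp h (2 * a) \<noteq> 1" for a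
  proof
    assume "qp h a - qp h (- a) = 0"
    then have "qp h a * qp h a = qp h a * qp h (- a)" by simp
    then show False using that by (simp add: qp_add[symmetric])
  qed
  have nz: "qp h (of_int n) - qp h (- of_int n) \<noteq> 0" if "n \<noteq> 0" for n :: int
    by (rule sq) (use g2[OF that] in \<open>simp add: mult.commute\<close>)
  \<comment> \<open>Denominators of the loop charge with \<sigma> = q_1^(1/2) = q^(- k - 2).\<close>
  have nz1: "qp h (of_int n * (- k - 2)) - qp h (- of_int n * (- k - 2)) \<noteq> 0" if "n \<noteq> 0" for n :: int
  proof -
    have e: "2 * (of_int n * (- k - 2)) = of_int n * (- 2 * k - 4)" by (simp add: algebra_simps)
    have "qp h (2 * (of_int n * (- k - 2))) \<noteq> 1" unfolding e by (rule g1[OF that])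
    from sq[OF this] show ?thesis by simp
  qed
  have n1: "qp h (2 * k + 4) \<noteq> 1" using g1[of "- 1"] by (simp add: add.commute)
  have nz0: "qp h 1 - qp h (- 1) \<noteq> 0" using nz[of 1] by simp
  have "(qp h k)\<^sup>2 = q3 / q2" unfolding k q2 qp_diff[symmetric] by (simp add: qp_pow)
  then show ?thesis
    using realization_I[OF nz0, of k] realization_II[OF nz0, of k] screenings_II[OF nz nz1] mutation_I_II[OF nz n1] by blast
qed

end
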